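(* Let $\Omega\subset\mathbb R^3$ be a bounded domain with smooth boundary, let $\mu>0$, $\beta\ge0$, $T>0$ and $u_0\in H$. Let $u$ be a weak solution on $[0,T)$ of the critical convective Brinkman--Forchheimer equations $$\partial_tu-\mu\Delta u+(u\cdot\nabla)u+\nabla p+\beta|u|^2u=0,\qquad\nabla\cdot u=0,\qquad u|_{\partial\Omega}=0,$$ with initial condition $u_0$. Then $u$ satisfies the energy equality $$\|u(t_1)\|^2+2\mu\int_{t_0}^{t_1}\|\nabla u(s)\|^2\,ds+2\beta\int_{t_0}^{t_1}\|u(s)\|_{L^4(\Omega)}^4\,ds=\|u(t_0)\|^2$$ for all $0\le t_0<t_1<T$. Consequently $u\in C([0,T);H)$.
   Context: $\langle\cdot,\cdot\rangle$ and $\|\cdot\|$ are the $L^2(\Omega)$ inner product and norm. $H$ is the closure in $L^2(\Omega)$ of $\{\varphi\in C_c^\infty(\Omega;\mathbb R^3):\nabla\cdot\varphi=0\}$. With $\Omega_T=\Omega\times[0,T)$, the test functions are $\mathcal D_\sigma(\Omega_T)=\{\varphi\in C_c^\infty(\Omega_T):\nabla\cdot\varphi(\cdot,t)=0\}$ (so $\varphi(\cdot,T)=0$). A weak solution on $[0,T)$ with initial condition $u_0\in H$ is a function $u\in L^\infty(0,T;H)\cap L^4(0,T;L^4(\Omega))\cap L^2(0,T;H_0^1(\Omega))$, with $u(0)=u_0$, such that for almost every $t\in(0,T)$ and all $\varphi\in\mathcal D_\sigma(\Omega_T)$: $$-\int_0^t\langle u,\partial_t\varphi\rangle+\mu\int_0^t\langle\nabla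 u,\nabla\varphi\rangle+\int_0^t\langle(u\cdot\nabla)u,\varphi\rangle+\beta\int_0^t\langle|u|^2u,\varphi\rangle=-\langle u(t),\varphi(t)\rangle+\langle u(0),\varphi(0)\rangle.$$ *)

theory Defs
  imports "HOL-Analysis.Analysis"
begin

text \<open>A function is C-infinity on an open set S if it is differentiable on S and all its
  first partial derivatives are again C-infinity on S (coinductively: derivatives of all orders).\<close>
coinductive smooth_on :: "'a::euclidean_space set \<Rightarrow> ('a \<Rightarrow> 'b::real_normed_vector) \<Rightarrow> bool" where
  "\<lbrakk> f differentiable_on S;
     \<And>b. b \<in> Basis \<Longrightarrow> smooth_on S (\<lambda>x. frechet_derivative f (at x) b) \<rbrakk>
   \<Longrightarrow> smooth_on S f"

definition bounded_smooth_domain :: "(real^3) set \<Rightarrow> bool" where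
  "bounded_smooth_domain \<Omega> \<longleftrightarrow>
     open \<Omega> \<and> connected \<Omega> \<and> \<Omega> \<noteq> {} \<and> bounded \<Omega> \<and>
     (\<forall>p\<in>frontier \<Omega>. \<exists>U (\<rho>::real^3 \<Rightarrow> real).
        open U \<and> p \<in> U \<and> smooth_on U \<rho> \<and>
        (\<forall>x\<in>U. \<exists>v. frechet_derivative \<rho> (at x) v \<noteq> 0) \<and>
        \<Omega> \<inter> U = {x\<in>U. \<rho> x < 0})"

definition pd :: "3 \<Rightarrow> (real^3 \<Rightarrow> 'b::real_normed_vector) \<Rightarrow> real^3 \<Rightarrow> 'b" where
  "pd j f x = vector_derivative (\<lambda>h. f (x + h *\<^sub>R axis j 1)) (at 0)"

definition pdx :: "3 \<Rightarrow> (real \<times> (real^3) \<Rightarrow> 'b::real_normed_vector) \<Rightarrow> real \<Rightarrow> real^3 \<Rightarrow> 'b" where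
  "pdx j g t x = vector_derivative (\<lambda>h. g (t, x + h *\<^sub>R axis j 1)) (at 0)"

definition pdt :: "(real \<times> (real^3) \<Rightarrow> 'b::real_normed_vector) \<Rightarrow> real \<Rightarrow> real^3 \<Rightarrow> 'b" where
  "pdt g t x = vector_derivative (\<lambda>s. g (s, x)) (at t)"

definition test_scalar :: "(real^3) set \<Rightarrow> (real^3 \<Rightarrow> real) \<Rightarrow> bool" where
  "test_scalar \<Omega> \<phi> \<longleftrightarrow> smooth_on UNIV \<phi> \<and>
     (\<exists>K. compact K \<and> K \<subseteq> \<Omega> \<and> (\<forall>x. x \<notin> K \<longrightarrow> \<phi> x = 0))"

definition test_vec :: "(real^3) set \<Rightarrow> (real^3 \<Rightarrow> real^3) \<Rightarrow> bool" where
  "test_vec \<Omega> \<phi> \<longleftrightarrow> smooth_on UNIV \<phi> \<and>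
     (\<exists>K. compact K \<and> K \<subseteq> \<Omega> \<and> (\<forall>x. x \<notin> K \<longrightarrow> \<phi> x = 0))"

definition test_divfree :: "(real^3) set \<Rightarrow> (real^3 \<Rightarrow> real^3) \<Rightarrow> bool" where
  "test_divfree \<Omega> \<phi> \<longleftrightarrow> test_vec \<Omega> \<phi> \<and>
     (\<forall>x. (\<Sum>j\<in>UNIV. pd j (\<lambda>y. \<phi> y $ j) x) = 0)"

text \<open>Space-time test functions D_sigma(Omega_T), Omega_T = Omega x [0,T), written as functions
  of (t,x). They are smooth functions on R x R^3 vanishing outside a compact subset of
  (-infinity,T) x Omega (so their restrictions to [0,T) x Omega are exactly the smooth functions
  with compact support in [0,T) x Omega), divergence free for t in [0,T).\<close>
definition test_DT :: "(real^3) set \<Rightarrow> real \<Rightarrow> (real \<times> (real^3) \<Rightarrow> real^3) \<Rightarrow> bool" where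
  "test_DT \<Omega> T \<phi> \<longleftrightarrow> smooth_on UNIV \<phi> \<and>
     (\<exists>K. compact K \<and> K \<subseteq> {..<T} \<times> \<Omega> \<and> (\<forall>p. p \<notin> K \<longrightarrow> \<phi> p = 0)) \<and>
     (\<forall>t\<in>{0..<T}. \<forall>x. (\<Sum>j\<in>UNIV. pdx j (\<lambda>p. \<phi> p $ j) t x) = 0)"

definition L2 :: "(real^3) set \<Rightarrow> (real^3 \<Rightarrow> real^3) \<Rightarrow> bool" where
  "L2 \<Omega> f \<longleftrightarrow> f \<in> borel_measurable (lebesgue_on \<Omega>) \<and>
     integrable (lebesgue_on \<Omega>) (\<lambda>x. (norm (f x))\<^sup>2)"

definition l2norm :: "(real^3) set \<Rightarrow> (real^3 \<Rightarrow> 'b::real_normed_vector) \<Rightarrow> real" where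
  "l2norm \<Omega> f = sqrt (integral\<^sup>L (lebesgue_on \<Omega>) (\<lambda>x. (norm (f x))\<^sup>2))"

definition in_H :: "(real^3) set \<Rightarrow> (real^3 \<Rightarrow> real^3) \<Rightarrow> bool" where
  "in_H \<Omega> f \<longleftrightarrow> L2 \<Omega> f \<and>
     (\<exists>\<phi>::nat \<Rightarrow> real^3 \<Rightarrow> real^3. (\<forall>n. test_divfree \<Omega> (\<phi> n)) \<and>
        (\<lambda>n. l2norm \<Omega> (\<lambda>x. \<phi> n x - f x)) \<longlonglongrightarrow> 0)"

definition is_weak_grad :: "(real^3) set \<Rightarrow> (real^3 \<Rightarrow> real^3) \<Rightarrow> (real^3 \<Rightarrow> real^3^3) \<Rightarrow> bool" where
  "is_weak_grad \<Omega> f G \<longleftrightarrow>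
     (\<forall>K. compact K \<and> K \<subseteq> \<Omega> \<longrightarrow>
        integrable (lebesgue_on K) f \<and> integrable (lebesgue_on K) G) \<and>
     (\<forall>\<phi>. test_scalar \<Omega> \<phi> \<longrightarrow> (\<forall>i j.
        integral\<^sup>L (lebesgue_on \<Omega>) (\<lambda>x. f x $ i * pd j \<phi> x)
        = - integral\<^sup>L (lebesgue_on \<Omega>) (\<lambda>x. G x $ i $ j * \<phi> x)))"

definition wgrad :: "(real^3) set \<Rightarrow> (real^3 \<Rightarrow> real^3) \<Rightarrow> real^3 \<Rightarrow> real^3^3" where
  "wgrad \<Omega> f = (SOME G. is_weak_grad \<Omega> f G)"

definition in_H01 :: "(real^3) set \<Rightarrow> (real^3 \<Rightarrow> real^3) \<Rightarrow> bool" where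
  "in_H01 \<Omega> f \<longleftrightarrow> L2 \<Omega> f \<and>
     (\<exists>G. is_weak_grad \<Omega> f G \<and> G \<in> borel_measurable (lebesgue_on \<Omega>) \<and>
        integrable (lebesgue_on \<Omega>) (\<lambda>x. (norm (G x))\<^sup>2) \<and>
        (\<exists>\<phi>::nat \<Rightarrow> real^3 \<Rightarrow> real^3. (\<forall>n. test_vec \<Omega> (\<phi> n)) \<and>
           (\<lambda>n. l2norm \<Omega> (\<lambda>x. \<phi> n x - f x)) \<longlonglongrightarrow> 0 \<and>
           (\<lambda>n. l2norm \<Omega> (\<lambda>x. (\<chi> i j. pd j (\<lambda>y. \<phi> n y $ i) x) - G x)) \<longlonglongrightarrow> 0))"

text \<open>u t x is the velocity at time t and position x. The weak gradient of u is given by a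
  jointly measurable G with G t the weak gradient of u t for a.e. t (this is the
  L^2(0,T;H_0^1) regularity).\<close>
definition weak_solution ::
  "(real^3) set \<Rightarrow> real \<Rightarrow> real \<Rightarrow> real \<Rightarrow> (real^3 \<Rightarrow> real^3) \<Rightarrow> (real \<Rightarrow> real^3 \<Rightarrow> real^3) \<Rightarrow> bool" where
  "weak_solution \<Omega> \<mu> \<beta> T u0 u \<longleftrightarrow>
     (\<exists>G :: real \<Rightarrow> real^3 \<Rightarrow> real^3^3.
        \<comment> \<open>u in L^infinity(0,T;H)\<close>
        (\<lambda>p. u (fst p) (snd p)) \<in> borel_measurable (lebesgue_on ({0<..<T} \<times> \<Omega>)) \<and>
        (AE t in lebesgue_on {0<..<T}. in_H \<Omega> (u t)) \<and>
        (\<exists>C. AE t in lebesgue_on {0<..<T}. l2norm \<Omega> (u t) \<le> C) \<and>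
        \<comment> \<open>u in L^4(0,T;L^4(Omega))\<close>
        (\<integral>\<^sup>+ p. ennreal ((norm (u (fst p) (snd p))) ^ 4) \<partial>lebesgue_on ({0<..<T} \<times> \<Omega>)) < \<infinity> \<and>
        \<comment> \<open>u in L^2(0,T;H_0^1(Omega))\<close>
        (\<lambda>p. G (fst p) (snd p)) \<in> borel_measurable (lebesgue_on ({0<..<T} \<times> \<Omega>)) \<and>
        (AE t in lebesgue_on {0<..<T}. in_H01 \<Omega> (u t) \<and> is_weak_grad \<Omega> (u t) (G t)) \<and>
        (\<integral>\<^sup>+ p. ennreal ((norm (G (fst p) (snd p)))\<^sup>2) \<partial>lebesgue_on ({0<..<T} \<times> \<Omega>)) < \<infinity> \<and>
        \<comment> \<open>initial condition u(0) = u0 (in L^2)\<close>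
        (AE x in lebesgue_on \<Omega>. u 0 x = u0 x) \<and>
        \<comment> \<open>weak formulation\<close>
        (AE t in lebesgue_on {0<..<T}. \<forall>\<phi>. test_DT \<Omega> T \<phi> \<longrightarrow>
           - integral\<^sup>L (lebesgue_on {0..t}) (\<lambda>s. integral\<^sup>L (lebesgue_on \<Omega>)
                 (\<lambda>x. u s x \<bullet> pdt \<phi> s x))
           + \<mu> * integral\<^sup>L (lebesgue_on {0..t}) (\<lambda>s. integral\<^sup>L (lebesgue_on \<Omega>)
                 (\<lambda>x. \<Sum>i\<in>UNIV. \<Sum>j\<in>UNIV. G s x $ i $ j * pdx j (\<lambda>p. \<phi> p $ i) s x))
           + integral\<^sup>L (lebesgue_on {0..t}) (\<lambda>s. integral\<^sup>L (lebesgue_on \<Omega>)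
                 (\<lambda>x. \<Sum>i\<in>UNIV. (\<Sum>j\<in>UNIV. u s x $ j * G s x $ i $ j) * \<phi> (s, x) $ i))
           + \<beta> * integral\<^sup>L (lebesgue_on {0..t}) (\<lambda>s. integral\<^sup>L (lebesgue_on \<Omega>)
                 (\<lambda>x. (norm (u s x))\<^sup>2 * (u s x \<bullet> \<phi> (s, x))))
           = - integral\<^sup>L (lebesgue_on \<Omega>) (\<lambda>x. u t x \<bullet> \<phi> (t, x))
             + integral\<^sup>L (lebesgue_on \<Omega>) (\<lambda>x. u 0 x \<bullet> \<phi> (0, x))))"

end

theory Submission
  imports Defs
begin

text \<open>Why the energy equality holds: \<open>u\<close> itself has to be admissible as a test function. A velocity
  \<open>u(t)\<close> is approximated by solenoidal test fields bounded in \<open>L^4\<close> and \<open>H^1\<close>: push it into the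
  domain along a smooth inward field with the Piola transform (which keeps it divergence free), then
  mollify. Weak convergence of these fields suffices, because \<open>L^4\<close> integrability makes every term
  of the weak form a bounded functional of the test field. This gives, for almost all \<open>s\<close> and \<open>t\<close>,
  the identity \<open>\<langle>u(s), u(t)\<rangle> - \<langle>u(0), u(t)\<rangle> = - \<integral>\<^sub>0\<^sup>s F(r, t) dr\<close>. Doubling variables,
  \<open>\<parallel>u(t + h)\<parallel>\<^sup>2 - \<parallel>u(t)\<parallel>\<^sup>2\<close> telescopes over steps \<open>h/n\<close>, and continuity of translations in
  \<open>L^p\<close> turns the sum into \<open>-2 \<integral> F(r, r) dr\<close>, where the convective part of \<open>F(r, r)\<close> vanishes.
  The same identity bounds \<open>\<parallel>u(t) - u(r)\<parallel>\<close> by the mass of \<open>[r, t]\<close>, so \<open>u\<close> extends continuously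
  in \<open>L^2\<close>; its value at \<open>0\<close> is \<open>u0\<close> since both lie in \<open>H\<close> and agree on solenoidal test fields.\<close>


section \<open>Calculus of smooth functions\<close>

text \<open>With \<open>u\<close> in L^4 and its gradient in L^2, the terms (u.grad)u and |u|^2 u
  lie in L^(4/3), the dual of L^4: every pairing in the weak form is just finite for a test field of
  the same class. The obstacle is to find such test fields. Those that define H are solenoidal but
  controlled in L^2 alone; those that define H_0^1 have convergent gradients but need not be
  solenoidal. The push-forward acts on \<open>u(t)\<close> itself, so the first sequence has to
  certify only that the divergence vanishes weakly, and the second only that gradients stay bounded.
  By Young's inequality the single density |U|^4 + |G|^2 controls all terms, in space as well as in
  time. The diagonal r = t is a null set of pairs of times; it is reached through continuity of
  translations in space-time. All estimates run over Borel representatives extended by zero to the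
  whole space; the given functions are tied to them at almost every time, and the claims about
  \<open>u\<close> transfer back through almost everywhere equality.\<close>

abbreviation dd :: "'a::euclidean_space => ('a => 'b::real_normed_vector) => 'a => 'b" where
  "dd b f x \<equiv> frechet_derivative f (at x) b"

text \<open>Finite stages of the coinductive \<open>smooth_on\<close>, so that closure properties
  are proved by induction on \<open>n\<close>. The derivatives of the last order are not asked to be
  continuous; the conjunction over all \<open>n\<close> is the same.\<close>

fun Ck :: "nat => ('a::euclidean_space => 'b::real_normed_vector) => bool" where
  "Ck 0 f = True"
| "Ck (Suc n) f = ((\<forall>x. f differentiable at x) \<and> (\<forall>b\<in>Basis. Ck n (dd b f)))"

lemma smooth_on_UNIV_iff_Ck: "smooth_on UNIV f \<longleftrightarrow> (\<forall>n. Ck n f)"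
proof
  assume "smooth_on UNIV f"
  have "smooth_on UNIV f ==> Ck n f" for n and f :: "'a => 'b"
    by (induction n arbitrary: f)
      (auto elim: smooth_on.cases simp: differentiable_on_def)
  then show "\<forall>n. Ck n f" using \<open>smooth_on UNIV f\<close> by blast
next
  assume "\<forall>n. Ck n f"
  then show "smooth_on UNIV f"
  proof (coinduction arbitrary: f)
    case smooth_on
    then have a: "Ck (Suc n) f" for n by blast
    then show ?case by (auto simp: differentiable_on_def)
  qed
qed

lemma has_derivative_dd:
  "f differentiable at x ==> (f has_derivative (\<lambda>h. dd h f x)) (at x)"
  using frechet_derivative_works by force

lemma dd_eqI: "(f has_derivative f') (at x) ==> dd b f x = f' b"
  by (metis frechet_derivative_at)

lemma Ck_SucI:
  assumes "\<And>x. (f has_derivative f' x) (at x)" "\<And>b. b \<in> Basis ==> Ck n (\<lambda>x. f' x b)"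
  shows "Ck (Suc n) f"
proof -
  have "dd b f = (\<lambda>x. f' x b)" for b using dd_eqI[OF assms(1)] by auto
  then show ?thesis using assms by (auto simp: differentiable_def)
qed

lemma Ck_SucD:
  assumes "Ck (Suc n) f"
  shows "(f has_derivative (\<lambda>h. dd h f x)) (at x)" "b \<in> Basis ==> Ck n (dd b f)"
  using assms by (auto intro: has_derivative_dd)

lemma Ck_Suc_imp: "Ck (Suc n) f ==> Ck n f"
  by (induction n arbitrary: f) auto

lemma Ck_const: "Ck n (\<lambda>x. c)"
proof (induction n arbitrary: c)
  case (Suc n)
  show ?case by (rule Ck_SucI[OF has_derivative_const]) (rule Suc)
qed simp

lemma Ck_add: "Ck n f ==> Ck n g ==> Ck n (\<lambda>x. f x + g x)"
proof (induction n arbitrary: f g)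
  case (Suc n)
  show ?case
    by (rule Ck_SucI[OF has_derivative_add[OF Ck_SucD(1)[OF Suc.prems(1)] Ck_SucD(1)[OF Suc.prems(2)]]])
      (use Suc in auto)
qed simp

lemma Ck_sum: "(\<And>i. i \<in> S ==> Ck n (f i)) ==> Ck n (\<lambda>x. \<Sum>i\<in>S. f i x)"
  by (induction S rule: infinite_finite_induct) (auto intro: Ck_add Ck_const)

lemma Ck_bilinear:
  assumes B: "bounded_bilinear B"
  shows "Ck n f ==> Ck n g ==> Ck n (\<lambda>x. B (f x) (g x))"
proof (induction n arbitrary: f g)
  case (Suc n)
  show ?case
    by (rule Ck_SucI[OF bounded_bilinear.FDERIV[OF B Ck_SucD(1)[OF Suc.prems(1)] Ck_SucD(1)[OF Suc.prems(2)]]])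
      (use Suc.prems Ck_Suc_imp[OF Suc.prems(1)] Ck_Suc_imp[OF Suc.prems(2)] in \<open>auto intro!: Ck_add Suc.IH simp del: Ck.simps simp: Ck_SucD\<close>)
qed simp

lemma Ck_linear:
  assumes L: "bounded_linear L"
  shows "Ck n f ==> Ck n (\<lambda>x. L (f x))"
proof (induction n arbitrary: f)
  case (Suc n)
  show ?case
    by (rule Ck_SucI[OF bounded_linear.has_derivative[OF L Ck_SucD(1)[OF Suc.prems(1)]]])
      (use Suc in auto)
qed simp

lemma Ck_bounded_linear:
  assumes L: "bounded_linear L"
  shows "Ck n L"
proof (cases n)
  case (Suc m)
  show ?thesis unfolding Suc
    by (rule Ck_SucI[OF bounded_linear.has_derivative[OF L has_derivative_ident]]) (rule Ck_const)
qed simp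

text \<open>\<open>Ck\<close> controls derivatives along fixed basis vectors, while the chain rule
  differentiates \<open>f\<close> in the direction \<open>h' v\<close>, which moves with the point;
  hence the expansion in coordinates.\<close>

lemma has_derivative_compose_Basis:
  fixes f :: "'b::euclidean_space => 'c::real_normed_vector"
  assumes f: "f differentiable at (h x)" and h: "(h has_derivative h') (at x)"
  shows "((\<lambda>x. f (h x)) has_derivative (\<lambda>v. \<Sum>c\<in>Basis. (h' v \<bullet> c) *\<^sub>R dd c f (h x))) (at x)"
proof -
  have f': "(f has_derivative (\<lambda>v. dd v f (h x))) (at (h x))" by (rule has_derivative_dd[OF f])
  interpret L: bounded_linear "\<lambda>v. dd v f (h x)" using f' by (rule has_derivative_bounded_linear)
  have "dd v f (h x) = (\<Sum>c\<in>Basis. (v \<bullet> c) *\<^sub>R dd c f (h x))" for v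
    using arg_cong[OF euclidean_representation[of v, symmetric], of "\<lambda>v. dd v f (h x)"]
    by (simp only: L.sum L.scaleR)
  then have "(\<lambda>v. dd (h' v) f (h x)) = (\<lambda>v. \<Sum>c\<in>Basis. (h' v \<bullet> c) *\<^sub>R dd c f (h x))"
    by blast
  then show ?thesis using has_derivative_compose[OF h f'] by (simp only:)
qed

lemma Ck_compose:
  fixes f :: "'b::euclidean_space => 'c::real_normed_vector"
  shows "Ck n f ==> Ck n h ==> Ck n (\<lambda>x. f (h x))"
proof (induction n arbitrary: f)
  case (Suc n)
  have hn: "Ck n h" using Suc.prems(2) by (rule Ck_Suc_imp)
  show ?case
  proof (rule Ck_SucI[OF has_derivative_compose_Basis[OF _ Ck_SucD(1)[OF Suc.prems(2)]]])
    show "f differentiable at (h x)" for x using Suc.prems by simp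
    fix b :: 'a assume "b \<in> Basis"
    then show "Ck n (\<lambda>x. \<Sum>c\<in>Basis. (dd b h x \<bullet> c) *\<^sub>R dd c f (h x))"
      using Suc hn
      by (intro Ck_sum Ck_bilinear[OF bounded_bilinear_scaleR] Ck_linear[OF bounded_linear_inner_left] Suc.IH) auto
  qed
qed simp

subsection \<open>Smooth functions with bounded support\<close>

definition smooth :: "('a::euclidean_space => 'b::real_normed_vector) => bool" where
  "smooth f \<longleftrightarrow> (\<forall>n. Ck n f)"

lemma smooth_on_UNIV [simp]: "smooth_on UNIV f \<longleftrightarrow> smooth f"
  by (simp add: smooth_on_UNIV_iff_Ck smooth_def)

lemma smooth_differentiable: "smooth f ==> f differentiable at x"
proof -
  assume "smooth f"
  then have "Ck (Suc 0) f" unfolding smooth_def by blast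
  then show ?thesis by simp
qed

lemma smooth_has_derivative: "smooth f ==> (f has_derivative (\<lambda>h. dd h f x)) (at x)"
  by (intro has_derivative_dd smooth_differentiable)

lemma smooth_const: "smooth (\<lambda>x. c)" by (simp add: smooth_def Ck_const)
lemma smooth_add: "smooth f ==> smooth g ==> smooth (\<lambda>x. f x + g x)" by (simp add: smooth_def Ck_add)
lemma smooth_sum: "(\<And>i. i \<in> S ==> smooth (f i)) ==> smooth (\<lambda>x. \<Sum>i\<in>S. f i x)" by (simp add: smooth_def Ck_sum)
lemma smooth_bilinear: "bounded_bilinear B ==> smooth f ==> smooth g ==> smooth (\<lambda>x. B (f x) (g x))"
  by (simp add: smooth_def Ck_bilinear)
lemmas smooth_scaleR = smooth_bilinear[OF bounded_bilinear_scaleR]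
lemmas smooth_inner = smooth_bilinear[OF bounded_bilinear_inner]
lemma smooth_mult: "smooth f ==> smooth g ==> smooth (\<lambda>x. f x * g x :: real)"
  by (rule smooth_bilinear[OF bounded_bilinear_mult])
lemma smooth_linear: "bounded_linear L ==> smooth f ==> smooth (\<lambda>x. L (f x))" by (simp add: smooth_def Ck_linear)
lemma smooth_bounded_linear: "bounded_linear L ==> smooth L" by (simp add: smooth_def Ck_bounded_linear)
lemma smooth_ident: "smooth (\<lambda>x. x)" by (rule smooth_bounded_linear[OF bounded_linear_ident])
lemma smooth_compose:
  fixes f :: "'b::euclidean_space => 'c::real_normed_vector"
  shows "smooth f ==> smooth h ==> smooth (\<lambda>x. f (h x))" by (simp add: smooth_def Ck_compose)
lemma smooth_minus: "smooth f ==> smooth (\<lambda>x. - f x)"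
  by (rule smooth_linear[OF bounded_linear_minus[OF bounded_linear_ident]])
lemma smooth_diff: "smooth f ==> smooth g ==> smooth (\<lambda>x. f x - g x)"
  using smooth_add[OF _ smooth_minus] by fastforce
lemma smooth_continuous: "smooth f ==> continuous_on S f"
  by (meson continuous_at_imp_continuous_on differentiable_imp_continuous_within smooth_differentiable)

lemma dd_linear: "f differentiable at x ==> bounded_linear (\<lambda>b. dd b f x)"
  using has_derivative_dd has_derivative_bounded_linear by blast

lemma dd_eq_sum:
  fixes f :: "'a::euclidean_space => 'b::real_normed_vector"
  assumes "f differentiable at x"
  shows "dd v f x = (\<Sum>c\<in>Basis. (v \<bullet> c) *\<^sub>R dd c f x)"
proof -
  interpret L: bounded_linear "\<lambda>v. dd v f x" using assms by (rule dd_linear)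
  show ?thesis
    using arg_cong[OF euclidean_representation[of v, symmetric], of "\<lambda>v. dd v f x"]
    by (simp only: L.sum L.scaleR)
qed

lemma smooth_dd_field:
  assumes "smooth f" "smooth v"
  shows "smooth (\<lambda>x. dd (v x) f x)"
proof -
  have "smooth (\<lambda>x. dd c f x)" if "c \<in> Basis" for c
    unfolding smooth_def
  proof
    fix n
    have "Ck (Suc n) f" using assms(1) smooth_def by blast
    then show "Ck n (dd c f)" using that by simp
  qed
  then have "smooth (\<lambda>x. \<Sum>c\<in>Basis. (v x \<bullet> c) *\<^sub>R dd c f x)"
    by (intro smooth_sum smooth_scaleR smooth_inner assms smooth_const) auto
  moreover have "(\<lambda>x. dd (v x) f x) = (\<lambda>x. \<Sum>c\<in>Basis. (v x \<bullet> c) *\<^sub>R dd c f x)"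
    by (rule ext, rule dd_eq_sum, rule smooth_differentiable, rule assms)
  ultimately show ?thesis by simp
qed

lemmas smooth_dd = smooth_dd_field[OF _ smooth_const]

lemma smooth_vec_nth: "smooth f ==> smooth (\<lambda>x. f x $ i)"
  by (rule smooth_linear[OF bounded_linear_vec_nth])

text \<open>Bounded support, stated through a radius: no support set has to be formed, and products
  and derivatives inherit it at once.\<close>

definition bsupp :: "('a::real_normed_vector => 'b::zero) => bool" where
  "bsupp f \<longleftrightarrow> (\<exists>R. \<forall>x. norm x \<ge> R --> f x = 0)"

lemma dd_eq_0:
  fixes f :: "'a::euclidean_space => 'b::real_normed_vector"
  assumes "open S" "x \<in> S" "\<And>y. y \<in> S ==> f y = 0"
  shows "dd b f x = 0"
proof -
  have "(f has_derivative (\<lambda>_. 0)) (at x)"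
    by (rule has_derivative_transform_within_open[where f="\<lambda>_. 0", OF _ assms(1,2)]) (auto simp: assms)
  then show ?thesis by (rule dd_eqI)
qed

lemma bsupp_dd:
  fixes f :: "'a::euclidean_space => 'b::real_normed_vector"
  assumes "bsupp f" shows "bsupp (\<lambda>x. dd (v x) f x)"
proof -
  obtain R where R: "\<And>x. norm x \<ge> R ==> f x = 0" using assms by (auto simp: bsupp_def)
  have "dd (v x) f x = 0" if "norm x \<ge> R + 1" for x
    by (rule dd_eq_0[of "- cball 0 R"]) (use that R in \<open>auto\<close>)
  then show ?thesis by (auto simp: bsupp_def)
qed

lemma bsupp_uniform:
  fixes f :: "'a::euclidean_space => 'b::real_normed_vector"
  assumes c: "continuous_on UNIV f" and s: "bsupp f"
  shows "uniformly_continuous_on UNIV f" "\<exists>B>0. \<forall>x. norm (f x) \<le> B"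
proof -
  obtain R where R: "\<And>x. norm x \<ge> R ==> f x = 0" using s by (auto simp: bsupp_def)
  have "bounded (f ` cball 0 R)"
    by (intro compact_imp_bounded compact_continuous_image continuous_on_subset[OF c]) auto
  then obtain B where B: "\<And>x. norm x \<le> R ==> norm (f x) \<le> B" by (fastforce simp: bounded_iff)
  have "norm (f x) \<le> max B 1" for x using R[of x] B[of x] by (cases "norm x \<le> R") auto
  then show "\<exists>B>0. \<forall>x. norm (f x) \<le> B" by (intro exI[of _ "max B 1"]) auto
  \<comment> \<open>One unit of slack: two points closer than 1 either both lie in the ball of
    radius \<open>R + 1\<close>, or both have norm at least \<open>R\<close>, where \<open>f\<close>
    vanishes.\<close>
  have u: "uniformly_continuous_on (cball 0 (R+1)) f"
    by (intro compact_uniformly_continuous continuous_on_subset[OF c]) auto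
  show "uniformly_continuous_on UNIV f"
    unfolding uniformly_continuous_on_def
  proof (intro allI impI)
    fix e :: real assume "e > 0"
    then obtain d where d: "d > 0" "\<forall>x\<in>cball 0 (R+1). \<forall>x'\<in>cball 0 (R+1). dist x' x < d --> dist (f x') (f x) < e"
      using u unfolding uniformly_continuous_on_def by blast
    have "dist (f x') (f x) < e" if "dist x' x < min d 1" for x x'
    proof (cases "norm x \<le> R+1 \<and> norm x' \<le> R+1")
      case False
      have "\<bar>norm x - norm x'\<bar> < 1" using that norm_triangle_ineq3[of x x'] by (simp add: dist_norm norm_minus_commute)
      then have "f x = 0" "f x' = 0" using False R[of x] R[of x'] by linarith+
      then show ?thesis using \<open>e > 0\<close> by simp
    qed (use d that in auto)
    then show "\<exists>d>0. \<forall>x\<in>UNIV. \<forall>x'\<in>UNIV. dist x' x < d --> dist (f x') (f x) < e"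
      using d(1) by (intro exI[of _ "min d 1"]) auto
  qed
qed

lemma smooth_bsupp_bounded:
  fixes f :: "'a::euclidean_space => 'b::real_normed_vector"
  assumes "smooth f" "bsupp f"
  obtains B where "B > 0" "\<And>x. norm (f x) \<le> B" "\<And>x b. norm (dd b f x) \<le> B * norm b"
proof -
  obtain B0 where B0: "B0 > 0" "\<And>x. norm (f x) \<le> B0"
    using bsupp_uniform(2)[OF smooth_continuous assms(2)] assms by blast
  have "\<forall>c\<in>Basis. \<exists>B>0. \<forall>x. norm (dd c f x) \<le> B"
    by (intro ballI bsupp_uniform(2) smooth_continuous smooth_dd bsupp_dd assms)
  then obtain Bc where Bc: "\<And>c x. c \<in> Basis ==> Bc c > 0 \<and> norm (dd c f x) \<le> Bc c" by metis
  define B where "B = B0 + (\<Sum>c\<in>Basis. Bc c)"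
  have S: "(\<Sum>c\<in>Basis. Bc c) \<ge> 0" using Bc by (intro sum_nonneg) (auto simp: less_imp_le)
  show ?thesis
  proof (rule that[of B])
    show "B > 0" using B0 S by (simp add: B_def)
    show "norm (f x) \<le> B" for x using B0(2)[of x] S by (simp add: B_def)
    fix x b
    have "norm (dd b f x) \<le> (\<Sum>c\<in>Basis. norm ((b \<bullet> c) *\<^sub>R dd c f x))"
      unfolding dd_eq_sum[OF smooth_differentiable[OF assms(1)], where v=b] by (rule norm_sum)
    also have "\<dots> \<le> (\<Sum>c\<in>Basis. norm b * Bc c)"
      by (intro sum_mono) (auto simp: Basis_le_norm Bc intro!: mult_mono)
    also have "\<dots> \<le> B * norm b" using B0(1) unfolding B_def sum_distrib_left[symmetric] by (simp add: algebra_simps)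
    finally show "norm (dd b f x) \<le> B * norm b" .
  qed
qed

lemma smooth_bsupp_lipschitz:
  fixes f :: "'a::euclidean_space => 'b::real_normed_vector"
  assumes "smooth f" "bsupp f"
  obtains B where "B > 0" "\<And>x y. norm (f x - f y) \<le> B * norm (x - y)"
proof -
  obtain B where B: "B > 0" "\<And>x b. norm (dd b f x) \<le> B * norm b"
    using smooth_bsupp_bounded[OF assms] by metis
  show ?thesis
  proof (rule that[OF B(1)])
    fix x y
    show "norm (f x - f y) \<le> B * norm (x - y)"
    proof (rule differentiable_bound[of UNIV])
      show "(f has_derivative (\<lambda>h. dd h f z)) (at z within UNIV)" for z
        using smooth_has_derivative[OF assms(1)] by simp
      show "onorm (\<lambda>h. dd h f z) \<le> B" for z by (rule onorm_le) (use B in auto)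
    qed auto
  qed
qed

subsection \<open>Bump functions\<close>

text \<open>The family is closed under differentiation: the derivative of the \<open>k\<close>-th
  member combines the members \<open>k+1\<close> and \<open>k+2\<close>
  (\<open>DERIV_expinv\<close>). So smoothness of the ramp exp(-1/x), the case \<open>k = 0\<close>,
  is one induction over all \<open>k\<close> at once.\<close>

definition expinv :: "nat => real => real" where
  "expinv k x = (if x > 0 then (1/x)^k * exp (- 1/x) else 0)"

lemma expinv_tendsto: "(expinv k \<longlongrightarrow> 0) (at 0)"
proof (rule filterlim_split_at)
  have "((\<lambda>y::real. y^k / exp y) \<longlongrightarrow> 0) at_top" by (rule tendsto_power_div_exp_0)
  then have "((\<lambda>x::real. inverse x^k / exp (inverse x)) \<longlongrightarrow> 0) (at_right 0)"
    using filterlim_compose filterlim_inverse_at_top_right by blast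
  then show "(expinv k \<longlongrightarrow> 0) (at_right 0)"
    by (rule Lim_transform_eventually)
      (auto simp: eventually_at_filter expinv_def exp_minus divide_simps intro!: always_eventually)
  show "(expinv k \<longlongrightarrow> 0) (at_left 0)"
    by (rule Lim_transform_eventually[OF tendsto_const])
      (auto simp: eventually_at_filter expinv_def intro!: always_eventually)
qed

lemma DERIV_expinv: "DERIV (expinv k) x :> expinv (k+2) x - k * expinv (k+1) x"
proof -
  consider "x > 0" | "x < 0" | "x = 0" by linarith
  then show ?thesis
  proof cases
    case 1
    have "DERIV (\<lambda>x. (1/x)^k * exp (- 1/x)) x :> expinv (k+2) x - k * expinv (k+1) x"
      by (rule derivative_eq_intros refl | (use 1 in \<open>simp; fail\<close>))+
        (use 1 in \<open>cases k; simp add: expinv_def field_simps power2_eq_square\<close>)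
    then show ?thesis
      by (rule has_field_derivative_transform_within_open[where S="{0<..}"]) (use 1 in \<open>auto simp: expinv_def\<close>)
  next
    case 2
    have "DERIV (\<lambda>x. 0) x :> expinv (k+2) x - k * expinv (k+1) x" using 2 by (simp add: expinv_def)
    then show ?thesis
      by (rule has_field_derivative_transform_within_open[where S="{..<0}"]) (use 2 in \<open>auto simp: expinv_def\<close>)
  next
    case 3
    \<comment> \<open>At the origin the difference quotient of \<open>expinv k\<close> is
      \<open>expinv (k+1)\<close>, which tends to 0.\<close>
    have "((\<lambda>y. (expinv k y - expinv k 0) / (y - 0)) \<longlongrightarrow> 0) (at 0)"
      by (rule Lim_transform_eventually[OF expinv_tendsto[of "k+1"]])
        (auto simp: eventually_at_filter expinv_def intro!: always_eventually)
    then show ?thesis using 3 by (simp add: has_field_derivative_iff expinv_def)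
  qed
qed

lemma smooth_expinv: "smooth (expinv k)"
proof -
  have "Ck n (expinv k)" for n
  proof (induction n arbitrary: k)
    case (Suc n)
    show ?case
    proof (rule Ck_SucI)
      show "(expinv k has_derivative (*) (expinv (k+2) x - k * expinv (k+1) x)) (at x)" for x
        using DERIV_expinv[of k x] by (simp add: has_field_derivative_def)
      have "Ck n (\<lambda>x. expinv (k+2) x + (- real k) *\<^sub>R expinv (k+1) x)"
        by (intro Ck_add Ck_linear[OF bounded_linear_scaleR_right] Suc)
      then show "Ck n (\<lambda>x. (expinv (k+2) x - k * expinv (k+1) x) * b)" if "b \<in> Basis" for b :: real
        using that by simp
    qed
  qed simp
  then show ?thesis by (simp add: smooth_def)
qed

abbreviation "ramp \<equiv> expinv 0"

lemma ramp_simps: "ramp x = (if x > 0 then exp (-1/x) else 0)" by (simp add: expinv_def)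
lemma ramp_nonneg [simp]: "0 \<le> ramp x" and ramp_le_1: "ramp x \<le> 1" by (auto simp: ramp_simps)

definition bump :: "'a::euclidean_space => real" where "bump x = ramp (1 - x \<bullet> x)"

lemma smooth_bump: "smooth bump"
  unfolding bump_def
  by (intro smooth_compose[OF smooth_expinv] smooth_diff smooth_const smooth_inner smooth_ident)

lemma bump_eq_0: "norm x \<ge> 1 ==> bump x = 0"
proof -
  assume "norm x \<ge> 1"
  then have "x \<bullet> x \<ge> 1" by (simp add: dot_square_norm)
  then show ?thesis by (simp add: bump_def ramp_simps)
qed

lemma bump_nonneg [simp]: "0 \<le> bump x" and bump_le_1: "bump x \<le> 1"
  by (auto simp: bump_def ramp_le_1 ramp_simps)

text \<open>A smooth function that is exactly 1 on the negative axis and exactly 0 beyond a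
  point: \<open>ramp\<close> vanishes on the negative axis, so \<open>ramp (c - ramp t)\<close> is constant there.\<close>

definition cutoff :: "real => real" where
  "cutoff t = ramp (exp (-1) - ramp t) / ramp (exp (-1))"

lemma smooth_cutoff: "smooth cutoff"
proof -
  have "smooth (\<lambda>t. (1 / ramp (exp (-1))) * ramp (exp (-1) - ramp t))"
    by (intro smooth_mult smooth_const smooth_compose[OF smooth_expinv] smooth_diff smooth_expinv)
  then show ?thesis by (simp add: cutoff_def[abs_def])
qed

lemma cutoff_1: "t \<le> 0 ==> cutoff t = 1" by (simp add: cutoff_def ramp_simps)
lemma cutoff_0: "t \<ge> 1 ==> cutoff t = 0"
proof -
  assume "t \<ge> 1"
  then have "exp (-1) \<le> exp (-1/t)" by (simp add: field_simps)
  then show ?thesis using \<open>t \<ge> 1\<close> by (simp add: cutoff_def ramp_simps)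
qed

section \<open>Square integrable functions\<close>

text \<open>The measure is a parameter because two are in use: \<open>lborel\<close> for functions
  extended by zero, and \<open>lebesgue_on \<Omega>\<close> in the given definitions.\<close>

definition sqi :: "'a measure => ('a => 'b::euclidean_space) => bool" where
  "sqi M f \<longleftrightarrow> f \<in> borel_measurable M \<and> integrable M (\<lambda>x. (norm (f x))\<^sup>2)"

definition n2 :: "'a measure => ('a => 'b::euclidean_space) => real" where
  "n2 M f = sqrt (\<integral>x. (norm (f x))\<^sup>2 \<partial>M)"

lemma sqi_meas: "sqi M f ==> f \<in> borel_measurable M"
  and sqi_integrable: "sqi M f ==> integrable M (\<lambda>x. (norm (f x))\<^sup>2)"
  by (auto simp: sqi_def)

lemma n2_nonneg [simp]: "0 \<le> n2 M f" by (simp add: n2_def)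

lemma n2_sq: "(n2 M f)\<^sup>2 = (\<integral>x. (norm (f x))\<^sup>2 \<partial>M)" by (simp add: n2_def)

lemma sqi_bound:
  fixes g :: "'a => 'b::euclidean_space"
  assumes "integrable M f" "g \<in> borel_measurable M" "\<And>x. x \<in> space M ==> (norm (g x))\<^sup>2 \<le> f x"
  shows "sqi M g"
  unfolding sqi_def
proof
  show "integrable M (\<lambda>x. (norm (g x))\<^sup>2)"
    by (rule Bochner_Integration.integrable_bound[OF assms(1)])
      (use assms(2,3) in \<open>auto intro!: AE_I2 simp: abs_of_nonneg intro: order_trans[OF _ abs_ge_self]\<close>)
qed fact

lemma norm_add_sq_le: "(norm (a + b))\<^sup>2 \<le> 2 * (norm a)\<^sup>2 + 2 * (norm b)\<^sup>2"
proof -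
  have "(norm (a + b))\<^sup>2 \<le> (norm a + norm b)\<^sup>2" by (intro power_mono norm_triangle_ineq) auto
  also have "\<dots> \<le> 2 * (norm a)\<^sup>2 + 2 * (norm b)\<^sup>2"
    using sum_squares_bound[of "norm a" "norm b"] by (simp add: power2_sum)
  finally show ?thesis .
qed

lemma sqi_add: "sqi M f ==> sqi M g ==> sqi M (\<lambda>x. f x + g x)"
  by (rule sqi_bound[where f="\<lambda>x. 2 * (norm (f x))\<^sup>2 + 2 * (norm (g x))\<^sup>2"])
    (auto simp: sqi_def norm_add_sq_le)

lemma sqi_scaleR: "sqi M f ==> sqi M (\<lambda>x. c *\<^sub>R f x)"
  by (auto simp: sqi_def power_mult_distrib)

lemma sqi_minus: "sqi M f ==> sqi M (\<lambda>x. - f x)" using sqi_scaleR[of M f "-1"] by simp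

lemma sqi_diff: "sqi M f ==> sqi M g ==> sqi M (\<lambda>x. f x - g x)"
  using sqi_add[OF _ sqi_minus] by fastforce

lemma sqi_prod_integrable:
  assumes "sqi M f" "sqi M g"
  shows "integrable M (\<lambda>x. norm (f x) * norm (g x))"
proof (rule Bochner_Integration.integrable_bound[where f="\<lambda>x. (norm (f x))\<^sup>2 + (norm (g x))\<^sup>2"])
  show "AE x in M. norm (norm (f x) * norm (g x)) \<le> norm ((norm (f x))\<^sup>2 + (norm (g x))\<^sup>2)"
  proof (intro AE_I2)
    fix x
    have "0 \<le> norm (f x) * norm (g x)" by simp
    then show "norm (norm (f x) * norm (g x)) \<le> norm ((norm (f x))\<^sup>2 + (norm (g x))\<^sup>2)"
      using sum_squares_bound[of "norm (f x)" "norm (g x)"] unfolding real_norm_def by linarith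
  qed
qed (use assms in \<open>auto simp: sqi_def\<close>)

lemma sqi_inner:
  assumes "sqi M f" "sqi M g"
  shows "integrable M (\<lambda>x. f x \<bullet> g x)"
  by (rule Bochner_Integration.integrable_bound[OF sqi_prod_integrable[OF assms]])
    (use assms in \<open>auto simp: sqi_def Cauchy_Schwarz_ineq2 intro!: AE_I2\<close>)

lemma n2_add_sq:
  assumes "sqi M f" "sqi M g"
  shows "(n2 M (\<lambda>x. f x + g x))\<^sup>2 = (n2 M f)\<^sup>2 + 2 * (\<integral>x. f x \<bullet> g x \<partial>M) + (n2 M g)\<^sup>2"
proof -
  have "(n2 M (\<lambda>x. f x + g x))\<^sup>2 = (\<integral>x. (norm (f x))\<^sup>2 + 2 * (f x \<bullet> g x) + (norm (g x))\<^sup>2 \<partial>M)"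
    unfolding n2_sq by (intro Bochner_Integration.integral_cong) (auto simp: power2_norm_eq_inner inner_add_left inner_add_right inner_commute)
  then show ?thesis using assms sqi_inner[OF assms] by (simp add: n2_sq sqi_integrable)
qed

lemma n2_scaleR: "n2 M (\<lambda>x. c *\<^sub>R f x) = \<bar>c\<bar> * n2 M f"
  by (simp add: n2_def power_mult_distrib real_sqrt_mult)

lemma n2_minus: "n2 M (\<lambda>x. - f x) = n2 M f" by (simp add: n2_def)
lemma n2_diff_commute: "n2 M (\<lambda>x. f x - g x) = n2 M (\<lambda>x. g x - f x)" by (simp add: n2_def norm_minus_commute)

lemma n2_diff_sq:
  assumes "sqi M f" "sqi M g"
  shows "(n2 M (\<lambda>x. f x - g x))\<^sup>2 = (n2 M f)\<^sup>2 - 2 * (\<integral>x. f x \<bullet> g x \<partial>M) + (n2 M g)\<^sup>2"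
  using n2_add_sq[OF assms(1) sqi_minus[OF assms(2)]] by (simp add: n2_minus)

lemma nonneg_quadratic_discriminant:
  fixes a b c :: real
  assumes "\<And>l. 0 \<le> a + 2 * l * b + l\<^sup>2 * c" "c \<ge> 0"
  shows "b\<^sup>2 \<le> a * c"
proof (cases "c = 0")
  case True
  have "b = 0"
  proof (rule ccontr)
    assume "b \<noteq> 0"
    \<comment> \<open>This \<open>l\<close> turns \<open>a + 2 * l * b\<close> into -1.\<close>
    then show False using assms(1)[of "-(a+1)/(2*b)"] True by (simp add: field_simps)
  qed
  then show ?thesis using True by simp
next
  case False
  then have "c > 0" using assms by simp
  then show ?thesis using assms(1)[of "-b/c"] by (simp add: field_simps power2_eq_square)
qed

lemma n2_Cauchy_Schwarz:
  assumes "sqi M f" "sqi M g"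
  shows "\<bar>\<integral>x. f x \<bullet> g x \<partial>M\<bar> \<le> n2 M f * n2 M g"
proof -
  have "0 \<le> (n2 M f)\<^sup>2 + 2 * l * (\<integral>x. f x \<bullet> g x \<partial>M) + l\<^sup>2 * (n2 M g)\<^sup>2" for l
    using n2_add_sq[OF assms(1) sqi_scaleR[OF assms(2), of l]] zero_le_power2[of "n2 M (\<lambda>x. f x + l *\<^sub>R g x)"]
    by (simp add: n2_scaleR power_mult_distrib)
  then have "(\<integral>x. f x \<bullet> g x \<partial>M)\<^sup>2 \<le> (n2 M f)\<^sup>2 * (n2 M g)\<^sup>2"
    by (rule nonneg_quadratic_discriminant) simp
  then show ?thesis
    by (metis abs_le_square_iff abs_mult abs_of_nonneg n2_nonneg power_mult_distrib)
qed

lemma n2_Cauchy_Schwarz_norm: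
  fixes f :: "'a => 'b::euclidean_space" and g :: "'a => 'c::euclidean_space"
  assumes "sqi M f" "sqi M g"
  shows "(\<integral>x. norm (f x) * norm (g x) \<partial>M) \<le> n2 M f * n2 M g"
proof -
  have "sqi M (\<lambda>x. norm (f x))" "sqi M (\<lambda>x. norm (g x))" using assms by (auto simp: sqi_def)
  from n2_Cauchy_Schwarz[OF this] show ?thesis by (simp add: n2_def inner_real_def)
qed

lemma n2_triangle:
  assumes "sqi M f" "sqi M g"
  shows "n2 M (\<lambda>x. f x + g x) \<le> n2 M f + n2 M g"
proof (rule power2_le_imp_le)
  show "(n2 M (\<lambda>x. f x + g x))\<^sup>2 \<le> (n2 M f + n2 M g)\<^sup>2"
    using n2_add_sq[OF assms] n2_Cauchy_Schwarz[OF assms] by (simp add: power2_sum)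
qed simp

lemma n2_triangle_diff:
  assumes "sqi M f" "sqi M g" "sqi M h"
  shows "n2 M (\<lambda>x. f x - h x) \<le> n2 M (\<lambda>x. f x - g x) + n2 M (\<lambda>x. g x - h x)"
  using n2_triangle[OF sqi_diff[OF assms(1,2)] sqi_diff[OF assms(2,3)]] by simp

lemma n2_reverse_triangle:
  assumes "sqi M f" "sqi M g"
  shows "\<bar>n2 M f - n2 M g\<bar> \<le> n2 M (\<lambda>x. f x - g x)"
  using n2_triangle[OF sqi_diff[OF assms] assms(2)] n2_triangle[OF sqi_diff[OF assms(2,1)] assms(1)]
  by (simp add: n2_diff_commute[of M f g])

lemma n2_tendsto:
  assumes "\<And>i. sqi M (f i)" "sqi M g" "((\<lambda>i. n2 M (\<lambda>x. f i x - g x)) \<longlongrightarrow> 0) F"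
  shows "((\<lambda>i. n2 M (f i)) \<longlongrightarrow> n2 M g) F"
  using tendsto_0_le[OF assms(3), of "\<lambda>i. n2 M (f i) - n2 M g" 1] n2_reverse_triangle[OF assms(1,2)]
  by (auto simp: LIM_zero_iff)

lemma inner_tendsto_n2:
  assumes "\<And>i. sqi M (f i)" "sqi M g" "sqi M h" "((\<lambda>i. n2 M (\<lambda>x. f i x - g x)) \<longlongrightarrow> 0) F"
  shows "((\<lambda>i. \<integral>x. f i x \<bullet> h x \<partial>M) \<longlongrightarrow> (\<integral>x. g x \<bullet> h x \<partial>M)) F"
proof -
  have "norm ((\<integral>x. f i x \<bullet> h x \<partial>M) - (\<integral>x. g x \<bullet> h x \<partial>M)) \<le> norm (n2 M (\<lambda>x. f i x - g x)) * n2 M h" for i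
    using n2_Cauchy_Schwarz[OF sqi_diff[OF assms(1)[of i] assms(2)] assms(3)]
      sqi_inner[OF assms(1,3), of i] sqi_inner[OF assms(2,3)]
    by (simp add: inner_diff_left)
  then show ?thesis
    using tendsto_0_le[OF assms(4)] LIM_zero_iff by (metis (no_types, lifting) always_eventually)
qed

lemma (in finite_measure) sqi_integrable_norm:
  assumes "sqi M f" shows "integrable M (\<lambda>x. norm (f x))" "integrable M f"
    "(\<integral>x. norm (f x) \<partial>M) \<le> n2 M f * sqrt (measure M (space M))"
proof -
  have 1: "sqi M (\<lambda>_. 1::real)" by (simp add: sqi_def)
  show i: "integrable M (\<lambda>x. norm (f x))" using sqi_prod_integrable[OF assms 1] by simp
  then show "integrable M f" using assms by (simp add: sqi_def integrable_norm_iff)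
  show "(\<integral>x. norm (f x) \<partial>M) \<le> n2 M f * sqrt (measure M (space M))"
    using n2_Cauchy_Schwarz_norm[OF assms 1] by (simp add: n2_def)
qed

text \<open>Riesz-Fischer. On a finite measure space an L^2 Cauchy sequence is Cauchy in L^1, which
  yields a subsequence converging almost everywhere. Fatou's lemma along it (\<open>key\<close>)
  turns the Cauchy bound into a bound for the distance to the limit \<open>g\<close>.\<close>

lemma (in finite_measure) n2_complete:
  fixes f :: "nat => 'a => 'b::euclidean_space"
  assumes f: "\<And>n. sqi M (f n)"
    and C: "\<And>e. e > 0 ==> \<exists>N. \<forall>i\<ge>N. \<forall>j\<ge>N. n2 M (\<lambda>x. f i x - f j x) < e"
  obtains g where "sqi M g" "(\<lambda>n. n2 M (\<lambda>x. f n x - g x)) \<longlonglongrightarrow> 0"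
proof -
  define m where "m = sqrt (measure M (space M))"
  have s: "sqi M (\<lambda>x. f i x - f j x)" for i j by (intro sqi_diff f)
  have "\<exists>N. \<forall>i\<ge>N. \<forall>j\<ge>N. LINT x|M. norm (f i x - f j x) < e" if "e > 0" for e
  proof -
    have m0: "m \<ge> 0" by (simp add: m_def)
    obtain N where N: "\<forall>i\<ge>N. \<forall>j\<ge>N. n2 M (\<lambda>x. f i x - f j x) < e / (m + 1)"
      using C[of "e / (m+1)"] \<open>e > 0\<close> m0 by auto
    have "LINT x|M. norm (f i x - f j x) < e" if "i \<ge> N" "j \<ge> N" for i j
    proof -
      have "(LINT x|M. norm (f i x - f j x)) \<le> n2 M (\<lambda>x. f i x - f j x) * m"
        using sqi_integrable_norm(3)[OF s[of i j]] by (simp add: m_def)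
      also have "\<dots> \<le> n2 M (\<lambda>x. f i x - f j x) * (m + 1)" by (intro mult_left_mono) auto
      also have "\<dots> < e" using N that m0 by (simp add: field_simps)
      finally show ?thesis .
    qed
    then show ?thesis by blast
  qed
  from cauchy_L1_AE_cauchy_subseq[OF sqi_integrable_norm(2)[OF f] this]
  obtain r where r: "strict_mono r" "AE x in M. Cauchy (\<lambda>i. f (r i) x)" by blast
  have [measurable]: "f n \<in> borel_measurable M" for n using f by (simp add: sqi_def)
  define g where "g = (\<lambda>x. lim (\<lambda>i. f (r i) x))"
  have [measurable]: "g \<in> borel_measurable M" unfolding g_def by measurable
  have lim: "AE x in M. (\<lambda>i. f (r i) x) \<longlonglongrightarrow> g x"
    using r(2) by eventually_elim (auto simp: g_def Cauchy_convergent_iff convergent_LIMSEQ_iff)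
  have key: "(\<integral>\<^sup>+x. ennreal ((norm (f n x - g x))\<^sup>2) \<partial>M) \<le> ennreal (e\<^sup>2)"
    if "e > 0" "\<forall>i\<ge>N. \<forall>j\<ge>N. n2 M (\<lambda>x. f i x - f j x) < e" "n \<ge> N" for e n N
  proof -
    have "(\<integral>\<^sup>+x. ennreal ((norm (f n x - g x))\<^sup>2) \<partial>M) = (\<integral>\<^sup>+x. liminf (\<lambda>i. ennreal ((norm (f n x - f (r i) x))\<^sup>2)) \<partial>M)"
    proof (rule nn_integral_cong_AE, use lim in eventually_elim)
      fix x assume "(\<lambda>i. f (r i) x) \<longlonglongrightarrow> g x"
      then have "(\<lambda>i. ennreal ((norm (f n x - f (r i) x))\<^sup>2)) \<longlonglongrightarrow> ennreal ((norm (f n x - g x))\<^sup>2)"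
        by (intro tendsto_intros)
      then show "ennreal ((norm (f n x - g x))\<^sup>2) = liminf (\<lambda>i. ennreal ((norm (f n x - f (r i) x))\<^sup>2))"
        using lim_imp_Liminf[OF trivial_limit_sequentially] by metis
    qed
    also have "\<dots> \<le> liminf (\<lambda>i. \<integral>\<^sup>+x. ennreal ((norm (f n x - f (r i) x))\<^sup>2) \<partial>M)"
      by (rule nn_integral_liminf) measurable
    also have "\<dots> \<le> ennreal (e\<^sup>2)"
    proof (rule order_trans[OF Liminf_mono[where g="\<lambda>_. ennreal (e\<^sup>2)"]])
      have "(\<integral>\<^sup>+x. ennreal ((norm (f n x - f (r i) x))\<^sup>2) \<partial>M) \<le> ennreal (e\<^sup>2)" if "i \<ge> N" for i
      proof -
        have "r i \<ge> N" using that r(1) by (meson order_trans seq_suble)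
        then have "n2 M (\<lambda>x. f n x - f (r i) x) \<le> e" using \<open>n \<ge> N\<close> \<open>\<forall>i\<ge>N. \<forall>j\<ge>N. n2 M (\<lambda>x. f i x - f j x) < e\<close> by (simp add: less_imp_le)
        then have "(n2 M (\<lambda>x. f n x - f (r i) x))\<^sup>2 \<le> e\<^sup>2" by (intro power_mono) auto
        then show ?thesis
          using s[of n "r i"] by (subst nn_integral_eq_integral) (auto simp: sqi_def n2_sq)
      qed
      then show "\<forall>\<^sub>F i in sequentially. (\<integral>\<^sup>+x. ennreal ((norm (f n x - f (r i) x))\<^sup>2) \<partial>M) \<le> ennreal (e\<^sup>2)"
        by (auto simp: eventually_sequentially)
    qed (simp add: Liminf_const)
    finally show ?thesis .
  qed
  obtain N1 where N1: "\<forall>i\<ge>N1. \<forall>j\<ge>N1. n2 M (\<lambda>x. f i x - f j x) < 1" using C[of 1] by auto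
  have "integrable M (\<lambda>x. (norm (f N1 x - g x))\<^sup>2)"
    using key[of 1 N1 N1] N1 by (intro integrableI_bounded) (auto intro: le_less_trans)
  then have "sqi M (\<lambda>x. f N1 x - g x)" by (simp add: sqi_def)
  from sqi_diff[OF f[of N1] this] have g: "sqi M g" by simp
  have "(\<lambda>n. n2 M (\<lambda>x. f n x - g x)) \<longlonglongrightarrow> 0"
  proof (rule LIMSEQ_I)
    fix e :: real assume "e > 0"
    then obtain N where N: "\<forall>i\<ge>N. \<forall>j\<ge>N. n2 M (\<lambda>x. f i x - f j x) < e/2" using C[of "e/2"] by auto
    have "n2 M (\<lambda>x. f n x - g x) \<le> e/2" if "n \<ge> N" for n
    proof -
      have "ennreal ((n2 M (\<lambda>x. f n x - g x))\<^sup>2) \<le> ennreal ((e/2)\<^sup>2)"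
        using key[of "e/2" N n] N that \<open>e > 0\<close> sqi_diff[OF f[of n] g]
        by (simp add: nn_integral_eq_integral sqi_def n2_sq)
      then have "(n2 M (\<lambda>x. f n x - g x))\<^sup>2 \<le> (e/2)\<^sup>2" by (simp add: ennreal_le_iff)
      then show ?thesis by (rule power2_le_imp_le) (use \<open>e > 0\<close> in simp)
    qed
    moreover have "e / 2 < e" using \<open>e > 0\<close> by simp
    ultimately have "\<forall>n\<ge>N. n2 M (\<lambda>x. f n x - g x) < e" using le_less_trans by blast
    then show "\<exists>no. \<forall>n\<ge>no. norm (n2 M (\<lambda>x. f n x - g x) - 0) < e" by auto
  qed
  with g show ?thesis by (rule that)
qed

section \<open>Lebesgue measure: translations, averages and approximation\<close>

lemma nn_integral_shift:
  fixes f :: "'a::euclidean_space => ennreal"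
  assumes [measurable]: "f \<in> borel_measurable borel"
  shows "(\<integral>\<^sup>+x. f (x + a) \<partial>lborel) = (\<integral>\<^sup>+x. f x \<partial>lborel)"
  by (subst (2) lborel_distr_plus[of a, symmetric]) (simp add: nn_integral_distr add.commute)

lemma integral_shift:
  fixes f :: "'a::euclidean_space => 'b::{banach, second_countable_topology}"
  assumes [measurable]: "f \<in> borel_measurable borel"
  shows "(\<integral>x. f (x + a) \<partial>lborel) = (\<integral>x. f x \<partial>lborel)"
  by (subst (2) lborel_distr_plus[of a, symmetric]) (simp add: integral_distr add.commute)

lemma integrable_shift:
  fixes f :: "'a::euclidean_space => 'b::{banach, second_countable_topology}"
  assumes "integrable lborel f"
  shows "integrable lborel (\<lambda>x. f (x + a))"
proof -
  have [measurable]: "f \<in> borel_measurable borel" using assms by auto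
  have "integrable (distr lborel borel ((+) a)) f" using assms by (simp add: lborel_distr_plus)
  then show ?thesis by (simp add: integrable_distr_eq add.commute)
qed

lemma integral_dilate:
  fixes f :: "'a::euclidean_space => 'b::{banach, second_countable_topology}"
  assumes [measurable]: "f \<in> borel_measurable borel" and d: "d > 0"
  shows "(\<integral>y. f ((1/d) *\<^sub>R (y - a)) \<partial>lborel) = d ^ DIM('a) *\<^sub>R (\<integral>z. f z \<partial>lborel)"
proof -
  have "(\<integral>y. f ((1/d) *\<^sub>R (y - a)) \<partial>lborel)
     = (\<integral>y. f ((1/d) *\<^sub>R (y - a)) \<partial>density (distr lborel borel (\<lambda>x. a + d *\<^sub>R x)) (\<lambda>_. ennreal (\<bar>d\<bar> ^ DIM('a))))"
    using d by (subst lborel_affine[of d a]) (auto simp: ennreal_power)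
  also have "\<dots> = d ^ DIM('a) *\<^sub>R (\<integral>z. f z \<partial>lborel)"
    using d by (subst integral_density) (auto simp: integral_distr)
  finally show ?thesis .
qed

lemma integrable_bsupp:
  fixes f :: "'a::euclidean_space => 'b::euclidean_space"
  assumes "continuous_on UNIV f" "bsupp f"
  shows "integrable lborel f"
proof -
  obtain R where R: "\<And>x. norm x \<ge> R ==> f x = 0" using assms by (auto simp: bsupp_def)
  obtain B where B: "\<And>x. norm (f x) \<le> B" using bsupp_uniform(2)[OF assms] by auto
  have [measurable]: "f \<in> borel_measurable borel" using assms(1) by (rule borel_measurable_continuous_onI)
  show ?thesis
  proof (rule Bochner_Integration.integrable_bound[where f="\<lambda>x. indicator (cball 0 R) x *\<^sub>R B"])
    show "integrable lborel (\<lambda>x. indicator (cball (0::'a) R) x *\<^sub>R B)"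
      using emeasure_bounded_finite[of "cball (0::'a) R"] by (intro integrable_scaleR_left) (auto simp: integrable_indicator_iff)
    show "AE x in lborel. norm (f x) \<le> norm (indicator (cball 0 R) x *\<^sub>R B)"
    proof (intro AE_I2)
      fix x show "norm (f x) \<le> norm (indicator (cball 0 R) x *\<^sub>R B)"
        using R[of x] B[of x] by (cases "norm x \<le> R") (auto simp: indicator_def)
    qed
  qed simp
qed

lemma bsuppI: "(\<And>x. norm x \<ge> R ==> f x = 0) ==> bsupp f" unfolding bsupp_def by blast

text \<open>Translation invariance makes the integral of every difference quotient vanish. The
  quotients converge to the derivative and are dominated through the Lipschitz constant on a common
  ball.\<close>

lemma integral_dd_eq_0:
  fixes g :: "'a::euclidean_space => 'b::euclidean_space"
  assumes g: "smooth g" "bsupp g"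
  shows "(\<integral>x. dd b g x \<partial>lborel) = 0"
proof -
  obtain B where B: "\<And>x y. norm (g x - g y) \<le> B * norm (x - y)" "B > 0"
    using smooth_bsupp_lipschitz[OF g] by metis
  obtain R where R: "\<And>x. norm x \<ge> R ==> g x = 0" using g by (auto simp: bsupp_def)
  define h where "h n = inverse (real (Suc n))" for n
  have h: "h n > 0" "h n \<le> 1" "h \<longlonglongrightarrow> 0" for n unfolding h_def using LIMSEQ_inverse_real_of_nat by (auto simp: field_simps)
  have [measurable]: "g \<in> borel_measurable borel" "(\<lambda>x. dd b g x) \<in> borel_measurable borel"
    by (intro borel_measurable_continuous_onI smooth_continuous g smooth_dd)+
  have "h n \<noteq> 0" for n using h(1)[of n] by simp
  then have hf: "filterlim h (at 0) sequentially" using h(3) by (intro filterlim_atI) auto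
  have int: "integrable lborel g" by (intro integrable_bsupp smooth_continuous g)
  have "(\<lambda>n. \<integral>x. (1 / h n) *\<^sub>R (g (x + h n *\<^sub>R b) - g x) \<partial>lborel) \<longlonglongrightarrow> (\<integral>x. dd b g x \<partial>lborel)"
  proof (rule integral_dominated_convergence[where w="\<lambda>x. indicator (cball 0 (R + norm b)) x *\<^sub>R (B * norm b)"])
    show "integrable lborel (\<lambda>x. indicator (cball (0::'a) (R + norm b)) x *\<^sub>R (B * norm b))"
      using emeasure_bounded_finite[of "cball (0::'a) (R + norm b)"] by (intro integrable_scaleR_left) (auto simp: integrable_indicator_iff)
    show "AE x in lborel. (\<lambda>n. (1 / h n) *\<^sub>R (g (x + h n *\<^sub>R b) - g x)) \<longlonglongrightarrow> dd b g x"
    proof (intro AE_I2)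
      fix x
      have "((\<lambda>t. g (x + t *\<^sub>R b)) has_vector_derivative dd b g x) (at 0)"
      proof -
        have "((\<lambda>t. g (x + t *\<^sub>R b)) has_derivative (\<lambda>t. dd (t *\<^sub>R b) g x)) (at 0)"
          by (rule has_derivative_compose[where g=g and g'="\<lambda>v. dd v g x"])
            (auto intro!: derivative_eq_intros smooth_has_derivative g)
        moreover have "(\<lambda>t. dd (t *\<^sub>R b) g x) = (\<lambda>t. t *\<^sub>R dd b g x)"
          using dd_linear[OF smooth_differentiable[OF g(1)], of x] by (simp add: linear_simps bounded_linear.linear linear_cmul)
        ultimately show ?thesis by (simp add: has_vector_derivative_def)
      qed
      then have "((\<lambda>t. (1/t) *\<^sub>R (g (x + t *\<^sub>R b) - g x)) \<longlongrightarrow> dd b g x) (at 0)"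
      proof -
        assume "((\<lambda>t. g (x + t *\<^sub>R b)) has_vector_derivative dd b g x) (at 0)"
        then have "((\<lambda>t. norm (g (x + t *\<^sub>R b) - g x - t *\<^sub>R dd b g x) / \<bar>t\<bar>) \<longlongrightarrow> 0) (at 0)"
          by (auto simp: has_vector_derivative_def has_derivative_at)
        moreover have "norm (g (x + t *\<^sub>R b) - g x - t *\<^sub>R dd b g x) / \<bar>t\<bar>
            = norm ((1/t) *\<^sub>R (g (x + t *\<^sub>R b) - g x) - dd b g x)" if "t \<noteq> 0" for t
        proof -
          have "g (x + t *\<^sub>R b) - g x - t *\<^sub>R dd b g x = t *\<^sub>R ((1/t) *\<^sub>R (g (x + t *\<^sub>R b) - g x) - dd b g x)"
            using that by (simp add: scaleR_diff_right)
          then show ?thesis using that by simp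
        qed
        ultimately have "((\<lambda>t. norm ((1/t) *\<^sub>R (g (x + t *\<^sub>R b) - g x) - dd b g x)) \<longlongrightarrow> 0) (at 0)"
          by (auto elim!: Lim_transform_eventually simp: eventually_at_filter)
        then show ?thesis by (simp add: tendsto_norm_zero_iff LIM_zero_iff)
      qed
      from filterlim_compose[OF this hf]
      show "(\<lambda>n. (1 / h n) *\<^sub>R (g (x + h n *\<^sub>R b) - g x)) \<longlonglongrightarrow> dd b g x" .
    qed
    fix n
    show "AE x in lborel. norm ((1 / h n) *\<^sub>R (g (x + h n *\<^sub>R b) - g x)) \<le> indicator (cball 0 (R + norm b)) x *\<^sub>R (B * norm b)"
    proof (intro AE_I2)
      fix x
      have nb: "norm (h n *\<^sub>R b) \<le> norm b" using h(1,2)[of n] by (simp add: mult_left_le_one_le)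
      show "norm ((1 / h n) *\<^sub>R (g (x + h n *\<^sub>R b) - g x)) \<le> indicator (cball 0 (R + norm b)) x *\<^sub>R (B * norm b)"
      proof (cases "norm x \<le> R + norm b")
        case True
        then show ?thesis using B(1)[of "x + h n *\<^sub>R b" x] h(1)[of n]
          by (simp add: divide_le_eq mult_ac)
      next
        case False
        have "norm (x + h n *\<^sub>R b) \<ge> R"
          using norm_triangle_ineq4[of "x + h n *\<^sub>R b" "h n *\<^sub>R b"] False nb by simp
        moreover have "norm x \<ge> R" using False norm_ge_zero[of b] by linarith
        ultimately have "g (x + h n *\<^sub>R b) = 0" "g x = 0" using R by blast+
        then show ?thesis using False by simp
      qed
    qed
  qed measurable
  moreover have "(\<integral>x. (1 / h n) *\<^sub>R (g (x + h n *\<^sub>R b) - g x) \<partial>lborel) = 0" for n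
    using int integrable_shift[OF int] by (simp add: integral_shift)
  ultimately have "(\<lambda>n::nat. 0) \<longlonglongrightarrow> (\<integral>x. dd b g x \<partial>lborel)" by (simp only:)
  then show ?thesis by (simp add: LIMSEQ_const_iff)
qed

section \<open>Density of continuous functions with bounded support, and continuity of
  translations\<close>

lemma cball_borel [measurable]: "cball (a::'a::euclidean_space) r \<in> sets borel" by simp

text \<open>A Urysohn function between a closed set inside \<open>A\<close> and an open set around
  it. Cutting \<open>A\<close> to a large ball first, and the open set to a ball one unit larger,
  makes the support bounded; the error sits on three small difference sets.\<close>

lemma Cc_dense_indicator:
  fixes A :: "'a::euclidean_space set"
  assumes A: "A \<in> sets borel" "emeasure lborel A < \<infinity>" and e: "e > 0"
  obtains g :: "'a => real" where "continuous_on UNIV g" "bsupp g"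
    "(\<integral>x. \<bar>indicator A x - g x\<bar> \<partial>lborel) < e"
proof -
  have [measurable]: "A \<in> sets borel" by fact
  define An where "An n = A \<inter> cball 0 (real n)" for n :: nat
  have An[measurable]: "An n \<in> sets borel" for n by (simp add: An_def)
  have "(\<lambda>n. measure lborel (An n)) \<longlonglongrightarrow> measure lborel (\<Union>n. An n)"
  proof (rule Lim_measure_incseq)
    show "incseq An" by (auto simp: incseq_def An_def)
    have "(\<Union>n. An n) \<subseteq> A" by (auto simp: An_def)
    then show "emeasure lborel (\<Union>n. An n) \<noteq> \<infinity>" using A emeasure_mono[of _ A lborel] by (metis infinity_ennreal_def le_less_trans less_irrefl sets_lborel)
  qed auto
  moreover have "(\<Union>n. An n) = A" by (auto simp: An_def real_arch_simple)
  ultimately have "(\<lambda>n. measure lborel (An n)) \<longlonglongrightarrow> measure lborel A" by simp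
  then have "\<forall>\<^sub>F n in sequentially. measure lborel A - e/3 < measure lborel (An n)"
    using e by (intro order_tendstoD(1)) auto
  then obtain n where n: "measure lborel A - measure lborel (An n) < e/3"
    by (metis (no_types, lifting) add.commute diff_less_eq eventually_sequentially order_refl)
  have fA: "A \<in> fmeasurable lborel" using A by (simp add: fmeasurable_def)
  have "An n \<subseteq> A" by (auto simp: An_def)
  then have mAn: "measure lborel (A - An n) < e/3"
    using n measurable_measure_Diff[OF fA, of "An n"] An[of n] by (simp only: sets_lborel)
  have sA: "An n \<in> sets lebesgue" and e3: "e/3 > 0" using e by auto
  obtain K where K: "closed K" "K \<subseteq> An n" "emeasure lebesgue (An n - K) < ennreal (e/3)"
    by (rule sets_lebesgue_inner_closed[OF sA e3]) blast
  obtain P where P: "open P" "K \<subseteq> P" "emeasure lebesgue (P - K) < ennreal (e/3)"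
    by (rule sets_lebesgue_outer_open[OF _ e3, of K]) (use K(1) in \<open>auto intro: that\<close>)
  define Q where "Q = P \<inter> ball 0 (real n + 1)"
  have Q: "open Q" "K \<subseteq> Q" using P K by (auto simp: Q_def An_def)
  have [measurable]: "K \<in> sets borel" "P \<in> sets borel" "Q \<in> sets borel" using K P Q by auto
  have mK: "emeasure lborel (An n - K) < ennreal (e/3)" using K(3) by simp
  have "emeasure lborel (Q - K) \<le> emeasure lborel (P - K)" by (intro emeasure_mono) (auto simp: Q_def)
  with P(3) have mQ: "emeasure lborel (Q - K) < ennreal (e/3)" by simp
  obtain g :: "'a => real" where g: "continuous_on UNIV g" "\<And>x. g x \<in> closed_segment 1 0"
    "\<And>x. x \<in> K ==> g x = 1" "\<And>x. x \<in> - Q ==> g x = 0"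
    using Urysohn[of K "-Q" 1 0] K Q by auto
  have g01: "0 \<le> g x" "g x \<le> 1" for x using g(2)[of x] by (auto simp: closed_segment_eq_real_ivl split: if_splits)
  have i1: "integrable lborel (indicat_real (A - An n))" "integrable lborel (indicat_real (An n - K))"
      "integrable lborel (indicat_real (Q - K))"
    using mK mQ A emeasure_mono[of "A - An n" A lborel] by (auto simp: integrable_indicator_iff intro: less_trans le_less_trans)
  have bs: "bsupp g" by (rule bsuppI[of "real n + 1"]) (auto intro!: g simp: Q_def)
  have le: "\<bar>indicator A x - g x\<bar> \<le> indicator (A - An n) x + indicator (An n - K) x + indicator (Q - K) x" for x
    using g01[of x] g(3)[of x] g(4)[of x] K(2) Q(2) by (auto simp: indicator_def An_def)
  have "(\<integral>x. \<bar>indicator A x - g x\<bar> \<partial>lborel)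
     \<le> (\<integral>x. indicator (A - An n) x + indicator (An n - K) x + indicator (Q - K) x \<partial>lborel)"
    using i1 le integrable_bsupp[OF g(1) bs] A
    by (intro integral_mono) (auto simp: integrable_indicator_iff)
  also have "\<dots> = measure lborel (A - An n) + measure lborel (An n - K) + measure lborel (Q - K)"
    using i1 by simp
  also have "\<dots> < e"
  proof -
    have "measure lborel X < e/3" if "emeasure lborel X < ennreal (e/3)" for X :: "'a set"
    proof -
      have "emeasure lborel X = ennreal (measure lborel X)"
        using that by (intro emeasure_eq_ennreal_measure) auto
      then show ?thesis using that e3 by (simp add: ennreal_less_iff)
    qed
    from this[OF mK] this[OF mQ] show ?thesis using mAn by linarith
  qed
  finally show ?thesis using that g(1) bs by blast
qed

lemma bsupp_add:
  assumes "bsupp f" "bsupp g" shows "bsupp (\<lambda>x. f x + g x :: 'b::real_normed_vector)"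
proof -
  obtain R S where "\<And>x. norm x \<ge> R ==> f x = 0" "\<And>x. norm x \<ge> S ==> g x = 0"
    using assms by (auto simp: bsupp_def)
  then show ?thesis by (intro bsuppI[of "max R S"]) auto
qed

lemma Cc_dense_L1:
  fixes f :: "'a::euclidean_space => 'b::euclidean_space"
  assumes "integrable lborel f" "e > 0"
  shows "\<exists>g. continuous_on UNIV g \<and> bsupp g \<and> (\<integral>x. norm (f x - g x) \<partial>lborel) < e"
  using assms
proof (induction f arbitrary: e rule: integrable_induct)
  case (base A c)
  have "e / (norm c + 1) > 0" using base by (auto intro!: divide_pos_pos add_nonneg_pos)
  then obtain g :: "'a => real" where g: "continuous_on UNIV g" "bsupp g"
    "(\<integral>x. \<bar>indicator A x - g x\<bar> \<partial>lborel) < e / (norm c + 1)"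
    using Cc_dense_indicator[of A "e / (norm c + 1)"] base by auto
  have "(\<integral>x. norm (indicator A x *\<^sub>R c - g x *\<^sub>R c) \<partial>lborel) = (\<integral>x. \<bar>indicator A x - g x\<bar> \<partial>lborel) * norm c"
    by (simp flip: scaleR_diff_left)
  also have "\<dots> \<le> (\<integral>x. \<bar>indicator A x - g x\<bar> \<partial>lborel) * (norm c + 1)"
    by (intro mult_left_mono) auto
  also have "\<dots> < e" using g(3) by (simp add: pos_less_divide_eq add_nonneg_pos)
  finally show ?case
    using g by (intro exI[of _ "\<lambda>x. g x *\<^sub>R c"]) (auto intro!: continuous_intros simp: bsupp_def)
next
  case (add f g)
  obtain f' g' where *: "continuous_on UNIV f'" "bsupp f'" "(\<integral>x. norm (f x - f' x) \<partial>lborel) < e/2"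
    "continuous_on UNIV g'" "bsupp g'" "(\<integral>x. norm (g x - g' x) \<partial>lborel) < e/2"
    using add.IH(1)[of "e/2"] add.IH(2)[of "e/2"] add.prems by auto
  have i: "integrable lborel f'" "integrable lborel g'" using * integrable_bsupp by blast+
  have "(\<integral>x. norm (f x + g x - (f' x + g' x)) \<partial>lborel) \<le> (\<integral>x. norm (f x - f' x) + norm (g x - g' x) \<partial>lborel)"
    using add i by (intro integral_mono) (auto simp: norm_diff_triangle_ineq)
  also have "\<dots> < e" using add i * by simp
  finally show ?case using * by (intro exI[of _ "\<lambda>x. f' x + g' x"]) (auto intro!: continuous_intros bsupp_add)
next
  case (lim f s)
  have "(\<lambda>i. \<integral>x. norm (f x - s i x) \<partial>lborel) \<longlonglongrightarrow> (\<integral>x. norm (f x - f x) \<partial>lborel)"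
  proof (rule integral_dominated_convergence[where w="\<lambda>x. 3 * norm (f x)"])
    show "AE x in lborel. norm (norm (f x - s i x)) \<le> 3 * norm (f x)" for i
    proof (intro AE_I2)
      fix x
      have "norm (f x - s i x) \<le> norm (f x) + norm (s i x)" by (rule norm_triangle_ineq4)
      then show "norm (norm (f x - s i x)) \<le> 3 * norm (f x)" using lim.hyps(3)[of x i] by simp
    qed
    show "AE x in lborel. (\<lambda>i. norm (f x - s i x)) \<longlonglongrightarrow> norm (f x - f x)"
      using lim by (intro AE_I2 tendsto_intros) auto
  qed (use lim in auto)
  then have "(\<lambda>i. \<integral>x. norm (f x - s i x) \<partial>lborel) \<longlonglongrightarrow> 0" by simp
  then obtain i where i: "(\<integral>x. norm (f x - s i x) \<partial>lborel) < e/2"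
    using lim.prems by (metis (no_types, lifting) eventually_sequentially half_gt_zero order_refl order_tendstoD(2))
  obtain g where g: "continuous_on UNIV g" "bsupp g" "(\<integral>x. norm (s i x - g x) \<partial>lborel) < e/2"
    using lim.IH[of "e/2" i] lim.prems by auto
  have ig: "integrable lborel g" using g integrable_bsupp by blast
  have "(\<integral>x. norm (f x - g x) \<partial>lborel) \<le> (\<integral>x. norm (f x - s i x) + norm (s i x - g x) \<partial>lborel)"
    using lim.hyps(1)[of i] lim.hyps(4) ig norm_triangle_ineq[of "f x - s i x" "s i x - g x" for x]
    by (intro integral_mono) auto
  also have "\<dots> < e" using lim i g ig by simp
  finally show ?case using g by blast
qed

text \<open>For a continuous \<open>g\<close> with bounded support the difference is uniformly small
  and, for shifts below 1, lives on a fixed ball; \<open>f\<close> is compared with such a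
  \<open>g\<close> before and after the shift.\<close>

lemma translation_continuous_L1:
  fixes f :: "'a::euclidean_space => 'b::euclidean_space"
  assumes f: "integrable lborel f" and e: "e > 0"
  obtains d where "d > 0" "\<And>h. norm h < d ==> (\<integral>x. norm (f (x + h) - f x) \<partial>lborel) < e"
proof -
  obtain g where g: "continuous_on UNIV g" "bsupp g" "(\<integral>x. norm (f x - g x) \<partial>lborel) < e/4"
    using Cc_dense_L1[OF f, of "e/4"] e by auto
  have ig: "integrable lborel g" using g integrable_bsupp by blast
  obtain R where R: "\<And>x. norm x \<ge> R ==> g x = 0" using g by (auto simp: bsupp_def)
  define m where "m = measure lborel (cball (0::'a) (R + 1))"
  have m: "m \<ge> 0" by (simp add: m_def)
  have "e / (4 * (m + 1)) > 0" using e m by (intro divide_pos_pos) auto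
  then obtain d where d: "d > 0" "\<And>x x'. dist x' x < d ==> dist (g x') (g x) < e / (4 * (m + 1))"
    using bsupp_uniform(1)[OF g(1,2)] unfolding uniformly_continuous_on_def by (metis UNIV_I)
  have fin: "emeasure lborel (cball (0::'a) (R + 1)) < \<infinity>" by (rule emeasure_bounded_finite) simp
  show ?thesis
  proof (rule that[of "min d 1"])
    fix h :: 'a assume h: "norm h < min d 1"
    have gb: "norm (g (x + h) - g x) \<le> indicator (cball 0 (R + 1)) x * (e / (4 * (m + 1)))" for x
    proof (cases "norm x \<le> R + 1")
      case True
      then show ?thesis using d(2)[of "x + h" x] h by (simp add: dist_norm)
    next
      case False
      have "norm (x + h) \<ge> R" using norm_triangle_ineq4[of "x + h" h] False h by simp
      then show ?thesis using False R by simp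
    qed
    have "(\<integral>x. norm (g (x + h) - g x) \<partial>lborel) \<le> (\<integral>x. indicator (cball (0::'a) (R + 1)) x * (e / (4 * (m + 1))) \<partial>lborel)"
    proof (rule Bochner_Integration.integral_mono)
      show "integrable lborel (\<lambda>x. norm (g (x + h) - g x))" using ig integrable_shift[OF ig, of h] by auto
      show "integrable lborel (\<lambda>x. indicat_real (cball (0::'a) (R + 1)) x * (e / (4 * (m + 1))))"
        using fin by (intro integrable_mult_left) (auto simp: integrable_indicator_iff)
    qed (rule gb)
    also have "\<dots> = m * (e / (4 * (m + 1)))" using fin by (simp add: m_def)
    also have "\<dots> \<le> e / 4" using m e by (simp add: field_simps)
    finally have 1: "(\<integral>x. norm (g (x + h) - g x) \<partial>lborel) \<le> e / 4" .
    have [measurable]: "f \<in> borel_measurable borel" "g \<in> borel_measurable borel" using f ig by auto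
    have 2: "(\<integral>x. norm (f (x + h) - g (x + h)) \<partial>lborel) < e/4"
      using g(3) by (subst integral_shift[where f="\<lambda>x. norm (f x - g x)"]) auto
    note i = f ig integrable_shift[OF f, of h] integrable_shift[OF ig, of h]
    have "norm (f (x + h) - f x) \<le> norm (f (x + h) - g (x + h)) + norm (g (x + h) - g x) + norm (f x - g x)" for x
      by norm
    then have "(\<integral>x. norm (f (x + h) - f x) \<partial>lborel) \<le>
       (\<integral>x. norm (f (x + h) - g (x + h)) + norm (g (x + h) - g x) + norm (f x - g x) \<partial>lborel)"
      using i by (intro integral_mono) auto
    also have "\<dots> < e" using i 1 2 g(3) e by simp
    finally show "(\<integral>x. norm (f (x + h) - f x) \<partial>lborel) < e" .
  qed (use d in auto)
qed

text \<open>The signed power \<open>sgn a * |a|^p\<close> turns \<open>L^p\<close> into \<open>L^1\<close> and controls differences, so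
  that translation continuity in \<open>L^p\<close> reduces to the case \<open>p = 1\<close>.\<close>

lemma power_diff_le:
  fixes a b :: real
  assumes "0 \<le> b" "b \<le> a" "p \<ge> 1"
  shows "(a - b)^p \<le> a^p - b^p"
proof -
  obtain q where q: "p = Suc q" using assms(3) by (cases p) auto
  have "(a - b)^q \<le> a^q" "b^q \<le> a^q" using assms by (auto intro!: power_mono)
  then have "(a - b) * (a - b)^q \<le> (a - b) * a^q" "b * b^q \<le> b * a^q"
    using assms by (auto intro: mult_left_mono)
  then show ?thesis by (simp add: q algebra_simps)
qed

lemma add_power_le:
  fixes a b :: real
  assumes "0 \<le> a" "0 \<le> b"
  shows "(a + b)^p \<le> 2^p * (a^p + b^p)"
proof -
  have "(a + b)^p \<le> (2 * max a b)^p" using assms by (intro power_mono) auto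
  also have "\<dots> = 2^p * (max a b)^p" by (simp add: power_mult_distrib)
  also have "(max a b)^p \<le> a^p + b^p"
    using assms zero_le_power[of a p] zero_le_power[of b p] by (cases "a \<le> b") (simp_all add: max_def)
  finally show ?thesis by simp
qed

text \<open>For equal signs the cause is superadditivity of the power, for opposite signs the bound
  \<open>add_power_le\<close> for \<open>|a| + |b|\<close>; the factor \<open>2^p\<close> is due to
  the second case.\<close>

lemma abs_diff_power_le:
  fixes a b :: real assumes "p \<ge> 1"
  shows "\<bar>a - b\<bar>^p \<le> 2^p * abs (sgn a * \<bar>a\<bar>^p - sgn b * \<bar>b\<bar>^p)"
proof -
  have A: "\<bar>a - b\<bar>^p \<le> 2^p * \<bar>a^p - b^p\<bar>" if "0 \<le> b" "0 \<le> a" for a b :: real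
  proof -
    have "\<bar>a - b\<bar>^p \<le> \<bar>a^p - b^p\<bar>"
      using power_diff_le[of a b p] power_diff_le[of b a p] that assms
      by (cases "a \<le> b") (auto simp: abs_if intro: order_trans)
    also have "\<dots> \<le> 2^p * \<bar>a^p - b^p\<bar>" by (simp add: mult_le_cancel_right1)
    finally show ?thesis .
  qed
  have B: "\<bar>a - b\<bar>^p \<le> 2^p * abs (a^p + \<bar>b\<bar>^p)" if "b \<le> 0" "0 \<le> a" for a b :: real
    using add_power_le[of a "-b" p] that by simp
  have p: "0^p = (0::real)" using assms by simp
  have s: "sgn a * \<bar>a\<bar>^p = (if a \<ge> 0 then a^p else - ((- a)^p))" for a :: real using p by (auto simp: sgn_if)
  consider "a \<ge> 0" "b \<ge> 0" | "a \<ge> 0" "b < 0" | "a < 0" "b \<ge> 0" | "a < 0" "b < 0" by linarith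
  then show ?thesis
  proof cases
    case 1 then show ?thesis using A[of b a] unfolding s by simp
  next
    case 2 then show ?thesis using B[of b a] unfolding s by simp
  next
    case 3 then show ?thesis using B[of a b] unfolding s by (simp add: abs_minus_commute add.commute)
  next
    case 4 then show ?thesis using A[of "-b" "-a"] unfolding s by (simp add: abs_minus_commute add.commute)
  qed
qed

lemma norm_power_le_sum_Basis:
  fixes v :: "'a::euclidean_space"
  shows "norm v ^ p \<le> real DIM('a) ^ p * (\<Sum>b\<in>Basis. \<bar>v \<bullet> b\<bar>^p)"
proof -
  define m where "m = Max ((\<lambda>b. \<bar>v \<bullet> b\<bar>) ` (Basis::'a set))"
  have m: "\<And>b. b \<in> Basis ==> \<bar>v \<bullet> b\<bar> \<le> m" unfolding m_def by (auto intro: Max_ge)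
  have "m \<in> (\<lambda>b. \<bar>v \<bullet> b\<bar>) ` (Basis::'a set)" unfolding m_def by (intro Max_in) auto
  then obtain b where b: "b \<in> Basis" "m = \<bar>v \<bullet> b\<bar>" by auto
  have "norm v \<le> (\<Sum>b\<in>Basis. \<bar>v \<bullet> b\<bar>)" by (rule norm_le_l1)
  also have "\<dots> \<le> (\<Sum>b\<in>(Basis::'a set). m)" using m by (rule sum_mono)
  finally have "norm v ^ p \<le> (real DIM('a) * m)^p" by (intro power_mono) auto
  also have "\<dots> = real DIM('a)^p * \<bar>v \<bullet> b\<bar>^p" by (simp add: b power_mult_distrib)
  also have "\<bar>v \<bullet> b\<bar>^p \<le> (\<Sum>b\<in>Basis. \<bar>v \<bullet> b\<bar>^p)" using b by (intro member_le_sum) auto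
  finally show ?thesis by (simp add: mult_left_mono)
qed

lemma translation_continuous_Lp:
  fixes f :: "'a::euclidean_space => 'b::euclidean_space"
  assumes m[measurable]: "f \<in> borel_measurable borel" and f: "integrable lborel (\<lambda>x. norm (f x) ^ p)"
    and p: "p \<ge> 1" and e: "e > 0"
  obtains d where "d > 0" "\<And>h. norm h < d ==> (\<integral>x. norm (f (x + h) - f x) ^ p \<partial>lborel) < e"
proof -
  define F where "F b x = sgn (f x \<bullet> b) * \<bar>f x \<bullet> b\<bar>^p" for b x
  have F: "integrable lborel (F b)" if "b \<in> Basis" for b
  proof (rule Bochner_Integration.integrable_bound[OF f])
    show "F b \<in> borel_measurable lborel" unfolding F_def by measurable
    show "AE x in lborel. norm (F b x) \<le> norm (norm (f x) ^ p)"
      using that by (intro AE_I2) (auto simp: F_def abs_mult abs_sgn_eq intro!: power_mono Basis_le_norm)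
  qed
  define D where "D = real DIM('b)"
  have D: "D > 0" by (simp add: D_def)
  \<comment> \<open>Three factors are undone: \<open>D^p\<close> from comparing the norm with the
    coordinates, \<open>2^p\<close> from \<open>abs_diff_power_le\<close>, and \<open>D\<close> for
    the number of coordinates.\<close>
  define e' where "e' = e / (D^p * 2^p * D)"
  have e': "e' > 0" using e D by (simp add: e'_def)
  have "\<exists>d>0. \<forall>h. norm h < d --> (\<integral>x. norm (F b (x + h) - F b x) \<partial>lborel) < e'" if "b \<in> Basis" for b
    using translation_continuous_L1[OF F[OF that] e'] by metis
  then obtain d where d: "\<And>b. b \<in> Basis ==> d b > 0"
    "\<And>b h. b \<in> Basis ==> norm h < d b ==> (\<integral>x. norm (F b (x + h) - F b x) \<partial>lborel) < e'"
    by metis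
  show ?thesis
  proof (rule that[of "Min (d ` Basis)"])
    show "Min (d ` Basis) > 0" using d by (subst Min_gr_iff) auto
    fix h :: 'a assume "norm h < Min (d ` Basis)"
    then have h: "norm h < d b" if "b \<in> Basis" for b using that by (subst (asm) Min_gr_iff) auto
    have le: "norm (f (x + h) - f x) ^ p \<le> D^p * (\<Sum>b\<in>Basis. 2^p * norm (F b (x + h) - F b x))" for x
    proof -
      have "norm (f (x + h) - f x) ^ p \<le> D^p * (\<Sum>b\<in>Basis. \<bar>(f (x + h) - f x) \<bullet> b\<bar>^p)"
        unfolding D_def by (rule norm_power_le_sum_Basis)
      also have "\<dots> \<le> D^p * (\<Sum>b\<in>Basis. 2^p * norm (F b (x + h) - F b x))"
        using D abs_diff_power_le[OF p] by (intro mult_left_mono sum_mono) (auto simp: inner_diff_left F_def)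
      finally show ?thesis .
    qed
    have i: "integrable lborel (\<lambda>x. D^p * (\<Sum>b\<in>Basis. 2^p * norm (F b (x + h) - F b x)))"
      using F integrable_shift[OF F] by (intro integrable_mult_right Bochner_Integration.integrable_sum integrable_norm Bochner_Integration.integrable_diff) auto
    have "(\<integral>x. norm (f (x + h) - f x) ^ p \<partial>lborel) \<le> (\<integral>x. D^p * (\<Sum>b\<in>Basis. 2^p * norm (F b (x + h) - F b x)) \<partial>lborel)"
    proof (rule Bochner_Integration.integral_mono[OF _ i le])
      show "integrable lborel (\<lambda>x. norm (f (x + h) - f x) ^ p)"
      proof (rule Bochner_Integration.integrable_bound[OF i])
        show "AE x in lborel. norm (norm (f (x + h) - f x) ^ p) \<le> norm (D^p * (\<Sum>b\<in>Basis. 2^p * norm (F b (x + h) - F b x)))"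
          using le order_trans[OF le abs_ge_self] by (intro AE_I2) simp
      qed measurable
    qed
    also have "\<dots> = D^p * (\<Sum>b\<in>Basis. 2^p * (\<integral>x. norm (F b (x + h) - F b x) \<partial>lborel))"
      using F integrable_shift[OF F] by (subst integral_mult_right_zero, subst Bochner_Integration.integral_sum) auto
    also have "\<dots> < D^p * (\<Sum>b\<in>(Basis::'b set). 2^p * e')"
      using d(2)[OF _ h] D by (intro mult_strict_left_mono sum_strict_mono) auto
    also have "\<dots> = e" using D by (simp add: e'_def D_def[symmetric])
    finally show "(\<integral>x. norm (f (x + h) - f x) ^ p \<partial>lborel) < e" .
  qed
qed

text \<open>Projecting an L^1 approximation onto the ball of radius \<open>M\<close> leaves
  \<open>f\<close> fixed and is nonexpansive, so it costs nothing in L^1. The error is then at most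
  \<open>2 * M\<close>, and its square is controlled by its first power.\<close>

lemma bounded_dense_L2:
  fixes f :: "'a::euclidean_space => 'b::euclidean_space"
  assumes f: "integrable lborel f" "\<And>x. norm (f x) \<le> M" and e: "e > 0"
  obtains g where "continuous_on UNIV g" "bsupp g" "(\<integral>x. (norm (f x - g x))\<^sup>2 \<partial>lborel) < e"
proof -
  have M: "M \<ge> 0" using f(2)[of 0] norm_ge_zero order_trans by blast
  define e' where "e' = e / (2 * M + 1)"
  have e': "e' > 0" using e M by (simp add: e'_def)
  obtain g where g: "continuous_on UNIV g" "bsupp g" "(\<integral>x. norm (f x - g x) \<partial>lborel) < e'"
    using Cc_dense_L1[OF f(1) e'] by auto
  define c where "c = closest_point (cball (0::'b) M)"
  have S: "convex (cball (0::'b) M)" "closed (cball (0::'b) M)" "cball (0::'b) M \<noteq> {}" using M by auto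
  have c: "c y \<in> cball 0 M" "dist (c x) (c y) \<le> dist x y" "x \<in> cball 0 M ==> c x = x" for x y
    unfolding c_def using closest_point_in_set[OF S(2,3)] closest_point_lipschitz[OF S] closest_point_self[of _ "cball 0 M"] by auto
  have cg: "continuous_on UNIV (\<lambda>x. c (g x))"
    unfolding c_def by (rule continuous_on_compose2[OF continuous_on_closest_point[OF S, of UNIV] g(1)]) auto
  have bs: "bsupp (\<lambda>x. c (g x))" using g(2) c(3)[of 0] M unfolding bsupp_def by force
  have i: "integrable lborel g" "integrable lborel (\<lambda>x. c (g x))" using integrable_bsupp g cg bs by auto
  have d: "norm (f x - c (g x)) \<le> norm (f x - g x)" "norm (f x - c (g x)) \<le> 2 * M" for x
  proof -
    have "c (f x) = f x" using f(2)[of x] by (intro c) auto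
    then show "norm (f x - c (g x)) \<le> norm (f x - g x)" using c(2)[of "f x" "g x"] by (simp add: dist_norm)
    show "norm (f x - c (g x)) \<le> 2 * M"
      using norm_triangle_ineq4[of "f x" "c (g x)"] f(2)[of x] c(1)[of "g x"] by simp
  qed
  have le: "(norm (f x - c (g x)))\<^sup>2 \<le> (2 * M + 1) * norm (f x - g x)" for x
    unfolding power2_eq_square using d[of x] M by (intro mult_mono) auto
  have i2: "integrable lborel (\<lambda>x. (2 * M + 1) * norm (f x - g x))" using i f by auto
  have "(\<integral>x. (norm (f x - c (g x)))\<^sup>2 \<partial>lborel) \<le> (\<integral>x. (2 * M + 1) * norm (f x - g x) \<partial>lborel)"
    using i f le by (intro integral_mono i2 Bochner_Integration.integrable_bound[OF i2] AE_I2)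
      (auto intro: order_trans[OF _ abs_ge_self])
  also have "\<dots> < e" using g(3) M by (simp add: e'_def pos_less_divide_eq mult.commute)
  finally show ?thesis using that cg bs by blast
qed

subsection \<open>Averages over balls\<close>

text \<open>Integrating 2 g(x) g(y) \<le> g(x)^2 + g(y)^2 against k(x) k(y) gives Cauchy-Schwarz
  with weight \<open>k\<close>. Over \<open>ennreal\<close> infinite values are covered, so
  integrability is not an issue where it is applied.\<close>

lemma nn_integral_weight_square_le:
  fixes k g :: "'a => ennreal"
  assumes [measurable]: "k \<in> borel_measurable M" "g \<in> borel_measurable M"
  shows "(\<integral>\<^sup>+x. k x * g x \<partial>M)\<^sup>2 \<le> (\<integral>\<^sup>+x. k x \<partial>M) * (\<integral>\<^sup>+x. k x * (g x)\<^sup>2 \<partial>M)"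
proof -
  have ab: "2 * (a * b) \<le> a\<^sup>2 + b\<^sup>2" for a b :: ennreal
  proof (cases a; cases b)
    fix r s :: real assume rs: "a = ennreal r" "0 \<le> r" "b = ennreal s" "0 \<le> s"
    have "2 * (r * s) \<le> r\<^sup>2 + s\<^sup>2" using sum_squares_bound[of r s] by simp
    moreover have "2 * (a * b) = ennreal (2 * (r * s))" "a\<^sup>2 + b\<^sup>2 = ennreal (r\<^sup>2 + s\<^sup>2)"
      using rs by (simp_all add: ennreal_mult ennreal_power)
    ultimately show ?thesis by (simp only: ennreal_leI)
  qed (auto simp: power2_eq_square ennreal_top_mult ennreal_mult_top)
  let ?K = "\<integral>\<^sup>+x. k x \<partial>M" and ?G = "\<integral>\<^sup>+x. k x * g x \<partial>M" and ?H = "\<integral>\<^sup>+x. k x * (g x)\<^sup>2 \<partial>M"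
  have "2 * ?G\<^sup>2 = (\<integral>\<^sup>+x. (\<integral>\<^sup>+y. k x * k y * (2 * (g x * g y)) \<partial>M) \<partial>M)"
  proof -
    have "(\<integral>\<^sup>+y. k x * k y * (2 * (g x * g y)) \<partial>M) = 2 * (k x * g x) * ?G" for x
      by (subst nn_integral_cmult[symmetric]) (auto simp: mult_ac)
    then have "(\<integral>\<^sup>+x. (\<integral>\<^sup>+y. k x * k y * (2 * (g x * g y)) \<partial>M) \<partial>M) = (\<integral>\<^sup>+x. 2 * (k x * g x) * ?G \<partial>M)"
      by (simp only:)
    also have "\<dots> = 2 * ?G * ?G" by (subst nn_integral_multc, simp, subst nn_integral_cmult) auto
    finally show ?thesis by (simp add: power2_eq_square mult.assoc)
  qed
  also have "\<dots> \<le> (\<integral>\<^sup>+x. (\<integral>\<^sup>+y. k x * k y * ((g x)\<^sup>2 + (g y)\<^sup>2) \<partial>M) \<partial>M)"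
    by (intro nn_integral_mono mult_left_mono ab) auto
  also have "\<dots> = 2 * (?K * ?H)"
  proof -
    have "(\<integral>\<^sup>+y. k x * k y * ((g x)\<^sup>2 + (g y)\<^sup>2) \<partial>M) = (k x * (g x)\<^sup>2) * ?K + k x * ?H" for x
      by (subst (1 2) nn_integral_cmult[symmetric], simp, simp, subst nn_integral_add[symmetric])
        (auto simp: distrib_left mult_ac)
    then have "(\<integral>\<^sup>+x. (\<integral>\<^sup>+y. k x * k y * ((g x)\<^sup>2 + (g y)\<^sup>2) \<partial>M) \<partial>M) = (\<integral>\<^sup>+x. (k x * (g x)\<^sup>2) * ?K + k x * ?H \<partial>M)"
      by (simp only:)
    also have "\<dots> = ?H * ?K + ?K * ?H" by (subst nn_integral_add, simp, simp, subst (1 2) nn_integral_multc) auto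
    finally show ?thesis by (simp only: mult_2 mult.commute[of ?H ?K])
  qed
  finally show ?thesis by (simp add: ennreal_mult_le_mult_iff)
qed

text \<open>Not divided by the volume of the ball: the volume stays explicit and cancels against the
  size of the mollifier in \<open>kernel_mass\<close>.\<close>

definition av :: "real => ('a::euclidean_space => ennreal) => 'a => ennreal" where
  "av R f y = (\<integral>\<^sup>+z. indicator (cball 0 R) z * f (y + z) \<partial>lborel)"

lemma av_measurable [measurable]:
  assumes [measurable]: "f \<in> borel_measurable borel" shows "av R f \<in> borel_measurable borel"
  unfolding av_def by measurable

lemma nn_integral_av:
  fixes f :: "'a::euclidean_space => ennreal"
  assumes [measurable]: "f \<in> borel_measurable borel"
  shows "(\<integral>\<^sup>+y. av R f y \<partial>lborel) = emeasure lborel (cball (0::'a) R) * (\<integral>\<^sup>+y. f y \<partial>lborel)"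
proof -
  have "(\<integral>\<^sup>+y. av R f y \<partial>lborel) = (\<integral>\<^sup>+z. (\<integral>\<^sup>+y. indicator (cball 0 R) z * f (y + z) \<partial>lborel) \<partial>lborel)"
    unfolding av_def by (rule lborel_pair.Fubini'[symmetric]) measurable
  also have "\<dots> = (\<integral>\<^sup>+z. indicator (cball (0::'a) R) z * (\<integral>\<^sup>+y. f y \<partial>lborel) \<partial>lborel)"
    by (subst nn_integral_cmult) (auto simp: nn_integral_shift)
  finally show ?thesis by (simp add: nn_integral_multc)
qed

lemma av_square_le:
  fixes f :: "'a::euclidean_space => ennreal"
  assumes [measurable]: "f \<in> borel_measurable borel"
  shows "(av R f y)\<^sup>2 \<le> emeasure lborel (cball (0::'a) R) * av R (\<lambda>x. (f x)\<^sup>2) y"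
  using nn_integral_weight_square_le[of "indicator (cball (0::'a) R)" lborel "\<lambda>z. f (y + z)"]
  by (simp add: av_def)

lemma av_L2:
  fixes f :: "'a::euclidean_space => ennreal"
  assumes [measurable]: "f \<in> borel_measurable borel"
  shows "(\<integral>\<^sup>+y. (av R f y)\<^sup>2 \<partial>lborel) \<le> (emeasure lborel (cball (0::'a) R))\<^sup>2 * (\<integral>\<^sup>+y. (f y)\<^sup>2 \<partial>lborel)"
proof -
  have "(\<integral>\<^sup>+y. (av R f y)\<^sup>2 \<partial>lborel) \<le> (\<integral>\<^sup>+y. emeasure lborel (cball (0::'a) R) * av R (\<lambda>x. (f x)\<^sup>2) y \<partial>lborel)"
    by (intro nn_integral_mono av_square_le) measurable
  then show ?thesis by (simp add: nn_integral_cmult nn_integral_av power2_eq_square mult_ac)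
qed

text \<open>A fourth power is the square of a square: the square estimate is used once pointwise,
  and once in L^2 for the average of \<open>f\<close> squared.\<close>

lemma av_L4:
  fixes f :: "'a::euclidean_space => ennreal"
  assumes [measurable]: "f \<in> borel_measurable borel"
  shows "(\<integral>\<^sup>+y. (av R f y)^4 \<partial>lborel) \<le> (emeasure lborel (cball (0::'a) R))^4 * (\<integral>\<^sup>+y. (f y)^4 \<partial>lborel)"
proof -
  let ?c = "emeasure lborel (cball (0::'a) R)"
  have e4: "x^4 = (x\<^sup>2)\<^sup>2" for x :: ennreal by simp
  have "(\<integral>\<^sup>+y. (av R f y)^4 \<partial>lborel) \<le> (\<integral>\<^sup>+y. ?c\<^sup>2 * (av R (\<lambda>x. (f x)\<^sup>2) y)\<^sup>2 \<partial>lborel)"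
  proof (rule nn_integral_mono)
    fix y
    have "((av R f y)\<^sup>2)\<^sup>2 \<le> (?c * av R (\<lambda>x. (f x)\<^sup>2) y)\<^sup>2" by (intro power_mono av_square_le) auto
    then show "(av R f y)^4 \<le> ?c\<^sup>2 * (av R (\<lambda>x. (f x)\<^sup>2) y)\<^sup>2" unfolding e4 by (simp add: power_mult_distrib)
  qed
  also have "\<dots> = ?c\<^sup>2 * (\<integral>\<^sup>+y. (av R (\<lambda>x. (f x)\<^sup>2) y)\<^sup>2 \<partial>lborel)" by (rule nn_integral_cmult) measurable
  also have "\<dots> \<le> ?c\<^sup>2 * (?c\<^sup>2 * (\<integral>\<^sup>+y. ((f y)\<^sup>2)\<^sup>2 \<partial>lborel))" by (intro mult_left_mono av_L2) auto
  also have "\<dots> = ?c^4 * (\<integral>\<^sup>+y. (f y)^4 \<partial>lborel)" unfolding e4 by (simp only: power2_eq_square mult.assoc)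
  finally show ?thesis .
qed

section \<open>An inward field\<close>

lemma has_vector_derivative_line:
  fixes f :: "'a::euclidean_space => 'b::real_normed_vector"
  assumes d: "f differentiable at (x + t *\<^sub>R v)"
  shows "((\<lambda>t. f (x + t *\<^sub>R v)) has_vector_derivative dd v f (x + t *\<^sub>R v)) (at t)"
proof -
  have 1: "((\<lambda>t. x + t *\<^sub>R v) has_derivative (\<lambda>s. s *\<^sub>R v)) (at t)" by (auto intro!: derivative_eq_intros)
  have 2: "(\<lambda>s. dd (s *\<^sub>R v) f (x + t *\<^sub>R v)) = (\<lambda>s. s *\<^sub>R dd v f (x + t *\<^sub>R v))"
    using linear_cmul[OF bounded_linear.linear[OF dd_linear[OF d]]] by auto
  from has_derivative_compose[OF 1 has_derivative_dd[OF d]] show ?thesis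
    unfolding has_vector_derivative_def 2 .
qed

lemma smooth_onD:
  assumes "smooth_on S f"
  shows "f differentiable_on S" "b \<in> Basis ==> smooth_on S (\<lambda>x. dd b f x)"
  using assms by (blast elim: smooth_on.cases)+

text \<open>At \<open>p\<close> some direction \<open>n\<close> decreases \<rho>. The derivative is
  jointly continuous in point and direction, so it stays negative for points near \<open>p\<close>
  and directions near \<open>n\<close>, and \<rho> falls strictly along short segments. On the
  closure \<rho> is at most 0, so such a segment enters \<Omega> at once, even from the
  boundary.\<close>

lemma local_cone:
  fixes \<Omega> :: "'a::euclidean_space set" and \<rho> :: "'a => real"
  assumes U: "open U" "p \<in> U" and s: "smooth_on U \<rho>"
    and nz: "frechet_derivative \<rho> (at p) v0 \<noteq> 0"
    and eq: "\<Omega> \<inter> U = {x\<in>U. \<rho> x < 0}"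
  obtains n r c where "r > 0" "c > 0"
    "\<And>x e v. x \<in> closure \<Omega> ==> dist x p < r ==> 0 < e ==> e < r ==> norm (v - n) < c ==> x + e *\<^sub>R v \<in> \<Omega>"
proof -
  have diff: "\<rho> differentiable at x" if "x \<in> U" for x
    using smooth_onD(1)[OF s] that at_within_open[OF that U(1)] unfolding differentiable_on_def by metis
  have "continuous_on U (\<lambda>x. dd b \<rho> x)" if "b \<in> Basis" for b
    by (rule differentiable_imp_continuous_on[OF smooth_onD(1)[OF smooth_onD(2)[OF s that]]])
  then have "continuous_on (U \<times> (UNIV::'a set)) (\<lambda>q. dd b \<rho> (fst q))" if "b \<in> Basis" for b
    using that by (intro continuous_on_compose2[of U "\<lambda>x. dd b \<rho> x" "U \<times> UNIV" fst] continuous_on_fst continuous_on_id) auto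
  then have ctsum: "continuous_on (U \<times> UNIV) (\<lambda>q. \<Sum>b\<in>Basis. (snd q \<bullet> b) *\<^sub>R dd b \<rho> (fst q))"
    by (intro continuous_on_sum continuous_on_scaleR continuous_on_inner continuous_on_snd continuous_on_id continuous_on_const)
  have ct: "continuous_on (U \<times> UNIV) (\<lambda>q. dd (snd q) \<rho> (fst q))"
  proof (rule continuous_on_eq[OF ctsum])
    fix q assume "q \<in> U \<times> (UNIV :: 'a set)"
    then show "(\<Sum>b\<in>Basis. (snd q \<bullet> b) *\<^sub>R dd b \<rho> (fst q)) = dd (snd q) \<rho> (fst q)"
      using dd_eq_sum[OF diff, of "fst q" "snd q"] by auto
  qed
  define n where "n = (if dd v0 \<rho> p < 0 then v0 else - v0)"
  have neg: "dd n \<rho> p < 0"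
    using nz linear_neg[OF bounded_linear.linear[OF dd_linear[OF diff[OF U(2)]]], of v0] by (auto simp: n_def)
  define S where "S = {q \<in> U \<times> UNIV. dd (snd q) \<rho> (fst q) \<in> {..<0}}"
  have "open S"
    using continuous_open_preimage[OF ct, of "{..<0}"] U(1) by (auto simp: S_def open_Times vimage_def Int_def)
  moreover have "(p, n) \<in> S" using neg U by (simp add: S_def)
  ultimately obtain \<delta> where \<delta>: "\<delta> > 0" "ball (p, n) \<delta> \<subseteq> S" by (meson open_contains_ball)
  define c where "c = \<delta> / 2"
  \<comment> \<open>Chosen so that a point closer than \<open>r\<close> to \<open>p\<close>, moved
    by \<open>t\<close> times \<open>v\<close> with \<open>t < r\<close>, stays within
    \<open>\<delta> / 2\<close> of \<open>p\<close>; the other half of \<delta> is left for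
    \<open>v - n\<close>.\<close>
  define r where "r = \<delta> / (2 * (1 + norm n + c))"
  have c: "c > 0" using \<delta> by (simp add: c_def)
  have den: "1 + norm n + c > 0" using c norm_ge_zero[of n] by linarith
  have r: "r > 0" using \<delta> den by (simp add: r_def)
  have rr: "r * (1 + norm n + c) = \<delta> / 2" using den by (simp add: r_def field_simps)
  have key: "x + t *\<^sub>R v \<in> U \<and> dd v \<rho> (x + t *\<^sub>R v) < 0"
    if "dist x p < r" "0 \<le> t" "t < r" "norm (v - n) < c" for x t v
  proof -
    have nv: "norm v \<le> norm n + c" using that(4) norm_triangle_ineq[of "v - n" n] by simp
    have "dist (x + t *\<^sub>R v) p \<le> dist x p + norm (t *\<^sub>R v)"
      using dist_triangle[of "x + t *\<^sub>R v" p x] by (simp add: dist_norm)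
    also have "norm (t *\<^sub>R v) \<le> r * (norm n + c)" using that nv by (auto intro!: mult_mono)
    finally have "dist (x + t *\<^sub>R v) p < \<delta> / 2" using that(1) rr by (simp add: algebra_simps)
    moreover have "dist v n < \<delta> / 2" using that by (simp add: c_def dist_norm)
    moreover have "dist (x + t *\<^sub>R v, v) (p, n) \<le> dist (x + t *\<^sub>R v) p + dist v n"
      unfolding dist_Pair_Pair by (rule sqrt_sum_squares_le_sum) auto
    ultimately have "(x + t *\<^sub>R v, v) \<in> ball (p, n) \<delta>" by (simp add: dist_commute)
    then show ?thesis using \<delta>(2) by (auto simp: S_def)
  qed
  show ?thesis
  proof (rule that[OF r c])
    fix x e v assume h: "x \<in> closure \<Omega>" "dist x p < r" "0 < e" "e < r" "norm (v - n) < c"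
    have xU: "x \<in> U" using key[OF h(2) _ _ h(5), of 0] r by simp
    have "\<rho> x \<le> 0"
    proof -
      obtain f where f: "\<And>k::nat. f k \<in> \<Omega>" "f \<longlonglongrightarrow> x" using h(1) by (auto simp: closure_sequential)
      have "isCont \<rho> x" using diff[OF xU] differentiable_imp_continuous_within by blast
      then have "(\<lambda>k. \<rho> (f k)) \<longlonglongrightarrow> \<rho> x" using f(2) isCont_tendsto_compose by blast
      moreover have "\<forall>\<^sub>F k in sequentially. \<rho> (f k) \<le> 0"
        using topological_tendstoD[OF f(2) U(1) xU] by eventually_elim (use f(1) eq in force)
      ultimately show ?thesis by (intro tendsto_upperbound) auto
    qed
    have D: "((\<lambda>t. \<rho> (x + t *\<^sub>R v)) has_real_derivative dd v \<rho> (x + t *\<^sub>R v)) (at t)" if "0 \<le> t" "t \<le> e" for t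
    proof -
      have "x + t *\<^sub>R v \<in> U" using key[OF h(2) _ _ h(5), of t] that h by simp
      then have d: "\<rho> differentiable at (x + t *\<^sub>R v)" by (rule diff)
      show ?thesis
        using has_vector_derivative_line[OF d] by (simp add: has_real_derivative_iff_has_vector_derivative)
    qed
    obtain z where z: "0 < z" "z < e" "\<rho> (x + e *\<^sub>R v) - \<rho> (x + 0 *\<^sub>R v) = (e - 0) * dd v \<rho> (x + z *\<^sub>R v)"
      using MVT2[OF h(3), of "\<lambda>t. \<rho> (x + t *\<^sub>R v)" "\<lambda>t. dd v \<rho> (x + t *\<^sub>R v)"] D by blast
    have "dd v \<rho> (x + z *\<^sub>R v) < 0" using key[OF h(2) _ _ h(5), of z] z h by simp
    then have "e * dd v \<rho> (x + z *\<^sub>R v) < 0" using h(3) by (simp add: mult_pos_neg)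
    then have "\<rho> (x + e *\<^sub>R v) < 0" using z(3) \<open>\<rho> x \<le> 0\<close> by simp
    moreover have "x + e *\<^sub>R v \<in> U" using key[OF h(2) _ _ h(5), of e] h by simp
    ultimately show "x + e *\<^sub>R v \<in> \<Omega>" using eq by blast
  qed
qed

lemma bump_pos_iff: "bump x > 0 \<longleftrightarrow> norm x < 1"
proof -
  have "x \<bullet> x < 1 \<longleftrightarrow> norm x < 1" by (simp add: norm_eq_sqrt_inner)
  then show ?thesis by (simp add: bump_def ramp_simps)
qed

text \<open>The field is a sum of cut-off local cone directions. Adding the summands one at a time
  shows that the sum points inward, since each partial sum already lies in the closure.\<close>

lemma inward_field:
  assumes dom: "bounded_smooth_domain \<Omega>"
  obtains N c e0 where "smooth N" "bsupp N" "c > 0" "e0 > 0"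
    "\<And>x e z. x \<in> closure \<Omega> ==> 0 < e ==> e < e0 ==> norm z \<le> c * e ==> x + e *\<^sub>R N x + z \<in> \<Omega>"
proof -
  note D = dom[unfolded bounded_smooth_domain_def]
  note op = D[THEN conjunct1] and bd = D[THEN conjunct2, THEN conjunct2, THEN conjunct2, THEN conjunct1]
    and fr = D[THEN conjunct2, THEN conjunct2, THEN conjunct2, THEN conjunct2]
  define Q where "Q p n r c \<longleftrightarrow> r > 0 \<and> c > 0 \<and>
      (\<forall>x e v. x \<in> closure \<Omega> --> dist x p < r --> 0 < e --> e < r --> norm (v - n) < c --> x + e *\<^sub>R v \<in> \<Omega>)" for p n r c
  have "\<exists>t. Q p (fst t) (fst (snd t)) (snd (snd t))" if "p \<in> frontier \<Omega>" for p
  proof -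
    from bspec[OF fr that] obtain U \<rho> where UU: "open U \<and> p \<in> U \<and> smooth_on U (\<rho>::real^3 => real) \<and>
        (\<forall>x\<in>U. \<exists>v. frechet_derivative \<rho> (at x) v \<noteq> 0) \<and> \<Omega> \<inter> U = {x\<in>U. \<rho> x < 0}"
      by (elim exE)
    note U = UU[THEN conjunct1] UU[THEN conjunct2, THEN conjunct1] UU[THEN conjunct2, THEN conjunct2, THEN conjunct1]
      UU[THEN conjunct2, THEN conjunct2, THEN conjunct2, THEN conjunct1] UU[THEN conjunct2, THEN conjunct2, THEN conjunct2, THEN conjunct2]
    from bspec[OF U(4,2)] obtain v0 where v0: "frechet_derivative \<rho> (at p) v0 \<noteq> 0" by (elim exE)
    obtain n r c where "r > 0" "c > 0"
      "\<And>x e v. x \<in> closure \<Omega> ==> dist x p < r ==> 0 < e ==> e < r ==> norm (v - n) < c ==> x + e *\<^sub>R v \<in> \<Omega>"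
      by (rule local_cone[OF U(1,2,3) v0 U(5)]) (rule that)
    then show ?thesis by (intro exI[of _ "(n, r, c)"]) (simp add: Q_def)
  qed
  then obtain t where t: "\<forall>p\<in>frontier \<Omega>. Q p (fst (t p)) (fst (snd (t p))) (snd (snd (t p)))"
    using bchoice[of "frontier \<Omega>" "\<lambda>p t. Q p (fst t) (fst (snd t)) (snd (snd t))"] by blast
  define n where "n p = fst (t p)" for p
  define r where "r p = fst (snd (t p))" for p
  define c where "c p = snd (snd (t p))" for p
  have q: "Q p (n p) (r p) (c p)" if "p \<in> frontier \<Omega>" for p using t that by (simp add: n_def r_def c_def)
  have nrc: "\<And>p. p \<in> frontier \<Omega> ==> r p > 0 \<and> c p > 0"
    "\<And>p x e v. p \<in> frontier \<Omega> ==> x \<in> closure \<Omega> ==> dist x p < r p ==> 0 < e ==> e < r p ==> norm (v - n p) < c p ==> x + e *\<^sub>R v \<in> \<Omega>"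
    using q unfolding Q_def by blast+
  have cf: "compact (frontier \<Omega>)" using bd by (simp add: compact_frontier_bounded)
  obtain P where P: "P \<subseteq> frontier \<Omega>" "finite P" "frontier \<Omega> \<subseteq> (\<Union>p\<in>P. ball p (r p / 2))"
  proof (rule compactE_image[OF cf, of "frontier \<Omega>" "\<lambda>p. ball p (r p / 2)"])
    show "frontier \<Omega> \<subseteq> (\<Union>p\<in>frontier \<Omega>. ball p (r p / 2))"
    proof
      fix x assume "x \<in> frontier \<Omega>"
      then show "x \<in> (\<Union>p\<in>frontier \<Omega>. ball p (r p / 2))" using nrc(1)[of x] by (intro UN_I[of x]) auto
    qed
  qed (auto intro: that)
  define \<zeta> where "\<zeta> p x = bump ((2 / r p) *\<^sub>R (x - p))" for p x
  have rc: "r p > 0" "c p > 0" if "p \<in> P" for p using nrc(1) that P(1) by auto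
  have \<zeta>01: "0 \<le> \<zeta> p x" "\<zeta> p x \<le> 1" for p x by (auto simp: \<zeta>_def bump_le_1)
  have \<zeta>pos: "\<zeta> p x > 0 \<longleftrightarrow> dist x p < r p / 2" if "p \<in> P" for p x
  proof -
    have "norm ((2 / r p) *\<^sub>R (x - p)) = 2 / r p * norm (x - p)" using rc[OF that] by simp
    then show ?thesis
      unfolding \<zeta>_def bump_pos_iff dist_norm using rc[OF that] by (simp add: pos_less_divide_eq pos_divide_less_eq mult.commute)
  qed
  have \<zeta>sm: "smooth (\<zeta> p)" for p
    unfolding \<zeta>_def by (intro smooth_compose[OF smooth_bump] smooth_scaleR smooth_const smooth_diff smooth_ident)
  define N where "N x = (\<Sum>p\<in>P. \<zeta> p x *\<^sub>R n p)" for x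
  have Nsm: "smooth N" unfolding N_def by (intro smooth_sum smooth_scaleR smooth_const \<zeta>sm)
  have Nbs: "bsupp N"
  proof (rule bsuppI[of "(\<Sum>p\<in>P. norm p + r p)"])
    fix x :: "real^3" assume x: "(\<Sum>p\<in>P. norm p + r p) \<le> norm x"
    have "\<zeta> p x = 0" if "p \<in> P" for p
    proof -
      have "norm p + r p \<le> (\<Sum>p\<in>P. norm p + r p)" using that P rc by (intro member_le_sum) (auto simp: add_nonneg_nonneg less_imp_le)
      then have "norm p + r p \<le> norm x" using x by linarith
      then have "\<not> dist x p < r p / 2" using norm_triangle_ineq[of "x - p" p] rc[OF that] by (simp add: dist_norm)
      then show ?thesis using \<zeta>pos[OF that] \<zeta>01(1)[of p x] by fastforce
    qed
    then show "N x = 0" by (simp add: N_def)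
  qed
  define S where "S x = (\<Sum>p\<in>P. \<zeta> p x)" for x
  have Sc: "continuous_on T S" for T unfolding S_def by (intro continuous_on_sum smooth_continuous \<zeta>sm)
  have Spos: "S x > 0" if x: "x \<in> frontier \<Omega>" for x
  proof -
    obtain p where "p \<in> P" "dist x p < r p / 2" using P(3) x by (auto simp: dist_commute)
    then have "\<zeta> p x > 0" using \<zeta>pos by blast
    then show ?thesis unfolding S_def using \<open>p \<in> P\<close> P(2) \<zeta>01 by (intro sum_pos2[of _ p]) auto
  qed
  obtain \<kappa> where \<kappa>: "\<kappa> > 0" "\<And>x. x \<in> frontier \<Omega> ==> S x > \<kappa>"
  proof (cases "frontier \<Omega> = {}")
    case False
    obtain x0 where x0: "x0 \<in> frontier \<Omega>" "\<And>y. y \<in> frontier \<Omega> ==> S x0 \<le> S y"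
      using continuous_attains_inf[OF cf False Sc] by blast
    show ?thesis by (rule that[of "S x0 / 2"]) (use Spos[OF x0(1)] x0(2) in \<open>force+\<close>)
  qed (use that[of 1] in auto)
  \<comment> \<open>On the boundary \<open>S\<close> exceeds \<kappa>. The part of the closure where
    it does not is compact and contained in \<Omega>, so it has a positive distance
    \<open>d0\<close> from the complement and tolerates any short displacement. The direction of the
    field matters where \<open>S > \<kappa>\<close>.\<close>
  define L where "L = closure \<Omega> \<inter> S -` {..\<kappa>}"
  have "closed L" unfolding L_def using Sc[of "closure \<Omega>"] by (intro continuous_closed_preimage) auto
  then have cL: "compact L" using bd bounded_subset[of "closure \<Omega>" L] by (auto simp: L_def compact_eq_bounded_closed)
  have "L \<inter> (- \<Omega>) = {}"
  proof -
    have "S x > \<kappa>" if "x \<in> closure \<Omega>" "x \<notin> \<Omega>" for x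
      using \<kappa>(2)[of x] that op by (simp add: frontier_def interior_open)
    then show ?thesis unfolding L_def by force
  qed
  then obtain d0 where d0: "d0 > 0" "\<And>x y. x \<in> L ==> y \<in> - \<Omega> ==> d0 \<le> dist x y"
    using separate_compact_closed[OF cL, of "- \<Omega>"] op by (auto simp: closed_Compl)
  obtain B where B: "B > 0" "\<And>x. norm (N x) \<le> B" using smooth_bsupp_bounded[OF Nsm Nbs] by metis
  define m where "m = real (card P) + 1"
  have m: "m > 0" by (simp add: m_def)
  define cm where "cm = Min (insert 1 (c ` P))"
  define rm where "rm = Min (insert 1 (r ` P))"
  have cm: "cm > 0" "\<And>p. p \<in> P ==> cm \<le> c p" unfolding cm_def using P(2) rc by auto
  have rm: "rm > 0" "\<And>p. p \<in> P ==> rm \<le> r p" unfolding rm_def using P(2) rc by auto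
  \<comment> \<open>By pigeonhole some cut-off is at least \<open>k1\<close> wherever
    \<open>S > \<kappa>\<close>; the extra 1 in \<open>m\<close> keeps the divisor positive when
    \<open>P\<close> is empty.\<close>
  define k1 where "k1 = \<kappa> / m"
  have k1: "k1 > 0" using \<kappa> m by (simp add: k1_def)
  define cc where "cc = k1 * cm / 2"
  have cc: "cc > 0" using k1 cm by (simp add: cc_def)
  define B' where "B' = (\<Sum>p\<in>P. norm (n p) + c p) + 1"
  have "0 \<le> (\<Sum>p\<in>P. norm (n p) + c p)" using rc by (intro sum_nonneg add_nonneg_nonneg) (auto simp: less_imp_le)
  then have B': "B' > 0" by (simp add: B'_def)
  \<comment> \<open>In this order: a step stays within the range of every cone, all partial sums
    stay within half a cone radius of \<open>x\<close>, and the whole displacement is shorter than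
    \<open>d0\<close>.\<close>
  define e0 where "e0 = min rm (min (rm / (2 * B')) (d0 / (B + cc)))"
  have Bcc: "B + cc > 0" using B cc by simp
  have e0: "e0 > 0" unfolding e0_def using rm B' d0 Bcc by simp
  show ?thesis
  proof (rule that[OF Nsm Nbs cc e0])
    fix x z :: "real^3" and e assume x: "x \<in> closure \<Omega>" and e: "0 < e" "e < e0" and z: "norm z \<le> cc * e"
    have e1: "e < rm" "e * B' < rm / 2" "e * (B + cc) < d0"
    proof -
      have "e < rm" "e < rm / (2 * B')" "e < d0 / (B + cc)" using e(2) by (auto simp: e0_def)
      then show "e < rm" "e * B' < rm / 2" "e * (B + cc) < d0" using B' Bcc by (simp_all add: pos_less_divide_eq)
    qed
    show "x + e *\<^sub>R N x + z \<in> \<Omega>"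
    proof (cases "S x \<le> \<kappa>")
      case True
      have "norm (e *\<^sub>R N x + z) \<le> e * B + cc * e"
        using z B(2)[of x] e by (intro norm_triangle_le add_mono) auto
      then have "norm (e *\<^sub>R N x + z) < d0" using e1(3) by (simp add: algebra_simps)
      moreover have "dist x (x + e *\<^sub>R N x + z) = norm (e *\<^sub>R N x + z)"
        unfolding add.assoc dist_norm using norm_minus_cancel[of "e *\<^sub>R N x + z"] by simp
      ultimately have "dist x (x + e *\<^sub>R N x + z) < d0" by simp
      then show ?thesis using d0(2)[of x "x + e *\<^sub>R N x + z"] True x by (auto simp: L_def)
    next
      case False
      have "\<exists>p\<in>P. \<zeta> p x \<ge> k1"
      proof (rule ccontr)
        assume "\<not> (\<exists>p\<in>P. \<zeta> p x \<ge> k1)"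
        then have "S x \<le> (\<Sum>p\<in>P. k1)" unfolding S_def by (intro sum_mono) auto
        also have "\<dots> \<le> m * k1" using k1 by (simp add: m_def algebra_simps)
        also have "\<dots> = \<kappa>" using m by (simp add: k1_def)
        finally show False using False by simp
      qed
      then obtain q where q: "q \<in> P" "\<zeta> q x \<ge> k1" by blast
      \<comment> \<open>The perturbation \<open>z\<close> is loaded onto the single direction
        \<open>q\<close>, whose coefficient \<open>e * \<zeta> q x\<close> is at least
        \<open>e * k1\<close>. With the choice of \<open>cc\<close> it tilts this direction by at
        most \<open>cm / 2\<close>, less than the opening of the cone.\<close>
      define v where "v p = (if p = q then n p + (1 / (e * \<zeta> q x)) *\<^sub>R z else n p)" for p
      have vn: "norm (v p - n p) < c p" if "p \<in> P" for p
      proof (cases "p = q")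
        case True
        have "norm (v p - n p) = norm z / (e * \<zeta> q x)" using True e \<zeta>01(1)[of q x] by (simp add: v_def)
        also have "\<dots> \<le> (cc * e) / (e * k1)" using z e q k1 cc by (intro frac_le) (auto intro!: mult_left_mono)
        also have "\<dots> = cm / 2" using e k1 by (simp add: cc_def)
        also have "\<dots> < c p" using cm(1) cm(2)[OF that] by simp
        finally show ?thesis .
      qed (use rc[OF that] in \<open>simp add: v_def\<close>)
      have claim: "Q \<subseteq> P ==> x + e *\<^sub>R (\<Sum>p\<in>Q. \<zeta> p x *\<^sub>R v p) \<in> closure \<Omega> \<and> (q \<in> Q --> x + e *\<^sub>R (\<Sum>p\<in>Q. \<zeta> p x *\<^sub>R v p) \<in> \<Omega>)"
        if "finite Q" for Q
        using that
      proof (induction Q rule: finite_induct)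
        case (insert p Q)
        let ?y = "x + e *\<^sub>R (\<Sum>p\<in>Q. \<zeta> p x *\<^sub>R v p)"
        have pP: "p \<in> P" "Q \<subseteq> P" using insert.prems by auto
        have y: "x + e *\<^sub>R (\<Sum>p\<in>insert p Q. \<zeta> p x *\<^sub>R v p) = ?y + (e * \<zeta> p x) *\<^sub>R v p"
          using insert.hyps by (simp add: scaleR_add_right)
        have yc: "?y \<in> closure \<Omega>" "q \<in> Q ==> ?y \<in> \<Omega>" using insert.IH pP by auto
        show ?case
        proof (cases "\<zeta> p x > 0")
          case False
          then have "\<zeta> p x = 0" using \<zeta>01(1)[of p x] by simp
          moreover from this have "p \<noteq> q" using q k1 by auto
          ultimately show ?thesis unfolding y using yc by simp
        next
          case True
          have "norm (\<Sum>p\<in>Q. \<zeta> p x *\<^sub>R v p) \<le> (\<Sum>p\<in>Q. norm (n p) + c p)"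
          proof (rule sum_norm_le)
            fix p assume "p \<in> Q"
            have "norm (\<zeta> p x *\<^sub>R v p) \<le> norm (v p)" using \<zeta>01[of p x] by (simp add: mult_left_le_one_le)
            also have "\<dots> \<le> norm (n p) + c p"
              using norm_triangle_ineq[of "v p - n p" "n p"] vn[of p] \<open>p \<in> Q\<close> pP by fastforce
            finally show "norm (\<zeta> p x *\<^sub>R v p) \<le> norm (n p) + c p" .
          qed
          also have "\<dots> \<le> (\<Sum>p\<in>P. norm (n p) + c p)"
            using pP P(2) rc by (intro sum_mono2) (auto simp: add_nonneg_nonneg less_imp_le)
          finally have "norm (\<Sum>p\<in>Q. \<zeta> p x *\<^sub>R v p) \<le> B'" by (simp add: B'_def)
          then have "dist ?y x \<le> e * B'" using e by (simp add: dist_norm)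
          then have "dist ?y x < r p / 2" using e1(2) rm(2)[OF pP(1)] by simp
          moreover have "dist x p < r p / 2" using True \<zeta>pos[OF pP(1)] by simp
          ultimately have "dist ?y p < r p" using dist_triangle[of ?y p x] by simp
          moreover have "0 < e * \<zeta> p x" using True e by simp
          moreover have "e * \<zeta> p x < r p"
            using e e1(1) rm(2)[OF pP(1)] \<zeta>01[of p x] mult_left_le[of "\<zeta> p x" e] by linarith
          ultimately have "?y + (e * \<zeta> p x) *\<^sub>R v p \<in> \<Omega>"
            using nrc(2)[of p ?y "e * \<zeta> p x" "v p"] pP P(1) yc(1) vn by blast
          then show ?thesis unfolding y using closure_subset by blast
        qed
      qed (use x in simp)
      have "e *\<^sub>R (\<Sum>p\<in>P. \<zeta> p x *\<^sub>R v p) = e *\<^sub>R N x + z"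
      proof -
        have "(\<Sum>p\<in>P. \<zeta> p x *\<^sub>R v p) = (\<Sum>p\<in>P. \<zeta> p x *\<^sub>R n p + (if p = q then (1/e) *\<^sub>R z else 0))"
          using q k1 by (intro sum.cong) (auto simp: v_def scaleR_add_right)
        also have "\<dots> = N x + (1/e) *\<^sub>R z" using P(2) q(1) by (simp add: sum.distrib N_def)
        finally show ?thesis using e by (simp add: scaleR_add_right)
      qed
      then show ?thesis using claim[OF P(2) subset_refl] q(1) by (simp add: add.assoc)
    qed
  qed
qed

section \<open>Smoothing kernels\<close>

text \<open>The partial derivatives are Lipschitz, so the linearisation error is quadratic with one
  constant for all base points \<open>a\<close>. This uniformity is what allows differentiation
  under an integral.\<close>

lemma smooth_remainder:
  fixes g :: "'a::euclidean_space => 'b::real_normed_vector"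
  assumes g: "smooth g" "bsupp g"
  obtains L where "L > 0" "\<And>a h. norm (g (a + h) - g a - dd h g a) \<le> L * (norm h)\<^sup>2"
proof -
  have "\<exists>B>0. \<forall>x y. norm (dd c g x - dd c g y) \<le> B * norm (x - y)" for c :: 'a
    using smooth_bsupp_lipschitz[OF smooth_dd[OF g(1)] bsupp_dd[OF g(2)], of c] by metis
  then obtain L where L: "\<And>c. L c > 0" "\<And>c x y. norm (dd c g x - dd c g y) \<le> L c * norm (x - y)" by metis
  define M where "M = (\<Sum>c\<in>(Basis::'a set). L c)"
  have M: "M > 0" unfolding M_def using L by (intro sum_pos) auto
  show ?thesis
  proof (rule that[OF M])
    fix a h :: 'a
    have "norm (g (a + h) - g a - dd ((a + h) - a) g a) \<le> norm ((a + h) - a) * (M * norm h)"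
    proof (rule differentiable_bound_linearization[where S="cball a (norm h)"])
      show "a + t *\<^sub>R (a + h - a) \<in> cball a (norm h)" if "t \<in> {0..1}" for t
        using that by (simp add: dist_norm mult_left_le_one_le)
      show "(g has_derivative (\<lambda>v. dd v g x)) (at x within cball a (norm h))" for x
        by (rule has_derivative_at_withinI[OF smooth_has_derivative[OF g(1)]])
      show "onorm ((\<lambda>v. dd v g x) - (\<lambda>v. dd v g a)) \<le> M * norm h" if "x \<in> cball a (norm h)" for x
        unfolding fun_diff_def
      proof (rule onorm_le)
        fix v
        have "dd v g x - dd v g a = (\<Sum>c\<in>Basis. (v \<bullet> c) *\<^sub>R (dd c g x - dd c g a))"
          using dd_eq_sum[OF smooth_differentiable[OF g(1)], of x v] dd_eq_sum[OF smooth_differentiable[OF g(1)], of a v]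
          by (simp add: scaleR_diff_right sum_subtractf)
        also have "norm \<dots> \<le> (\<Sum>c\<in>Basis. norm v * (L c * norm h))"
        proof (rule sum_norm_le)
          fix c :: 'a assume c: "c \<in> Basis"
          have "norm (x - a) \<le> norm h" using that by (simp add: dist_norm norm_minus_commute)
          then have "norm (dd c g x - dd c g a) \<le> L c * norm h"
            using L(2)[of x c a] L(1)[of c] by (meson mult_left_mono less_imp_le order_trans)
          then show "norm ((v \<bullet> c) *\<^sub>R (dd c g x - dd c g a)) \<le> norm v * (L c * norm h)"
            using Basis_le_norm[OF c, of v] by (simp add: mult_mono)
        qed
        also have "\<dots> = M * norm h * norm v"
          by (simp add: M_def sum_distrib_left sum_distrib_right mult_ac)
        finally show "norm (dd v g x - dd v g a) \<le> M * norm h * norm v" .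
      qed
      show "a \<in> cball a (norm h)" by simp
    qed
    then show "norm (g (a + h) - g a - dd h g a) \<le> M * (norm h)\<^sup>2"
      by (simp add: power2_eq_square mult_ac)
  qed
qed

lemma kernel_integrable:
  fixes g :: "'a::euclidean_space => real" and V :: "'x => 'b::euclidean_space"
  assumes g: "continuous_on UNIV g" "bsupp g" and V: "integrable M V"
    and [measurable]: "\<Phi> \<in> borel_measurable M"
  shows "integrable M (\<lambda>x. g (y - \<Phi> x) *\<^sub>R V x)"
proof -
  obtain B where B: "\<And>x. norm (g x) \<le> B" "B > 0" using bsupp_uniform(2)[OF g] by auto
  have [measurable]: "g \<in> borel_measurable borel" using g(1) by (rule borel_measurable_continuous_onI)
  have [measurable]: "V \<in> borel_measurable M" using V by auto
  show ?thesis
    by (rule Bochner_Integration.integrable_bound[where f="\<lambda>x. B *\<^sub>R V x"])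
      (use V B in \<open>auto intro!: AE_I2 mult_right_mono\<close>)
qed

text \<open>The quadratic remainder, uniform in the base point, integrates to at most
  \<open>L * (norm h)\<^sup>2\<close> times the L^1 norm of \<open>V\<close>; dividing by
  \<open>norm h\<close> leaves a term that tends to 0.\<close>

lemma kernel_has_derivative:
  fixes g :: "'a::euclidean_space => real" and V :: "'x => 'b::euclidean_space"
  assumes g: "smooth g" "bsupp g" and V: "integrable M V"
    and m[measurable]: "\<Phi> \<in> borel_measurable M"
  shows "((\<lambda>y. \<integral>x. g (y - \<Phi> x) *\<^sub>R V x \<partial>M) has_derivative (\<lambda>h. \<integral>x. dd h g (y - \<Phi> x) *\<^sub>R V x \<partial>M)) (at y)"
proof -
  have i: "integrable M (\<lambda>x. g (y - \<Phi> x) *\<^sub>R V x)" for y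
    by (intro kernel_integrable smooth_continuous g V m)
  have id: "integrable M (\<lambda>x. dd h g (y - \<Phi> x) *\<^sub>R V x)" for h y
    by (intro kernel_integrable[where g="\<lambda>z. dd h g z"] smooth_continuous smooth_dd bsupp_dd g V m)
  obtain L where L: "L > 0" "\<And>a h. norm (g (a + h) - g a - dd h g a) \<le> L * (norm h)\<^sup>2"
    using smooth_remainder[OF g] by metis
  obtain B where B: "B > 0" "\<And>x b. norm (dd b g x) \<le> B * norm b" using smooth_bsupp_bounded[OF g] by metis
  define I where "I = (\<integral>x. norm (V x) \<partial>M)"
  have I: "I \<ge> 0" by (simp add: I_def)
  have lin: "linear (\<lambda>v. dd v g z)" for z by (intro bounded_linear.linear dd_linear smooth_differentiable g)
  have bl: "bounded_linear (\<lambda>h. \<integral>x. dd h g (y - \<Phi> x) *\<^sub>R V x \<partial>M)"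
  proof (rule bounded_linear_intro[where K="B * I"])
    show "(\<integral>x. dd (h + k) g (y - \<Phi> x) *\<^sub>R V x \<partial>M) = (\<integral>x. dd h g (y - \<Phi> x) *\<^sub>R V x \<partial>M) + (\<integral>x. dd k g (y - \<Phi> x) *\<^sub>R V x \<partial>M)" for h k
      by (subst Bochner_Integration.integral_add[symmetric, OF id id]) (simp add: linear_add[OF lin] scaleR_add_left)
    show "(\<integral>x. dd (r *\<^sub>R h) g (y - \<Phi> x) *\<^sub>R V x \<partial>M) = r *\<^sub>R (\<integral>x. dd h g (y - \<Phi> x) *\<^sub>R V x \<partial>M)" for r h
      by (subst integral_scaleR_right[symmetric]) (simp add: linear_cmul[OF lin])
    fix h
    have "norm (\<integral>x. dd h g (y - \<Phi> x) *\<^sub>R V x \<partial>M) \<le> (\<integral>x. norm (dd h g (y - \<Phi> x) *\<^sub>R V x) \<partial>M)"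
      by (rule integral_norm_bound)
    also have "\<dots> \<le> (\<integral>x. (B * norm h) * norm (V x) \<partial>M)"
      using B(2) V id[of y h] by (intro Bochner_Integration.integral_mono integrable_norm integrable_mult_right) (auto intro!: mult_right_mono)
    finally show "norm (\<integral>x. dd h g (y - \<Phi> x) *\<^sub>R V x \<partial>M) \<le> norm h * (B * I)" by (simp add: I_def mult_ac)
  qed
  show ?thesis
    unfolding has_derivative_at
  proof (intro conjI bl)
    have le: "norm (norm ((\<integral>x. g (y + h - \<Phi> x) *\<^sub>R V x \<partial>M) - (\<integral>x. g (y - \<Phi> x) *\<^sub>R V x \<partial>M) - (\<integral>x. dd h g (y - \<Phi> x) *\<^sub>R V x \<partial>M)) / norm h) \<le> norm h * (L * I)" for h
    proof (cases "h = 0")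
      case False
      have "(\<integral>x. g (y + h - \<Phi> x) *\<^sub>R V x \<partial>M) - (\<integral>x. g (y - \<Phi> x) *\<^sub>R V x \<partial>M) - (\<integral>x. dd h g (y - \<Phi> x) *\<^sub>R V x \<partial>M)
        = (\<integral>x. (g ((y - \<Phi> x) + h) - g (y - \<Phi> x) - dd h g (y - \<Phi> x)) *\<^sub>R V x \<partial>M)"
        using i[of "y + h"] i[of y] id[of y h] by (simp add: scaleR_diff_left diff_add_eq)
      also have "norm \<dots> \<le> (\<integral>x. norm ((g ((y - \<Phi> x) + h) - g (y - \<Phi> x) - dd h g (y - \<Phi> x)) *\<^sub>R V x) \<partial>M)"
        by (rule integral_norm_bound)
      also have "\<dots> \<le> (\<integral>x. (L * (norm h)\<^sup>2) * norm (V x) \<partial>M)"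
      proof (rule Bochner_Integration.integral_mono)
        have "integrable M (\<lambda>x. g (y + h - \<Phi> x) *\<^sub>R V x - g (y - \<Phi> x) *\<^sub>R V x - dd h g (y - \<Phi> x) *\<^sub>R V x)"
          using i id by auto
        then show "integrable M (\<lambda>x. norm ((g ((y - \<Phi> x) + h) - g (y - \<Phi> x) - dd h g (y - \<Phi> x)) *\<^sub>R V x))"
          by (intro integrable_norm) (simp add: scaleR_diff_left diff_add_eq)
      qed (use V L in \<open>auto intro!: mult_right_mono\<close>)
      also have "\<dots> = L * (norm h)\<^sup>2 * I" by (simp add: I_def)
      finally show ?thesis using False by (simp add: divide_le_eq power2_eq_square mult_ac)
    qed (use L I in simp)
    have "((\<lambda>h. norm h * (L * I)) \<longlongrightarrow> 0) (at (0::'a))"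
      by (rule tendsto_eq_intros refl)+ simp
    then show "(\<lambda>h. norm ((\<integral>x. g (y + h - \<Phi> x) *\<^sub>R V x \<partial>M) - (\<integral>x. g (y - \<Phi> x) *\<^sub>R V x \<partial>M) - (\<integral>x. dd h g (y - \<Phi> x) *\<^sub>R V x \<partial>M)) / norm h) \<midarrow>0\<rightarrow> 0"
      by (rule Lim_null_comparison[rotated]) (use le in \<open>auto intro!: always_eventually\<close>)
  qed
qed

lemma kernel_smooth:
  fixes g :: "'a::euclidean_space => real" and V :: "'x => 'b::euclidean_space"
  assumes V: "integrable M V" and m: "\<Phi> \<in> borel_measurable M" and g: "smooth g" "bsupp g"
  shows "smooth (\<lambda>y. \<integral>x. g (y - \<Phi> x) *\<^sub>R V x \<partial>M)"
proof -
  have "Ck n (\<lambda>y. \<integral>x. g (y - \<Phi> x) *\<^sub>R V x \<partial>M)" if "smooth g" "bsupp g" for n g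
    using that
  proof (induction n arbitrary: g)
    case (Suc n)
    show ?case
      by (rule Ck_SucI[OF kernel_has_derivative[OF Suc.prems V m]])
        (intro Suc.IH[where g="\<lambda>z. dd b g z" for b] smooth_dd bsupp_dd Suc.prems)
  qed simp
  then show ?thesis using g by (simp add: smooth_def)
qed

section \<open>Jacobian matrices and the standard mollifier\<close>

definition jac :: "(real^3 => real^3) => real^3 => real^3^3" where
  "jac f x = (\<chi> i j. pd j (\<lambda>y. f y $ i) x)"

lemma pd_eq_dd: "f differentiable at x ==> pd j f x = dd (axis j 1) f x"
  using has_vector_derivative_line[of f x 0 "axis j 1"] unfolding pd_def by (auto intro: vector_derivative_at)

lemma dd_nth:
  fixes f :: "'a::euclidean_space => real^3"
  assumes "f differentiable at x" shows "dd b (\<lambda>y. f y $ i) x = dd b f x $ i"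
  by (rule dd_eqI[OF bounded_linear.has_derivative[OF bounded_linear_vec_nth has_derivative_dd[OF assms]]])

lemma jac_nth: "smooth f ==> jac f x $ i $ j = dd (axis j 1) f x $ i"
  by (simp add: jac_def pd_eq_dd smooth_differentiable smooth_vec_nth dd_nth)

lemma jac_norm_sq:
  assumes "smooth f"
  shows "(norm (jac f x))\<^sup>2 = (\<Sum>j\<in>UNIV. (norm (dd (axis j 1) f x))\<^sup>2)"
proof -
  have "(norm (jac f x))\<^sup>2 = (\<Sum>i\<in>UNIV. \<Sum>j\<in>UNIV. (jac f x $ i $ j)\<^sup>2)"
    unfolding power2_norm_eq_inner inner_vec_def by (simp add: power2_eq_square)
  also have "\<dots> = (\<Sum>j\<in>UNIV. \<Sum>i\<in>UNIV. (dd (axis j 1) f x $ i)\<^sup>2)"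
    by (subst sum.swap) (simp add: jac_nth[OF assms])
  also have "\<dots> = (\<Sum>j\<in>UNIV. (norm (dd (axis j 1) f x))\<^sup>2)"
    unfolding power2_norm_eq_inner inner_vec_def by (simp add: power2_eq_square)
  finally show ?thesis .
qed

lemma test_vec_smooth:
  assumes "test_vec \<Omega> f" shows "smooth f" "bsupp f" "\<And>x. x \<notin> \<Omega> ==> f x = 0"
proof -
  obtain K where K: "smooth f" "compact K" "K \<subseteq> \<Omega>" "\<And>x. x \<notin> K ==> f x = 0"
    using assms by (auto simp: test_vec_def)
  show "smooth f" by fact
  show "f x = 0" if "x \<notin> \<Omega>" for x using K that by blast
  obtain B where B: "\<And>x. x \<in> K ==> norm x \<le> B" using compact_imp_bounded[OF K(2)] by (auto simp: bounded_iff)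
  show "bsupp f"
  proof (rule bsuppI[of "B + 1"])
    fix x :: "real^3" assume "B + 1 \<le> norm x"
    then have "x \<notin> K" using B[of x] by auto
    then show "f x = 0" by (rule K)
  qed
qed

lemma borel_smooth: "smooth f ==> f \<in> borel_measurable borel"
  by (intro borel_measurable_continuous_onI smooth_continuous)

lemma sqi_bsupp:
  fixes f :: "'a::euclidean_space => 'b::euclidean_space"
  assumes "continuous_on UNIV f" "bsupp f" shows "sqi lborel f"
proof -
  have "integrable lborel (\<lambda>x. (norm (f x))\<^sup>2)"
    by (rule integrable_bsupp) (use assms in \<open>auto intro!: continuous_intros simp: bsupp_def\<close>)
  then show ?thesis using assms(1) by (auto simp: sqi_def intro: borel_measurable_continuous_onI)
qed

definition Zb :: real where "Zb = (\<integral>x. bump (x::real^3) \<partial>lborel)"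

definition mol :: "real => real^3 => real" where
  "mol d y = bump ((1/d) *\<^sub>R y) / (d^3 * Zb)"

lemma Zb_pos: "Zb > 0"
proof -
  have i: "integrable lborel (bump :: real^3 => real)"
    by (intro integrable_bsupp smooth_continuous smooth_bump bsuppI[of 1] bump_eq_0)
  have "Zb \<noteq> 0"
  proof
    assume "Zb = 0"
    then have "AE x in lborel. bump (x::real^3) = 0"
      using integral_nonneg_eq_0_iff_AE[OF i] by (simp add: Zb_def)
    then have "AE x in lborel. x \<notin> ball (0::real^3) 1"
      by eventually_elim (use bump_pos_iff in \<open>force\<close>)
    then have "ball (0::real^3) 1 \<in> null_sets lborel" by (subst (asm) AE_iff_null_sets[symmetric]) auto
    then have "negligible (ball (0::real^3) 1)" by (simp add: negligible_iff_null_sets null_sets_completionI)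
    then show False using open_not_negligible[of "ball (0::real^3) 1"] by simp
  qed
  moreover have "Zb \<ge> 0" unfolding Zb_def by (intro integral_nonneg_AE AE_I2) simp
  ultimately show ?thesis by simp
qed

lemma mol_smooth: "smooth (mol d)"
proof -
  have "smooth (\<lambda>y. (1 / (d^3 * Zb)) * bump ((1/d) *\<^sub>R y))"
    by (intro smooth_mult smooth_const smooth_compose[OF smooth_bump] smooth_scaleR smooth_ident)
  then show ?thesis by (simp add: mol_def[abs_def])
qed

lemma mol_eq_0: "d > 0 ==> norm y \<ge> d ==> mol d y = 0"
  by (simp add: mol_def bump_eq_0)

lemma mol_bsupp: "d > 0 ==> bsupp (mol d)" by (rule bsuppI[of d]) (rule mol_eq_0)

lemma mol_dd_eq_0: "d > 0 ==> norm y > d ==> dd b (mol d) y = 0"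
  by (rule dd_eq_0[of "- cball 0 d"]) (auto intro: mol_eq_0)

lemma mol_nonneg: "d > 0 ==> 0 \<le> mol d y" using Zb_pos by (simp add: mol_def)

lemma mol_dd: "d > 0 ==> dd b (mol d) y = dd b bump ((1/d) *\<^sub>R y) / (d^4 * Zb)"
proof -
  assume d: "d > 0"
  have 1: "((\<lambda>y. (1/d) *\<^sub>R y) has_derivative (\<lambda>h. (1/d) *\<^sub>R h)) (at y)" by (auto intro!: derivative_eq_intros)
  have 2: "((\<lambda>y. (1 / (d^3 * Zb)) *\<^sub>R bump ((1/d) *\<^sub>R y)) has_derivative (\<lambda>h. (1 / (d^3 * Zb)) *\<^sub>R dd ((1/d) *\<^sub>R h) bump ((1/d) *\<^sub>R y))) (at y)"
    by (rule bounded_linear.has_derivative[OF bounded_linear_scaleR_right has_derivative_compose[OF 1 smooth_has_derivative[OF smooth_bump]]])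
  have 3: "(\<lambda>y. (1 / (d^3 * Zb)) *\<^sub>R bump ((1/d) *\<^sub>R y)) = mol d" by (auto simp: mol_def)
  have "dd b (mol d) y = (1 / (d^3 * Zb)) *\<^sub>R dd ((1/d) *\<^sub>R b) bump ((1/d) *\<^sub>R y)"
    by (rule dd_eqI) (use 2 in \<open>simp only: 3\<close>)
  also have "dd ((1/d) *\<^sub>R b) bump ((1/d) *\<^sub>R y) = (1/d) *\<^sub>R dd b bump ((1/d) *\<^sub>R y)"
    by (rule linear_cmul[OF bounded_linear.linear[OF dd_linear[OF smooth_differentiable[OF smooth_bump]]]])
  finally show ?thesis using d by (simp add: power_numeral_reduce mult_ac)
qed

text \<open>The powers of \<open>d\<close> are explicit because the later bounds must be uniform as
  \<open>d\<close> tends to 0: a derivative costs one factor 1/d.\<close>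

lemma mol_bounds:
  obtains C where "C > 0" "\<And>d y. d > 0 ==> mol d y \<le> C / d^3"
    "\<And>d y b. d > 0 ==> \<bar>dd b (mol d) y\<bar> \<le> C / d^4 * norm b"
proof -
  obtain B where B: "B > 0" "\<And>(x::real^3) b. norm (dd b bump x) \<le> B * norm b"
    using smooth_bsupp_bounded[OF smooth_bump bsuppI[of 1 bump]] bump_eq_0 by metis
  define C where "C = (1 + B) / Zb"
  show ?thesis
  proof (rule that[of C])
    show "C > 0" using B Zb_pos by (simp add: C_def)
    fix d :: real and y assume d: "d > 0"
    have "mol d y \<le> (1 + B) / (d^3 * Zb)"
      unfolding mol_def using d Zb_pos B bump_le_1[of "(1/d) *\<^sub>R y"] by (intro divide_right_mono) auto
    then show "mol d y \<le> C / d^3" by (simp add: C_def mult.commute)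
    fix b
    have "\<bar>dd b (mol d) y\<bar> = \<bar>dd b bump ((1/d) *\<^sub>R y)\<bar> / (d^4 * Zb)" using d Zb_pos by (simp add: mol_dd)
    also have "\<dots> \<le> ((1 + B) * norm b) / (d^4 * Zb)"
      using d Zb_pos B(2)[of "(1/d) *\<^sub>R y" b]
      by (intro divide_right_mono) (simp_all add: distrib_right add_increasing)
    finally show "\<bar>dd b (mol d) y\<bar> \<le> C / d^4 * norm b" by (simp add: C_def mult_ac)
  qed
qed

lemma mol_integral: "d > 0 ==> (\<integral>y. mol d (y - a) \<partial>lborel) = 1"
  using integral_dilate[OF borel_smooth[OF smooth_bump], of d a] Zb_pos by (simp add: mol_def Zb_def[symmetric])

text \<open>Reduces bounds for integral operators to averages over balls: a kernel that vanishes for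
  \<open>norm (x - y) > R\<close> sees \<open>h\<close> on the ball of radius \<open>R\<close>
  around \<open>y\<close> alone.\<close>

lemma kernel_le_av:
  fixes V :: "real^3 => 'b::euclidean_space" and k :: "real^3 => real^3 => 'b"
  assumes i: "integrable lborel (k y)" and [measurable]: "h \<in> borel_measurable borel"
    and k: "\<And>x. ennreal (norm (k y x)) \<le> ennreal K * h x" "\<And>x. norm (x - y) > R ==> k y x = 0"
  shows "ennreal (norm (\<integral>x. k y x \<partial>lborel)) \<le> ennreal K * av R h y"
proof -
  have "ennreal (norm (\<integral>x. k y x \<partial>lborel)) \<le> (\<integral>\<^sup>+x. ennreal (norm (k y x)) \<partial>lborel)"
    by (rule integral_norm_bound_ennreal[OF i])
  also have "\<dots> \<le> (\<integral>\<^sup>+x. ennreal K * (indicator (cball 0 R) (x - y) * h x) \<partial>lborel)"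
  proof (rule nn_integral_mono)
    fix x show "ennreal (norm (k y x)) \<le> ennreal K * (indicator (cball 0 R) (x - y) * h x)"
      using k(1)[of x] k(2)[of x] by (cases "norm (x - y) \<le> R") auto
  qed
  also have "\<dots> = ennreal K * (\<integral>\<^sup>+x. indicator (cball 0 R) (x - y) * h x \<partial>lborel)"
    by (rule nn_integral_cmult) measurable
  also have "(\<integral>\<^sup>+x. indicator (cball 0 R) (x - y) * h x \<partial>lborel) = av R h y"
    using nn_integral_shift[of "\<lambda>x. indicator (cball 0 R) (x - y) * h x" y] by (simp add: av_def add.commute)
  finally show ?thesis .
qed

lemma av_bound_L2:
  fixes T :: "real^3 => 'b::euclidean_space"
  assumes T: "\<And>y. ennreal (norm (T y)) \<le> K * av R h y" and [measurable]: "h \<in> borel_measurable borel"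
  shows "(\<integral>\<^sup>+y. ennreal ((norm (T y))\<^sup>2) \<partial>lborel) \<le> (K * emeasure lborel (cball (0::real^3) R))\<^sup>2 * (\<integral>\<^sup>+y. (h y)\<^sup>2 \<partial>lborel)"
proof -
  have "(\<integral>\<^sup>+y. ennreal ((norm (T y))\<^sup>2) \<partial>lborel) \<le> (\<integral>\<^sup>+y. K\<^sup>2 * (av R h y)\<^sup>2 \<partial>lborel)"
    using power_mono[OF T, where n=2] by (intro nn_integral_mono) (simp add: ennreal_power[symmetric] power_mult_distrib)
  also have "\<dots> = K\<^sup>2 * (\<integral>\<^sup>+y. (av R h y)\<^sup>2 \<partial>lborel)" by (rule nn_integral_cmult) measurable
  also have "\<dots> \<le> K\<^sup>2 * ((emeasure lborel (cball (0::real^3) R))\<^sup>2 * (\<integral>\<^sup>+y. (h y)\<^sup>2 \<partial>lborel))"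
    by (intro mult_left_mono av_L2) auto
  finally show ?thesis by (simp add: power_mult_distrib mult.assoc)
qed

lemma av_bound_L4:
  fixes T :: "real^3 => 'b::euclidean_space"
  assumes T: "\<And>y. ennreal (norm (T y)) \<le> K * av R h y" and [measurable]: "h \<in> borel_measurable borel"
  shows "(\<integral>\<^sup>+y. ennreal ((norm (T y))^4) \<partial>lborel) \<le> (K * emeasure lborel (cball (0::real^3) R))^4 * (\<integral>\<^sup>+y. (h y)^4 \<partial>lborel)"
proof -
  have "(\<integral>\<^sup>+y. ennreal ((norm (T y))^4) \<partial>lborel) \<le> (\<integral>\<^sup>+y. K^4 * (av R h y)^4 \<partial>lborel)"
    using power_mono[OF T, where n=4] by (intro nn_integral_mono) (simp add: ennreal_power[symmetric] power_mult_distrib)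
  also have "\<dots> = K^4 * (\<integral>\<^sup>+y. (av R h y)^4 \<partial>lborel)" by (rule nn_integral_cmult) measurable
  also have "\<dots> \<le> K^4 * ((emeasure lborel (cball (0::real^3) R))^4 * (\<integral>\<^sup>+y. (h y)^4 \<partial>lborel))"
    by (intro mult_left_mono av_L4) auto
  finally show ?thesis by (simp add: power_mult_distrib mult.assoc)
qed

lemma bounded_support_L1_le:
  fixes f :: "real^3 => 'b::euclidean_space"
  assumes f: "sqi lborel f" "\<And>x. x \<notin> \<Omega> ==> f x = 0" and O: "open \<Omega>" "bounded \<Omega>"
  shows "integrable lborel f" "(\<integral>x. norm (f x) \<partial>lborel) \<le> n2 lborel f * sqrt (measure lborel \<Omega>)"
proof -
  have s: "sqi lborel (indicat_real \<Omega>)"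
    using O emeasure_bounded_finite[OF O(2)] by (auto simp: sqi_def integrable_indicator_iff power2_eq_square indicator_inter_arith[symmetric])
  have e: "norm (f x) * norm (indicat_real \<Omega> x) = norm (f x)" for x using f(2)[of x] by (cases "x \<in> \<Omega>") auto
  show "integrable lborel f" using sqi_prod_integrable[OF f(1) s] f(1) unfolding e by (simp add: sqi_def integrable_norm_iff)
  have "n2 lborel (indicat_real \<Omega>) = sqrt (measure lborel \<Omega>)"
    using O by (simp add: n2_def power2_eq_square indicator_inter_arith[symmetric])
  then show "(\<integral>x. norm (f x) \<partial>lborel) \<le> n2 lborel f * sqrt (measure lborel \<Omega>)"
    using n2_Cauchy_Schwarz_norm[OF f(1) s] unfolding e by simp
qed

section \<open>Divergence free approximation\<close>

lemma norm_scaleR_le: "\<bar>a\<bar> \<le> A ==> norm v \<le> V ==> norm (a *\<^sub>R v) \<le> A * V"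
  unfolding norm_scaleR by (intro mult_mono) auto

lemma dd_sum_axis:
  fixes f :: "real^3 => 'b::real_normed_vector"
  assumes "f differentiable at x"
  shows "dd v f x = (\<Sum>j\<in>UNIV. (v $ j) *\<^sub>R dd (axis j 1) f x)"
proof -
  interpret L: bounded_linear "\<lambda>v. dd v f x" using assms by (rule dd_linear)
  have "v = (\<Sum>j\<in>UNIV. (v $ j) *\<^sub>R axis j 1)"
    using basis_expansion[of v] by (simp add: scalar_mult_eq_scaleR)
  from arg_cong[OF this, of "\<lambda>v. dd v f x"] show ?thesis by (simp only: L.sum L.scaleR)
qed

lemma dd_scaleR:
  fixes g :: "'a::euclidean_space => 'b::real_normed_vector"
  assumes "f differentiable at x" "g differentiable at x"
  shows "dd b (\<lambda>x. f x *\<^sub>R g x) x = f x *\<^sub>R dd b g x + dd b f x *\<^sub>R g x"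
  by (rule dd_eqI[OF has_derivative_scaleR[OF has_derivative_dd[OF assms(1)] has_derivative_dd[OF assms(2)]]])

lemma test_divfree_vec: "test_divfree \<Omega> \<phi> ==> test_vec \<Omega> \<phi>" by (simp add: test_divfree_def)

lemma test_divfree_sum_dd:
  assumes "test_divfree \<Omega> \<phi>" shows "(\<Sum>j\<in>UNIV. dd (axis j 1) \<phi> x $ j) = 0"
  using assms test_vec_smooth(1)[of \<Omega> \<phi>]
  by (simp add: test_divfree_def pd_eq_dd smooth_differentiable smooth_vec_nth dd_nth)

text \<open>The integrand is the divergence of \<open>\<kappa> x *\<^sub>R \<phi> x\<close>, because
  \<phi> itself is divergence free.\<close>

lemma test_divfree_orthogonal:
  fixes \<kappa> :: "real^3 => real"
  assumes \<phi>: "test_divfree \<Omega> \<phi>" and k: "smooth \<kappa>"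
  shows "(\<integral>x. dd (\<phi> x) \<kappa> x \<partial>lborel) = 0"
proof -
  note s = test_vec_smooth[OF test_divfree_vec[OF \<phi>]]
  define g where "g j x = \<kappa> x *\<^sub>R (\<phi> x $ j)" for j x
  have gs: "smooth (g j)" for j unfolding g_def by (intro smooth_scaleR k smooth_vec_nth s)
  have gb: "bsupp (g j)" for j using s(2) unfolding g_def bsupp_def by fastforce
  have gd: "dd (axis j 1) (g j) x = \<kappa> x * dd (axis j 1) \<phi> x $ j + dd (axis j 1) \<kappa> x * \<phi> x $ j" for j x
    using dd_scaleR[of \<kappa> x "\<lambda>x. \<phi> x $ j" "axis j 1"] dd_nth[OF smooth_differentiable[OF s(1)], where x=x and b="axis j 1" and i=j]
      smooth_differentiable[OF k] smooth_differentiable[OF smooth_vec_nth[OF s(1)]]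
    unfolding g_def by simp
  have "(\<Sum>j\<in>UNIV. dd (axis j 1) (g j) x) = \<kappa> x * (\<Sum>j\<in>UNIV. dd (axis j 1) \<phi> x $ j) + dd (\<phi> x) \<kappa> x" for x
    unfolding gd dd_sum_axis[OF smooth_differentiable[OF k], of x "\<phi> x"]
    by (simp add: sum.distrib sum_distrib_left mult.commute)
  then have "dd (\<phi> x) \<kappa> x = (\<Sum>j\<in>UNIV. dd (axis j 1) (g j) x)" for x
    using test_divfree_sum_dd[OF \<phi>, of x] by simp
  moreover have "integrable lborel (\<lambda>x. dd (axis j 1) (g j) x)" for j
    by (intro integrable_bsupp smooth_continuous smooth_dd bsupp_dd gs gb)
  ultimately show ?thesis using integral_dd_eq_0[OF gs gb] by (simp add: Bochner_Integration.integral_sum)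
qed

lemma borel_dd_field:
  fixes f :: "'a::euclidean_space => 'b::euclidean_space"
  assumes "smooth f" and [measurable]: "v \<in> borel_measurable borel"
  shows "(\<lambda>x. dd (v x) f x) \<in> borel_measurable borel"
proof -
  have [measurable]: "(\<lambda>x. dd c f x) \<in> borel_measurable borel" for c
    by (intro borel_smooth smooth_dd assms)
  have "(\<lambda>x. dd (v x) f x) = (\<lambda>x. \<Sum>c\<in>Basis. (v x \<bullet> c) *\<^sub>R dd c f x)"
    by (rule ext, rule dd_eq_sum, rule smooth_differentiable, rule assms)
  then show ?thesis by simp
qed

lemma dd_diff_arg: "f differentiable at x ==> dd (a - b) f x = dd a f x - dd b f x"
  by (rule linear_diff[OF bounded_linear.linear[OF dd_linear]])
lemma dd_add_arg: "f differentiable at x ==> dd (a + b) f x = dd a f x + dd b f x"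
  by (rule linear_add[OF bounded_linear.linear[OF dd_linear]])
lemma dd_scaleR_arg: "f differentiable at x ==> dd (r *\<^sub>R a) f x = r *\<^sub>R dd a f x"
  by (rule linear_cmul[OF bounded_linear.linear[OF dd_linear]])
lemma dd_minus_arg: "f differentiable at x ==> dd (- a) f x = - dd a f x"
  by (rule linear_neg[OF bounded_linear.linear[OF dd_linear]])
lemma dd_0_arg: "f differentiable at x ==> dd 0 f x = 0"
  by (rule linear_0[OF bounded_linear.linear[OF dd_linear]])

text \<open>\<kappa> may be nonzero on the boundary of \<Omega>: the identity says that the
  extension of \<open>v\<close> by zero is divergence free in the whole space, so it also carries
  the vanishing normal trace. It passes from test fields to their L^2 limit since the gradient of
  \<kappa> is bounded and \<Omega> has finite measure.\<close>

lemma weakly_divfree: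
  fixes \<kappa> :: "real^3 => real"
  assumes O: "open \<Omega>" "bounded \<Omega>" and v: "sqi lborel v" "\<And>x. x \<notin> \<Omega> ==> v x = 0"
    and \<phi>: "\<And>n. test_divfree \<Omega> (\<phi> n)" "(\<lambda>n. n2 lborel (\<lambda>x. \<phi> n x - v x)) \<longlonglongrightarrow> 0"
    and k: "smooth \<kappa>" "\<And>x b. norm (dd b \<kappa> x) \<le> B * norm b"
  shows "(\<integral>x. dd (v x) \<kappa> x \<partial>lborel) = 0"
proof -
  note s = test_vec_smooth[OF test_divfree_vec[OF \<phi>(1)]]
  have sp: "sqi lborel (\<phi> n)" for n by (intro sqi_bsupp smooth_continuous s)
  have kd: "\<kappa> differentiable at x" for x using k(1) by (rule smooth_differentiable)
  have i: "integrable lborel (\<lambda>x. dd (f x) \<kappa> x)" if "integrable lborel f" for f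
  proof (rule Bochner_Integration.integrable_bound[where f="\<lambda>x. B * norm (f x)"])
    show "(\<lambda>x. dd (f x) \<kappa> x) \<in> borel_measurable lborel" using borel_dd_field[OF k(1), of f] that by simp
    show "AE x in lborel. norm (dd (f x) \<kappa> x) \<le> norm (B * norm (f x))"
      using k(2) by (intro AE_I2) (auto intro: order_trans[OF _ abs_ge_self])
  qed (use that in auto)
  have iv: "integrable lborel v" "integrable lborel (\<phi> n)" for n
    using bounded_support_L1_le(1)[OF v O] bounded_support_L1_le(1)[OF sp s(3) O] by auto
  have le: "norm (\<integral>x. dd (v x) \<kappa> x \<partial>lborel) \<le> n2 lborel (\<lambda>x. \<phi> n x - v x) * (sqrt (measure lborel \<Omega>) * B)" for n
  proof -
    have "(\<integral>x. dd (v x) \<kappa> x \<partial>lborel) = - (\<integral>x. dd (\<phi> n x - v x) \<kappa> x \<partial>lborel)"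
      using test_divfree_orthogonal[OF \<phi>(1)[of n] k(1)] i[OF iv(1)] i[OF iv(2)[of n]]
      by (simp add: dd_diff_arg[OF kd])
    then have "norm (\<integral>x. dd (v x) \<kappa> x \<partial>lborel) \<le> (\<integral>x. norm (dd (\<phi> n x - v x) \<kappa> x) \<partial>lborel)"
      using integral_norm_bound[of lborel "\<lambda>x. dd (\<phi> n x - v x) \<kappa> x"] by (simp only: norm_minus_cancel)
    also have "\<dots> \<le> (\<integral>x. B * norm (\<phi> n x - v x) \<partial>lborel)"
      by (rule Bochner_Integration.integral_mono) (use iv k(2) in \<open>auto intro!: i integrable_norm\<close>)
    also have "\<dots> = B * (\<integral>x. norm (\<phi> n x - v x) \<partial>lborel)" by simp
    also have "\<dots> \<le> B * (n2 lborel (\<lambda>x. \<phi> n x - v x) * sqrt (measure lborel \<Omega>))"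
    proof (rule mult_left_mono)
      show "(\<integral>x. norm (\<phi> n x - v x) \<partial>lborel) \<le> n2 lborel (\<lambda>x. \<phi> n x - v x) * sqrt (measure lborel \<Omega>)"
        by (rule bounded_support_L1_le(2)[OF sqi_diff[OF sp v(1)] _ O]) (use s(3) v(2) in auto)
      have "0 \<le> norm (dd (axis 1 1) \<kappa> 0)" by simp
      also have "\<dots> \<le> B" using k(2)[of 0 "axis 1 1"] by simp
      finally show "0 \<le> B" .
    qed
    finally show ?thesis by (simp add: mult_ac)
  qed
  have "(\<lambda>n. n2 lborel (\<lambda>x. \<phi> n x - v x) * (sqrt (measure lborel \<Omega>) * B)) \<longlonglongrightarrow> 0"
    using tendsto_mult_right[OF \<phi>(2)] by simp
  then have "norm (\<integral>x. dd (v x) \<kappa> x \<partial>lborel) \<le> 0"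
    by (rule LIMSEQ_le_const) (use le in auto)
  then show ?thesis by simp
qed

text \<open>The outcome of \<open>inward_field\<close>: moving along \<open>N\<close> carries the
  closure into \<Omega> with room for a ball of radius \<open>c * e\<close>, which is the room taken
  by the mollifier.\<close>

locale inward =
  fixes \<Omega> :: "(real^3) set" and N :: "real^3 => real^3" and c e0 :: real
  assumes op: "open \<Omega>" and bd: "bounded \<Omega>" and Nsm: "smooth N" and Nbs: "bsupp N"
    and c: "c > 0" and e0: "e0 > 0"
    and inw: "\<And>x e z. x \<in> closure \<Omega> ==> 0 < e ==> e < e0 ==> norm z \<le> c * e ==> x + e *\<^sub>R N x + z \<in> \<Omega>"
begin

definition Phi :: "real => real^3 => real^3" where "Phi e x = x + e *\<^sub>R N x"
text \<open>The derivative of \<open>Phi e\<close> at \<open>x\<close>, applied to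
  \<open>v x\<close>.\<close>

definition Vf :: "real => (real^3 => real^3) => real^3 => real^3" where "Vf e v x = v x + e *\<^sub>R dd (v x) N x"

text \<open>The push-forward of \<open>v\<close> under \<open>Phi e\<close> as a vector density (Piola transform), mollified at
  scale \<open>c * e\<close>. Written as an integral over the source, it needs neither the inverse of
  \<open>Phi e\<close> nor its Jacobian determinant, and it visibly preserves the divergence constraint.\<close>

definition W :: "real => (real^3 => real^3) => real^3 => real^3" where
  "W e v y = (\<integral>x. mol (c * e) (y - Phi e x) *\<^sub>R Vf e v x \<partial>lborel)"

lemma Nd: "N differentiable at x" by (rule smooth_differentiable[OF Nsm])

lemma Phi_smooth: "smooth (Phi e)"
  unfolding Phi_def by (intro smooth_add smooth_ident smooth_scaleR smooth_const Nsm)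

lemma Phi_borel [measurable]: "Phi e \<in> borel_measurable borel"
  by (rule borel_smooth[OF Phi_smooth])

lemma Vf_borel [measurable]:
  assumes [measurable]: "v \<in> borel_measurable borel" shows "Vf e v \<in> borel_measurable borel"
proof -
  have [measurable]: "(\<lambda>x. dd (v x) N x) \<in> borel_measurable borel" by (rule borel_dd_field[OF Nsm assms])
  show ?thesis unfolding Vf_def by measurable
qed

lemma Vf_diff: "Vf e (\<lambda>x. v x - v' x) x = Vf e v x - Vf e v' x"
  by (simp add: Vf_def dd_diff_arg[OF Nd] algebra_simps)

lemma Vf_0: "v x = 0 ==> Vf e v x = 0" by (simp add: Vf_def dd_0_arg[OF Nd])

lemma Vf_smooth: "smooth v ==> smooth (Vf e v)"
  unfolding Vf_def by (intro smooth_add smooth_scaleR smooth_const smooth_dd_field Nsm)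

lemma N_bounds:
  obtains B where "B > 0" "\<And>x. norm (N x) \<le> B" "\<And>x b. norm (dd b N x) \<le> B * norm b"
    "\<And>\<psi> x b. smooth \<psi> ==> norm b = 1 ==> norm (dd b (\<lambda>x. dd (\<psi> x) N x) x) \<le> B * (norm (\<psi> x) + norm (dd b \<psi> x))"
proof -
  obtain B where B: "B > 0" "\<And>x. norm (N x) \<le> B" "\<And>x b. norm (dd b N x) \<le> B * norm b"
    using smooth_bsupp_bounded[OF Nsm Nbs] by metis
  have "\<exists>B>0. \<forall>x b. norm (dd b (\<lambda>x. dd (axis j 1) N x) x) \<le> B * norm b" for j :: 3
    using smooth_bsupp_bounded[OF smooth_dd[OF Nsm] bsupp_dd[OF Nbs], of "axis j 1"] by metis
  then obtain Bj where Bj: "\<And>j. Bj j > 0" "\<And>j x b. norm (dd b (\<lambda>x. dd (axis j 1) N x) x) \<le> Bj j * norm b" by metis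
  \<comment> \<open>One constant for all four estimates: the sum over the coordinates bounds the
    product rule, and a single summand already exceeds \<open>B\<close>.\<close>
  define B' where "B' = (\<Sum>j\<in>(UNIV::3 set). B + Bj j)"
  have "B \<le> B + Bj 1" using Bj(1)[of 1] by simp
  also have "B + Bj 1 \<le> B'" unfolding B'_def by (rule member_le_sum) (use B(1) Bj(1) in \<open>auto simp: add_nonneg_nonneg less_imp_le\<close>)
  finally have BB: "B \<le> B'" .
  show ?thesis
  proof (rule that[of B'])
    show "B' > 0" using BB B by simp
    show "norm (N x) \<le> B'" for x using B(2)[of x] BB by simp
    show "norm (dd b N x) \<le> B' * norm b" for x b
      using B(3)[of x b] BB by (meson mult_right_mono norm_ge_zero order_trans)
    fix \<psi> :: "real^3 => real^3" and x b :: "real^3" assume \<psi>: "smooth \<psi>" and b: "norm b = 1"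
    have e: "(\<lambda>x. dd (\<psi> x) N x) = (\<lambda>x. \<Sum>j\<in>UNIV. (\<psi> x $ j) *\<^sub>R dd (axis j 1) N x)"
      by (rule ext, rule dd_sum_axis, rule Nd)
    have h1: "((\<lambda>x. \<psi> x $ j) has_derivative (\<lambda>h. dd h \<psi> x $ j)) (at x)" for j
      by (rule bounded_linear.has_derivative[OF bounded_linear_vec_nth smooth_has_derivative[OF \<psi>]])
    have h2: "((\<lambda>x. dd (axis j 1) N x) has_derivative (\<lambda>h. dd h (\<lambda>x. dd (axis j 1) N x) x)) (at x)" for j
      by (rule smooth_has_derivative[OF smooth_dd[OF Nsm]])
    have "dd b (\<lambda>x. dd (\<psi> x) N x) x = (\<Sum>j\<in>UNIV. (\<psi> x $ j) *\<^sub>R dd b (\<lambda>x. dd (axis j 1) N x) x + (dd b \<psi> x $ j) *\<^sub>R dd (axis j 1) N x)"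
      unfolding e by (rule dd_eqI[OF has_derivative_sum[OF has_derivative_scaleR[OF h1 h2]]])
    also have "norm \<dots> \<le> (\<Sum>j\<in>UNIV. (B + Bj j) * (norm (\<psi> x) + norm (dd b \<psi> x)))"
    proof (rule sum_norm_le)
      fix j :: 3
      have "norm ((\<psi> x $ j) *\<^sub>R dd b (\<lambda>x. dd (axis j 1) N x) x) \<le> norm (\<psi> x) * Bj j"
        using Bj(2)[of j x b] b component_le_norm_cart[of "\<psi> x" j] by (auto intro!: mult_mono)
      moreover have "norm ((dd b \<psi> x $ j) *\<^sub>R dd (axis j 1) N x) \<le> norm (dd b \<psi> x) * B"
        using B(3)[of x "axis j 1"] component_le_norm_cart[of "dd b \<psi> x" j] by (auto intro!: mult_mono)
      moreover have "norm (\<psi> x) * Bj j + norm (dd b \<psi> x) * B \<le> (B + Bj j) * (norm (\<psi> x) + norm (dd b \<psi> x))"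
        using B(1) Bj(1)[of j] by (simp add: algebra_simps)
      ultimately show "norm ((\<psi> x $ j) *\<^sub>R dd b (\<lambda>x. dd (axis j 1) N x) x + (dd b \<psi> x $ j) *\<^sub>R dd (axis j 1) N x)
          \<le> (B + Bj j) * (norm (\<psi> x) + norm (dd b \<psi> x))"
        using norm_triangle_ineq order_trans by (smt (verit))
    qed
    also have "\<dots> = B' * (norm (\<psi> x) + norm (dd b \<psi> x))" by (simp add: B'_def sum_distrib_right)
    finally show "norm (dd b (\<lambda>x. dd (\<psi> x) N x) x) \<le> B' * (norm (\<psi> x) + norm (dd b \<psi> x))" .
  qed
qed

lemma Vf_norm:
  assumes "\<And>b. norm (dd b N x) \<le> B * norm b" "0 \<le> e" "e \<le> 1"
  shows "norm (Vf e v x) \<le> (1 + B) * norm (v x)"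
proof -
  have "norm (e *\<^sub>R dd (v x) N x) \<le> norm (dd (v x) N x)" using assms by (simp add: mult_left_le_one_le)
  also have "\<dots> \<le> B * norm (v x)" by (rule assms)
  finally show ?thesis
    unfolding Vf_def using norm_triangle_ineq[of "v x" "e *\<^sub>R dd (v x) N x"] by (simp add: algebra_simps)
qed

lemma Vf_integrable:
  assumes v: "integrable lborel v" and e: "0 \<le> e" "e \<le> 1"
  shows "integrable lborel (Vf e v)"
proof -
  obtain B where B: "\<And>x b. norm (dd b N x) \<le> B * norm b" using N_bounds by metis
  have [measurable]: "v \<in> borel_measurable borel" using v by simp
  show ?thesis
  proof (rule Bochner_Integration.integrable_bound[where f="\<lambda>x. (1 + B) * norm (v x)"])
    show "AE x in lborel. norm (Vf e v x) \<le> norm ((1 + B) * norm (v x))"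
      using Vf_norm[OF B e] by (intro AE_I2) (auto intro: order_trans[OF _ abs_ge_self])
  qed (use v in auto)
qed

lemma W_smooth:
  assumes v: "integrable lborel v" and e: "0 < e" "e \<le> 1"
  shows "smooth (W e v)" "dd b (W e v) y = (\<integral>x. dd b (mol (c * e)) (y - Phi e x) *\<^sub>R Vf e v x \<partial>lborel)"
proof -
  have d: "c * e > 0" using c e by simp
  have V: "integrable lborel (Vf e v)" using Vf_integrable[OF v] e by simp
  have m: "Phi e \<in> borel_measurable lborel" by measurable
  show "smooth (W e v)" unfolding W_def by (rule kernel_smooth[OF V m mol_smooth mol_bsupp[OF d]])
  show "dd b (W e v) y = (\<integral>x. dd b (mol (c * e)) (y - Phi e x) *\<^sub>R Vf e v x \<partial>lborel)"
    unfolding W_def by (rule dd_eqI[OF kernel_has_derivative[OF mol_smooth mol_bsupp[OF d] V m]])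
qed

text \<open>Mollification reaches distance \<open>c * e\<close> and \<open>Phi e\<close> displaces
  by at most \<open>B * e\<close>; the kernel links no points farther apart than the sum.\<close>

lemma far_kernel:
  assumes B: "\<And>x. norm (N x) \<le> B" and e: "0 < e" and far: "norm (x - y) > (c + B) * e"
  shows "norm (y - Phi e x) > c * e"
proof -
  have "norm (x - y) \<le> norm (y - Phi e x) + norm (e *\<^sub>R N x)"
    using norm_triangle_ineq4[of "y - Phi e x" "- (e *\<^sub>R N x)"] by (simp add: Phi_def norm_minus_commute)
  also have "norm (e *\<^sub>R N x) \<le> e * B" using B[of x] e by simp
  finally show ?thesis using far by (simp add: algebra_simps)
qed

lemma kernel_bsupp:
  assumes B: "\<And>x. norm (N x) \<le> B" and e: "0 < e"
  shows "bsupp (\<lambda>x. mol (c * e) (y - Phi e x))"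
proof (rule bsuppI[of "norm y + (c + B) * e + 1"])
  fix x :: "real^3" assume "norm y + (c + B) * e + 1 \<le> norm x"
  then have "norm (x - y) > (c + B) * e" using norm_triangle_ineq2[of x y] by linarith
  then show "mol (c * e) (y - Phi e x) = 0"
    using far_kernel[OF B e, of x y] c e by (intro mol_eq_0) auto
qed

text \<open>By the chain rule through \<open>Phi e\<close>, differentiating the kernel in
  \<open>x\<close> along \<open>b\<close> is minus differentiating it in \<open>y\<close> along the
  image of \<open>b\<close> under the derivative of \<open>Phi e\<close>. This exchange underlies
  both \<open>W_divfree\<close> and \<open>W_grad_bound\<close>.\<close>

lemma kernel_dd:
  "dd b (\<lambda>x. mol d (y - Phi e x)) x = - dd b (mol d) (y - Phi e x) - e *\<^sub>R dd (dd b N x) (mol d) (y - Phi e x)"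
proof -
  have 1: "((\<lambda>x. y - Phi e x) has_derivative (\<lambda>h. 0 - (h + e *\<^sub>R dd h N x))) (at x)"
    unfolding Phi_def
    by (rule has_derivative_diff[OF has_derivative_const has_derivative_add[OF has_derivative_ident
          bounded_linear.has_derivative[OF bounded_linear_scaleR_right smooth_has_derivative[OF Nsm]]]])
  have md: "mol d differentiable at z" for z by (rule smooth_differentiable[OF mol_smooth])
  have "dd b (\<lambda>x. mol d (y - Phi e x)) x = dd (0 - (b + e *\<^sub>R dd b N x)) (mol d) (y - Phi e x)"
    by (rule dd_eqI[OF has_derivative_compose[OF 1 smooth_has_derivative[OF mol_smooth]]])
  then show ?thesis by (simp add: dd_diff_arg[OF md] dd_add_arg[OF md] dd_scaleR_arg[OF md] dd_0_arg[OF md] dd_minus_arg[OF md])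
qed

lemma kernel_smooth_x: "smooth (\<lambda>x. mol d (y - Phi e x))"
  by (intro smooth_compose[OF mol_smooth] smooth_diff smooth_const Phi_smooth)

text \<open>The divergence in \<open>y\<close> pairs the gradient of the mollifier with the
  derivative of \<open>Phi e\<close> applied to \<open>v x\<close>. By the chain rule this is minus
  the derivative along \<open>v x\<close> of the kernel as a function of \<open>x\<close>, whose
  integral vanishes by \<open>weakly_divfree\<close>.\<close>

lemma W_divfree:
  assumes v: "sqi lborel v" "\<And>x. x \<notin> \<Omega> ==> v x = 0" and e: "0 < e" "e \<le> 1"
    and \<phi>: "\<And>n. test_divfree \<Omega> (\<phi> n)" "(\<lambda>n. n2 lborel (\<lambda>x. \<phi> n x - v x)) \<longlonglongrightarrow> 0"
  shows "(\<Sum>j\<in>UNIV. dd (axis j 1) (W e v) y $ j) = 0"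
proof -
  have iv: "integrable lborel v" by (rule bounded_support_L1_le(1)[OF v op bd])
  have d: "c * e > 0" using c e by simp
  have V: "integrable lborel (Vf e v)" using Vf_integrable[OF iv] e by simp
  have m: "Phi e \<in> borel_measurable lborel" by measurable
  have i: "integrable lborel (\<lambda>x. dd b (mol (c * e)) (y - Phi e x) *\<^sub>R Vf e v x)" for b
    by (intro kernel_integrable[where g="\<lambda>z. dd b (mol (c*e)) z"] smooth_continuous smooth_dd bsupp_dd mol_smooth mol_bsupp d V m)
  have md: "mol (c*e) differentiable at z" for z by (rule smooth_differentiable[OF mol_smooth])
  define k where "k x = mol (c * e) (y - Phi e x)" for x
  have ks: "smooth k" unfolding k_def by (rule kernel_smooth_x)
  obtain B where B: "\<And>x. norm (N x) \<le> B" using N_bounds by metis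
  have kb: "bsupp k" unfolding k_def by (rule kernel_bsupp[OF B e(1)])
  obtain Bk where Bk: "\<And>x b. norm (dd b k x) \<le> Bk * norm b" using smooth_bsupp_bounded[OF ks kb] by metis
  have dk: "dd b k x = - dd (b + e *\<^sub>R dd b N x) (mol (c * e)) (y - Phi e x)" for b x
    unfolding k_def kernel_dd by (simp add: dd_add_arg[OF md] dd_scaleR_arg[OF md])
  have "(\<Sum>j\<in>UNIV. dd (axis j 1) (W e v) y $ j)
      = (\<Sum>j\<in>UNIV. \<integral>x. dd (axis j 1) (mol (c * e)) (y - Phi e x) * Vf e v x $ j \<partial>lborel)"
  proof (rule sum.cong)
    fix j :: 3
    have "(\<integral>x. (dd (axis j 1) (mol (c * e)) (y - Phi e x) *\<^sub>R Vf e v x) $ j \<partial>lborel) = dd (axis j 1) (W e v) y $ j"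
      unfolding W_smooth(2)[OF iv e] by (rule integral_bounded_linear[OF bounded_linear_vec_nth i])
    then show "dd (axis j 1) (W e v) y $ j = (\<integral>x. dd (axis j 1) (mol (c * e)) (y - Phi e x) * Vf e v x $ j \<partial>lborel)" by simp
  qed simp
  also have "\<dots> = (\<integral>x. (\<Sum>j\<in>UNIV. dd (axis j 1) (mol (c * e)) (y - Phi e x) * Vf e v x $ j) \<partial>lborel)"
  proof (rule Bochner_Integration.integral_sum[symmetric])
    fix j :: 3
    show "integrable lborel (\<lambda>x. dd (axis j 1) (mol (c * e)) (y - Phi e x) * Vf e v x $ j)"
      using integrable_bounded_linear[OF bounded_linear_vec_nth i[of "axis j 1"], of j] by simp
  qed
  also have "\<dots> = (\<integral>x. dd (Vf e v x) (mol (c * e)) (y - Phi e x) \<partial>lborel)"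
    by (subst dd_sum_axis[OF md]) (simp add: mult.commute)
  also have "\<dots> = - (\<integral>x. dd (v x) k x \<partial>lborel)" unfolding dk Vf_def by simp
  also have "\<dots> = 0" by (simp add: weakly_divfree[OF op bd v \<phi> ks Bk])
  finally show ?thesis .
qed

text \<open>Everything that \<open>W\<close> reaches is a point of the pushed closure plus a vector
  of norm at most \<open>c * e\<close>. These form the image of a compact set, and
  \<open>inw\<close> places it inside \<Omega>.\<close>

lemma W_support:
  assumes v: "\<And>x. x \<notin> \<Omega> ==> v x = 0" and e: "0 < e" "e < e0"
  shows "\<exists>K. compact K \<and> K \<subseteq> \<Omega> \<and> (\<forall>y. y \<notin> K --> W e v y = 0)"
proof (intro exI conjI allI impI)
  let ?K = "(\<lambda>q. Phi e (fst q) + snd q) ` (closure \<Omega> \<times> cball 0 (c * e))"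
  show "compact ?K"
    by (intro compact_continuous_image compact_Times continuous_on_add continuous_on_compose2[OF smooth_continuous[OF Phi_smooth, of UNIV]] continuous_on_fst continuous_on_snd continuous_on_id)
      (use bd in auto)
  show "?K \<subseteq> \<Omega>" using inw e by (auto simp: Phi_def)
  fix y assume y: "y \<notin> ?K"
  have z: "mol (c * e) (y - Phi e x) *\<^sub>R Vf e v x = 0" for x
  proof (cases "x \<in> \<Omega>")
    case True
    have "norm (y - Phi e x) \<ge> c * e"
    proof (rule ccontr)
      assume "\<not> ?thesis"
      then have "y \<in> ?K" using True closure_subset by (intro image_eqI[of _ _ "(x, y - Phi e x)"]) auto
      then show False using y by simp
    qed
    then show ?thesis using c e by (simp add: mol_eq_0)
  qed (use v Vf_0 in simp)
  show "W e v y = 0" unfolding W_def z by simp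
qed

text \<open>The mollifier has size of order \<open>1 / (c * e)^3\<close> and acts within a ball of
  radius \<open>(c + B) * e\<close>: the powers of \<open>e\<close> cancel, which is why the bounds
  for \<open>W\<close> do not depend on \<open>e\<close>.\<close>

lemma kernel_mass:
  assumes "e > 0" "B > 0" "C > 0"
  shows "ennreal (C / (c * e)^3 * D) * emeasure lborel (cball (0::real^3) ((c + B) * e))
     = ennreal (C * D * unit_ball_vol 3 * ((c + B) / c)^3)"
proof -
  have "C / (c * e)^3 * D * (unit_ball_vol 3 * ((c + B) * e)^3) = C * D * unit_ball_vol 3 * ((c + B) / c)^3"
    using assms c by (simp add: power_mult_distrib power_divide)
  moreover have "emeasure lborel (cball (0::real^3) ((c + B) * e)) = ennreal (unit_ball_vol 3 * ((c + B) * e)^3)"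
    using emeasure_cball[of "(c + B) * e" "0::real^3"] assms c by simp
  moreover have "0 \<le> unit_ball_vol 3 * ((c + B) * e)^3" using assms c by simp
  ultimately show ?thesis by (simp add: ennreal_mult''[symmetric])
qed

lemma W_L4_bound:
  obtains C1 where "C1 \<ge> 0" "\<And>e v. 0 < e ==> e \<le> 1 ==> integrable lborel v ==>
     (\<integral>\<^sup>+y. ennreal (norm (W e v y) ^ 4) \<partial>lborel) \<le> ennreal C1 * (\<integral>\<^sup>+x. ennreal (norm (v x) ^ 4) \<partial>lborel)"
proof -
  obtain B where B: "B > 0" "\<And>x. norm (N x) \<le> B" "\<And>x b. norm (dd b N x) \<le> B * norm b" using N_bounds by metis
  obtain C where C: "C > 0" "\<And>d y. d > 0 ==> mol d y \<le> C / d^3" using mol_bounds by metis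
  define A where "A = C * (1 + B) * unit_ball_vol 3 * ((c + B) / c)^3"
  have A: "A \<ge> 0" using B C c by (simp add: A_def)
  show ?thesis
  proof (rule that[of "A^4"])
    fix e :: real and v :: "real^3 => real^3" assume e: "0 < e" "e \<le> 1" and v: "integrable lborel v"
    have [measurable]: "v \<in> borel_measurable borel" using v by simp
    have d: "c * e > 0" using c e by simp
    have V: "integrable lborel (Vf e v)" using Vf_integrable[OF v] e by simp
    have "ennreal (norm (W e v y)) \<le> ennreal (C / (c * e)^3 * (1 + B)) * av ((c + B) * e) (\<lambda>x. ennreal (norm (v x))) y" for y
      unfolding W_def
    proof (rule kernel_le_av)
      show "integrable lborel (\<lambda>x. mol (c * e) (y - Phi e x) *\<^sub>R Vf e v x)"
        by (intro kernel_integrable smooth_continuous mol_smooth mol_bsupp d V) measurable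
      fix x
      have "norm (mol (c * e) (y - Phi e x) *\<^sub>R Vf e v x) \<le> C / (c * e)^3 * ((1 + B) * norm (v x))"
        by (rule norm_scaleR_le) (use C(2)[OF d] mol_nonneg[OF d] Vf_norm[OF B(3), where x=x and e=e and v=v] e in auto)
      then have "ennreal (norm (mol (c * e) (y - Phi e x) *\<^sub>R Vf e v x)) \<le> ennreal ((C / (c * e)^3 * (1 + B)) * norm (v x))"
        by (intro ennreal_leI) (simp add: mult.assoc)
      also have "\<dots> = ennreal (C / (c * e)^3 * (1 + B)) * ennreal (norm (v x))"
        using C(1) d B(1) by (intro ennreal_mult) auto
      finally show "ennreal (norm (mol (c * e) (y - Phi e x) *\<^sub>R Vf e v x)) \<le> ennreal (C / (c * e)^3 * (1 + B)) * ennreal (norm (v x))" .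
      assume "(c + B) * e < norm (x - y)"
      then show "mol (c * e) (y - Phi e x) *\<^sub>R Vf e v x = 0"
        using far_kernel[OF B(2) e(1), of x y] d by (simp add: mol_eq_0)
    qed measurable
    from av_bound_L4[OF this] show "(\<integral>\<^sup>+y. ennreal (norm (W e v y) ^ 4) \<partial>lborel) \<le> ennreal (A^4) * (\<integral>\<^sup>+x. ennreal (norm (v x) ^ 4) \<partial>lborel)"
      unfolding kernel_mass[OF e(1) B(1) C(1)] A_def[symmetric] using A by (simp add: ennreal_power)
  qed (use A in simp)
qed

text \<open>The derivative of the kernel in \<open>y\<close> is traded for one in \<open>x\<close>, which integration by parts
  moves onto \<open>\<psi>\<close>. The defect carries a factor \<open>e\<close>, which makes up for the additional
  \<open>1 / (c * e)\<close> of the differentiated kernel.\<close>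

lemma W_grad_bound:
  obtains C1 where "C1 \<ge> 0" "\<And>e \<psi> b. 0 < e ==> e \<le> 1 ==> smooth \<psi> ==> bsupp \<psi> ==> norm b = 1 ==>
     (\<integral>\<^sup>+y. ennreal ((norm (dd b (W e \<psi>) y))\<^sup>2) \<partial>lborel) \<le> ennreal C1 * (\<integral>\<^sup>+x. ennreal ((norm (\<psi> x) + norm (dd b \<psi> x))\<^sup>2) \<partial>lborel)"
proof -
  obtain B where B: "B > 0" "\<And>x. norm (N x) \<le> B" "\<And>x b. norm (dd b N x) \<le> B * norm b"
    "\<And>\<psi> x b. smooth \<psi> ==> norm b = 1 ==> norm (dd b (\<lambda>x. dd (\<psi> x) N x) x) \<le> B * (norm (\<psi> x) + norm (dd b \<psi> x))"
    by (rule N_bounds) (rule that)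
  obtain C where C: "C > 0" "\<And>d y. d > 0 ==> mol d y \<le> C / d^3"
    "\<And>d y b. d > 0 ==> \<bar>dd b (mol d) y\<bar> \<le> C / d^4 * norm b" by (rule mol_bounds) (rule that)
  \<comment> \<open>The summand \<open>1 + B\<close> bounds the derivative of \<open>V\<close>. The
    other one bounds the defect, where \<open>e * (C / (c * e)^4)\<close> is
    \<open>C / (c * e)^3\<close> divided by \<open>c\<close>.\<close>
  define D where "D = 1 + B + (B / c) * (1 + B)"
  have D: "D > 0" using B(1) c by (simp add: D_def add_pos_pos)
  define A where "A = C * D * unit_ball_vol 3 * ((c + B) / c)^3"
  have A: "A \<ge> 0" using B C c D by (simp add: A_def)
  show ?thesis
  proof (rule that[of "A^2"])
    fix e :: real and \<psi> :: "real^3 => real^3" and b :: "real^3" assume e: "0 < e" "e \<le> 1" and \<psi>: "smooth \<psi>" "bsupp \<psi>" and b: "norm b = 1"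
    have [measurable]: "\<psi> \<in> borel_measurable borel" "(\<lambda>x. dd b \<psi> x) \<in> borel_measurable borel"
      by (intro borel_smooth smooth_dd \<psi>)+
    have v: "integrable lborel \<psi>" by (intro integrable_bsupp smooth_continuous \<psi>)
    have d: "c * e > 0" using c e by simp
    define V where "V = Vf e \<psi>"
    have Vs: "smooth V" unfolding V_def by (rule Vf_smooth[OF \<psi>(1)])
    have Vb: "bsupp V" using \<psi>(2) Vf_0 unfolding V_def bsupp_def by metis
    have V: "integrable lborel V" by (intro integrable_bsupp smooth_continuous Vs Vb)
    have dV: "norm (dd b V x) \<le> (1 + B) * (norm (\<psi> x) + norm (dd b \<psi> x))" for x
    proof -
      have "dd b V x = dd b \<psi> x + e *\<^sub>R dd b (\<lambda>x. dd (\<psi> x) N x) x"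
        unfolding V_def Vf_def
        by (rule dd_eqI[OF has_derivative_add[OF smooth_has_derivative[OF \<psi>(1)]
              bounded_linear.has_derivative[OF bounded_linear_scaleR_right smooth_has_derivative[OF smooth_dd_field[OF Nsm \<psi>(1)]]]]])
      then have "norm (dd b V x) \<le> norm (dd b \<psi> x) + norm (e *\<^sub>R dd b (\<lambda>x. dd (\<psi> x) N x) x)"
        by (simp only: norm_triangle_ineq)
      also have "norm (e *\<^sub>R dd b (\<lambda>x. dd (\<psi> x) N x) x) \<le> norm (dd b (\<lambda>x. dd (\<psi> x) N x) x)"
        using e by (simp add: mult_left_le_one_le)
      also have "\<dots> \<le> B * (norm (\<psi> x) + norm (dd b \<psi> x))" by (rule B(4)[OF \<psi>(1) b])
      finally show ?thesis
        using norm_ge_zero[of "\<psi> x"] unfolding distrib_left distrib_right mult_1 by linarith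
    qed
    have nV: "norm (V x) \<le> (1 + B) * norm (\<psi> x)" for x
      unfolding V_def using Vf_norm[OF B(3)] e by simp
    have m: "Phi e \<in> borel_measurable lborel" by measurable
    \<comment> \<open>What integration by parts leaves: the undifferentiated mollifier against the
      derivative of \<open>V\<close>, and the part of the chain rule that comes from the derivative
      of \<open>N\<close>.\<close>
    define k where "k y x = mol (c * e) (y - Phi e x) *\<^sub>R dd b V x - (e * dd (dd b N x) (mol (c * e)) (y - Phi e x)) *\<^sub>R V x" for y x
    define \<kappa> where "\<kappa> y x = mol (c * e) (y - Phi e x)" for y x
    have \<kappa>s: "smooth (\<kappa> y)" for y unfolding \<kappa>_def by (rule kernel_smooth_x)
    have gs: "smooth (\<lambda>x. \<kappa> y x *\<^sub>R V x)" for y by (intro smooth_scaleR \<kappa>s Vs)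
    have gb: "bsupp (\<lambda>x. \<kappa> y x *\<^sub>R V x)" for y using Vb unfolding bsupp_def by fastforce
    have gd: "dd b (\<lambda>x. \<kappa> y x *\<^sub>R V x) x = k y x - dd b (mol (c * e)) (y - Phi e x) *\<^sub>R V x" for y x
    proof -
      have "dd b (\<lambda>x. \<kappa> y x *\<^sub>R V x) x = \<kappa> y x *\<^sub>R dd b V x + dd b (\<kappa> y) x *\<^sub>R V x"
        by (rule dd_scaleR) (intro smooth_differentiable \<kappa>s Vs)+
      also have "dd b (\<kappa> y) x = - dd b (mol (c * e)) (y - Phi e x) - e * dd (dd b N x) (mol (c * e)) (y - Phi e x)"
        unfolding \<kappa>_def kernel_dd by simp
      finally show ?thesis by (simp add: k_def \<kappa>_def algebra_simps)
    qed
    have i1: "integrable lborel (\<lambda>x. dd b (mol (c * e)) (y - Phi e x) *\<^sub>R V x)" for y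
      by (intro kernel_integrable[where g="\<lambda>z. dd b (mol (c*e)) z"] smooth_continuous smooth_dd bsupp_dd mol_smooth mol_bsupp d V m)
    have i2: "integrable lborel (\<lambda>x. dd b (\<lambda>x. \<kappa> y x *\<^sub>R V x) x)" for y
      by (intro integrable_bsupp smooth_continuous smooth_dd bsupp_dd gs gb)
    have ik: "integrable lborel (k y)" for y
      using Bochner_Integration.integrable_add[OF i2[of y] i1[of y]] unfolding gd by simp
    have ibp: "dd b (W e \<psi>) y = (\<integral>x. k y x \<partial>lborel)" for y
    proof -
      have "0 = (\<integral>x. dd b (\<lambda>x. \<kappa> y x *\<^sub>R V x) x \<partial>lborel)" using integral_dd_eq_0[OF gs gb] by simp
      also have "\<dots> = (\<integral>x. k y x \<partial>lborel) - (\<integral>x. dd b (mol (c * e)) (y - Phi e x) *\<^sub>R V x \<partial>lborel)"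
        unfolding gd by (rule Bochner_Integration.integral_diff[OF ik i1])
      finally show ?thesis unfolding W_smooth(2)[OF v e] V_def[symmetric] by simp
    qed
    define h where "h x = ennreal (norm (\<psi> x) + norm (dd b \<psi> x))" for x
    have "ennreal (norm (dd b (W e \<psi>) y)) \<le> ennreal (C / (c * e)^3 * D) * av ((c + B) * e) h y" for y
      unfolding ibp
    proof (rule kernel_le_av[OF ik])
      show "h \<in> borel_measurable borel" unfolding h_def by measurable
      fix x
      let ?s = "norm (\<psi> x) + norm (dd b \<psi> x)"
      have "norm (mol (c * e) (y - Phi e x) *\<^sub>R dd b V x) \<le> C / (c * e)^3 * ((1 + B) * ?s)"
        by (rule norm_scaleR_le) (use C(2)[OF d] mol_nonneg[OF d] dV[of x] in auto)
      moreover have "norm ((e * dd (dd b N x) (mol (c * e)) (y - Phi e x)) *\<^sub>R V x) \<le> C / (c * e)^3 * ((B / c) * (1 + B) * ?s)"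
      proof -
        have "norm (dd b N x) \<le> B" using B(3)[of x b] b by simp
        then have "\<bar>dd (dd b N x) (mol (c * e)) (y - Phi e x)\<bar> \<le> C / (c * e)^4 * B"
          using C(3)[OF d, of "y - Phi e x" "dd b N x"] C(1) d by (meson divide_nonneg_pos less_imp_le mult_left_mono order_trans zero_less_power)
        then have "e * \<bar>dd (dd b N x) (mol (c * e)) (y - Phi e x)\<bar> \<le> e * (C / (c * e)^4 * B)"
          using e by (intro mult_left_mono) auto
        also have "\<dots> = C / (c * e)^3 * (B / c)" using e c by (simp add: power_mult_distrib power_numeral_reduce)
        finally have "norm ((e * dd (dd b N x) (mol (c * e)) (y - Phi e x)) *\<^sub>R V x) \<le> C / (c * e)^3 * (B / c) * ((1 + B) * norm (\<psi> x))"
          using e by (intro norm_scaleR_le nV) (simp add: abs_mult)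
        also have "\<dots> \<le> C / (c * e)^3 * (B / c) * ((1 + B) * ?s)"
          using C(1) d B(1) c by (intro mult_left_mono) auto
        finally show ?thesis by (simp add: mult.assoc)
      qed
      ultimately have "norm (k y x) \<le> C / (c * e)^3 * ((1 + B) * ?s) + C / (c * e)^3 * ((B / c) * (1 + B) * ?s)"
        unfolding k_def by (intro order_trans[OF norm_triangle_ineq4] add_mono)
      also have "\<dots> = (C / (c * e)^3 * D) * ?s"
      proof -
        have "K * (p * s) + K * (q * s) = (K * (p + q)) * s" for K p q s :: real by (simp add: algebra_simps)
        then show ?thesis unfolding D_def by blast
      qed
      finally have "ennreal (norm (k y x)) \<le> ennreal ((C / (c * e)^3 * D) * ?s)" by (rule ennreal_leI)
      also have "\<dots> = ennreal (C / (c * e)^3 * D) * h x"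
        unfolding h_def using C(1) d D by (intro ennreal_mult) auto
      finally show "ennreal (norm (k y x)) \<le> ennreal (C / (c * e)^3 * D) * h x" .
      assume "(c + B) * e < norm (x - y)"
      then have "norm (y - Phi e x) > c * e" by (rule far_kernel[OF B(2) e(1)])
      then show "k y x = 0" unfolding k_def using d by (simp add: mol_eq_0 mol_dd_eq_0)
    qed
    from av_bound_L2[OF this] show "(\<integral>\<^sup>+y. ennreal ((norm (dd b (W e \<psi>) y))\<^sup>2) \<partial>lborel) \<le> ennreal (A^2) * (\<integral>\<^sup>+x. ennreal ((norm (\<psi> x) + norm (dd b \<psi> x))\<^sup>2) \<partial>lborel)"
      unfolding kernel_mass[OF e(1) B(1) C(1)] A_def[symmetric] h_def using A by (simp add: ennreal_power del: ennreal_plus)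
  qed (use A in simp)
qed

end

lemma jac_eq: "smooth f ==> jac f = (\<lambda>x. \<chi> i j. dd (axis j 1) f x $ i)"
  by (rule ext) (simp add: vec_eq_iff jac_nth)

lemma jac_continuous: "smooth f ==> continuous_on S (jac f)"
  by (simp only: jac_eq) (intro continuous_on_vec_lambda continuous_on_component smooth_continuous smooth_dd)

lemma jac_bsupp:
  assumes "smooth f" "bsupp f" shows "bsupp (jac f)"
proof -
  obtain R where R: "\<And>x. norm x \<ge> R ==> f x = 0" using assms(2) by (auto simp: bsupp_def)
  have "dd (axis j 1) f x = 0" if "norm x \<ge> R + 1" for x j
    by (rule dd_eq_0[of "- cball 0 R"]) (use that R in \<open>auto\<close>)
  then show ?thesis unfolding jac_eq[OF assms(1)] by (intro bsuppI[of "R + 1"]) (simp add: vec_eq_iff)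
qed

lemma sqi_jac: "smooth f ==> bsupp f ==> sqi lborel (jac f)"
  by (intro sqi_bsupp jac_continuous jac_bsupp)

lemma square_le_fourth: "(a::real)\<^sup>2 \<le> 1 + a^4"
proof -
  have "0 \<le> (a\<^sup>2 - 1)\<^sup>2 + a\<^sup>2" by simp
  then show ?thesis by (simp add: power2_diff power_mult[symmetric])
qed

lemma sqi_L4:
  fixes v :: "real^3 => 'b::euclidean_space"
  assumes O: "open \<Omega>" "bounded \<Omega>" and v: "v \<in> borel_measurable borel" "\<And>x. x \<notin> \<Omega> ==> v x = 0"
    and v4: "integrable lborel (\<lambda>x. norm (v x) ^ 4)"
  shows "sqi lborel v"
proof (rule sqi_bound)
  show "integrable lborel (\<lambda>x. indicat_real \<Omega> x + norm (v x) ^ 4)"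
    using O emeasure_bounded_finite[OF O(2)] v4 by (auto simp: integrable_indicator_iff)
  show "(norm (v x))\<^sup>2 \<le> indicat_real \<Omega> x + norm (v x) ^ 4" for x
    using square_le_fourth[of "norm (v x)"] v(2)[of x] by (cases "x \<in> \<Omega>") auto
qed (use v in simp)

context inward begin

text \<open>Fubini moves the mollifier onto \<theta>, which replaces \<theta>(x) by an average of
  \<theta> near \<open>Phi e x\<close>, an error of at most \<eta>. Replacing \<open>Vf e v\<close>
  by \<open>v\<close> costs another \<open>e * (T * B)\<close>.\<close>

lemma W_weak_estimate:
  fixes \<theta> :: "real^3 => real^3"
  assumes \<theta>: "continuous_on UNIV \<theta>" "bsupp \<theta>" "\<And>x. norm (\<theta> x) \<le> T"
    and B: "B > 0" "\<And>x. norm (N x) \<le> B" "\<And>x b. norm (dd b N x) \<le> B * norm b"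
    and e: "0 < e" "e \<le> 1" and v: "integrable lborel v"
    and \<eta>: "\<And>x y. norm (x - y) \<le> (c + B) * e ==> norm (\<theta> y - \<theta> x) \<le> \<eta>"
  shows "\<bar>(\<integral>y. \<theta> y \<bullet> W e v y \<partial>lborel) - (\<integral>y. \<theta> y \<bullet> v y \<partial>lborel)\<bar>
     \<le> (\<eta> * (1 + B) + e * (T * B)) * (\<integral>x. norm (v x) \<partial>lborel)"
proof -
  have d: "c * e > 0" using c e by simp
  have T: "T \<ge> 0" using \<theta>(3)[of 0] norm_ge_zero order_trans by blast
  have [measurable]: "v \<in> borel_measurable borel" using v by simp
  have [measurable]: "\<theta> \<in> borel_measurable borel" using \<theta>(1) by (rule borel_measurable_continuous_onI)
  have [measurable]: "mol (c*e) \<in> borel_measurable borel" by (rule borel_smooth[OF mol_smooth])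
  define V where "V = Vf e v"
  have V: "integrable lborel V" using Vf_integrable[OF v] e unfolding V_def by simp
  have [measurable]: "V \<in> borel_measurable borel" using V by simp
  have nV: "norm (V x) \<le> (1 + B) * norm (v x)" for x unfolding V_def using Vf_norm[OF B(3)] e by simp
  have mi: "integrable lborel (\<lambda>y. mol (c * e) (y - a))" for a
    using mol_integral[OF d, of a] not_integrable_integral_eq by fastforce
  define f where "f x y = mol (c * e) (y - Phi e x) * (\<theta> y \<bullet> V x)" for x y
  have fn: "norm (f x y) \<le> mol (c * e) (y - Phi e x) * (T * norm (V x))" for x y
  proof -
    have "\<bar>\<theta> y \<bullet> V x\<bar> \<le> T * norm (V x)"
      by (rule order_trans[OF Cauchy_Schwarz_ineq2 mult_right_mono[OF \<theta>(3) norm_ge_zero]])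
    then show ?thesis unfolding f_def using mol_nonneg[OF d] by (simp add: abs_mult mult_left_mono)
  qed
  have [measurable]: "(\<lambda>(x, y). f x y) \<in> borel_measurable (lborel \<Otimes>\<^sub>M lborel)"
    unfolding f_def by measurable
  have fx: "integrable lborel (f x)" for x
  proof (rule Bochner_Integration.integrable_bound[where f="\<lambda>y. mol (c * e) (y - Phi e x) * (T * norm (V x))"])
    show "integrable lborel (\<lambda>y. mol (c * e) (y - Phi e x) * (T * norm (V x)))" using mi by simp
    show "f x \<in> borel_measurable lborel" unfolding f_def by measurable
    show "AE y in lborel. norm (f x y) \<le> norm (mol (c * e) (y - Phi e x) * (T * norm (V x)))"
      using fn by (intro AE_I2) (auto intro: order_trans[OF _ abs_ge_self])
  qed
  have fxn: "(\<integral>y. norm (f x y) \<partial>lborel) \<le> T * norm (V x)" for x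
  proof -
    have "(\<integral>y. norm (f x y) \<partial>lborel) \<le> (\<integral>y. mol (c * e) (y - Phi e x) * (T * norm (V x)) \<partial>lborel)"
      by (rule Bochner_Integration.integral_mono) (use fx fn mi in auto)
    then show ?thesis using mol_integral[OF d, of "Phi e x"] by simp
  qed
  have pint: "integrable (lborel \<Otimes>\<^sub>M lborel) (\<lambda>(x, y). f x y)"
  proof (rule lborel_pair.Fubini_integrable)
    show "integrable lborel (\<lambda>x. \<integral>y. norm (case (x, y) of (x, y) => f x y) \<partial>lborel)"
      by (rule Bochner_Integration.integrable_bound[where f="\<lambda>x. T * norm (V x)"])
        (use V fxn in \<open>auto intro!: AE_I2 borel_measurable_integrable simp: T\<close>)
  qed (use fx in auto)
  have "(\<integral>y. \<theta> y \<bullet> W e v y \<partial>lborel) = (\<integral>y. (\<integral>x. f x y \<partial>lborel) \<partial>lborel)"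
  proof (rule Bochner_Integration.integral_cong[OF refl])
    fix y
    have i: "integrable lborel (\<lambda>x. mol (c * e) (y - Phi e x) *\<^sub>R V x)"
      by (intro kernel_integrable smooth_continuous mol_smooth mol_bsupp d V) measurable
    have "(\<integral>x. \<theta> y \<bullet> (mol (c * e) (y - Phi e x) *\<^sub>R V x) \<partial>lborel) = \<theta> y \<bullet> W e v y"
      unfolding W_def V_def[symmetric] by (rule integral_bounded_linear[OF bounded_linear_inner_right i])
    then show "\<theta> y \<bullet> W e v y = (\<integral>x. f x y \<partial>lborel)" by (simp add: f_def)
  qed
  also have "\<dots> = (\<integral>x. (\<integral>y. f x y \<partial>lborel) \<partial>lborel)" by (rule lborel_pair.Fubini_integral[OF pint])
  finally have E1: "(\<integral>y. \<theta> y \<bullet> W e v y \<partial>lborel) = (\<integral>x. (\<integral>y. f x y \<partial>lborel) \<partial>lborel)" .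
  have ifx: "integrable lborel (\<lambda>x. \<integral>y. f x y \<partial>lborel)"
    using lborel_pair.integrable_fst'[OF pint] by simp
  have it: "integrable lborel (\<lambda>x. \<theta> x \<bullet> g x)" if g: "integrable lborel g" for g :: "real^3 => real^3"
  proof (rule Bochner_Integration.integrable_bound[where f="\<lambda>x. T * norm (g x)"])
    show "AE x in lborel. norm (\<theta> x \<bullet> g x) \<le> norm (T * norm (g x))"
      using \<theta>(3) T by (intro AE_I2) (auto intro!: order_trans[OF Cauchy_Schwarz_ineq2] mult_right_mono)
  qed (use g in auto)
  have p1: "\<bar>(\<integral>y. f x y \<partial>lborel) - \<theta> x \<bullet> V x\<bar> \<le> \<eta> * norm (V x)" for x
  proof -
    have "\<theta> x \<bullet> V x = (\<integral>y. mol (c * e) (y - Phi e x) * (\<theta> x \<bullet> V x) \<partial>lborel)"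
      using mol_integral[OF d, of "Phi e x"] by simp
    then have "(\<integral>y. f x y \<partial>lborel) - \<theta> x \<bullet> V x = (\<integral>y. f x y - mol (c * e) (y - Phi e x) * (\<theta> x \<bullet> V x) \<partial>lborel)"
      using fx mi by simp
    also have "\<bar>\<dots>\<bar> \<le> (\<integral>y. norm (f x y - mol (c * e) (y - Phi e x) * (\<theta> x \<bullet> V x)) \<partial>lborel)"
      unfolding real_norm_def[symmetric] by (rule integral_norm_bound)
    also have "\<dots> \<le> (\<integral>y. mol (c * e) (y - Phi e x) * (\<eta> * norm (V x)) \<partial>lborel)"
    proof (rule Bochner_Integration.integral_mono)
      fix y
      have e1: "f x y - mol (c * e) (y - Phi e x) * (\<theta> x \<bullet> V x) = mol (c * e) (y - Phi e x) * ((\<theta> y - \<theta> x) \<bullet> V x)"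
        by (simp add: f_def inner_diff_left algebra_simps)
      show "norm (f x y - mol (c * e) (y - Phi e x) * (\<theta> x \<bullet> V x)) \<le> mol (c * e) (y - Phi e x) * (\<eta> * norm (V x))"
      proof (cases "norm (x - y) \<le> (c + B) * e")
        case True
        have "\<bar>(\<theta> y - \<theta> x) \<bullet> V x\<bar> \<le> \<eta> * norm (V x)"
          using Cauchy_Schwarz_ineq2[of "\<theta> y - \<theta> x" "V x"] mult_right_mono[OF \<eta>[OF True] norm_ge_zero[of "V x"]] by linarith
        then show ?thesis unfolding e1 using mol_nonneg[OF d] by (simp add: abs_mult mult_left_mono)
      next
        case False
        then have "mol (c * e) (y - Phi e x) = 0"
          using far_kernel[OF B(2) e(1), of x y] d by (intro mol_eq_0) auto
        then show ?thesis unfolding e1 by simp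
      qed
    qed (use fx mi in auto)
    also have "\<dots> = \<eta> * norm (V x)" using mol_integral[OF d, of "Phi e x"] by simp
    finally show ?thesis .
  qed
  have "\<bar>(\<integral>y. \<theta> y \<bullet> W e v y \<partial>lborel) - (\<integral>y. \<theta> y \<bullet> v y \<partial>lborel)\<bar>
      = \<bar>\<integral>x. ((\<integral>y. f x y \<partial>lborel) - \<theta> x \<bullet> V x) + (\<theta> x \<bullet> V x - \<theta> x \<bullet> v x) \<partial>lborel\<bar>"
    unfolding E1 using ifx it[OF V] it[OF v] by simp
  also have "\<dots> \<le> (\<integral>x. norm (((\<integral>y. f x y \<partial>lborel) - \<theta> x \<bullet> V x) + (\<theta> x \<bullet> V x - \<theta> x \<bullet> v x)) \<partial>lborel)"
    unfolding real_norm_def[symmetric] by (rule integral_norm_bound)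
  also have "\<dots> \<le> (\<integral>x. (\<eta> * (1 + B) + e * (T * B)) * norm (v x) \<partial>lborel)"
  proof (rule Bochner_Integration.integral_mono)
    show "integrable lborel (\<lambda>x. norm (((\<integral>y. f x y \<partial>lborel) - \<theta> x \<bullet> V x) + (\<theta> x \<bullet> V x - \<theta> x \<bullet> v x)))"
      using ifx it[OF V] it[OF v] by (intro integrable_norm Bochner_Integration.integrable_add Bochner_Integration.integrable_diff)
    fix x
    have \<eta>0: "\<eta> \<ge> 0" using \<eta>[of x x] c B(1) e by simp
    have "\<eta> * norm (V x) \<le> \<eta> * ((1 + B) * norm (v x))" by (rule mult_left_mono[OF nV \<eta>0])
    moreover have "\<bar>\<theta> x \<bullet> V x - \<theta> x \<bullet> v x\<bar> \<le> e * (T * B) * norm (v x)"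
    proof -
      have "\<theta> x \<bullet> V x - \<theta> x \<bullet> v x = \<theta> x \<bullet> (e *\<^sub>R dd (v x) N x)" by (simp add: V_def Vf_def inner_add_right)
      also have "\<bar>\<dots>\<bar> \<le> norm (\<theta> x) * norm (e *\<^sub>R dd (v x) N x)" by (rule Cauchy_Schwarz_ineq2)
      also have "\<dots> \<le> T * (e * (B * norm (v x)))"
        using \<theta>(3)[of x] T e B(3)[of x "v x"] by (intro mult_mono) (auto intro: mult_left_mono)
      finally show ?thesis by (simp add: mult_ac)
    qed
    ultimately show "norm (((\<integral>y. f x y \<partial>lborel) - \<theta> x \<bullet> V x) + (\<theta> x \<bullet> V x - \<theta> x \<bullet> v x)) \<le> (\<eta> * (1 + B) + e * (T * B)) * norm (v x)"
      using p1[of x] abs_triangle_ineq[of "(\<integral>y. f x y \<partial>lborel) - \<theta> x \<bullet> V x" "\<theta> x \<bullet> V x - \<theta> x \<bullet> v x"]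
      unfolding real_norm_def by (simp add: algebra_simps)
  qed (use v in auto)
  finally show ?thesis by simp
qed

lemma W_weak_tendsto:
  fixes \<theta> :: "real^3 => real^3"
  assumes \<theta>: "continuous_on UNIV \<theta>" "bsupp \<theta>" and v: "integrable lborel v"
    and e: "\<And>k. 0 < e k" "\<And>k. e k \<le> 1" "e \<longlonglongrightarrow> 0"
  shows "(\<lambda>k. \<integral>y. \<theta> y \<bullet> W (e k) v y \<partial>lborel) \<longlonglongrightarrow> (\<integral>y. \<theta> y \<bullet> v y \<partial>lborel)"
proof (rule LIMSEQ_I)
  fix r :: real assume r: "r > 0"
  obtain B where B: "B > 0" "\<And>x. norm (N x) \<le> B" "\<And>x b. norm (dd b N x) \<le> B * norm b" using N_bounds by metis
  obtain T where T: "T > 0" "\<And>x. norm (\<theta> x) \<le> T" using bsupp_uniform(2)[OF \<theta>] by auto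
  define I where "I = (\<integral>x. norm (v x) \<partial>lborel)"
  have I: "I \<ge> 0" by (simp add: I_def)
  define P where "P = (1 + B) * (I + 1)"
  have P: "P > 0" using B I by (simp add: P_def)
  define \<eta> where "\<eta> = r / (2 * P)"
  have \<eta>: "\<eta> > 0" using r P by (simp add: \<eta>_def)
  have \<eta>I: "\<eta> * (1 + B) * I \<le> r / 2"
  proof -
    have "\<eta> * (1 + B) * I \<le> \<eta> * (1 + B) * (I + 1)" using \<eta> B by (intro mult_left_mono) auto
    also have "\<dots> = \<eta> * P" by (simp add: P_def mult.assoc)
    also have "\<dots> = r / 2" using P by (simp add: \<eta>_def)
    finally show ?thesis .
  qed
  obtain \<delta> where \<delta>: "\<delta> > 0" "\<And>x y. dist y x < \<delta> ==> dist (\<theta> y) (\<theta> x) < \<eta>"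
    using bsupp_uniform(1)[OF \<theta>] \<eta> unfolding uniformly_continuous_on_def by (meson UNIV_I)
  have "(\<lambda>k. (c + B) * e k) \<longlonglongrightarrow> 0" "(\<lambda>k. e k * (T * B) * I) \<longlonglongrightarrow> 0"
    using tendsto_mult_right_zero[OF e(3), of "c + B"] tendsto_mult_left_zero[OF e(3), of "T * B * I"] by (simp_all add: mult_ac)
  note lims = this
  have "r / 2 > 0" using r by simp
  then have "\<forall>\<^sub>F k in sequentially. (c + B) * e k < \<delta>" "\<forall>\<^sub>F k in sequentially. e k * (T * B) * I < r / 2"
    using order_tendstoD(2)[OF lims(1) \<delta>(1)] order_tendstoD(2)[OF lims(2)] by blast+
  then have "\<forall>\<^sub>F k in sequentially. norm ((\<integral>y. \<theta> y \<bullet> W (e k) v y \<partial>lborel) - (\<integral>y. \<theta> y \<bullet> v y \<partial>lborel)) < r"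
  proof eventually_elim
    case (elim k)
    have "\<bar>(\<integral>y. \<theta> y \<bullet> W (e k) v y \<partial>lborel) - (\<integral>y. \<theta> y \<bullet> v y \<partial>lborel)\<bar> \<le> (\<eta> * (1 + B) + e k * (T * B)) * (\<integral>x. norm (v x) \<partial>lborel)"
    proof (rule W_weak_estimate[OF \<theta> T(2) B e(1,2) v])
      fix x y :: "real^3" assume "norm (x - y) \<le> (c + B) * e k"
      then have "dist y x < \<delta>" using elim(1) by (simp add: dist_norm norm_minus_commute)
      from \<delta>(2)[OF this] show "norm (\<theta> y - \<theta> x) \<le> \<eta>" by (simp add: dist_norm)
    qed
    then show ?case using \<eta>I elim(2) unfolding I_def[symmetric] by (simp add: algebra_simps)
  qed
  then show "\<exists>no. \<forall>n\<ge>no. norm ((\<integral>y. \<theta> y \<bullet> W (e n) v y \<partial>lborel) - (\<integral>y. \<theta> y \<bullet> v y \<partial>lborel)) < r"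
    by (simp add: eventually_sequentially)
qed

text \<open>For fixed \<open>e\<close> the differentiated kernel is bounded, so L^2 convergence of
  the fields, which implies L^1 convergence on the bounded set \<Omega>, gives pointwise convergence
  of the derivatives. It prepares Fatou's lemma in \<open>W_grad_L2\<close>.\<close>

lemma W_grad_tendsto:
  assumes v: "sqi lborel v" "\<And>x. x \<notin> \<Omega> ==> v x = 0" and e: "0 < e" "e \<le> 1"
    and \<psi>: "\<And>n. test_vec \<Omega> (\<psi> n)" "(\<lambda>n. n2 lborel (\<lambda>x. \<psi> n x - v x)) \<longlonglongrightarrow> 0"
  shows "(\<lambda>n. dd b (W e (\<psi> n)) y) \<longlonglongrightarrow> dd b (W e v) y"
proof -
  note s = test_vec_smooth[OF \<psi>(1)]
  have sp: "sqi lborel (\<psi> n)" for n by (intro sqi_bsupp smooth_continuous s)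
  have iv: "integrable lborel v" by (rule bounded_support_L1_le(1)[OF v op bd])
  have ip: "integrable lborel (\<psi> n)" for n by (rule bounded_support_L1_le(1)[OF sp s(3) op bd])
  have d: "c * e > 0" using c e by simp
  obtain B where B: "B > 0" "\<And>x b. norm (dd b N x) \<le> B * norm b" using N_bounds by metis
  obtain Bm where Bm: "Bm > 0" "\<And>z b. norm (dd b (mol (c*e)) z) \<le> Bm * norm b"
    using smooth_bsupp_bounded[OF mol_smooth mol_bsupp[OF d]] by metis
  have m: "Phi e \<in> borel_measurable lborel" by measurable
  define K where "K = Bm * norm b * ((1 + B) * sqrt (measure lborel \<Omega>))"
  have i: "integrable lborel (\<lambda>x. dd b (mol (c * e)) (y - Phi e x) *\<^sub>R Vf e u x)" if "integrable lborel u" for u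
    using Vf_integrable[OF that] e
    by (intro kernel_integrable[where g="\<lambda>z. dd b (mol (c*e)) z"] smooth_continuous smooth_dd bsupp_dd mol_smooth mol_bsupp d m) auto
  have le: "norm (dd b (W e (\<psi> n)) y - dd b (W e v) y) \<le> norm (n2 lborel (\<lambda>x. \<psi> n x - v x)) * K" for n
  proof -
    let ?u = "\<lambda>x. \<psi> n x - v x"
    have iu: "integrable lborel ?u" using iv ip by auto
    have eq: "dd b (W e (\<psi> n)) y - dd b (W e v) y = (\<integral>x. dd b (mol (c * e)) (y - Phi e x) *\<^sub>R Vf e ?u x \<partial>lborel)"
      unfolding W_smooth(2)[OF iv e] W_smooth(2)[OF ip e] Vf_diff
      by (subst Bochner_Integration.integral_diff[symmetric, OF i[OF ip] i[OF iv]]) (simp add: scaleR_diff_right)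
    have "norm (dd b (W e (\<psi> n)) y - dd b (W e v) y) \<le> (\<integral>x. norm (dd b (mol (c * e)) (y - Phi e x) *\<^sub>R Vf e ?u x) \<partial>lborel)"
      unfolding eq by (rule integral_norm_bound)
    also have "\<dots> \<le> (\<integral>x. (Bm * norm b) * ((1 + B) * norm (?u x)) \<partial>lborel)"
    proof (rule Bochner_Integration.integral_mono)
      fix x show "norm (dd b (mol (c * e)) (y - Phi e x) *\<^sub>R Vf e ?u x) \<le> (Bm * norm b) * ((1 + B) * norm (?u x))"
        using Bm(2)[of "y - Phi e x" b] e by (intro norm_scaleR_le Vf_norm[OF B(2)]) simp_all
      show "integrable lborel (\<lambda>x. norm (dd b (mol (c * e)) (y - Phi e x) *\<^sub>R Vf e ?u x))"
        by (rule integrable_norm[OF i[OF iu]])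
      show "integrable lborel (\<lambda>x. (Bm * norm b) * ((1 + B) * norm (?u x)))"
        using iu by (intro integrable_mult_right integrable_norm)
    qed
    also have "\<dots> = (Bm * norm b) * ((1 + B) * (\<integral>x. norm (?u x) \<partial>lborel))" by simp
    also have "\<dots> \<le> (Bm * norm b) * ((1 + B) * (n2 lborel ?u * sqrt (measure lborel \<Omega>)))"
    proof (intro mult_left_mono)
      show "(\<integral>x. norm (?u x) \<partial>lborel) \<le> n2 lborel ?u * sqrt (measure lborel \<Omega>)"
        by (rule bounded_support_L1_le(2)[OF sqi_diff[OF sp v(1)] _ op bd]) (use s(3) v(2) in auto)
    qed (use Bm B in auto)
    finally show ?thesis by (simp add: K_def mult_ac)
  qed
  have "(\<lambda>n. dd b (W e (\<psi> n)) y - dd b (W e v) y) \<longlonglongrightarrow> 0"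
    by (rule tendsto_0_le[OF \<psi>(2) always_eventually[OF allI[OF le]]])
  then show ?thesis by (simp add: LIM_zero_iff)
qed

text \<open>The integration by parts behind \<open>W_grad_bound\<close> acts on smooth fields.
  Fatou's lemma passes the bound on to \<open>v\<close> along its smooth approximants.\<close>

lemma W_grad_L2:
  obtains C1 where "C1 \<ge> 0" "\<And>e v \<psi> j M. sqi lborel v ==> \<forall>x. x \<notin> \<Omega> --> v x = 0 ==> 0 < e ==> e \<le> 1 ==>
     \<forall>n. test_vec \<Omega> (\<psi> n) ==> (\<lambda>n. n2 lborel (\<lambda>x. \<psi> n x - v x)) \<longlonglongrightarrow> 0 ==>
     \<forall>n. n2 lborel (\<psi> n) \<le> M \<and> n2 lborel (jac (\<psi> n)) \<le> M ==>
     (\<integral>\<^sup>+y. ennreal ((norm (dd (axis j 1) (W e v) y))\<^sup>2) \<partial>lborel) \<le> ennreal (C1 * M\<^sup>2)"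
proof -
  obtain C where C: "C \<ge> 0" "\<And>e \<psi> b. 0 < e ==> e \<le> 1 ==> smooth \<psi> ==> bsupp \<psi> ==> norm b = 1 ==>
     (\<integral>\<^sup>+y. ennreal ((norm (dd b (W e \<psi>) y))\<^sup>2) \<partial>lborel) \<le> ennreal C * (\<integral>\<^sup>+x. ennreal ((norm (\<psi> x) + norm (dd b \<psi> x))\<^sup>2) \<partial>lborel)"
    by (rule W_grad_bound) (rule that)
  show ?thesis
  proof (rule that[of "C * 4"])
    fix e :: real and v :: "real^3 => real^3" and \<psi> :: "nat => real^3 => real^3" and j :: 3 and M :: real
    assume v1: "sqi lborel v" "\<forall>x. x \<notin> \<Omega> --> v x = 0" and e: "0 < e" "e \<le> 1"
      and \<psi>1: "\<forall>n. test_vec \<Omega> (\<psi> n)" "(\<lambda>n. n2 lborel (\<lambda>x. \<psi> n x - v x)) \<longlonglongrightarrow> 0"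
      and M1: "\<forall>n. n2 lborel (\<psi> n) \<le> M \<and> n2 lborel (jac (\<psi> n)) \<le> M"
    have v: "sqi lborel v" "\<And>x. x \<notin> \<Omega> ==> v x = 0" using v1 by auto
    have \<psi>: "\<And>n. test_vec \<Omega> (\<psi> n)" "(\<lambda>n. n2 lborel (\<lambda>x. \<psi> n x - v x)) \<longlonglongrightarrow> 0" using \<psi>1 by auto
    have M: "\<And>n. n2 lborel (\<psi> n) \<le> M" "\<And>n. n2 lborel (jac (\<psi> n)) \<le> M" using M1 by auto
    let ?b = "axis j 1 :: real^3"
    note s = test_vec_smooth[OF \<psi>(1)]
    have ip: "integrable lborel (\<psi> n)" for n by (intro integrable_bsupp smooth_continuous s)
    have [measurable]: "(\<lambda>y. dd ?b (W e (\<psi> n)) y) \<in> borel_measurable borel" for n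
      by (intro borel_smooth smooth_dd W_smooth ip e)
    have jb: "sqi lborel (jac (\<psi> n))" for n by (rule sqi_jac[OF s(1,2)])
    have bound: "(\<integral>\<^sup>+y. ennreal ((norm (dd ?b (W e (\<psi> n)) y))\<^sup>2) \<partial>lborel) \<le> ennreal (C * 4 * M\<^sup>2)" for n
    proof -
      have [measurable]: "\<psi> n \<in> borel_measurable borel" "(\<lambda>y. dd ?b (\<psi> n) y) \<in> borel_measurable borel"
        by (intro borel_smooth smooth_dd s)+
      have sp: "sqi lborel (\<psi> n)" by (intro sqi_bsupp smooth_continuous s)
      have pt: "(norm (\<psi> n x) + norm (dd ?b (\<psi> n) x))\<^sup>2 \<le> 2 * (norm (\<psi> n x))\<^sup>2 + 2 * (norm (jac (\<psi> n) x))\<^sup>2" for x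
      proof -
        have "(norm (dd ?b (\<psi> n) x))\<^sup>2 \<le> (norm (jac (\<psi> n) x))\<^sup>2"
          unfolding jac_norm_sq[OF s(1)] by (rule member_le_sum) auto
        then show ?thesis using sum_squares_bound[of "norm (\<psi> n x)" "norm (dd ?b (\<psi> n) x)"] unfolding power2_sum by linarith
      qed
      have "(\<integral>\<^sup>+x. ennreal ((norm (\<psi> n x) + norm (dd ?b (\<psi> n) x))\<^sup>2) \<partial>lborel)
          \<le> (\<integral>\<^sup>+x. ennreal (2 * (norm (\<psi> n x))\<^sup>2 + 2 * (norm (jac (\<psi> n) x))\<^sup>2) \<partial>lborel)"
        by (intro nn_integral_mono ennreal_leI pt)
      also have "\<dots> = ennreal (2 * (n2 lborel (\<psi> n))\<^sup>2 + 2 * (n2 lborel (jac (\<psi> n)))\<^sup>2)"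
        using sqi_integrable[OF sp] sqi_integrable[OF jb[of n]] by (subst nn_integral_eq_integral) (auto simp: n2_sq)
      also have "\<dots> \<le> ennreal (2 * M\<^sup>2 + 2 * M\<^sup>2)"
        by (intro ennreal_leI add_mono mult_left_mono power_mono M) auto
      finally have "ennreal C * (\<integral>\<^sup>+x. ennreal ((norm (\<psi> n x) + norm (dd ?b (\<psi> n) x))\<^sup>2) \<partial>lborel) \<le> ennreal C * ennreal (4 * M\<^sup>2)"
        by (intro mult_left_mono) auto
      also have "\<dots> = ennreal (C * 4 * M\<^sup>2)" using C(1) by (simp add: ennreal_mult[symmetric] mult.assoc)
      finally show ?thesis using C(2)[OF e s(1) s(2), of ?b n] by (auto intro: order_trans)
    qed
    have "(\<integral>\<^sup>+y. ennreal ((norm (dd ?b (W e v) y))\<^sup>2) \<partial>lborel)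
        = (\<integral>\<^sup>+y. liminf (\<lambda>n. ennreal ((norm (dd ?b (W e (\<psi> n)) y))\<^sup>2)) \<partial>lborel)"
    proof (rule nn_integral_cong)
      fix y
      have "(\<lambda>n. ennreal ((norm (dd ?b (W e (\<psi> n)) y))\<^sup>2)) \<longlonglongrightarrow> ennreal ((norm (dd ?b (W e v) y))\<^sup>2)"
        by (intro tendsto_ennrealI tendsto_power tendsto_norm W_grad_tendsto[OF v e \<psi>])
      from lim_imp_Liminf[OF trivial_limit_sequentially this]
      show "ennreal ((norm (dd ?b (W e v) y))\<^sup>2) = liminf (\<lambda>n. ennreal ((norm (dd ?b (W e (\<psi> n)) y))\<^sup>2))" by (rule sym)
    qed
    also have "\<dots> \<le> liminf (\<lambda>n. \<integral>\<^sup>+y. ennreal ((norm (dd ?b (W e (\<psi> n)) y))\<^sup>2) \<partial>lborel)"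
      by (rule nn_integral_liminf) measurable
    also have "\<dots> \<le> liminf (\<lambda>n::nat. ennreal (C * 4 * M\<^sup>2))"
      by (intro Liminf_mono always_eventually allI bound)
    also have "\<dots> = ennreal (C * 4 * M\<^sup>2)" by (simp add: Liminf_const)
    finally show "(\<integral>\<^sup>+y. ennreal ((norm (dd ?b (W e v) y))\<^sup>2) \<partial>lborel) \<le> ennreal (C * 4 * M\<^sup>2)" .
  qed (use C in simp)
qed

text \<open>Weak convergence is stated against continuous \<theta> with bounded support; together
  with the bounds by \<open>K\<close> it extends to the L^2 and L^(4/3) pairings that occur in the
  weak form.\<close>

lemma approx:
  assumes v: "v \<in> borel_measurable borel" "\<And>x. x \<notin> \<Omega> ==> v x = 0" "integrable lborel (\<lambda>x. norm (v x) ^ 4)"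
    and \<phi>: "\<And>n. test_divfree \<Omega> (\<phi> n)" "(\<lambda>n. n2 lborel (\<lambda>x. \<phi> n x - v x)) \<longlonglongrightarrow> 0"
    and \<psi>: "\<And>n. test_vec \<Omega> (\<psi> n)" "(\<lambda>n. n2 lborel (\<lambda>x. \<psi> n x - v x)) \<longlonglongrightarrow> 0"
    and M: "\<And>n. n2 lborel (jac (\<psi> n)) \<le> M"
  obtains w K where "\<And>k. test_divfree \<Omega> (w k)" "\<And>k. (\<integral>x. norm (w k x) ^ 4 \<partial>lborel) \<le> K"
    "\<And>k. (n2 lborel (jac (w k)))\<^sup>2 \<le> K"
    "\<And>\<theta>. continuous_on UNIV \<theta> ==> bsupp \<theta> ==> (\<lambda>k. \<integral>x. \<theta> x \<bullet> w k x \<partial>lborel) \<longlonglongrightarrow> (\<integral>x. \<theta> x \<bullet> v x \<partial>lborel)"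
proof -
  have sv: "sqi lborel v" by (rule sqi_L4[OF op bd v])
  have iv: "integrable lborel v" by (rule bounded_support_L1_le(1)[OF sv v(2) op bd])
  note s = test_vec_smooth[OF \<psi>(1)]
  have sp: "sqi lborel (\<psi> n)" for n by (intro sqi_bsupp smooth_continuous s)
  have "(\<lambda>n. n2 lborel (\<psi> n)) \<longlonglongrightarrow> n2 lborel v" by (rule n2_tendsto[OF sp sv \<psi>(2)])
  then have "Bseq (\<lambda>n. n2 lborel (\<psi> n))" using convergentI convergent_imp_Bseq by blast
  then obtain M1 where M1: "\<And>n. n2 lborel (\<psi> n) \<le> M1" unfolding Bseq_def by (metis abs_of_nonneg n2_nonneg real_norm_def)
  define M2 where "M2 = max M M1"
  have M2: "n2 lborel (\<psi> n) \<le> M2" "n2 lborel (jac (\<psi> n)) \<le> M2" for n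
    using M[of n] M1[of n] by (auto simp: M2_def)
  obtain C4 where C4: "C4 \<ge> 0" "\<And>e v. 0 < e ==> e \<le> 1 ==> integrable lborel v ==>
     (\<integral>\<^sup>+y. ennreal (norm (W e v y) ^ 4) \<partial>lborel) \<le> ennreal C4 * (\<integral>\<^sup>+x. ennreal (norm (v x) ^ 4) \<partial>lborel)"
    by (rule W_L4_bound) (rule that)
  obtain C2 where C2: "C2 \<ge> 0" "\<And>e v \<psi> j M. sqi lborel v ==> \<forall>x. x \<notin> \<Omega> --> v x = 0 ==> 0 < e ==> e \<le> 1 ==>
     \<forall>n. test_vec \<Omega> (\<psi> n) ==> (\<lambda>n. n2 lborel (\<lambda>x. \<psi> n x - v x)) \<longlonglongrightarrow> 0 ==>
     \<forall>n. n2 lborel (\<psi> n) \<le> M \<and> n2 lborel (jac (\<psi> n)) \<le> M ==>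
     (\<integral>\<^sup>+y. ennreal ((norm (dd (axis j 1) (W e v) y))\<^sup>2) \<partial>lborel) \<le> ennreal (C2 * M\<^sup>2)"
    by (rule W_grad_L2) (rule that)
  define m where "m = min 1 (e0 / 2)"
  have m: "m > 0" "m \<le> 1" "m < e0" using e0 by (auto simp: m_def)
  define e where "e k = m / real (Suc k)" for k
  have e: "0 < e k" "e k \<le> m" for k using m by (auto simp: e_def field_simps)
  have e': "e k \<le> 1" "e k < e0" for k using e(2)[of k] m by auto
  have elim: "e \<longlonglongrightarrow> 0"
    using tendsto_mult_right_zero[OF LIMSEQ_inverse_real_of_nat, of m] by (simp add: e_def[abs_def] divide_inverse)
  define w where "w k = W (e k) v" for k
  have ws: "smooth (w k)" for k unfolding w_def by (rule W_smooth(1)[OF iv e(1) e'(1)])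
  have tv: "test_vec \<Omega> (w k)" for k
    using ws[of k] W_support[OF v(2) e(1)[of k] e'(2)[of k]] by (simp add: test_vec_def w_def)
  note wb = test_vec_smooth[OF tv]
  have td: "test_divfree \<Omega> (w k)" for k
  proof -
    have "(\<Sum>j\<in>UNIV. pd j (\<lambda>y. w k y $ j) x) = (\<Sum>j\<in>UNIV. dd (axis j 1) (w k) x $ j)" for x
      using ws by (simp add: pd_eq_dd smooth_differentiable smooth_vec_nth dd_nth)
    also have "\<dots> x = 0" for x unfolding w_def by (rule W_divfree[OF sv v(2) e(1) e'(1) \<phi>])
    finally show ?thesis using tv by (simp add: test_divfree_def)
  qed
  define K4 where "K4 = C4 * (\<integral>x. norm (v x) ^ 4 \<partial>lborel)"
  have K4: "(\<integral>x. norm (w k x) ^ 4 \<partial>lborel) \<le> K4" for k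
  proof -
    have i: "integrable lborel (\<lambda>x. norm (w k x) ^ 4)"
    proof (rule integrable_bsupp)
      show "continuous_on UNIV (\<lambda>x. norm (w k x) ^ 4)"
        by (intro continuous_on_power continuous_on_norm smooth_continuous[OF ws])
      show "bsupp (\<lambda>x. norm (w k x) ^ 4)" using wb(2)[of k] by (auto simp: bsupp_def)
    qed
    have "ennreal (\<integral>x. norm (w k x) ^ 4 \<partial>lborel) = (\<integral>\<^sup>+x. ennreal (norm (w k x) ^ 4) \<partial>lborel)"
      by (rule nn_integral_eq_integral[symmetric, OF i]) simp
    also have "\<dots> \<le> ennreal C4 * (\<integral>\<^sup>+x. ennreal (norm (v x) ^ 4) \<partial>lborel)"
      unfolding w_def by (rule C4(2)[OF e(1) e'(1) iv])
    also have "(\<integral>\<^sup>+x. ennreal (norm (v x) ^ 4) \<partial>lborel) = ennreal (\<integral>x. norm (v x) ^ 4 \<partial>lborel)"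
      by (rule nn_integral_eq_integral[OF v(3)]) simp
    also have "ennreal C4 * \<dots> = ennreal K4" unfolding K4_def using C4(1) by (intro ennreal_mult[symmetric]) auto
    finally show ?thesis using C4(1) by (subst (asm) ennreal_le_iff) (auto simp: K4_def)
  qed
  define K2 where "K2 = 3 * (C2 * M2\<^sup>2)"
  have K2: "(n2 lborel (jac (w k)))\<^sup>2 \<le> K2" for k
  proof -
    have i: "integrable lborel (\<lambda>y. (norm (dd (axis j 1) (w k) y))\<^sup>2)" for j
      by (rule sqi_integrable) (intro sqi_bsupp smooth_continuous smooth_dd bsupp_dd wb)
    have le: "(\<integral>y. (norm (dd (axis j 1) (w k) y))\<^sup>2 \<partial>lborel) \<le> C2 * M2\<^sup>2" for j
    proof -
      have "ennreal (\<integral>y. (norm (dd (axis j 1) (w k) y))\<^sup>2 \<partial>lborel) = (\<integral>\<^sup>+y. ennreal ((norm (dd (axis j 1) (w k) y))\<^sup>2) \<partial>lborel)"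
        by (rule nn_integral_eq_integral[symmetric, OF i]) simp
      also have "\<dots> \<le> ennreal (C2 * M2\<^sup>2)"
        unfolding w_def by (rule C2(2)[OF sv _ e(1) e'(1) _ \<psi>(2)]) (use v(2) \<psi>(1) M2 in auto)
      finally show ?thesis using C2(1) by (subst (asm) ennreal_le_iff) auto
    qed
    have "(n2 lborel (jac (w k)))\<^sup>2 = (\<Sum>j\<in>UNIV. \<integral>y. (norm (dd (axis j 1) (w k) y))\<^sup>2 \<partial>lborel)"
      unfolding n2_sq jac_norm_sq[OF ws] by (rule Bochner_Integration.integral_sum) (rule i)
    also have "\<dots> \<le> (\<Sum>j\<in>(UNIV::3 set). C2 * M2\<^sup>2)" by (rule sum_mono) (rule le)
    finally show ?thesis by (simp add: K2_def)
  qed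
  show ?thesis
  proof (rule that[of w "max K4 K2"])
    show "test_divfree \<Omega> (w k)" for k by (rule td)
    show "(\<integral>x. norm (w k x) ^ 4 \<partial>lborel) \<le> max K4 K2" for k using K4[of k] by simp
    show "(n2 lborel (jac (w k)))\<^sup>2 \<le> max K4 K2" for k using K2[of k] by simp
    show "(\<lambda>k. \<integral>x. \<theta> x \<bullet> w k x \<partial>lborel) \<longlonglongrightarrow> (\<integral>x. \<theta> x \<bullet> v x \<partial>lborel)"
      if "continuous_on UNIV \<theta>" "bsupp \<theta>" for \<theta> :: "real^3 => real^3"
      unfolding w_def by (rule W_weak_tendsto[OF that iv e(1) e'(1) elim])
  qed
qed

end

section \<open>The energy balance in doubled variables\<close>

text \<open>With \<open>B\<close> the gradient of a field v, row \<open>i\<close> belonging to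
  component \<open>i\<close>, this is ((a.grad)v).\<phi> at a point.\<close>

definition tri :: "real^3^3 => real^3 => real^3 => real" where
  "tri B a \<phi> = (\<Sum>i\<in>UNIV. (\<Sum>j\<in>UNIV. a $ j * B $ i $ j) * \<phi> $ i)"

text \<open>The integrand of the weak form without its time derivative: \<open>a\<close> and
  \<open>B\<close> stand for velocity and gradient of the solution, \<phi> and \<open>A\<close> for
  those of the test field. It is linear in the latter pair.\<close>

definition kk :: "real => real => real^3 => real^3^3 => real^3 => real^3^3 => real" where
  "kk \<mu> \<beta> a B \<phi> A = \<mu> * (B \<bullet> A) + tri B a \<phi> + \<beta> * ((norm a)\<^sup>2 * (a \<bullet> \<phi>))"

lemma tri_bound: "\<bar>tri B a \<phi>\<bar> \<le> norm B * norm a * norm \<phi>"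
proof -
  define w :: "real^3" where "w = (\<chi> i. B $ i \<bullet> a)"
  have "tri B a \<phi> = w \<bullet> \<phi>" by (simp add: tri_def w_def inner_vec_def mult.commute)
  then have 1: "\<bar>tri B a \<phi>\<bar> \<le> norm w * norm \<phi>" using Cauchy_Schwarz_ineq2 by simp
  have "(norm w)\<^sup>2 = (\<Sum>i\<in>UNIV. (B $ i \<bullet> a)\<^sup>2)"
    unfolding power2_norm_eq_inner inner_vec_def[of w] by (simp add: w_def power2_eq_square)
  also have "\<dots> \<le> (\<Sum>i\<in>UNIV. (norm (B $ i))\<^sup>2 * (norm a)\<^sup>2)"
  proof (rule sum_mono)
    fix i show "(B $ i \<bullet> a)\<^sup>2 \<le> (norm (B $ i))\<^sup>2 * (norm a)\<^sup>2"
      using Cauchy_Schwarz_ineq[of "B $ i" a] by (simp add: power2_norm_eq_inner)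
  qed
  also have "\<dots> = (norm B * norm a)\<^sup>2"
    unfolding power_mult_distrib power2_norm_eq_inner inner_vec_def[of B] by (simp add: sum_distrib_right)
  finally have "norm w \<le> norm B * norm a" by (rule power2_le_imp_le) simp
  then have "norm w * norm \<phi> \<le> norm B * norm a * norm \<phi>" by (rule mult_right_mono) simp
  with 1 show ?thesis by linarith
qed

lemma tri_diff: "tri B a (\<phi> - \<phi>') = tri B a \<phi> - tri B a \<phi>'"
  by (simp add: tri_def right_diff_distrib sum_subtractf)

lemma kk_diff: "kk \<mu> \<beta> a B (\<phi> - \<phi>') (A - A') = kk \<mu> \<beta> a B \<phi> A - kk \<mu> \<beta> a B \<phi>' A'"
  by (simp add: kk_def tri_diff inner_diff_right algebra_simps)

lemma young: "s > 0 ==> x * y \<le> s * x\<^sup>2 + y\<^sup>2 / (4 * s)" for x y s :: real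
proof -
  assume s: "s > 0"
  have "0 \<le> (2 * s * x - y)\<^sup>2" by simp
  then have "4 * s * (x * y) \<le> 4 * s * (s * x\<^sup>2) + y\<^sup>2" by (simp add: power2_eq_square algebra_simps)
  then have "x * y \<le> (4 * s * (s * x\<^sup>2) + y\<^sup>2) / (4 * s)" using s by (simp add: pos_le_divide_eq mult.commute)
  also have "\<dots> = s * x\<^sup>2 + y\<^sup>2 / (4 * s)" using s by (simp add: add_divide_distrib)
  finally show ?thesis .
qed

lemma kk_abs: "\<bar>kk \<mu> \<beta> a B \<phi> A\<bar> \<le> norm B * (\<bar>\<mu>\<bar> * norm A) + norm B * (norm a * norm \<phi>) + (norm a)\<^sup>2 * (\<bar>\<beta>\<bar> * (norm a * norm \<phi>))"
proof -
  have 1: "\<bar>\<mu> * (B \<bullet> A)\<bar> \<le> norm B * (\<bar>\<mu>\<bar> * norm A)"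
  proof -
    have "\<bar>\<mu>\<bar> * \<bar>B \<bullet> A\<bar> \<le> \<bar>\<mu>\<bar> * (norm B * norm A)" by (intro mult_left_mono Cauchy_Schwarz_ineq2) auto
    then show ?thesis by (simp add: abs_mult mult_ac)
  qed
  have 3: "\<bar>\<beta> * ((norm a)\<^sup>2 * (a \<bullet> \<phi>))\<bar> \<le> (norm a)\<^sup>2 * (\<bar>\<beta>\<bar> * (norm a * norm \<phi>))"
  proof -
    have "(norm a)\<^sup>2 * (\<bar>\<beta>\<bar> * \<bar>a \<bullet> \<phi>\<bar>) \<le> (norm a)\<^sup>2 * (\<bar>\<beta>\<bar> * (norm a * norm \<phi>))"
      by (intro mult_left_mono Cauchy_Schwarz_ineq2) auto
    then show ?thesis by (simp add: abs_mult mult_ac)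
  qed
  show ?thesis using 1 3 tri_bound[of B a \<phi>] unfolding kk_def by (simp add: mult.assoc)
qed

text \<open>The exponents close: 1/2 + 1/2 in the viscous term, 1/2 + 1/4 + 1/4 in the convective
  one, 3/4 + 1/4 in the damping. The weight \<open>l\<close> on the solution can be made small at
  the price of \<open>C\<close> on the test field; \<open>g_small\<close> relies on this when the
  test field is a small difference.\<close>

lemma kk_bound:
  assumes "l > 0"
  obtains C where "C \<ge> 0" "\<And>a B \<phi> A. \<bar>kk \<mu> \<beta> a B \<phi> A\<bar> \<le> l * (norm a ^ 4 + (norm B)\<^sup>2) + C * (norm \<phi> ^ 4 + (norm A)\<^sup>2)"
proof -
  define s where "s = l / 2"
  \<comment> \<open>\<open>K\<close> collects the coefficients of
    \<open>(norm a * norm \<phi>)\<^sup>2\<close> from the convective and the damping term;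
    \<open>s'\<close> is such that splitting this product once more returns exactly \<open>s\<close>
    times \<open>norm a ^ 4\<close>.\<close>
  define K where "K = (1 + \<beta>\<^sup>2) / (4 * s)"
  define s' where "s' = s / K"
  have s: "s > 0" using assms by (simp add: s_def)
  have K: "K > 0" using s by (simp add: K_def add_pos_nonneg)
  have s': "s' > 0" using s K by (simp add: s'_def)
  define C where "C = \<mu>\<^sup>2 / (4 * s) + K / (4 * s')"
  have C0: "\<mu>\<^sup>2 / (4 * s) \<ge> 0" "K / (4 * s') \<ge> 0" using s K s' by auto
  show ?thesis
  proof (rule that[of C])
    show "C \<ge> 0" using C0 by (simp add: C_def)
    fix a \<phi> :: "real^3" and A B :: "real^3^3"
    let ?p = "norm a" and ?q = "norm B" and ?f = "norm \<phi>" and ?g = "norm A"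
    have 1: "?q * (\<bar>\<mu>\<bar> * ?g) \<le> s * ?q\<^sup>2 + \<mu>\<^sup>2 / (4 * s) * ?g\<^sup>2"
      using young[OF s, of ?q "\<bar>\<mu>\<bar> * ?g"] by (simp add: power_mult_distrib)
    have 2: "?q * (?p * ?f) \<le> s * ?q\<^sup>2 + 1 / (4 * s) * (?p * ?f)\<^sup>2"
      using young[OF s, of ?q "?p * ?f"] by simp
    have 3: "?p\<^sup>2 * (\<bar>\<beta>\<bar> * (?p * ?f)) \<le> s * ?p^4 + \<beta>\<^sup>2 / (4 * s) * (?p * ?f)\<^sup>2"
      using young[OF s, of "?p\<^sup>2" "\<bar>\<beta>\<bar> * (?p * ?f)"] by (simp add: power_mult_distrib)
    have "(?p * ?f)\<^sup>2 \<le> s' * ?p^4 + ?f^4 / (4 * s')"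
      using young[OF s', of "?p\<^sup>2" "?f\<^sup>2"] by (simp add: power_mult_distrib)
    then have "K * (?p * ?f)\<^sup>2 \<le> K * (s' * ?p^4 + ?f^4 / (4 * s'))" using K by (intro mult_left_mono) auto
    also have "\<dots> = s * ?p^4 + K / (4 * s') * ?f^4" using K by (simp add: distrib_left s'_def)
    finally have 4: "K * (?p * ?f)\<^sup>2 \<le> s * ?p^4 + K / (4 * s') * ?f^4" .
    have 5: "1 / (4 * s) * (?p * ?f)\<^sup>2 + \<beta>\<^sup>2 / (4 * s) * (?p * ?f)\<^sup>2 = K * (?p * ?f)\<^sup>2"
      unfolding K_def by (simp add: add_divide_distrib distrib_right)
    have 6: "\<mu>\<^sup>2 / (4 * s) * ?g\<^sup>2 \<le> C * ?g\<^sup>2" "K / (4 * s') * ?f^4 \<le> C * ?f^4"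
      by (rule mult_right_mono; use C0 in \<open>simp add: C_def\<close>)+
    have "\<bar>kk \<mu> \<beta> a B \<phi> A\<bar> \<le> 2 * s * ?q\<^sup>2 + 2 * s * ?p^4 + (C * ?g\<^sup>2 + C * ?f^4)"
      using kk_abs[of \<mu> \<beta> a B \<phi> A] 1 2 3 4 5 6 by linarith
    also have "\<dots> = l * (?p^4 + ?q\<^sup>2) + C * (?f^4 + ?g\<^sup>2)" by (simp add: s_def algebra_simps)
    finally show "\<bar>kk \<mu> \<beta> a B \<phi> A\<bar> \<le> l * (?p^4 + ?q\<^sup>2) + C * (?f^4 + ?g\<^sup>2)" .
  qed
qed

lemma borel_measurable_nth [measurable (raw)]:
  fixes f :: "'a => 'b::euclidean_space^'n"
  assumes "f \<in> borel_measurable M" shows "(\<lambda>x. f x $ i) \<in> borel_measurable M"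
  using measurable_compose[OF assms, of "\<lambda>v. v $ i" borel]
  by (simp add: borel_measurable_continuous_onI continuous_on_component)

lemma tri_measurable [measurable (raw)]:
  assumes [measurable]: "a \<in> borel_measurable M" "B \<in> borel_measurable M" "\<phi> \<in> borel_measurable M"
  shows "(\<lambda>x. tri (B x) (a x) (\<phi> x)) \<in> borel_measurable M"
  unfolding tri_def by measurable

lemma kk_measurable [measurable (raw)]:
  assumes [measurable]: "a \<in> borel_measurable M" "B \<in> borel_measurable M" "\<phi> \<in> borel_measurable M" "A \<in> borel_measurable M"
  shows "(\<lambda>x. kk \<mu> \<beta> (a x) (B x) (\<phi> x) (A x)) \<in> borel_measurable M"
  unfolding kk_def by measurable

text \<open>\<open>E\<close> is the full-measure set of times at which everything known almost everywhere in time
  holds; \<open>ident\<close> is the weak form at time \<open>s\<close>, tested with the solution at time \<open>t\<close>.\<close>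

locale core =
  fixes T \<mu> \<beta> :: real and \<Omega> :: "(real^3) set" and U :: "real => real^3 => real^3"
    and G :: "real => real^3 => real^3^3" and u0 :: "real^3 => real^3" and E :: "real set"
  assumes T: "0 < T" and op: "open \<Omega>" and bd: "bounded \<Omega>"
    and Um: "(\<lambda>p. U (fst p) (snd p)) \<in> borel_measurable borel"
    and Gm: "(\<lambda>p. G (fst p) (snd p)) \<in> borel_measurable borel"
    and U0: "\<And>t x. t \<notin> {0<..<T} \<or> x \<notin> \<Omega> ==> U t x = 0"
    and G0: "\<And>t x. t \<notin> {0<..<T} \<or> x \<notin> \<Omega> ==> G t x = 0"
    and U4: "integrable lborel (\<lambda>p. norm (U (fst p) (snd p)) ^ 4)"
    and G2: "integrable lborel (\<lambda>p. (norm (G (fst p) (snd p)))\<^sup>2)"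
    and E: "E \<subseteq> {0<..<T}" and EAE: "AE t in lborel. t \<in> {0<..<T} --> t \<in> E"
    and EU: "\<And>t. t \<in> E ==> integrable lborel (\<lambda>x. norm (U t x) ^ 4)"
    and EG: "\<And>t. t \<in> E ==> integrable lborel (\<lambda>x. (norm (G t x))\<^sup>2)"
    and ident: "\<And>s t. s \<in> E ==> t \<in> E ==>
      (\<integral>x. U s x \<bullet> U t x \<partial>lborel) - (\<integral>x. u0 x \<bullet> U t x \<partial>lborel)
       = - (\<integral>r. indicator {0<..<s} r * (\<integral>x. kk \<mu> \<beta> (U r x) (G r x) (U t x) (G t x) \<partial>lborel) \<partial>lborel)"
begin

lemma U_comp [measurable (raw)]:
  assumes "f \<in> borel_measurable M" "g \<in> borel_measurable M"
  shows "(\<lambda>p. U (f p) (g p)) \<in> borel_measurable M"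
  using measurable_compose[OF borel_measurable_Pair[OF assms] Um] by simp

lemma G_comp [measurable (raw)]:
  assumes "f \<in> borel_measurable M" "g \<in> borel_measurable M"
  shows "(\<lambda>p. G (f p) (g p)) \<in> borel_measurable M"
  using measurable_compose[OF borel_measurable_Pair[OF assms] Gm] by simp

definition F :: "real => real => real" where
  "F r t = (\<integral>x. kk \<mu> \<beta> (U r x) (G r x) (U t x) (G t x) \<partial>lborel)"

definition ok :: "real => bool" where
  "ok t \<longleftrightarrow> integrable lborel (\<lambda>x. norm (U t x) ^ 4) \<and> integrable lborel (\<lambda>x. (norm (G t x))\<^sup>2)"

text \<open>The mass that the overview speaks of: integrable in time, and dominating
  \<open>F\<close> at times that are \<open>ok\<close> by \<open>F_bound\<close>.\<close>

definition m :: "real => real" where "m t = (\<integral>x. norm (U t x) ^ 4 + (norm (G t x))\<^sup>2 \<partial>lborel)"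

definition en :: "real => real" where "en t = (\<integral>x. (norm (U t x))\<^sup>2 \<partial>lborel)"

text \<open>Twice this is the energy dissipated up to time \<open>t\<close>; its integrand on the
  diagonal is identified in \<open>dissipation\<close>.\<close>

definition S :: "real => real" where "S t = (\<integral>r. indicator {0<..<t} r * F r r \<partial>lborel)"

lemma F_measurable [measurable (raw)]:
  assumes [measurable]: "f \<in> borel_measurable M" "g \<in> borel_measurable M"
  shows "(\<lambda>p. F (f p) (g p)) \<in> borel_measurable M"
  unfolding F_def by measurable

lemma m_measurable [measurable]: "m \<in> borel_measurable borel" unfolding m_def by measurable
lemma en_measurable [measurable]: "en \<in> borel_measurable borel" unfolding en_def by measurable

lemma S_measurable [measurable]: "S \<in> borel_measurable borel"
proof -
  have "S = (\<lambda>t. \<integral>r. (if 0 < r \<and> r < t then F r r else 0) \<partial>lborel)"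
    unfolding S_def by (intro ext Bochner_Integration.integral_cong) (auto simp: indicator_def)
  then show ?thesis by simp
qed

lemma m_nonneg: "0 \<le> m t" unfolding m_def by (intro integral_nonneg_AE AE_I2) simp

lemma E_ok: "t \<in> E ==> ok t" by (simp add: ok_def EU EG)

lemma mass_integrable: "integrable lborel (\<lambda>p. norm (U (fst p) (snd p)) ^ 4 + (norm (G (fst p) (snd p)))\<^sup>2)"
  using U4 G2 by simp

lemma mass_integrable': "integrable (lborel \<Otimes>\<^sub>M lborel) (\<lambda>p. norm (U (fst p) (snd p)) ^ 4 + (norm (G (fst p) (snd p)))\<^sup>2)"
  using mass_integrable by (simp add: lborel_prod)

lemma AE_ok: "AE t in lborel. ok t"
proof -
  have 1: "AE t in lborel. integrable lborel (\<lambda>x. norm (U t x) ^ 4)"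
    using lborel_pair.AE_integrable_fst'[of "\<lambda>p. norm (U (fst p) (snd p)) ^ 4"] U4 by (simp add: lborel_prod)
  have 2: "AE t in lborel. integrable lborel (\<lambda>x. (norm (G t x))\<^sup>2)"
    using lborel_pair.AE_integrable_fst'[of "\<lambda>p. (norm (G (fst p) (snd p)))\<^sup>2"] G2 by (simp add: lborel_prod)
  from 1 2 show ?thesis by eventually_elim (simp add: ok_def)
qed

lemma m_integrable: "integrable lborel m"
  using lborel_pair.integrable_fst'[OF mass_integrable'] by (simp add: m_def[abs_def])

lemma kk_integrable:
  assumes "ok r" "ok t" shows "integrable lborel (\<lambda>x. kk \<mu> \<beta> (U r x) (G r x) (U t x) (G t x))"
proof -
  obtain C where C: "C \<ge> 0" "\<And>a B \<phi> A. \<bar>kk \<mu> \<beta> a B \<phi> A\<bar> \<le> 1 * (norm a ^ 4 + (norm B)\<^sup>2) + C * (norm \<phi> ^ 4 + (norm A)\<^sup>2)"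
    by (rule kk_bound[of 1]) (simp, rule that)
  show ?thesis
  proof (rule Bochner_Integration.integrable_bound)
    show "integrable lborel (\<lambda>x. 1 * (norm (U r x) ^ 4 + (norm (G r x))\<^sup>2) + C * (norm (U t x) ^ 4 + (norm (G t x))\<^sup>2))"
      using assms by (simp add: ok_def)
    show "AE x in lborel. norm (kk \<mu> \<beta> (U r x) (G r x) (U t x) (G t x)) \<le> norm (1 * (norm (U r x) ^ 4 + (norm (G r x))\<^sup>2) + C * (norm (U t x) ^ 4 + (norm (G t x))\<^sup>2))"
    proof (intro AE_I2)
      fix x show "norm (kk \<mu> \<beta> (U r x) (G r x) (U t x) (G t x)) \<le> norm (1 * (norm (U r x) ^ 4 + (norm (G r x))\<^sup>2) + C * (norm (U t x) ^ 4 + (norm (G t x))\<^sup>2))"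
        unfolding real_norm_def by (rule order_trans[OF C(2) abs_ge_self])
    qed
  qed measurable
qed

text \<open>\<open>kk_bound\<close> gives the existence of a constant; choosing it once fixes it for
  the whole locale.\<close>

definition Ck1 :: real where
  "Ck1 = (SOME C. C \<ge> 1 \<and> (\<forall>a B \<phi> A. \<bar>kk \<mu> \<beta> a B \<phi> A\<bar> \<le> C * ((norm a ^ 4 + (norm B)\<^sup>2) + (norm \<phi> ^ 4 + (norm A)\<^sup>2))))"

lemma Ck1: "Ck1 \<ge> 1" "\<bar>kk \<mu> \<beta> a B \<phi> A\<bar> \<le> Ck1 * ((norm a ^ 4 + (norm B)\<^sup>2) + (norm \<phi> ^ 4 + (norm A)\<^sup>2))"
proof -
  obtain C where C: "C \<ge> 0" "\<And>a B \<phi> A. \<bar>kk \<mu> \<beta> a B \<phi> A\<bar> \<le> 1 * (norm a ^ 4 + (norm B)\<^sup>2) + C * (norm \<phi> ^ 4 + (norm A)\<^sup>2)"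
    by (rule kk_bound[of 1]) (simp, rule that)
  have "\<bar>kk \<mu> \<beta> a B \<phi> A\<bar> \<le> (1 + C) * ((norm a ^ 4 + (norm B)\<^sup>2) + (norm \<phi> ^ 4 + (norm A)\<^sup>2))" for a B \<phi> A
  proof -
    define X where "X = norm a ^ 4 + (norm B)\<^sup>2"
    define Y where "Y = norm \<phi> ^ 4 + (norm A)\<^sup>2"
    have "X \<ge> 0" "Y \<ge> 0" by (auto simp: X_def Y_def)
    then have "0 \<le> C * X" using C by simp
    moreover have "(1 + C) * (X + Y) = X + Y + C * X + C * Y" by (simp add: algebra_simps)
    ultimately show ?thesis using C(2)[of a B \<phi> A] \<open>Y \<ge> 0\<close> unfolding X_def[symmetric] Y_def[symmetric] by linarith
  qed
  then have "1 + C \<ge> 1 \<and> (\<forall>a B \<phi> A. \<bar>kk \<mu> \<beta> a B \<phi> A\<bar> \<le> (1 + C) * ((norm a ^ 4 + (norm B)\<^sup>2) + (norm \<phi> ^ 4 + (norm A)\<^sup>2)))"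
    using C(1) by simp
  from someI[of "\<lambda>C. C \<ge> 1 \<and> (\<forall>a B \<phi> A. \<bar>kk \<mu> \<beta> a B \<phi> A\<bar> \<le> C * ((norm a ^ 4 + (norm B)\<^sup>2) + (norm \<phi> ^ 4 + (norm A)\<^sup>2)))", OF this]
  have "Ck1 \<ge> 1 \<and> (\<forall>a B \<phi> A. \<bar>kk \<mu> \<beta> a B \<phi> A\<bar> \<le> Ck1 * ((norm a ^ 4 + (norm B)\<^sup>2) + (norm \<phi> ^ 4 + (norm A)\<^sup>2)))"
    unfolding Ck1_def .
  then show "Ck1 \<ge> 1" "\<bar>kk \<mu> \<beta> a B \<phi> A\<bar> \<le> Ck1 * ((norm a ^ 4 + (norm B)\<^sup>2) + (norm \<phi> ^ 4 + (norm A)\<^sup>2))" by blast+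
qed

lemma F_bound:
  assumes "ok r" "ok t" shows "\<bar>F r t\<bar> \<le> Ck1 * (m r + m t)"
proof -
  have "\<bar>F r t\<bar> \<le> (\<integral>x. norm (kk \<mu> \<beta> (U r x) (G r x) (U t x) (G t x)) \<partial>lborel)"
    unfolding F_def real_norm_def[symmetric] by (rule integral_norm_bound)
  also have "\<dots> \<le> (\<integral>x. Ck1 * ((norm (U r x) ^ 4 + (norm (G r x))\<^sup>2) + (norm (U t x) ^ 4 + (norm (G t x))\<^sup>2)) \<partial>lborel)"
  proof (rule Bochner_Integration.integral_mono)
    show "integrable lborel (\<lambda>x. norm (kk \<mu> \<beta> (U r x) (G r x) (U t x) (G t x)))"
      by (rule integrable_norm[OF kk_integrable[OF assms]])
    show "integrable lborel (\<lambda>x. Ck1 * ((norm (U r x) ^ 4 + (norm (G r x))\<^sup>2) + (norm (U t x) ^ 4 + (norm (G t x))\<^sup>2)))"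
      using assms by (simp add: ok_def)
  qed (unfold real_norm_def, rule Ck1)
  also have "\<dots> = Ck1 * (m r + m t)" using assms by (simp add: ok_def m_def)
  finally show ?thesis .
qed

lemma F_integrable:
  assumes t: "ok t" and A: "A \<in> sets borel" "emeasure lborel A < \<infinity>"
  shows "integrable lborel (\<lambda>r. indicator A r * F r t)"
proof (rule Bochner_Integration.integrable_bound)
  show "integrable lborel (\<lambda>r. Ck1 * (m r + indicator A r * m t))"
    using m_integrable A by (simp add: integrable_indicator_iff)
  show "AE r in lborel. norm (indicator A r * F r t) \<le> norm (Ck1 * (m r + indicator A r * m t))"
    using AE_ok
  proof eventually_elim
    case (elim r)
    have p: "0 \<le> Ck1 * (m r + indicator A r * m t)"
      using Ck1(1) m_nonneg[of r] m_nonneg[of t] by (simp add: indicator_def)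
    show ?case unfolding real_norm_def abs_of_nonneg[OF p] using F_bound[OF elim t] p by (cases "r \<in> A") auto
  qed
  have [measurable]: "A \<in> sets borel" by fact
  show "(\<lambda>r. indicator A r * F r t) \<in> borel_measurable lborel" by measurable
qed

lemma Frr_integrable: "integrable lborel (\<lambda>r. F r r)"
proof (rule Bochner_Integration.integrable_bound)
  show "integrable lborel (\<lambda>r. 2 * Ck1 * m r)" using m_integrable by simp
  show "AE r in lborel. norm (F r r) \<le> norm (2 * Ck1 * m r)"
    using AE_ok
  proof eventually_elim
    case (elim r)
    show ?case using F_bound[OF elim elim] by simp
  qed
qed measurable

lemma Frr_set_integrable:
  assumes "A \<in> sets borel" shows "integrable lborel (\<lambda>r. indicator A r * F r r)"
  using integrable_mult_indicator[OF _ Frr_integrable, of A] assms by simp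

lemma Ico_finite: "emeasure lborel {a..<b::real} < \<infinity>" "emeasure lborel {a<..<b::real} < \<infinity>"
  by (rule emeasure_bounded_finite, rule bounded_subset[OF bounded_cbox[of a b]], force)+

lemma F_step:
  assumes a: "a \<in> E" and b: "b \<in> E" and t: "t \<in> E" and ab: "a \<le> b"
  shows "(\<integral>x. U b x \<bullet> U t x \<partial>lborel) - (\<integral>x. U a x \<bullet> U t x \<partial>lborel) = - (\<integral>r. indicator {a..<b} r * F r t \<partial>lborel)"
proof -
  have i: "integrable lborel (\<lambda>r. indicator {0<..<a} r * F r t)" "integrable lborel (\<lambda>r. indicator {a..<b} r * F r t)"
    by (intro F_integrable E_ok[OF t] Ico_finite; simp)+
  have a0: "0 < a" using a E by auto
  have "(\<lambda>r. indicator {0<..<b} r * F r t) = (\<lambda>r. indicator {0<..<a} r * F r t + indicator {a..<b} r * F r t)"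
    using a0 ab by (auto simp: indicator_def fun_eq_iff)
  then have "(\<integral>r. indicator {0<..<b} r * F r t \<partial>lborel) = (\<integral>r. indicator {0<..<a} r * F r t \<partial>lborel) + (\<integral>r. indicator {a..<b} r * F r t \<partial>lborel)"
    using Bochner_Integration.integral_add[OF i] by (simp only:)
  then show ?thesis using ident[OF b t] ident[OF a t] unfolding F_def[symmetric] by linarith
qed

lemma S_diff: "0 \<le> a ==> a \<le> b ==> S b - S a = (\<integral>r. indicator {a..<b} r * F r r \<partial>lborel)"
proof -
  assume ab: "0 \<le> a" "a \<le> b"
  have i: "integrable lborel (\<lambda>r. indicator {0<..<a} r * F r r)" "integrable lborel (\<lambda>r. indicator {a..<b} r * F r r)"
    by (intro Frr_set_integrable; simp)+
  have ae: "AE r in lborel. indicator {0<..<b} r * F r r = indicator {0<..<a} r * F r r + indicator {a..<b} r * F r r"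
    using AE_lborel_singleton[of 0] by eventually_elim (use ab in \<open>auto simp: indicator_def\<close>)
  have "S b = (\<integral>r. indicator {0<..<a} r * F r r + indicator {a..<b} r * F r r \<partial>lborel)"
    unfolding S_def by (rule integral_cong_AE[OF _ _ ae]) measurable
  then show ?thesis using Bochner_Integration.integral_add[OF i] by (simp add: S_def)
qed

text \<open>Energy plus what has been dissipated so far: the energy equality says that this is
  constant.\<close>

definition kf :: "real => real" where "kf t = en t + 2 * S t"

lemma kf_measurable [measurable]: "kf \<in> borel_measurable borel" unfolding kf_def by measurable

text \<open>|b|^2 - |a|^2 = <b - a, b> + <b - a, a>: the mixed products cancel by symmetry, and each
  half is \<open>F_step\<close> with one end point as the test time. Adding \<open>2 * S\<close>
  leaves differences between diagonal and off-diagonal values of \<open>F\<close>.\<close>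

lemma kf_step:
  assumes a: "a \<in> E" and b: "a + h \<in> E" and h: "h > 0"
  shows "kf (a + h) - kf a = (\<integral>r. indicator {0..<h} r * (2 * F (a + r) (a + r) - F (a + r) (a + h) - F (a + r) a) \<partial>lborel)"
proof -
  let ?b = "a + h"
  have a0: "0 \<le> a" using a E by auto
  have c: "(\<integral>x. U ?b x \<bullet> U a x \<partial>lborel) = (\<integral>x. U a x \<bullet> U ?b x \<partial>lborel)" by (simp add: inner_commute)
  have e: "en t = (\<integral>x. U t x \<bullet> U t x \<partial>lborel)" for t by (simp add: en_def power2_norm_eq_inner)
  have i: "integrable lborel (\<lambda>r. indicator {a..<?b} r * F r r)" "integrable lborel (\<lambda>r. indicator {a..<?b} r * F r ?b)"
    "integrable lborel (\<lambda>r. indicator {a..<?b} r * F r a)"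
    by (intro Frr_set_integrable F_integrable E_ok a b Ico_finite; simp)+
  have "kf ?b - kf a = 2 * (\<integral>r. indicator {a..<?b} r * F r r \<partial>lborel) - (\<integral>r. indicator {a..<?b} r * F r ?b \<partial>lborel) - (\<integral>r. indicator {a..<?b} r * F r a \<partial>lborel)"
    using F_step[OF a b b] F_step[OF a b a] S_diff[OF a0, of ?b] h c unfolding kf_def e by simp
  also have "\<dots> = (\<integral>r. 2 * (indicator {a..<?b} r * F r r) - indicator {a..<?b} r * F r ?b - indicator {a..<?b} r * F r a \<partial>lborel)"
    using i by simp
  also have "\<dots> = (\<integral>r. 2 * (indicator {a..<?b} (r + a) * F (r + a) (r + a)) - indicator {a..<?b} (r + a) * F (r + a) ?b - indicator {a..<?b} (r + a) * F (r + a) a \<partial>lborel)"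
    by (rule integral_shift[symmetric]) measurable
  also have "\<dots> = (\<integral>r. indicator {0..<h} r * (2 * F (a + r) (a + r) - F (a + r) ?b - F (a + r) a) \<partial>lborel)"
    by (intro Bochner_Integration.integral_cong refl) (auto simp: indicator_def add.commute)
  finally show ?thesis .
qed

text \<open>The off-diagonal defect of \<open>F\<close>, with values in \<open>ennreal\<close> so
  that Fubini applies to nonnegative functions.\<close>

definition g :: "real => real => ennreal" where "g t r = ennreal \<bar>F t t - F t (t + r)\<bar>"

lemma g_measurable [measurable (raw)]:
  assumes [measurable]: "f \<in> borel_measurable M" "h \<in> borel_measurable M"
  shows "(\<lambda>p. g (f p) (h p)) \<in> borel_measurable M"
  unfolding g_def by measurable

lemma AE_shift:
  assumes "AE t in lborel. P t" shows "AE t in lborel. P (t + (a::real))"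
proof -
  have "AE t in distr lborel borel ((+) a). P t" using assms by (subst lborel_distr_plus)
  then have "AE t in lborel. P (a + t)"
    by (rule AE_distrD[rotated]) simp
  then show ?thesis by (simp add: add.commute)
qed

text \<open>For fixed \<open>r\<close> the integral over \<open>t\<close> is invariant under the
  shift by \<open>r\<close>, after which the two end points sit at offsets \<open>h - r\<close> and
  \<open>- r\<close>, both of size at most \<open>h\<close>. These are two integrals of
  \<open>g\<close> for each \<open>r\<close> in an interval of length \<open>h\<close>, hence the
  factor \<open>2 * h\<close>.\<close>

lemma kf_step_nn:
  assumes h: "h > 0" and om: "\<And>r. \<bar>r\<bar> \<le> h ==> (\<integral>\<^sup>+t. g t r \<partial>lborel) \<le> ennreal e" and e: "e \<ge> 0"
  shows "(\<integral>\<^sup>+t. indicator {0<..<T - h} t * ennreal \<bar>kf (t + h) - kf t\<bar> \<partial>lborel) \<le> ennreal (2 * e * h)"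
proof -
  have "(\<integral>\<^sup>+t. indicator {0<..<T - h} t * ennreal \<bar>kf (t + h) - kf t\<bar> \<partial>lborel)
     \<le> (\<integral>\<^sup>+t. (\<integral>\<^sup>+r. indicator {0..<h} r * (g (t + r) (h - r) + g (t + r) (- r)) \<partial>lborel) \<partial>lborel)"
  proof (rule nn_integral_mono_AE)
    show "AE t in lborel. indicator {0<..<T - h} t * ennreal \<bar>kf (t + h) - kf t\<bar>
        \<le> (\<integral>\<^sup>+r. indicator {0..<h} r * (g (t + r) (h - r) + g (t + r) (- r)) \<partial>lborel)"
      using EAE AE_shift[OF EAE, of h]
    proof eventually_elim
      case (elim t)
      show ?case
      proof (cases "t \<in> {0<..<T - h}")
        case True
        then have tE: "t \<in> E" "t + h \<in> E" using elim h by auto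
        have "ennreal \<bar>kf (t + h) - kf t\<bar>
            \<le> (\<integral>\<^sup>+r. ennreal (norm (indicator {0..<h} r * (2 * F (t + r) (t + r) - F (t + r) (t + h) - F (t + r) t))) \<partial>lborel)"
        proof (cases "integrable lborel (\<lambda>r. indicator {0..<h} r * (2 * F (t + r) (t + r) - F (t + r) (t + h) - F (t + r) t))")
          case True
          show ?thesis unfolding kf_step[OF tE h] real_norm_def[symmetric] by (rule integral_norm_bound_ennreal[OF True])
        next
          \<comment> \<open>A Bochner integral that does not exist is 0 by convention, so the bound
            is trivial here.\<close>
          case False
          show ?thesis unfolding kf_step[OF tE h] not_integrable_integral_eq[OF False] by simp
        qed
        also have "\<dots> \<le> (\<integral>\<^sup>+r. indicator {0..<h} r * (g (t + r) (h - r) + g (t + r) (- r)) \<partial>lborel)"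
        proof (rule nn_integral_mono)
          fix r
          have "\<bar>2 * F (t + r) (t + r) - F (t + r) (t + h) - F (t + r) t\<bar>
             \<le> \<bar>F (t + r) (t + r) - F (t + r) (t + h)\<bar> + \<bar>F (t + r) (t + r) - F (t + r) t\<bar>" by linarith
          then have "ennreal \<bar>2 * F (t + r) (t + r) - F (t + r) (t + h) - F (t + r) t\<bar> \<le> g (t + r) (h - r) + g (t + r) (- r)"
            using ennreal_leI by (fastforce simp: g_def)
          then show "ennreal (norm (indicator {0..<h} r * (2 * F (t + r) (t + r) - F (t + r) (t + h) - F (t + r) t)))
             \<le> indicator {0..<h} r * (g (t + r) (h - r) + g (t + r) (- r))" by (auto simp: indicator_def)
        qed
        finally show ?thesis using True by simp
      qed simp
    qed
  qed
  also have "\<dots> = (\<integral>\<^sup>+r. (\<integral>\<^sup>+t. indicator {0..<h} r * (g (t + r) (h - r) + g (t + r) (- r)) \<partial>lborel) \<partial>lborel)"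
    by (rule lborel_pair.Fubini'[symmetric]) measurable
  also have "\<dots> \<le> (\<integral>\<^sup>+r. indicator {0..<h} r * ennreal (2 * e) \<partial>lborel)"
  proof (rule nn_integral_mono)
    fix r
    show "(\<integral>\<^sup>+t. indicator {0..<h} r * (g (t + r) (h - r) + g (t + r) (- r)) \<partial>lborel) \<le> indicator {0..<h} r * ennreal (2 * e)"
    proof (cases "r \<in> {0..<h}")
      case True
      have "(\<integral>\<^sup>+t. g (t + r) (h - r) + g (t + r) (- r) \<partial>lborel) = (\<integral>\<^sup>+t. g (t + r) (h - r) \<partial>lborel) + (\<integral>\<^sup>+t. g (t + r) (- r) \<partial>lborel)"
        by (rule nn_integral_add) measurable
      also have "\<dots> = (\<integral>\<^sup>+t. g t (h - r) \<partial>lborel) + (\<integral>\<^sup>+t. g t (- r) \<partial>lborel)"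
        by (simp add: nn_integral_shift[of "\<lambda>t. g t (h - r)" r] nn_integral_shift[of "\<lambda>t. g t (- r)" r])
      also have "\<dots> \<le> ennreal e + ennreal e" by (intro add_mono om) (use True in auto)
      also have "\<dots> = ennreal (2 * e)" using e by (simp add: ennreal_plus[symmetric] del: ennreal_plus)
      finally show ?thesis using True by simp
    qed simp
  qed
  also have "\<dots> = ennreal (2 * e) * ennreal h" using h by (simp add: nn_integral_multc mult.commute)
  also have "\<dots> = ennreal (2 * e * h)" using e h by (simp add: ennreal_mult)
  finally show ?thesis .
qed

end

section \<open>Constancy in time of energy plus dissipation\<close>

lemma AE_interval_ex:
  assumes "AE t in lborel. P t" "a < (b::real)"
  obtains t where "a < t" "t < b" "P t"
proof (rule ccontr)
  assume no: "\<not> thesis"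
  have "AE t in lborel. t \<notin> {a<..<b}" using assms(1) by eventually_elim (use no that in auto)
  then have "{a<..<b} \<in> null_sets lborel" by (subst AE_iff_null_sets) auto
  then have "emeasure lborel {a<..<b} = 0" by auto
  then show False using assms(2) by simp
qed

lemma norm_diff_power_le: "norm (a - b) ^ p \<le> 2^p * (norm a ^ p + norm b ^ p)"
proof -
  have "norm (a - b) ^ p \<le> (norm a + norm b) ^ p" by (intro power_mono norm_triangle_ineq4) simp
  also have "\<dots> \<le> 2^p * (norm a ^ p + norm b ^ p)" by (intro add_power_le) auto
  finally show ?thesis .
qed

lemma integrable_shift_diff_power:
  fixes f :: "'a::euclidean_space => 'b::euclidean_space"
  assumes [measurable]: "f \<in> borel_measurable borel" and f: "integrable lborel (\<lambda>x. norm (f x) ^ p)"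
  shows "integrable lborel (\<lambda>x. norm (f (x + h) - f x) ^ p)"
proof (rule Bochner_Integration.integrable_bound)
  show "integrable lborel (\<lambda>x. 2^p * (norm (f (x + h)) ^ p + norm (f x) ^ p))"
    using integrable_shift[OF f, of h] f by simp
  show "AE x in lborel. norm (norm (f (x + h) - f x) ^ p) \<le> norm (2^p * (norm (f (x + h)) ^ p + norm (f x) ^ p))"
  proof (intro AE_I2)
    fix x
    have "0 \<le> norm (f (x + h) - f x) ^ p" by simp
    then show "norm (norm (f (x + h) - f x) ^ p) \<le> norm (2^p * (norm (f (x + h)) ^ p + norm (f x) ^ p))"
      unfolding real_norm_def using norm_diff_power_le[of "f (x + h)" "f x" p] by linarith
  qed
qed measurable

context core begin

text \<open>By linearity the defect is \<open>kk\<close> tested with the difference of the solution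
  at times \<open>t\<close> and \<open>t + r\<close>. The weight \<open>l\<close> is fixed first,
  small against the total mass \<open>A\<close>; it determines \<open>C\<close>, and then the shift
  is made so small that the L^4 and L^2 translation moduli beat \<open>C\<close>.\<close>

lemma g_small:
  assumes e: "e > 0"
  obtains \<delta> where "\<delta> > 0" "\<And>r. \<bar>r\<bar> < \<delta> ==> (\<integral>\<^sup>+t. g t r \<partial>lborel) \<le> ennreal e"
proof -
  define UU where "UU p = U (fst p) (snd p)" for p
  define GG where "GG p = G (fst p) (snd p)" for p
  have [measurable]: "UU \<in> borel_measurable borel" "GG \<in> borel_measurable borel"
    using Um Gm unfolding UU_def GG_def by auto
  have U4': "integrable lborel (\<lambda>p. norm (UU p) ^ 4)" and G2': "integrable lborel (\<lambda>p. (norm (GG p))\<^sup>2)"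
    using U4 G2 unfolding UU_def GG_def by auto
  define A where "A = (\<integral>p. norm (UU p) ^ 4 + (norm (GG p))\<^sup>2 \<partial>lborel)"
  have A: "A \<ge> 0" unfolding A_def by (intro integral_nonneg_AE AE_I2) simp
  have dc: "x / y * y = x" if "y \<noteq> 0" for x y :: real using that by simp
  have A1: "A + 1 \<noteq> 0" using A by simp
  define l where "l = e / 2 / (A + 1)"
  have l: "l > 0" using e A by (simp add: l_def)
  have "l * A \<le> l * (A + 1)" using l by simp
  also have "\<dots> = e / 2" unfolding l_def by (rule dc[OF A1])
  finally have lA: "l * A \<le> e / 2" .
  obtain C where C: "C \<ge> 0" "\<And>a B \<phi> A. \<bar>kk \<mu> \<beta> a B \<phi> A\<bar> \<le> l * (norm a ^ 4 + (norm B)\<^sup>2) + C * (norm \<phi> ^ 4 + (norm A)\<^sup>2)"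
    by (rule kk_bound[OF l]) (rule that)
  have C1: "C + 1 \<noteq> 0" using C by simp
  define e' where "e' = e / 4 / (C + 1)"
  have e': "e' > 0" using e C by (simp add: e'_def)
  have "C * (e' + e') \<le> (C + 1) * (e' + e')" using e' by simp
  also have "\<dots> = 2 * ((C + 1) * e')" by (simp add: algebra_simps)
  also have "(C + 1) * e' = e / 4" unfolding e'_def mult.commute[of "C + 1"] by (rule dc[OF C1])
  also have "2 * (e / 4) = e / 2" by simp
  finally have Ce: "C * (e' + e') \<le> e / 2" .
  obtain d4 where d4: "d4 > 0" "\<And>h. norm h < d4 ==> (\<integral>p. norm (UU (p + h) - UU p) ^ 4 \<partial>lborel) < e'"
    by (rule translation_continuous_Lp[OF _ U4' _ e']) (simp, simp, rule that)
  obtain d2 where d2: "d2 > 0" "\<And>h. norm h < d2 ==> (\<integral>p. norm (GG (p + h) - GG p) ^ 2 \<partial>lborel) < e'"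
    by (rule translation_continuous_Lp[OF _ G2' _ e']) (simp, simp, rule that)
  show ?thesis
  proof (rule that[of "min d4 d2"])
    show "min d4 d2 > 0" using d4 d2 by simp
    fix r :: real assume r: "\<bar>r\<bar> < min d4 d2"
    \<comment> \<open>A shift in time is a translation of space-time. The representatives live on
      the whole of it and vanish outside (0,T) \<times> \<Omega>, so the end points of the time
      interval cause no boundary terms.\<close>
    define h :: "real \<times> (real^3)" where "h = (r, 0)"
    have nh: "norm h = \<bar>r\<bar>" by (simp add: h_def norm_Pair)
    define q where "q p = l * (norm (UU p) ^ 4 + (norm (GG p))\<^sup>2) + C * (norm (UU (p + h) - UU p) ^ 4 + (norm (GG (p + h) - GG p))\<^sup>2)" for p
    have [measurable]: "q \<in> borel_measurable borel" unfolding q_def by measurable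
    have q0: "q p \<ge> 0" for p unfolding q_def using l C by (intro add_nonneg_nonneg mult_nonneg_nonneg) auto
    note i = U4' G2' integrable_shift_diff_power[OF _ U4', of h] integrable_shift_diff_power[OF _ G2', of h]
    have iq: "integrable lborel q" unfolding q_def using i by simp
    have "(\<integral>\<^sup>+t. g t r \<partial>lborel) \<le> (\<integral>\<^sup>+t. (\<integral>\<^sup>+x. ennreal (q (t, x)) \<partial>lborel) \<partial>lborel)"
    proof (rule nn_integral_mono_AE)
      show "AE t in lborel. g t r \<le> (\<integral>\<^sup>+x. ennreal (q (t, x)) \<partial>lborel)"
        using AE_ok AE_shift[OF AE_ok, of r]
      proof eventually_elim
        case (elim t)
        have "F t t - F t (t + r) = (\<integral>x. kk \<mu> \<beta> (U t x) (G t x) (U t x - U (t + r) x) (G t x - G (t + r) x) \<partial>lborel)"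
          unfolding F_def kk_diff
          by (rule Bochner_Integration.integral_diff[symmetric]) (intro kk_integrable elim)+
        moreover have "integrable lborel (\<lambda>x. kk \<mu> \<beta> (U t x) (G t x) (U t x - U (t + r) x) (G t x - G (t + r) x))"
          unfolding kk_diff by (intro Bochner_Integration.integrable_diff kk_integrable elim)
        ultimately have "g t r \<le> (\<integral>\<^sup>+x. ennreal (norm (kk \<mu> \<beta> (U t x) (G t x) (U t x - U (t + r) x) (G t x - G (t + r) x))) \<partial>lborel)"
          unfolding g_def real_norm_def[symmetric] by (simp only: integral_norm_bound_ennreal)
        also have "\<dots> \<le> (\<integral>\<^sup>+x. ennreal (q (t, x)) \<partial>lborel)"
        proof (rule nn_integral_mono, rule ennreal_leI)
          fix x
          show "norm (kk \<mu> \<beta> (U t x) (G t x) (U t x - U (t + r) x) (G t x - G (t + r) x)) \<le> q (t, x)"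
            using C(2)[of "U t x" "G t x" "U t x - U (t + r) x" "G t x - G (t + r) x"]
            by (simp add: q_def UU_def GG_def h_def norm_minus_commute)
        qed
        finally show ?case .
      qed
    qed
    also have "\<dots> = (\<integral>\<^sup>+p. ennreal (q p) \<partial>lborel)"
    proof -
      have "(\<lambda>p. ennreal (q p)) \<in> borel_measurable (lborel \<Otimes>\<^sub>M lborel)" by (simp add: lborel_prod)
      from lborel.nn_integral_fst[OF this] show ?thesis by (simp add: lborel_prod)
    qed
    also have "\<dots> = ennreal (\<integral>p. q p \<partial>lborel)" by (rule nn_integral_eq_integral[OF iq]) (simp add: q0)
    also have "\<dots> \<le> ennreal e"
    proof (rule ennreal_leI)
      have "(\<integral>p. q p \<partial>lborel) = l * A + C * ((\<integral>p. norm (UU (p + h) - UU p) ^ 4 \<partial>lborel) + (\<integral>p. (norm (GG (p + h) - GG p))\<^sup>2 \<partial>lborel))"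
        unfolding q_def A_def using i by simp
      also have "\<dots> \<le> e / 2 + C * (e' + e')"
        using d4(2)[of h] d2(2)[of h] r nh C(1) lA by (intro add_mono mult_left_mono) auto
      finally show "(\<integral>p. q p \<partial>lborel) \<le> e" using Ce by simp
    qed
    finally show "(\<integral>\<^sup>+t. g t r \<partial>lborel) \<le> ennreal e" .
  qed
qed

text \<open>Split \<open>d\<close> into \<open>n\<close> steps: each of them contributes at most \<open>d/n\<close> times a modulus of continuity
  at scale \<open>d/n\<close>, so the total is arbitrarily small.\<close>

lemma kf_shift_eq:
  assumes d: "0 < d" "d < T"
  shows "(\<integral>\<^sup>+t. indicator {0<..<T - d} t * ennreal \<bar>kf (t + d) - kf t\<bar> \<partial>lborel) = 0" (is "?X = 0")
proof -
  have small: "?X \<le> 0 + ennreal e" if e: "e > 0" for e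
  proof -
    \<comment> \<open>The \<open>n\<close> steps contribute \<open>2 * e1 * h\<close> each, together
      \<open>2 * e1 * d = e\<close>.\<close>
    define e1 where "e1 = e / (2 * d)"
    have e1: "e1 > 0" using e d by (simp add: e1_def)
    obtain \<delta> where \<delta>: "\<delta> > 0" "\<And>r. \<bar>r\<bar> < \<delta> ==> (\<integral>\<^sup>+t. g t r \<partial>lborel) \<le> ennreal e1"
      using g_small[OF e1] by metis
    obtain n0 where n0: "d / \<delta> < real n0" using reals_Archimedean2 by blast
    define n where "n = Suc n0"
    have n: "real n > 0" "d < real n * \<delta>"
      using n0 \<delta>(1) d by (auto simp: n_def field_simps intro: less_trans)
    define h where "h = d / real n"
    have h: "h > 0" "h < \<delta>" "real n * h = d" using d n by (auto simp: h_def pos_divide_less_eq mult.commute)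
    let ?f = "\<lambda>t. ennreal \<bar>kf (t + h) - kf t\<bar>"
    have step: "(\<integral>\<^sup>+t. indicator {0<..<T - h} t * ?f t \<partial>lborel) \<le> ennreal (2 * e1 * h)"
      by (rule kf_step_nn[OF h(1)]) (use \<delta>(2) h e1 in auto)
    have "?X \<le> (\<integral>\<^sup>+t. (\<Sum>j<n. indicator {0<..<T - h} (t + real j * h) * ?f (t + real j * h)) \<partial>lborel)"
    proof (rule nn_integral_mono)
      fix t
      show "indicator {0<..<T - d} t * ennreal \<bar>kf (t + d) - kf t\<bar>
          \<le> (\<Sum>j<n. indicator {0<..<T - h} (t + real j * h) * ?f (t + real j * h))"
      proof (cases "t \<in> {0<..<T - d}")
        case True
        have ind: "t + real j * h \<in> {0<..<T - h}" if "j < n" for j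
        proof -
          have "(real j + 1) * h \<le> real n * h" using that h by (intro mult_right_mono) auto
          then have "real j * h + h \<le> d" using h(3) by (simp add: algebra_simps)
          moreover have "0 \<le> real j * h" using h by simp
          ultimately show ?thesis using True by auto
        qed
        have sj: "t + real (Suc j) * h = t + real j * h + h" for j by (simp add: algebra_simps)
        have eq: "kf (t + d) - kf t = (\<Sum>j<n. kf (t + real j * h + h) - kf (t + real j * h))"
          using sum_lessThan_telescope[of "\<lambda>j. kf (t + real j * h)" n] h(3) unfolding sj by simp
        have "\<bar>kf (t + d) - kf t\<bar> \<le> (\<Sum>j<n. \<bar>kf (t + real j * h + h) - kf (t + real j * h)\<bar>)"
          unfolding eq by (rule sum_abs)
        from ennreal_leI[OF this] have "ennreal \<bar>kf (t + d) - kf t\<bar> \<le> (\<Sum>j<n. ?f (t + real j * h))"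
          by (subst sum_ennreal) simp_all
        then show ?thesis using True ind by simp
      qed simp
    qed
    also have "\<dots> = (\<Sum>j<n. \<integral>\<^sup>+t. indicator {0<..<T - h} (t + real j * h) * ?f (t + real j * h) \<partial>lborel)"
      by (rule nn_integral_sum) measurable
    also have "\<dots> = (\<Sum>j<n. \<integral>\<^sup>+t. indicator {0<..<T - h} t * ?f t \<partial>lborel)"
      by (intro sum.cong refl nn_integral_shift[of "\<lambda>t. indicator {0<..<T - h} t * ?f t"]) measurable
    also have "\<dots> \<le> (\<Sum>j<n. ennreal (2 * e1 * h))" by (rule sum_mono) (rule step)
    also have "\<dots> = ennreal (real n * (2 * e1 * h))" using e1 h by (simp add: ennreal_mult'' ennreal_of_nat_eq_real_of_nat ennreal_mult)
    also have "real n * (2 * e1 * h) = e"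
    proof -
      have "real n * (2 * e1 * h) = 2 * e1 * (real n * h)" by simp
      then show ?thesis using h(3) d by (simp add: e1_def)
    qed
    finally show ?thesis by simp
  qed
  have "?X \<le> 0" by (rule ennreal_le_epsilon) (rule small)
  then show ?thesis by simp
qed

text \<open>Integrating \<open>kf_shift_eq\<close> over \<open>d\<close> shows that
  \<open>kf\<close> agrees at almost every pair of times. By Fubini some fixed time \<open>t\<close>
  agrees with almost all later and almost all earlier ones; these are the two orders of the
  arguments of \<open>Q\<close>.\<close>

lemma kf_constant:
  obtains c where "AE t in lborel. t \<in> {0<..<T} --> kf t = c"
proof -
  define Q where "Q t s = (if 0 < t \<and> t < s \<and> s < T then ennreal \<bar>kf s - kf t\<bar> else 0)" for t s
  have Qm [measurable]: "(\<lambda>p. Q (fst p) (snd p)) \<in> borel_measurable (lborel \<Otimes>\<^sub>M lborel)" unfolding Q_def by measurable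
  have [measurable]: "(\<lambda>s. Q t s) \<in> borel_measurable borel" "(\<lambda>s. Q s t) \<in> borel_measurable borel" for t
    unfolding Q_def by measurable
  have Q2: "(\<lambda>t. \<integral>\<^sup>+s. Q t s \<partial>lborel) \<in> borel_measurable lborel" "(\<lambda>t. \<integral>\<^sup>+s. Q s t \<partial>lborel) \<in> borel_measurable lborel"
    unfolding Q_def by measurable
  have "(\<integral>\<^sup>+t. (\<integral>\<^sup>+s. Q t s \<partial>lborel) \<partial>lborel) = (\<integral>\<^sup>+t. (\<integral>\<^sup>+d. Q t (d + t) \<partial>lborel) \<partial>lborel)"
    by (intro nn_integral_cong nn_integral_shift[symmetric]) measurable
  also have "\<dots> = (\<integral>\<^sup>+d. (\<integral>\<^sup>+t. Q t (d + t) \<partial>lborel) \<partial>lborel)"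
    unfolding Q_def by (rule lborel_pair.Fubini'[symmetric]) measurable
  also have "\<dots> = (\<integral>\<^sup>+(d::real). 0 \<partial>lborel)"
  proof (rule nn_integral_cong)
    fix d :: real
    show "(\<integral>\<^sup>+t. Q t (d + t) \<partial>lborel) = 0"
    proof (cases "0 < d \<and> d < T")
      case True
      have "(\<lambda>t. Q t (d + t)) = (\<lambda>t. indicator {0<..<T - d} t * ennreal \<bar>kf (t + d) - kf t\<bar>)"
        using True by (auto simp: Q_def indicator_def add.commute fun_eq_iff)
      then show ?thesis using kf_shift_eq[of d] True by simp
    next
      case False
      then have "(\<lambda>t. Q t (d + t)) = (\<lambda>t. 0)" by (auto simp: Q_def fun_eq_iff)
      then show ?thesis by simp
    qed
  qed
  finally have 1: "(\<integral>\<^sup>+t. (\<integral>\<^sup>+s. Q t s \<partial>lborel) \<partial>lborel) = 0" by simp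
  have 2: "(\<integral>\<^sup>+t. (\<integral>\<^sup>+s. Q s t \<partial>lborel) \<partial>lborel) = 0"
    using lborel_pair.Fubini'[of Q] 1 Qm by (simp add: split_beta')
  have "AE t in lborel. (\<integral>\<^sup>+s. Q t s \<partial>lborel) = 0" "AE t in lborel. (\<integral>\<^sup>+s. Q s t \<partial>lborel) = 0"
    using 1 2 nn_integral_0_iff_AE[OF Q2(1)] nn_integral_0_iff_AE[OF Q2(2)] by auto
  then have "AE t in lborel. (\<integral>\<^sup>+s. Q t s \<partial>lborel) = 0 \<and> (\<integral>\<^sup>+s. Q s t \<partial>lborel) = 0" by eventually_elim simp
  from AE_interval_ex[OF this T] obtain t where t: "0 < t" "t < T" "(\<integral>\<^sup>+s. Q t s \<partial>lborel) = 0" "(\<integral>\<^sup>+s. Q s t \<partial>lborel) = 0" by blast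
  have "AE s in lborel. Q t s = 0" "AE s in lborel. Q s t = 0"
    using t nn_integral_0_iff_AE[of "\<lambda>s. Q t s" lborel] nn_integral_0_iff_AE[of "\<lambda>s. Q s t" lborel] by auto
  then have "AE s in lborel. s \<in> {0<..<T} --> kf s = kf t"
  proof eventually_elim
    case (elim s)
    show ?case
    proof
      assume s: "s \<in> {0<..<T}"
      consider "s < t" | "s = t" | "t < s" by linarith
      then show "kf s = kf t" using elim s t(1,2) by cases (auto simp: Q_def)
    qed
  qed
  then show ?thesis by (rule that)
qed

section \<open>Strong continuity in time\<close>

lemma small_mass:
  assumes "\<eta> > 0"
  obtains \<delta> where "\<delta> > 0" "(\<integral>r. indicator {t0-\<delta><..<t0+\<delta>} r * m r \<partial>lborel) < \<eta>"
proof -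
  let ?d = "\<lambda>n. inverse (real (Suc n))"
  have "(\<lambda>n. \<integral>r. indicator {t0 - ?d n<..<t0 + ?d n} r * m r \<partial>lborel) \<longlonglongrightarrow> (\<integral>r. indicator {t0} r * m r \<partial>lborel)"
  proof (rule integral_dominated_convergence[where w=m])
    show "AE r in lborel. (\<lambda>n. indicator {t0 - ?d n<..<t0 + ?d n} r * m r) \<longlonglongrightarrow> indicator {t0} r * m r"
    proof (intro AE_I2 tendsto_mult tendsto_const)
      fix r
      show "(\<lambda>n. indicator {t0 - ?d n<..<t0 + ?d n} r) \<longlonglongrightarrow> (indicator {t0} r :: real)"
      proof (cases "r = t0")
        case False
        have "\<forall>\<^sub>F n in sequentially. ?d n < \<bar>r - t0\<bar>"
          using order_tendstoD(2)[OF LIMSEQ_inverse_real_of_nat, of "\<bar>r - t0\<bar>"] False by simp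
        then have "\<forall>\<^sub>F n in sequentially. (indicator {t0} r :: real) = indicator {t0 - ?d n<..<t0 + ?d n} r"
          by eventually_elim (use False in \<open>auto simp: indicator_def\<close>)
        then show ?thesis by (rule Lim_transform_eventually[OF tendsto_const])
      qed simp
    qed
    show "AE r in lborel. norm (indicator {t0 - ?d n<..<t0 + ?d n} r * m r) \<le> m r" for n
      using m_nonneg by (intro AE_I2) (auto simp: indicator_def)
  qed (use m_integrable in auto)
  moreover have "(\<integral>r. indicator {t0} r * m r \<partial>lborel) = 0"
  proof (rule integral_eq_zero_AE)
    show "AE r in lborel. indicator {t0} r * m r = 0"
      using AE_lborel_singleton[of t0] by eventually_elim simp
  qed
  ultimately have "\<forall>\<^sub>F n in sequentially. (\<integral>r. indicator {t0 - ?d n<..<t0 + ?d n} r * m r \<partial>lborel) < \<eta>"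
    using assms by (simp add: order_tendstoD(2))
  then obtain n where "(\<integral>r. indicator {t0 - ?d n<..<t0 + ?d n} r * m r \<partial>lborel) < \<eta>"
    using eventually_happens'[OF sequentially_bot] by blast
  then show ?thesis using that[of "?d n"] by simp
qed

lemma sqi_E: "t \<in> E ==> sqi lborel (U t)"
proof -
  assume t: "t \<in> E"
  have "U t \<in> borel_measurable borel" using U_comp[of "\<lambda>_. t" borel "\<lambda>x. x"] by simp
  then show ?thesis using sqi_L4[OF op bd _ _ EU[OF t]] U0 by blast
qed

text \<open>Expanding the square leaves \<open>en t - en r\<close>, controlled through
  \<open>S\<close>, and twice <U t - U r, U r>, controlled by \<open>F_step\<close> with test time
  \<open>r\<close>. Bounding \<open>F s r\<close> costs the mass of the interval plus its length
  times \<open>m r\<close>; the factor 6 is 4 from the first part and 2 from the second.\<close>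

lemma energy_increment:
  assumes c: "en t = c - 2 * S t" "en r = c - 2 * S r" and t: "t \<in> E" and r: "r \<in> E"
    and ab: "a \<le> t" "t < b" "a \<le> r" "r < b"
  defines "A \<equiv> (\<integral>s. indicator {a<..<b} s * m s \<partial>lborel)"
  shows "(n2 lborel (\<lambda>x. U t x - U r x))\<^sup>2 \<le> 6 * Ck1 * A + 2 * Ck1 * ((b - a) * m r)"
proof -
  define lo where "lo = min t r"
  define hi where "hi = max t r"
  have lohi: "lo \<le> hi" "a \<le> lo" "hi < b" "0 \<le> lo" "lo \<in> E" "hi \<in> E" "lo = t \<and> hi = r \<or> lo = r \<and> hi = t"
    using ab t r E by (auto simp: lo_def hi_def min_def max_def)
  have iA: "integrable lborel (\<lambda>s. indicator {a<..<b} s * m s)"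
    using integrable_mult_indicator[OF _ m_integrable, of "{a<..<b}"] by simp
  have 1: "\<bar>S hi - S lo\<bar> \<le> 2 * Ck1 * A"
  proof -
    have "\<bar>S hi - S lo\<bar> \<le> (\<integral>s. norm (indicator {lo..<hi} s * F s s) \<partial>lborel)"
      unfolding S_diff[OF lohi(4,1)] real_norm_def[symmetric] by (rule integral_norm_bound)
    also have "\<dots> \<le> (\<integral>s. 2 * Ck1 * (indicator {a<..<b} s * m s) \<partial>lborel)"
    proof (rule integral_mono_AE)
      show "integrable lborel (\<lambda>s. norm (indicator {lo..<hi} s * F s s))" by (intro integrable_norm Frr_set_integrable) simp
      show "integrable lborel (\<lambda>s. 2 * Ck1 * (indicator {a<..<b} s * m s))" using iA by simp
      show "AE s in lborel. norm (indicator {lo..<hi} s * F s s) \<le> 2 * Ck1 * (indicator {a<..<b} s * m s)"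
        using AE_ok AE_lborel_singleton[of a]
      proof eventually_elim
        case (elim s)
        have "\<bar>F s s\<bar> \<le> 2 * Ck1 * m s" using F_bound[OF elim(1) elim(1)] by simp
        moreover have "0 \<le> 2 * Ck1 * m s" using Ck1(1) m_nonneg[of s] by simp
        ultimately show ?case using lohi elim(2) by (auto simp: indicator_def)
      qed
    qed
    finally show ?thesis by (simp add: A_def)
  qed
  have 2: "\<bar>(\<integral>x. U hi x \<bullet> U r x \<partial>lborel) - (\<integral>x. U lo x \<bullet> U r x \<partial>lborel)\<bar> \<le> Ck1 * A + Ck1 * ((b - a) * m r)"
  proof -
    have i: "integrable lborel (\<lambda>s. indicator {lo..<hi} s * F s r)"
      by (intro F_integrable E_ok r Ico_finite) simp
    have ab': "a \<le> b" using ab by linarith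
    have "\<bar>(\<integral>x. U hi x \<bullet> U r x \<partial>lborel) - (\<integral>x. U lo x \<bullet> U r x \<partial>lborel)\<bar> = norm (\<integral>s. indicator {lo..<hi} s * F s r \<partial>lborel)"
      unfolding F_step[OF lohi(5,6) r lohi(1)] by simp
    also have "\<dots> \<le> (\<integral>s. norm (indicator {lo..<hi} s * F s r) \<partial>lborel)" by (rule integral_norm_bound)
    also have "\<dots> \<le> (\<integral>s. Ck1 * (indicator {a<..<b} s * m s) + indicator {a<..<b} s * (Ck1 * m r) \<partial>lborel)"
    proof (rule integral_mono_AE)
      show "integrable lborel (\<lambda>s. norm (indicator {lo..<hi} s * F s r))" by (rule integrable_norm[OF i])
      show "integrable lborel (\<lambda>s. Ck1 * (indicator {a<..<b} s * m s) + indicator {a<..<b} s * (Ck1 * m r))"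
        using iA ab' by (auto simp: integrable_indicator_iff)
      show "AE s in lborel. norm (indicator {lo..<hi} s * F s r) \<le> Ck1 * (indicator {a<..<b} s * m s) + indicator {a<..<b} s * (Ck1 * m r)"
        using AE_ok AE_lborel_singleton[of a]
      proof eventually_elim
        case (elim s)
        have "\<bar>F s r\<bar> \<le> Ck1 * m s + Ck1 * m r" using F_bound[OF elim(1) E_ok[OF r]] by (simp add: distrib_left)
        moreover have "0 \<le> Ck1 * m s" "0 \<le> Ck1 * m r" using Ck1(1) m_nonneg by simp_all
        ultimately show ?case using lohi elim(2) by (auto simp: indicator_def)
      qed
    qed
    also have "\<dots> = Ck1 * A + (b - a) * (Ck1 * m r)"
      using iA ab' by (simp add: A_def integrable_indicator_iff)
    finally show ?thesis by (simp add: mult_ac)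
  qed
  have e: "en s = (\<integral>x. U s x \<bullet> U s x \<partial>lborel)" for s by (simp add: en_def power2_norm_eq_inner)
  have n: "(n2 lborel (U s))\<^sup>2 = en s" for s by (simp add: n2_sq en_def)
  have "(n2 lborel (\<lambda>x. U t x - U r x))\<^sup>2 = (en t - en r) - 2 * ((\<integral>x. U t x \<bullet> U r x \<partial>lborel) - (\<integral>x. U r x \<bullet> U r x \<partial>lborel))"
    using n2_diff_sq[OF sqi_E[OF t] sqi_E[OF r]] unfolding n e[of r] by simp
  moreover have "\<bar>S t - S r\<bar> \<le> 2 * Ck1 * A" using 1 lohi(7) by (auto simp: abs_minus_commute)
  moreover have "\<bar>(\<integral>x. U t x \<bullet> U r x \<partial>lborel) - (\<integral>x. U r x \<bullet> U r x \<partial>lborel)\<bar> \<le> Ck1 * A + Ck1 * ((b - a) * m r)"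
    using 2 lohi(7) by (auto simp: abs_minus_commute)
  ultimately show ?thesis using c by (simp add: abs_le_iff)
qed

text \<open>Both times are compared with a third one \<open>r\<close> at which \<open>m\<close> hardly exceeds its mean, which
  makes the term \<open>(b - a) * m r\<close> of \<open>energy_increment\<close> small.\<close>

lemma cauchy_at:
  assumes c: "AE t in lborel. t \<in> {0<..<T} --> kf t = c" and t0: "0 \<le> t0" "t0 < T" and \<epsilon>: "\<epsilon> > 0"
  obtains \<delta> where "\<delta> > 0" "\<And>t t'. t \<in> E ==> kf t = c ==> \<bar>t - t0\<bar> < \<delta> ==> t' \<in> E ==> kf t' = c ==> \<bar>t' - t0\<bar> < \<delta> ==>
     n2 lborel (\<lambda>x. U t x - U t' x) < \<epsilon>"
proof -
  have Ck: "Ck1 > 0" using Ck1(1) by simp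
  \<comment> \<open>\<open>energy_increment\<close> will give at most
    \<open>10 * Ck1 * \<eta>\<close>, that is \<epsilon>^2 / 5, which is below the required
    \<epsilon>^2 / 4.\<close>
  define \<eta> where "\<eta> = \<epsilon>\<^sup>2 / (50 * Ck1)"
  have \<eta>: "\<eta> > 0" using \<epsilon> Ck by (simp add: \<eta>_def)
  obtain \<delta> where \<delta>: "\<delta> > 0" "(\<integral>r. indicator {t0-\<delta><..<t0+\<delta>} r * m r \<partial>lborel) < \<eta>"
    using small_mass[OF \<eta>, of t0] by metis
  define a where "a = max 0 (t0 - \<delta>)"
  define b where "b = min T (t0 + \<delta>)"
  have ab: "a < b" "0 \<le> a" "b \<le> T" using t0 \<delta>(1) T by (auto simp: a_def b_def)
  define A where "A = (\<integral>s. indicator {a<..<b} s * m s \<partial>lborel)"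
  have im: "integrable lborel (\<lambda>s. indicator B s * m s)" if "B \<in> sets borel" for B
    using integrable_mult_indicator[OF _ m_integrable, of B] that by simp
  have A\<eta>: "A < \<eta>"
  proof -
    have "A \<le> (\<integral>r. indicator {t0-\<delta><..<t0+\<delta>} r * m r \<partial>lborel)"
      unfolding A_def
    proof (rule Bochner_Integration.integral_mono)
      fix s show "indicator {a<..<b} s * m s \<le> indicator {t0-\<delta><..<t0+\<delta>} s * m s"
        using m_nonneg[of s] by (auto simp: indicator_def a_def b_def)
    qed (intro im; simp)+
    then show ?thesis using \<delta>(2) by simp
  qed
  have "\<exists>r. a < r \<and> r < b \<and> r \<in> E \<and> kf r = c \<and> (b - a) * m r \<le> A + \<eta>"
  proof (rule ccontr)
    assume no: "\<not> ?thesis"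
    have ae: "AE s in lborel. indicator {a<..<b} s * (A + \<eta>) \<le> (b - a) * (indicator {a<..<b} s * m s)"
      using EAE c
    proof eventually_elim
      case (elim s)
      show ?case
      proof (cases "s \<in> {a<..<b}")
        case True
        then have "s \<in> E" "kf s = c" using elim ab by auto
        then have "(b - a) * m s > A + \<eta>" using no True by force
        then show ?thesis using True by simp
      qed simp
    qed
    have "(b - a) * (A + \<eta>) = (\<integral>s. indicator {a<..<b} s * (A + \<eta>) \<partial>lborel)" using ab by simp
    also have "\<dots> \<le> (\<integral>s. (b - a) * (indicator {a<..<b} s * m s) \<partial>lborel)"
      by (rule integral_mono_AE[OF _ _ ae]) (use im[of "{a<..<b}"] ab in \<open>auto simp: integrable_indicator_iff\<close>)
    also have "\<dots> = (b - a) * A" by (simp add: A_def)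
    finally have "(b - a) * \<eta> \<le> 0" by (simp add: distrib_left)
    then show False using ab(1) \<eta> by (simp add: mult_le_0_iff)
  qed
  then obtain r where r: "a < r" "r < b" "r \<in> E" "kf r = c" "(b - a) * m r \<le> A + \<eta>" by blast
  have near: "n2 lborel (\<lambda>x. U t x - U r x) < \<epsilon> / 2" if t: "t \<in> E" "kf t = c" "\<bar>t - t0\<bar> < \<delta>" for t
  proof (rule power_less_imp_less_base)
    have t': "a \<le> t" "t < b" using t E by (auto simp: a_def b_def)
    have en: "en t = c - 2 * S t" "en r = c - 2 * S r" using t(2) r(4) by (auto simp: kf_def)
    have "(n2 lborel (\<lambda>x. U t x - U r x))\<^sup>2 \<le> 6 * Ck1 * A + 2 * Ck1 * ((b - a) * m r)"
      unfolding A_def by (rule energy_increment[OF en t(1) r(3) t' _ r(2)]) (use r in simp)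
    also have "\<dots> \<le> 6 * Ck1 * \<eta> + 2 * Ck1 * (\<eta> + \<eta>)"
      using A\<eta> r(5) Ck by (intro add_mono mult_left_mono) auto
    also have "\<dots> = 10 * (Ck1 * \<eta>)" by simp
    also have "\<dots> < (\<epsilon> / 2)\<^sup>2" using Ck \<epsilon> by (simp add: \<eta>_def power_divide)
    finally show "(n2 lborel (\<lambda>x. U t x - U r x))\<^sup>2 < (\<epsilon> / 2)\<^sup>2" .
  qed (use \<epsilon> in simp)
  show ?thesis
  proof (rule that[OF \<delta>(1)])
    fix t t' assume h: "t \<in> E" "kf t = c" "\<bar>t - t0\<bar> < \<delta>" "t' \<in> E" "kf t' = c" "\<bar>t' - t0\<bar> < \<delta>"
    have "n2 lborel (\<lambda>x. U t x - U t' x) \<le> n2 lborel (\<lambda>x. U t x - U r x) + n2 lborel (\<lambda>x. U r x - U t' x)"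
      by (rule n2_triangle_diff[OF sqi_E[OF h(1)] sqi_E[OF r(3)] sqi_E[OF h(4)]])
    also have "\<dots> < \<epsilon> / 2 + \<epsilon> / 2"
      using near[OF h(1,2,3)] near[OF h(4,5,6)] unfolding n2_diff_commute[of lborel "U r" "U t'"] by linarith
    finally show "n2 lborel (\<lambda>x. U t x - U t' x) < \<epsilon>" by simp
  qed
qed

end

section \<open>Lebesgue measure on a domain and Borel representatives\<close>

lemma AE_lebesgue_on_iff:
  fixes S :: "'a::euclidean_space set"
  assumes "S \<in> sets borel"
  shows "(AE x in lebesgue_on S. P x) \<longleftrightarrow> (AE x in lborel. x \<in> S --> P x)"
proof -
  have "S \<inter> space lebesgue \<in> sets lebesgue" using assms by auto
  then show ?thesis by (simp add: AE_restrict_space_iff AE_completion_iff)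
qed

text \<open>The bridge between the two measures: quantities taken with \<open>lebesgue_on S\<close>,
  for functions known up to null sets, become \<open>lborel\<close> integrals of a Borel function
  that vanishes outside \<open>S\<close>.\<close>

lemma lebesgue_on_representative:
  fixes f g :: "'a::euclidean_space => 'b::euclidean_space"
  assumes S: "S \<in> sets borel" and g: "g \<in> borel_measurable borel" "\<And>x. x \<notin> S ==> g x = 0"
    and ae: "AE x in lborel. x \<in> S --> f x = g x"
  shows "f \<in> borel_measurable (lebesgue_on S)" "integral\<^sup>L (lebesgue_on S) f = integral\<^sup>L lborel g"
    "integrable (lebesgue_on S) f \<longleftrightarrow> integrable lborel g"
proof -
  have SS: "S \<inter> space lebesgue \<in> sets lebesgue" using S by auto
  have eq: "AE x in lebesgue. g x = indicator S x *\<^sub>R f x"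
    using AE_completion[OF ae] by eventually_elim (use g(2) in \<open>auto simp: indicator_def\<close>)
  have gm: "g \<in> borel_measurable lebesgue" using g(1) by (simp add: measurable_completion)
  have fm: "(\<lambda>x. indicator S x *\<^sub>R f x) \<in> borel_measurable lebesgue" by (rule borel_measurable_AE[OF gm eq])
  then show "f \<in> borel_measurable (lebesgue_on S)"
    by (simp add: borel_measurable_restrict_space_iff[OF SS])
  have eq': "AE x in lebesgue. indicator S x *\<^sub>R f x = g x" using eq by eventually_elim simp
  have "integral\<^sup>L (lebesgue_on S) f = integral\<^sup>L lebesgue g"
    unfolding integral_restrict_space[OF SS] by (rule integral_cong_AE[OF fm gm eq'])
  then show "integral\<^sup>L (lebesgue_on S) f = integral\<^sup>L lborel g" using g(1) by (simp add: integral_completion)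
  have "integrable (lebesgue_on S) f \<longleftrightarrow> integrable lebesgue g"
    unfolding integrable_restrict_space[OF SS] by (rule integrable_cong_AE[OF fm gm eq'])
  then show "integrable (lebesgue_on S) f \<longleftrightarrow> integrable lborel g" using g(1) by (simp add: integrable_completion)
qed

lemma borel_representative:
  fixes f :: "'a::euclidean_space => 'b::euclidean_space"
  assumes f: "f \<in> borel_measurable (lebesgue_on S)" and S: "S \<in> sets borel"
  obtains g where "g \<in> borel_measurable borel" "\<And>x. x \<notin> S ==> g x = 0" "AE x in lborel. x \<in> S --> f x = g x"
proof -
  have SS: "S \<inter> space lebesgue \<in> sets lebesgue" using S by auto
  have fm: "(\<lambda>x. indicator S x *\<^sub>R f x) \<in> borel_measurable lebesgue"
    using f by (simp add: borel_measurable_restrict_space_iff[OF SS])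
  have "\<exists>g'\<in>borel_measurable lborel. AE x in lborel. (indicator S x *\<^sub>R f x) \<bullet> b = g' x" for b
    by (rule completion_ex_borel_measurable_real, rule borel_measurable_inner[OF fm]) simp
  then obtain h where h: "\<And>b. h b \<in> borel_measurable lborel" "\<And>b. AE x in lborel. (indicator S x *\<^sub>R f x) \<bullet> b = h b x"
    by metis
  have [measurable]: "h b \<in> borel_measurable borel" for b using h(1) by simp
  have [measurable]: "S \<in> sets borel" by fact
  define g where "g x = indicator S x *\<^sub>R (\<Sum>b\<in>Basis. h b x *\<^sub>R b)" for x
  have gm: "g \<in> borel_measurable borel" unfolding g_def by measurable
  have "AE x in lborel. \<forall>b\<in>Basis. (indicator S x *\<^sub>R f x) \<bullet> b = h b x"
    by (rule AE_finite_allI[OF finite_Basis h(2)])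
  then have ae: "AE x in lborel. x \<in> S --> f x = g x"
  proof eventually_elim
    case (elim x)
    show ?case
    proof
      assume x: "x \<in> S"
      have "f x = (\<Sum>b\<in>Basis. (f x \<bullet> b) *\<^sub>R b)" by (simp add: euclidean_representation)
      also have "\<dots> = (\<Sum>b\<in>Basis. h b x *\<^sub>R b)" using elim x by (intro sum.cong) auto
      finally show "f x = g x" using x by (simp add: g_def)
    qed
  qed
  show ?thesis by (rule that[OF gm _ ae]) (simp add: g_def)
qed

lemma AE_lborel_sections:
  assumes "AE p in (lborel :: ('a::euclidean_space \<times> 'b::euclidean_space) measure). P p"
  shows "AE t in lborel. AE x in lborel. P (t, x)"
proof -
  have "AE p in lborel \<Otimes>\<^sub>M lborel. P p" using assms by (subst lborel_prod)
  then show ?thesis by (rule lborel_pair.AE_pair)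
qed

section \<open>Uniqueness of weak gradients\<close>

lemma smooth_real_polynomial_function:
  fixes p :: "'a::euclidean_space => real"
  assumes "real_polynomial_function p" shows "smooth p"
  using assms
  by (induction rule: real_polynomial_function.induct)
    (auto intro: smooth_bounded_linear smooth_const smooth_add smooth_mult)

text \<open>Polynomials are smooth, so by Stone-Weierstrass \<open>f\<close> is orthogonal to every
  continuous function bounded by 1. Taking a continuous approximation of the sign of
  \<open>f\<close> as such a function shows that the L^1 norm of \<open>f\<close> vanishes.\<close>

lemma orthogonal_to_smooth_imp_AE_0:
  fixes f :: "'a::euclidean_space => real"
  assumes f: "integrable lborel f" and K: "compact K" "\<And>x. x \<notin> K ==> f x = 0"
    and orth: "\<And>\<theta>. smooth \<theta> ==> (\<integral>x. f x * \<theta> x \<partial>lborel) = 0"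
  shows "AE x in lborel. f x = 0"
proof -
  have [measurable]: "f \<in> borel_measurable borel" using f by simp
  have Kf: "emeasure lborel K < \<infinity>" by (rule emeasure_bounded_finite[OF compact_imp_bounded[OF K(1)]])
  have [measurable]: "K \<in> sets borel" using K(1) by (simp add: borel_compact)
  define I where "I = (\<integral>x. \<bar>f x\<bar> \<partial>lborel)"
  have I: "I \<ge> 0" by (simp add: I_def)
  have cont: "(\<integral>x. f x * \<theta> x \<partial>lborel) = 0" if \<theta>: "continuous_on UNIV \<theta>" "\<And>x. \<bar>\<theta> x\<bar> \<le> 1" for \<theta> :: "'a => real"
  proof -
    have [measurable]: "\<theta> \<in> borel_measurable borel" using \<theta>(1) by (rule borel_measurable_continuous_onI)
    have "\<bar>\<integral>x. f x * \<theta> x \<partial>lborel\<bar> \<le> e * I" if e: "e > 0" for e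
    proof -
      obtain p where p: "real_polynomial_function p" "\<And>x. x \<in> K ==> \<bar>\<theta> x - p x\<bar> < e"
        using Stone_Weierstrass_real_polynomial_function[OF K(1) continuous_on_subset[OF \<theta>(1)] e] by blast
      have ps: "smooth p" by (rule smooth_real_polynomial_function[OF p(1)])
      have [measurable]: "p \<in> borel_measurable borel" by (rule borel_smooth[OF ps])
      have le: "\<bar>f x * \<theta> x - f x * p x\<bar> \<le> e * \<bar>f x\<bar>" for x
      proof (cases "x \<in> K")
        case True
        have "\<bar>f x * \<theta> x - f x * p x\<bar> = \<bar>f x\<bar> * \<bar>\<theta> x - p x\<bar>" by (simp add: abs_mult[symmetric] right_diff_distrib)
        also have "\<dots> \<le> \<bar>f x\<bar> * e" using p(2)[OF True] by (intro mult_left_mono) auto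
        finally show ?thesis by (simp add: mult.commute)
      qed (simp add: K(2))
      have i1: "integrable lborel (\<lambda>x. f x * \<theta> x)"
      proof (rule Bochner_Integration.integrable_bound[OF f])
        show "AE x in lborel. norm (f x * \<theta> x) \<le> norm (f x)"
          using \<theta>(2) by (intro AE_I2) (simp add: abs_mult mult_left_le)
      qed measurable
      have i2: "integrable lborel (\<lambda>x. f x * \<theta> x - f x * p x)"
      proof (rule Bochner_Integration.integrable_bound[where f="\<lambda>x. e * f x"])
        show "AE x in lborel. norm (f x * \<theta> x - f x * p x) \<le> norm (e * f x)"
          using le e by (intro AE_I2) (simp add: abs_mult)
      qed (use f in auto)
      have i3: "integrable lborel (\<lambda>x. f x * p x)" using Bochner_Integration.integrable_diff[OF i1 i2] by simp
      have "(\<integral>x. f x * \<theta> x \<partial>lborel) = (\<integral>x. f x * \<theta> x - f x * p x \<partial>lborel)"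
        using orth[OF ps] Bochner_Integration.integral_diff[OF i1 i3] by simp
      then have "\<bar>\<integral>x. f x * \<theta> x \<partial>lborel\<bar> \<le> (\<integral>x. norm (f x * \<theta> x - f x * p x) \<partial>lborel)"
        using integral_norm_bound[of lborel "\<lambda>x. f x * \<theta> x - f x * p x"] by (simp only: real_norm_def)
      also have "\<dots> \<le> (\<integral>x. e * \<bar>f x\<bar> \<partial>lborel)"
        by (rule Bochner_Integration.integral_mono) (use i2 f le in auto)
      finally show ?thesis by (simp add: I_def)
    qed
    note small = this
    have "\<bar>\<integral>x. f x * \<theta> x \<partial>lborel\<bar> \<le> 0 + e" if e: "e > 0" for e
    proof -
      have "e / (I + 1) * I \<le> e" using I e by (simp add: field_simps)
      moreover have "e / (I + 1) > 0" using I e by simp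
      ultimately show ?thesis using small[of "e / (I + 1)"] by linarith
    qed
    then show ?thesis using field_le_epsilon[of "\<bar>\<integral>x. f x * \<theta> x \<partial>lborel\<bar>" 0] by simp
  qed
  define k where "k = measure lborel K"
  have k: "k \<ge> 0" by (simp add: k_def)
  have "I \<le> 0 + e" if e: "e > 0" for e
  proof -
    have "e / 3 > 0" using e by simp
    then obtain \<theta> where \<theta>: "continuous_on UNIV \<theta>" "bsupp \<theta>" "(\<integral>x. norm (f x - \<theta> x) \<partial>lborel) < e / 3"
      using Cc_dense_L1[OF f] by blast
    have i\<theta>: "integrable lborel \<theta>" by (rule integrable_bsupp[OF \<theta>(1,2)])
    have [measurable]: "\<theta> \<in> borel_measurable borel" using i\<theta> by simp
    define q where "q = e / 3 / (k + 1)"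
    have q: "q > 0" "q * k \<le> e / 3" using e k by (auto simp: q_def field_simps)
    \<comment> \<open>A continuous substitute for the sign of \<theta>, bounded by 1. In
      \<open>\<theta> x * s x\<close> it loses at most \<open>q\<close> against the absolute value
      of \<open>\<theta> x\<close>, and over \<open>K\<close> this adds up to at most
      \<open>e / 3\<close>.\<close>
    define s where "s x = \<theta> x / (\<bar>\<theta> x\<bar> + q)" for x
    have nz: "\<bar>\<theta> x\<bar> + q > 0" for x using q(1) by linarith
    have s1: "\<bar>s x\<bar> \<le> 1" for x using nz[of x] q(1) by (simp add: s_def)
    have sc: "continuous_on UNIV s" unfolding s_def
      by (intro continuous_on_divide continuous_on_add continuous_on_rabs continuous_on_const \<theta>(1)) (use nz in \<open>auto simp: less_imp_neq[symmetric]\<close>)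
    have [measurable]: "s \<in> borel_measurable borel" using sc by (rule borel_measurable_continuous_onI)
    have st: "\<bar>\<theta> x\<bar> - q \<le> \<theta> x * s x" for x
    proof -
      have "(\<bar>\<theta> x\<bar> - q) * (\<bar>\<theta> x\<bar> + q) \<le> \<theta> x * \<theta> x" by (simp add: algebra_simps abs_mult_self_eq)
      then show ?thesis using nz[of x] by (simp add: s_def pos_le_divide_eq)
    qed
    have pt: "\<bar>f x\<bar> \<le> 2 * \<bar>f x - \<theta> x\<bar> + f x * s x + q * indicator K x" for x
    proof (cases "x \<in> K")
      case True
      have "\<theta> x * s x - f x * s x \<le> \<bar>f x - \<theta> x\<bar>"
      proof -
        have "\<theta> x * s x - f x * s x \<le> \<bar>(\<theta> x - f x) * s x\<bar>" by (simp add: left_diff_distrib)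
        also have "\<dots> \<le> \<bar>\<theta> x - f x\<bar> * 1" unfolding abs_mult using s1[of x] by (intro mult_left_mono) auto
        finally show ?thesis by (simp add: abs_minus_commute)
      qed
      then show ?thesis using st[of x] True by (simp add: abs_if split: if_splits)
    qed (simp add: K(2))
    have isx: "integrable lborel (\<lambda>x. f x * s x)"
    proof (rule Bochner_Integration.integrable_bound[OF f])
      show "AE x in lborel. norm (f x * s x) \<le> norm (f x)"
        using s1 by (intro AE_I2) (simp add: abs_mult mult_left_le)
    qed measurable
    have iK: "integrable lborel (indicat_real K)" using Kf by (simp add: integrable_indicator_iff)
    have "I \<le> (\<integral>x. 2 * \<bar>f x - \<theta> x\<bar> + f x * s x + q * indicator K x \<partial>lborel)"
      unfolding I_def by (rule Bochner_Integration.integral_mono) (use f i\<theta> isx iK pt in auto)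
    also have "\<dots> = 2 * (\<integral>x. \<bar>f x - \<theta> x\<bar> \<partial>lborel) + (\<integral>x. f x * s x \<partial>lborel) + q * k"
      using f i\<theta> isx iK by (simp add: k_def)
    also have "(\<integral>x. f x * s x \<partial>lborel) = 0" by (rule cont[OF sc s1])
    finally show ?thesis using \<theta>(3) q(2) by simp
  qed
  then have "I \<le> 0" by (rule field_le_epsilon)
  then have "I = 0" using I by simp
  then have "(\<integral>x. \<bar>f x\<bar> \<partial>lborel) = 0" unfolding I_def .
  then have "AE x in lborel. \<bar>f x\<bar> = 0" using integral_nonneg_eq_0_iff_AE[OF integrable_abs[OF f]] by simp
  then show ?thesis by eventually_elim simp
qed

text \<open>The claim is local. On a small ball, \<open>h\<close> times a bump has compact support
  and is orthogonal to all smooth functions, hence vanishes almost everywhere; inside the ball the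
  bump is positive.\<close>

lemma weakly_zero_imp_AE_0:
  fixes h :: "real^3 => real"
  assumes op: "open \<Omega>" and int: "\<And>K. compact K ==> K \<subseteq> \<Omega> ==> integrable (lebesgue_on K) h"
    and z: "\<And>\<phi>. test_scalar \<Omega> \<phi> ==> integral\<^sup>L (lebesgue_on \<Omega>) (\<lambda>x. h x * \<phi> x) = 0"
  shows "AE x in lborel. x \<in> \<Omega> --> h x = 0"
proof -
  define Z where "Z = {x \<in> \<Omega>. h x \<noteq> 0}"
  have "negligible Z"
    unfolding locally_negligible_alt[of Z]
  proof
    fix p assume "p \<in> Z"
    then have p: "p \<in> \<Omega>" by (simp add: Z_def)
    obtain r where r: "r > 0" "cball p r \<subseteq> \<Omega>" using op p by (meson open_contains_cball)
    have cK: "compact (cball p r)" by simp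
    obtain f where f: "f \<in> borel_measurable borel" "\<And>x. x \<notin> cball p r ==> f x = 0" "AE x in lborel. x \<in> cball p r --> h x = f x"
      by (rule borel_representative[OF borel_measurable_integrable[OF int[OF cK r(2)]] cball_borel]) (rule that)
    have fi: "integrable lborel f"
      using int[OF cK r(2)] lebesgue_on_representative(3)[OF cball_borel f] by simp
    define \<zeta> where "\<zeta> x = bump ((1/r) *\<^sub>R (x - p))" for x
    have \<zeta>s: "smooth \<zeta>" unfolding \<zeta>_def
      by (intro smooth_compose[OF smooth_bump] smooth_scaleR smooth_const smooth_diff smooth_ident)
    have \<zeta>p: "\<zeta> x > 0 \<longleftrightarrow> x \<in> ball p r" for x
      using r(1) by (simp add: \<zeta>_def bump_pos_iff dist_norm norm_minus_commute pos_divide_less_eq)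
    have \<zeta>0: "\<zeta> x = 0" if "x \<notin> cball p r" for x
      using \<zeta>p[of x] that bump_nonneg[of "(1/r) *\<^sub>R (x - p)"] unfolding \<zeta>_def by (auto simp: order_less_le)
    have \<zeta>1: "0 \<le> \<zeta> x" "\<zeta> x \<le> 1" for x by (auto simp: \<zeta>_def bump_le_1)
    have [measurable]: "\<zeta> \<in> borel_measurable borel" "f \<in> borel_measurable borel" using borel_smooth[OF \<zeta>s] f(1) by auto
    have ffi: "integrable lborel (\<lambda>x. f x * \<zeta> x)"
    proof (rule Bochner_Integration.integrable_bound[OF fi])
      show "AE x in lborel. norm (f x * \<zeta> x) \<le> norm (f x)"
        using \<zeta>1 by (intro AE_I2) (simp add: abs_mult mult_left_le)
    qed measurable
    have "AE x in lborel. f x * \<zeta> x = 0"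
    proof (rule orthogonal_to_smooth_imp_AE_0[OF ffi cK])
      show "f x * \<zeta> x = 0" if "x \<notin> cball p r" for x using f(2) that by simp
      fix \<theta> :: "real^3 => real" assume \<theta>: "smooth \<theta>"
      have [measurable]: "\<theta> \<in> borel_measurable borel" by (rule borel_smooth[OF \<theta>])
      have "test_scalar \<Omega> (\<lambda>x. \<zeta> x * \<theta> x)"
        unfolding test_scalar_def using smooth_mult[OF \<zeta>s \<theta>] \<zeta>0 r(2) cK by (auto intro!: exI[of _ "cball p r"])
      then have "0 = integral\<^sup>L (lebesgue_on \<Omega>) (\<lambda>x. h x * (\<zeta> x * \<theta> x))" using z by simp
      also have "\<dots> = (\<integral>x. f x * \<zeta> x * \<theta> x \<partial>lborel)"
      proof (rule lebesgue_on_representative(2))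
        show "\<Omega> \<in> sets borel" using op by simp
        show "(\<lambda>x. f x * \<zeta> x * \<theta> x) \<in> borel_measurable borel" by measurable
        show "f x * \<zeta> x * \<theta> x = 0" if "x \<notin> \<Omega>" for x
        proof -
          have "x \<notin> cball p r" using that r(2) by blast
          from f(2)[OF this] show ?thesis by simp
        qed
        show "AE x in lborel. x \<in> \<Omega> --> h x * (\<zeta> x * \<theta> x) = f x * \<zeta> x * \<theta> x"
          using f(3)
        proof eventually_elim
          case (elim x)
          then show ?case using \<zeta>0[of x] by (cases "x \<in> cball p r") auto
        qed
      qed
      finally show "(\<integral>x. f x * \<zeta> x * \<theta> x \<partial>lborel) = 0" by simp
    qed
    with f(3) have "AE x in lborel. x \<notin> Z \<inter> ball p r"
    proof eventually_elim
      case (elim x)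
      show ?case
      proof
        assume x: "x \<in> Z \<inter> ball p r"
        then have "\<zeta> x > 0" using \<zeta>p by simp
        then have "f x = 0" using elim(2) by simp
        then show False using elim(1) x by (simp add: Z_def)
      qed
    qed
    from AE_completion[OF this] obtain M where M: "\<And>x. x \<in> space lebesgue - M ==> x \<notin> Z \<inter> ball p r" "M \<in> null_sets lebesgue"
      by (rule AE_E3) blast
    have "negligible (Z \<inter> ball p r)"
    proof (rule negligible_subset[of M])
      show "negligible M" using M(2) by (simp add: negligible_iff_null_sets)
      show "Z \<inter> ball p r \<subseteq> M" using M(1) by fastforce
    qed
    moreover have "openin (top_of_set Z) (Z \<inter> ball p r)" by (simp add: openin_open_Int)
    moreover have "p \<in> Z \<inter> ball p r" using \<open>p \<in> Z\<close> r(1) by simp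
    ultimately show "\<exists>U. openin (top_of_set Z) U \<and> p \<in> U \<and> negligible U" by blast
  qed
  then have "Z \<in> null_sets lebesgue" by (simp add: negligible_iff_null_sets)
  then have "AE x in lebesgue. x \<notin> Z" by (rule AE_not_in)
  then have "AE x in lborel. x \<notin> Z" by (simp add: AE_completion_iff)
  then show ?thesis by eventually_elim (auto simp: Z_def)
qed

lemma test_scalar_bounded:
  assumes "test_scalar \<Omega> \<phi>"
  obtains K where "compact K" "K \<subseteq> \<Omega>" "\<And>x. x \<notin> K ==> \<phi> x = 0" "smooth \<phi>"
  using assms by (auto simp: test_scalar_def)

text \<open>Three gradients occur: the one chosen by \<open>wgrad\<close>, the one in
  \<open>in_H01\<close>, and the jointly measurable one of \<open>weak_solution\<close>. This
  identifies them almost everywhere.\<close>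

lemma weak_grad_unique:
  assumes op: "open \<Omega>" and 1: "is_weak_grad \<Omega> f G1" and 2: "is_weak_grad \<Omega> f G2"
  shows "AE x in lborel. x \<in> \<Omega> --> G1 x = G2 x"
proof -
  have i: "integrable (lebesgue_on K) (\<lambda>x. G x $ i $ j)" if "is_weak_grad \<Omega> f G" "compact K" "K \<subseteq> \<Omega>" for G K i j
  proof -
    have "integrable (lebesgue_on K) G" using that by (simp add: is_weak_grad_def)
    then have "integrable (lebesgue_on K) (\<lambda>x. G x $ i)" by (rule integrable_bounded_linear[OF bounded_linear_vec_nth])
    then show ?thesis by (rule integrable_bounded_linear[OF bounded_linear_vec_nth])
  qed
  have ip: "integrable (lebesgue_on \<Omega>) (\<lambda>x. G x $ i $ j * \<phi> x)" if G: "is_weak_grad \<Omega> f G" and \<phi>: "test_scalar \<Omega> \<phi>" for G \<phi> i j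
  proof -
    obtain K where K: "compact K" "K \<subseteq> \<Omega>" "\<And>x. x \<notin> K ==> \<phi> x = 0" "smooth \<phi>" 
      by (rule test_scalar_bounded[OF \<phi>]) (rule that)
    have Kb: "K \<in> sets borel" using K(1) by (simp add: borel_compact)
    obtain g where g: "g \<in> borel_measurable borel" "\<And>x. x \<notin> K ==> g x = 0" "AE x in lborel. x \<in> K --> G x $ i $ j = g x"
      by (rule borel_representative[OF borel_measurable_integrable[OF i[OF G K(1,2), of i j]] Kb]) (rule that)
    have gi: "integrable lborel g" using i[OF G K(1,2), of i j] lebesgue_on_representative(3)[OF Kb g] by simp
    have [measurable]: "\<phi> \<in> borel_measurable borel" "g \<in> borel_measurable borel" using borel_smooth[OF K(4)] g(1) by auto
    have "bounded (\<phi> ` K)" by (intro compact_imp_bounded compact_continuous_image smooth_continuous K)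
    then obtain B where B: "\<And>x. x \<in> K ==> \<bar>\<phi> x\<bar> \<le> B" by (auto simp: bounded_iff)
    have "integrable lborel (\<lambda>x. g x * \<phi> x)"
    proof (rule Bochner_Integration.integrable_bound[where f="\<lambda>x. B * g x"])
      show "AE x in lborel. norm (g x * \<phi> x) \<le> norm (B * g x)"
      proof (intro AE_I2)
        fix x show "norm (g x * \<phi> x) \<le> norm (B * g x)"
        proof (cases "x \<in> K")
          case True
          have "\<bar>\<phi> x\<bar> * \<bar>g x\<bar> \<le> \<bar>B\<bar> * \<bar>g x\<bar>" using B[OF True] by (intro mult_right_mono) auto
          then show ?thesis by (simp add: abs_mult mult.commute)
        qed (simp add: K(3))
      qed
    qed (use gi in auto)
    moreover have "integrable (lebesgue_on \<Omega>) (\<lambda>x. G x $ i $ j * \<phi> x) \<longleftrightarrow> integrable lborel (\<lambda>x. g x * \<phi> x)"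
    proof (rule lebesgue_on_representative(3))
      show "AE x in lborel. x \<in> \<Omega> --> G x $ i $ j * \<phi> x = g x * \<phi> x"
        using g(3)
      proof eventually_elim
        case (elim x)
        then show ?case using K(3)[of x] by (cases "x \<in> K") auto
      qed
      show "g x * \<phi> x = 0" if "x \<notin> \<Omega>" for x using K(2,3) that by auto
    qed (use op in auto)
    ultimately show ?thesis by simp
  qed
  have "AE x in lborel. x \<in> \<Omega> --> G1 x $ i $ j - G2 x $ i $ j = 0" for i j
  proof (rule weakly_zero_imp_AE_0[OF op])
    show "integrable (lebesgue_on K) (\<lambda>x. G1 x $ i $ j - G2 x $ i $ j)" if "compact K" "K \<subseteq> \<Omega>" for K
      using i[OF 1 that] i[OF 2 that] by auto
    fix \<phi> assume \<phi>: "test_scalar \<Omega> \<phi>"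
    have "integral\<^sup>L (lebesgue_on \<Omega>) (\<lambda>x. G1 x $ i $ j * \<phi> x) = integral\<^sup>L (lebesgue_on \<Omega>) (\<lambda>x. G2 x $ i $ j * \<phi> x)"
    proof -
      have "integral\<^sup>L (lebesgue_on \<Omega>) (\<lambda>x. f x $ i * pd j \<phi> x) = - integral\<^sup>L (lebesgue_on \<Omega>) (\<lambda>x. G x $ i $ j * \<phi> x)"
        if "is_weak_grad \<Omega> f G" for G using that \<phi> unfolding is_weak_grad_def by blast
      from this[OF 1] this[OF 2] show ?thesis by simp
    qed
    then show "integral\<^sup>L (lebesgue_on \<Omega>) (\<lambda>x. (G1 x $ i $ j - G2 x $ i $ j) * \<phi> x) = 0"
      using ip[OF 1 \<phi>, of i j] ip[OF 2 \<phi>, of i j] by (simp add: left_diff_distrib)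
  qed
  then have "AE x in lborel. \<forall>i\<in>UNIV. \<forall>j\<in>UNIV. x \<in> \<Omega> --> G1 x $ i $ j - G2 x $ i $ j = 0"
    by (intro AE_finite_allI) auto
  then show ?thesis by eventually_elim (auto simp: vec_eq_iff)
qed

section \<open>Passing to the limit in the weak form\<close>

lemma divide_times_cancel: "y \<noteq> 0 ==> x / y * y = (x::real)" by simp

text \<open>Truncating the values first reduces the claim to bounded fields, which
  \<open>bounded_dense_L2\<close> can approximate.\<close>

lemma L2_dense:
  fixes \<theta> :: "real^3 => real^3"
  assumes O: "open \<Omega>" "bounded \<Omega>" and \<theta>: "sqi lborel \<theta>" "\<And>x. x \<notin> \<Omega> ==> \<theta> x = 0" and e: "e > 0"
  obtains g where "continuous_on UNIV g" "bsupp g" "n2 lborel (\<lambda>x. \<theta> x - g x) < e"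
proof -
  have [measurable]: "\<theta> \<in> borel_measurable borel" using sqi_meas[OF \<theta>(1)] by simp
  define \<theta>n where "\<theta>n n x = (if norm (\<theta> x) \<le> real n then \<theta> x else 0)" for n x
  have [measurable]: "\<theta>n n \<in> borel_measurable borel" for n unfolding \<theta>n_def by measurable
  have "(\<lambda>n. \<integral>x. (norm (\<theta> x - \<theta>n n x))\<^sup>2 \<partial>lborel) \<longlonglongrightarrow> (\<integral>(x::real^3). 0 \<partial>lborel)"
  proof (rule integral_dominated_convergence[where w="\<lambda>x. (norm (\<theta> x))\<^sup>2"])
    show "AE x in lborel. (\<lambda>n. (norm (\<theta> x - \<theta>n n x))\<^sup>2) \<longlonglongrightarrow> 0"
    proof (intro AE_I2)
      fix x
      obtain N where N: "norm (\<theta> x) \<le> real N" using real_arch_simple by blast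
      have "\<forall>\<^sub>F n in sequentially. 0 = (norm (\<theta> x - \<theta>n n x))\<^sup>2"
        unfolding eventually_sequentially using N by (intro exI[of _ N]) (auto simp: \<theta>n_def)
      then show "(\<lambda>n. (norm (\<theta> x - \<theta>n n x))\<^sup>2) \<longlonglongrightarrow> 0" by (rule Lim_transform_eventually[OF tendsto_const])
    qed
    show "AE x in lborel. norm ((norm (\<theta> x - \<theta>n n x))\<^sup>2) \<le> (norm (\<theta> x))\<^sup>2" for n
      by (intro AE_I2) (simp add: \<theta>n_def)
  qed (use \<theta>(1) in \<open>auto simp: sqi_def\<close>)
  then have "(\<lambda>n. \<integral>x. (norm (\<theta> x - \<theta>n n x))\<^sup>2 \<partial>lborel) \<longlonglongrightarrow> 0" by simp
  moreover have e4: "(e/2)\<^sup>2 > 0" using e by simp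
  ultimately have "\<forall>\<^sub>F n in sequentially. (\<integral>x. (norm (\<theta> x - \<theta>n n x))\<^sup>2 \<partial>lborel) < (e/2)\<^sup>2"
    by (rule order_tendstoD(2))
  then obtain n where n: "(\<integral>x. (norm (\<theta> x - \<theta>n n x))\<^sup>2 \<partial>lborel) < (e/2)\<^sup>2"
    using eventually_happens'[OF sequentially_bot] by blast
  have sn: "sqi lborel (\<theta>n n)"
    by (rule sqi_bound[OF sqi_integrable[OF \<theta>(1)]]) (auto simp: \<theta>n_def)
  have "integrable lborel (\<theta>n n)"
    by (rule bounded_support_L1_le(1)[OF sn _ O]) (simp add: \<theta>n_def \<theta>(2))
  moreover have "norm (\<theta>n n x) \<le> real n" for x by (simp add: \<theta>n_def)
  ultimately obtain g where g: "continuous_on UNIV g" "bsupp g" "(\<integral>x. (norm (\<theta>n n x - g x))\<^sup>2 \<partial>lborel) < (e/2)\<^sup>2"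
    using e4 by (rule bounded_dense_L2)
  have lt: "n2 lborel f < e/2" if "(\<integral>x. (norm (f x))\<^sup>2 \<partial>lborel) < (e/2)\<^sup>2" for f :: "real^3 => real^3"
    by (rule power_less_imp_less_base[of _ 2]) (use that e in \<open>simp_all add: n2_sq\<close>)
  have sg: "sqi lborel g" by (rule sqi_bsupp[OF g(1,2)])
  have "n2 lborel (\<lambda>x. \<theta> x - g x) \<le> n2 lborel (\<lambda>x. \<theta> x - \<theta>n n x) + n2 lborel (\<lambda>x. \<theta>n n x - g x)"
    by (rule n2_triangle_diff[OF \<theta>(1) sn sg])
  also have "\<dots> < e/2 + e/2" by (rule add_strict_mono[OF lt[OF n] lt[OF g(3)]])
  finally show ?thesis using that[OF g(1,2)] by simp
qed

text \<open>Continuous fields of bounded support are dense in L^2 and the sequence is bounded there,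
  so the convergence carries over to all \<theta> in L^2.\<close>

lemma weak_pairing_L2:
  fixes \<theta> v :: "real^3 => real^3"
  assumes O: "open \<Omega>" "bounded \<Omega>" and w: "\<And>k. sqi lborel (w k)" "\<And>k. n2 lborel (w k) \<le> M" and v: "sqi lborel v"
    and wk: "\<And>\<theta>. continuous_on UNIV \<theta> ==> bsupp \<theta> ==> (\<lambda>k. \<integral>x. \<theta> x \<bullet> w k x \<partial>lborel) \<longlonglongrightarrow> (\<integral>x. \<theta> x \<bullet> v x \<partial>lborel)"
    and \<theta>: "sqi lborel \<theta>" "\<And>x. x \<notin> \<Omega> ==> \<theta> x = 0"
  shows "(\<lambda>k. \<integral>x. \<theta> x \<bullet> w k x \<partial>lborel) \<longlonglongrightarrow> (\<integral>x. \<theta> x \<bullet> v x \<partial>lborel)"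
proof (rule LIMSEQ_I)
  fix r :: real assume r: "r > 0"
  define Q where "Q = M + n2 lborel v + 1"
  have "0 \<le> M" using w(2)[of 0] n2_nonneg order_trans by blast
  then have Q: "Q > 0" "M + n2 lborel v \<le> Q" using n2_nonneg[of lborel v] unfolding Q_def by linarith+
  have rQ: "r / 2 / Q > 0" using r Q by simp
  obtain g where g: "continuous_on UNIV g" "bsupp g" "n2 lborel (\<lambda>x. \<theta> x - g x) < r / 2 / Q"
    by (rule L2_dense[OF O \<theta>(1) _ rQ]) (erule \<theta>(2), rule that)
  have sg: "sqi lborel g" by (rule sqi_bsupp[OF g(1,2)])
  have sd: "sqi lborel (\<lambda>x. \<theta> x - g x)" by (rule sqi_diff[OF \<theta>(1) sg])
  have "\<forall>\<^sub>F k in sequentially. dist (\<integral>x. g x \<bullet> w k x \<partial>lborel) (\<integral>x. g x \<bullet> v x \<partial>lborel) < r / 2"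
    using wk[OF g(1,2)] r by (intro tendstoD) auto
  then have "\<forall>\<^sub>F k in sequentially. norm ((\<integral>x. \<theta> x \<bullet> w k x \<partial>lborel) - (\<integral>x. \<theta> x \<bullet> v x \<partial>lborel)) < r"
  proof eventually_elim
    case (elim k)
    have s: "(\<integral>x. \<theta> x \<bullet> f x \<partial>lborel) = (\<integral>x. (\<theta> x - g x) \<bullet> f x \<partial>lborel) + (\<integral>x. g x \<bullet> f x \<partial>lborel)" if "sqi lborel f" for f
      using sqi_inner[OF \<theta>(1) that] sqi_inner[OF sg that] by (simp add: inner_diff_left)
    have 1: "\<bar>\<integral>x. (\<theta> x - g x) \<bullet> w k x \<partial>lborel\<bar> \<le> n2 lborel (\<lambda>x. \<theta> x - g x) * M"
      using n2_Cauchy_Schwarz[OF sd w(1)[of k]] mult_left_mono[OF w(2)[of k] n2_nonneg[of lborel "\<lambda>x. \<theta> x - g x"]] by linarith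
    have 2: "\<bar>\<integral>x. (\<theta> x - g x) \<bullet> v x \<partial>lborel\<bar> \<le> n2 lborel (\<lambda>x. \<theta> x - g x) * n2 lborel v"
      by (rule n2_Cauchy_Schwarz[OF sd v])
    have "n2 lborel (\<lambda>x. \<theta> x - g x) * M + n2 lborel (\<lambda>x. \<theta> x - g x) * n2 lborel v \<le> n2 lborel (\<lambda>x. \<theta> x - g x) * Q"
      unfolding distrib_left[symmetric] by (rule mult_left_mono[OF Q(2)]) simp
    also have "\<dots> < r / 2 / Q * Q" by (rule mult_strict_right_mono[OF g(3) Q(1)])
    also have "r / 2 / Q * Q = r / 2" using Q(1) by simp
    finally have 3: "n2 lborel (\<lambda>x. \<theta> x - g x) * M + n2 lborel (\<lambda>x. \<theta> x - g x) * n2 lborel v < r / 2" .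
    show ?case using 1 2 3 elim unfolding s[OF w(1)] s[OF v] dist_real_def real_norm_def by linarith
  qed
  then show "\<exists>no. \<forall>n\<ge>no. norm ((\<integral>x. \<theta> x \<bullet> w n x \<partial>lborel) - (\<integral>x. \<theta> x \<bullet> v x \<partial>lborel)) < r"
    by (simp add: eventually_sequentially)
qed

text \<open>The vector paired with \<phi> in the convective and damping terms. For the solution it
  lies in L^(4/3) but in general not in L^2, so these terms need another limit argument than the
  viscous one.\<close>

definition hv :: "real => real^3 => real^3^3 => real^3" where
  "hv \<beta> a B = (\<chi> i. (\<Sum>j\<in>UNIV. a $ j * B $ i $ j)) + (\<beta> * (norm a)\<^sup>2) *\<^sub>R a"

lemma hv_inner: "hv \<beta> a B \<bullet> \<phi> = kk 0 \<beta> a B \<phi> 0"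
  by (simp add: hv_def kk_def tri_def inner_add_left) (simp add: inner_vec_def)

lemma kk_split: "kk \<mu> \<beta> a B \<phi> A = \<mu> * (B \<bullet> A) + hv \<beta> a B \<bullet> \<phi>"
  by (simp add: hv_inner kk_def)

lemma hv_measurable [measurable (raw)]:
  assumes [measurable]: "a \<in> borel_measurable M" "B \<in> borel_measurable M"
  shows "(\<lambda>x. hv \<beta> (a x) (B x)) \<in> borel_measurable M"
proof (subst borel_measurable_euclidean_space, intro ballI)
  fix i :: "real^3"
  have "(\<lambda>x. kk 0 \<beta> (a x) (B x) i 0) \<in> borel_measurable M" by measurable
  then show "(\<lambda>x. hv \<beta> (a x) (B x) \<bullet> i) \<in> borel_measurable M" by (simp add: hv_inner)
qed

text \<open>\<open>kk_abs\<close> is tested with \<open>hv \<beta> a B\<close> itself, and one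
  factor of its norm is cancelled.\<close>

lemma hv_bound:
  assumes "norm a \<le> M" "norm B \<le> M" shows "norm (hv \<beta> a B) \<le> M * M + M\<^sup>2 * (\<bar>\<beta>\<bar> * M)"
proof (cases "hv \<beta> a B = 0")
  case True
  have "0 \<le> M" using assms(1) norm_ge_zero order_trans by blast
  then show ?thesis using True by simp
next
  case False
  let ?h = "hv \<beta> a B"
  have M: "0 \<le> M" using assms(1) norm_ge_zero order_trans by blast
  have "norm ?h * norm ?h = ?h \<bullet> ?h" by (simp add: dot_square_norm power2_eq_square)
  also have "\<dots> \<le> norm B * (norm a * norm ?h) + (norm a)\<^sup>2 * (\<bar>\<beta>\<bar> * (norm a * norm ?h))"
    unfolding hv_inner[of \<beta> a B ?h] using kk_abs[of 0 \<beta> a B ?h 0] by simp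
  also have "\<dots> \<le> M * (M * norm ?h) + M\<^sup>2 * (\<bar>\<beta>\<bar> * (M * norm ?h))"
    using assms M by (intro add_mono mult_mono mult_left_mono mult_right_mono power_mono mult_nonneg_nonneg) auto
  also have "\<dots> = (M * M + M\<^sup>2 * (\<bar>\<beta>\<bar> * M)) * norm ?h" by (simp add: algebra_simps)
  finally show ?thesis using False by simp
qed

text \<open>In contrast to \<open>kk_bound\<close> the small weight is on the test field. It comes
  from scaling: the left side is linear in \<phi> and the bound quartic, so replacing \<phi> by
  \<open>s *\<^sub>R \<phi>\<close> gains a factor \<open>s^3\<close>.\<close>

lemma kk0_scaled_bound:
  assumes "e > 0"
  obtains C where "C \<ge> 0" "\<And>a B \<phi>. \<bar>hv \<beta> a B \<bullet> \<phi>\<bar> \<le> C * (norm a ^ 4 + (norm B)\<^sup>2) + e * norm \<phi> ^ 4"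
proof -
  obtain C where C: "C \<ge> 0" "\<And>a B \<phi> A. \<bar>kk 0 \<beta> a B \<phi> A\<bar> \<le> 1 * (norm a ^ 4 + (norm B)\<^sup>2) + C * (norm \<phi> ^ 4 + (norm A)\<^sup>2)"
    by (rule kk_bound[of 1]) (simp, rule that)
  define s where "s = min 1 (e / (C + 1))"
  have s: "0 < s" "s \<le> 1" "s \<le> e / (C + 1)" using assms C by (auto simp: s_def)
  have Cs: "C * s^3 \<le> e"
  proof -
    have "s^3 \<le> s^1" using s by (intro power_decreasing) auto
    then have "s^3 \<le> s" by simp
    then have "C * s^3 \<le> (C + 1) * s" using C(1) s by (intro mult_mono) auto
    also have "\<dots> \<le> e" using s(3) C(1) by (simp add: pos_le_divide_eq mult.commute)
    finally show ?thesis .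
  qed
  show ?thesis
  proof (rule that[of "1 / s"])
    fix a \<phi> :: "real^3" and B :: "real^3^3"
    have s3: "s^4 = s * s^3" by (simp add: power_numeral_reduce)
    have "s * \<bar>hv \<beta> a B \<bullet> \<phi>\<bar> = \<bar>kk 0 \<beta> a B (s *\<^sub>R \<phi>) 0\<bar>"
      unfolding hv_inner[symmetric] using s by (simp add: abs_mult)
    also have "\<dots> \<le> (norm a ^ 4 + (norm B)\<^sup>2) + C * (s^4 * norm \<phi> ^ 4)"
      using C(2)[of a B "s *\<^sub>R \<phi>" 0] s by (simp add: power_mult_distrib)
    also have "\<dots> = s * (1 / s * (norm a ^ 4 + (norm B)\<^sup>2) + C * s^3 * norm \<phi> ^ 4)"
      using s(1) unfolding s3 by (simp add: distrib_left)
    finally have "\<bar>hv \<beta> a B \<bullet> \<phi>\<bar> \<le> 1 / s * (norm a ^ 4 + (norm B)\<^sup>2) + C * s^3 * norm \<phi> ^ 4"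
      using s(1) by (simp only: mult_le_cancel_left_pos)
    also have "\<dots> \<le> 1 / s * (norm a ^ 4 + (norm B)\<^sup>2) + e * norm \<phi> ^ 4"
      using Cs by (intro add_left_mono mult_right_mono) auto
    finally show "\<bar>hv \<beta> a B \<bullet> \<phi>\<bar> \<le> 1 / s * (norm a ^ 4 + (norm B)\<^sup>2) + e * norm \<phi> ^ 4" .
  qed (use s in simp)
qed

text \<open>\<open>hv\<close> is truncated to the set \<open>X n\<close> where \<open>a\<close> and
  \<open>B\<close> are at most \<open>n\<close>: there it is bounded, so weak convergence in L^2
  applies. The rest is small uniformly in \<open>k\<close>, since the integral of \<open>D\<close>
  over the complement is small and the L^4 norms of \<open>w k\<close> are bounded.\<close>

lemma weak_pairing_L4:
  fixes v a :: "real^3 => real^3" and B :: "real^3 => real^3^3"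
  assumes O: "open \<Omega>" "bounded \<Omega>" and w: "\<And>k. sqi lborel (w k)" "\<And>k. n2 lborel (w k) \<le> M"
    "\<And>k. integrable lborel (\<lambda>x. norm (w k x) ^ 4)" "\<And>k. (\<integral>x. norm (w k x) ^ 4 \<partial>lborel) \<le> K"
    and v: "sqi lborel v" "integrable lborel (\<lambda>x. norm (v x) ^ 4)"
    and wk: "\<And>\<theta>. continuous_on UNIV \<theta> ==> bsupp \<theta> ==> (\<lambda>k. \<integral>x. \<theta> x \<bullet> w k x \<partial>lborel) \<longlonglongrightarrow> (\<integral>x. \<theta> x \<bullet> v x \<partial>lborel)"
    and m[measurable]: "a \<in> borel_measurable borel" "B \<in> borel_measurable borel"
    and z: "\<And>x. x \<notin> \<Omega> ==> a x = 0" "\<And>x. x \<notin> \<Omega> ==> B x = 0"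
    and i: "integrable lborel (\<lambda>x. norm (a x) ^ 4)" "integrable lborel (\<lambda>x. (norm (B x))\<^sup>2)"
  shows "(\<lambda>k. \<integral>x. hv \<beta> (a x) (B x) \<bullet> w k x \<partial>lborel) \<longlonglongrightarrow> (\<integral>x. hv \<beta> (a x) (B x) \<bullet> v x \<partial>lborel)"
proof (rule LIMSEQ_I)
  fix r :: real assume r: "r > 0"
  define h where "h x = hv \<beta> (a x) (B x)" for x
  define D where "D x = norm (a x) ^ 4 + (norm (B x))\<^sup>2" for x
  have hm[measurable]: "h \<in> borel_measurable borel" unfolding h_def by measurable
  have D: "integrable lborel D" "\<And>x. D x \<ge> 0" unfolding D_def using i by auto
  define Kv where "Kv = (\<integral>x. norm (v x) ^ 4 \<partial>lborel)"
  have Kv: "Kv \<ge> 0" by (simp add: Kv_def)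
  have "0 \<le> (\<integral>x. norm (w 0 x) ^ 4 \<partial>lborel)" by (intro integral_nonneg_AE AE_I2) simp
  then have K: "K \<ge> 0" using w(4)[of 0] by linarith
  define e where "e = r / 4 / (K + Kv + 1)"
  have P: "K + Kv + 1 > 0" using K Kv by simp
  have e: "e > 0" using r P by (simp add: e_def)
  have eK: "e * (K + Kv) \<le> r / 4"
  proof -
    have "e * (K + Kv) \<le> e * (K + Kv + 1)" using e by simp
    also have "\<dots> = r / 4" unfolding e_def by (rule divide_times_cancel) (use P in linarith)
    finally show ?thesis .
  qed
  obtain C where C: "C \<ge> 0" "\<And>a B \<phi>. \<bar>hv \<beta> a B \<bullet> \<phi>\<bar> \<le> C * (norm a ^ 4 + (norm B)\<^sup>2) + e * norm \<phi> ^ 4"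
    by (rule kk0_scaled_bound[OF e]) (rule that)
  define X where "X n = {x. norm (a x) \<le> real n \<and> norm (B x) \<le> real n}" for n :: nat
  have [measurable]: "X n \<in> sets borel" for n unfolding X_def by measurable
  have iX: "integrable lborel (\<lambda>x. indicator (- X n) x * D x)" for n
    using integrable_mult_indicator[OF _ D(1), of "- X n"] by simp
  have "(\<lambda>n. \<integral>x. indicator (- X n) x * D x \<partial>lborel) \<longlonglongrightarrow> (\<integral>(x::real^3). 0 \<partial>lborel)"
  proof (rule integral_dominated_convergence[where w=D])
    show "AE x in lborel. (\<lambda>n. indicator (- X n) x * D x) \<longlonglongrightarrow> 0"
    proof (intro AE_I2)
      fix x
      obtain N where N: "max (norm (a x)) (norm (B x)) \<le> real N" using real_arch_simple by blast
      have "\<forall>\<^sub>F n in sequentially. 0 = indicator (- X n) x * D x"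
        unfolding eventually_sequentially using N by (intro exI[of _ N]) (auto simp: X_def indicator_def)
      then show "(\<lambda>n. indicator (- X n) x * D x) \<longlonglongrightarrow> 0" by (rule Lim_transform_eventually[OF tendsto_const])
    qed
    show "AE x in lborel. norm (indicator (- X n) x * D x) \<le> D x" for n
      using D(2) by (intro AE_I2) (auto simp: indicator_def)
  qed (use D iX in auto)
  then have lim: "(\<lambda>n. \<integral>x. indicator (- X n) x * D x \<partial>lborel) \<longlonglongrightarrow> 0" by simp
  \<comment> \<open>The remainder occurs for \<open>w k\<close> and for \<open>v\<close>: r/8 for
    each, r/4 from the weight \<open>e\<close> and less than r/2 from the truncated part add up to
    less than \<open>r\<close>.\<close>
  define q where "q = r / 8 / (C + 1)"
  have q: "q > 0" using r C by (simp add: q_def)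
  have qC: "C * q \<le> r / 8"
  proof -
    have "C * q \<le> (C + 1) * q" using q by simp
    also have "\<dots> = r / 8" unfolding q_def mult.commute[of "C + 1"]
      by (rule divide_times_cancel) (use C(1) in linarith)
    finally show ?thesis .
  qed
  from order_tendstoD(2)[OF lim q] obtain n where n: "(\<integral>x. indicator (- X n) x * D x \<partial>lborel) < q"
    using eventually_happens'[OF sequentially_bot] by blast
  define hn where "hn x = indicator (X n) x *\<^sub>R h x" for x
  have hz: "h x = 0" if "x \<notin> \<Omega>" for x using z[OF that] by (simp add: h_def hv_def vec_eq_iff)
  have hnm[measurable]: "hn \<in> borel_measurable borel" unfolding hn_def by measurable
  define Bd where "Bd = real n * real n + (real n)\<^sup>2 * (\<bar>\<beta>\<bar> * real n)"
  have hb: "norm (hn x) \<le> Bd" for x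
    using hv_bound[of "a x" "real n" "B x" \<beta>] by (auto simp: hn_def indicator_def X_def h_def Bd_def)
  have shn: "sqi lborel hn"
  proof (rule sqi_bound)
    show "integrable lborel (\<lambda>x. indicat_real \<Omega> x * Bd\<^sup>2)"
      using O emeasure_bounded_finite[OF O(2)] by (auto simp: integrable_indicator_iff)
    show "(norm (hn x))\<^sup>2 \<le> indicat_real \<Omega> x * Bd\<^sup>2" for x
      using hb[of x] hz[of x] by (cases "x \<in> \<Omega>") (auto simp: hn_def intro: power_mono)
  qed simp
  have rest: "\<bar>(\<integral>x. h x \<bullet> f x \<partial>lborel) - (\<integral>x. hn x \<bullet> f x \<partial>lborel)\<bar> \<le> C * q + e * (\<integral>x. norm (f x) ^ 4 \<partial>lborel)"
    if f: "sqi lborel f" "integrable lborel (\<lambda>x. norm (f x) ^ 4)" for f :: "real^3 => real^3"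
  proof -
    have [measurable]: "f \<in> borel_measurable borel" using sqi_meas[OF f(1)] by simp
    have ih: "integrable lborel (\<lambda>x. h x \<bullet> f x)"
    proof (rule Bochner_Integration.integrable_bound)
      show "integrable lborel (\<lambda>x. C * D x + e * norm (f x) ^ 4)" using D f by auto
      show "AE x in lborel. norm (h x \<bullet> f x) \<le> norm (C * D x + e * norm (f x) ^ 4)"
        unfolding real_norm_def h_def D_def by (intro AE_I2 order_trans[OF C(2) abs_ge_self])
    qed measurable
    have ihn: "integrable lborel (\<lambda>x. hn x \<bullet> f x)" by (rule sqi_inner[OF shn f(1)])
    have "\<bar>(\<integral>x. h x \<bullet> f x \<partial>lborel) - (\<integral>x. hn x \<bullet> f x \<partial>lborel)\<bar> = norm (\<integral>x. h x \<bullet> f x - hn x \<bullet> f x \<partial>lborel)"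
      using ih ihn by simp
    also have "\<dots> \<le> (\<integral>x. norm (h x \<bullet> f x - hn x \<bullet> f x) \<partial>lborel)" by (rule integral_norm_bound)
    also have "\<dots> \<le> (\<integral>x. C * (indicator (- X n) x * D x) + e * norm (f x) ^ 4 \<partial>lborel)"
    proof (rule Bochner_Integration.integral_mono)
      show "integrable lborel (\<lambda>x. norm (h x \<bullet> f x - hn x \<bullet> f x))" using ih ihn by auto
      show "integrable lborel (\<lambda>x. C * (indicator (- X n) x * D x) + e * norm (f x) ^ 4)" using iX f by auto
      fix x show "norm (h x \<bullet> f x - hn x \<bullet> f x) \<le> C * (indicator (- X n) x * D x) + e * norm (f x) ^ 4"
        using C(2)[of "a x" "B x" "f x"] e by (cases "x \<in> X n") (auto simp: hn_def h_def D_def)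
    qed
    also have "\<dots> = C * (\<integral>x. indicator (- X n) x * D x \<partial>lborel) + e * (\<integral>x. norm (f x) ^ 4 \<partial>lborel)"
      using iX f by simp
    also have "\<dots> \<le> C * q + e * (\<integral>x. norm (f x) ^ 4 \<partial>lborel)" using n C(1) by (intro add_right_mono mult_left_mono) auto
    finally show ?thesis .
  qed
  have "(\<lambda>k. \<integral>x. hn x \<bullet> w k x \<partial>lborel) \<longlonglongrightarrow> (\<integral>x. hn x \<bullet> v x \<partial>lborel)"
    by (rule weak_pairing_L2[OF O w(1,2) v(1) wk shn]) (simp_all add: hn_def hz)
  then have "\<forall>\<^sub>F k in sequentially. dist (\<integral>x. hn x \<bullet> w k x \<partial>lborel) (\<integral>x. hn x \<bullet> v x \<partial>lborel) < r / 2"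
    using r by (intro tendstoD) auto
  then have "\<forall>\<^sub>F k in sequentially. norm ((\<integral>x. h x \<bullet> w k x \<partial>lborel) - (\<integral>x. h x \<bullet> v x \<partial>lborel)) < r"
  proof eventually_elim
    case (elim k)
    have "e * (\<integral>x. norm (w k x) ^ 4 \<partial>lborel) \<le> e * K" using w(4)[of k] e by (intro mult_left_mono) auto
    then show ?case
      using elim rest[OF w(1)[of k] w(3)[of k]] rest[OF v] eK qC
      unfolding dist_real_def real_norm_def Kv_def[symmetric] distrib_left by linarith
  qed
  then show "\<exists>no. \<forall>n\<ge>no. norm ((\<integral>x. hv \<beta> (a x) (B x) \<bullet> w n x \<partial>lborel) - (\<integral>x. hv \<beta> (a x) (B x) \<bullet> v x \<partial>lborel)) < r"
    unfolding h_def by (simp add: eventually_sequentially)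
qed

subsection \<open>Gradients\<close>

definition lap :: "(real^3 => real^3) => real^3 => real^3" where
  "lap \<psi> x = (\<Sum>j\<in>UNIV. dd (axis j 1) (\<lambda>y. dd (axis j 1) \<psi> y) x)"

lemma lap_smooth: "smooth \<psi> ==> smooth (lap \<psi>)"
  unfolding lap_def by (intro smooth_sum smooth_dd)

lemma lap_bsupp:
  assumes "bsupp \<psi>" shows "bsupp (lap \<psi>)"
proof -
  have "bsupp (\<lambda>x. \<Sum>j\<in>J. dd (axis j 1) (\<lambda>y. dd (axis j 1) \<psi> y) x)" if "finite J" for J :: "3 set"
    using that
  proof (induction J rule: finite_induct)
    case empty
    show ?case by (simp add: bsupp_def)
  next
    case (insert j J)
    then show ?case using bsupp_add[OF bsupp_dd[OF bsupp_dd[OF assms]] insert.IH, of "\<lambda>_. axis j 1" "\<lambda>_. axis j 1"] by simp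
  qed
  then show ?thesis unfolding lap_def by simp
qed

lemma jac_inner: "smooth f ==> smooth h ==> jac f x \<bullet> jac h x = (\<Sum>j\<in>UNIV. dd (axis j 1) f x \<bullet> dd (axis j 1) h x)"
  unfolding inner_vec_def by (subst sum.swap) (simp add: jac_nth)

text \<open>Moving the derivatives onto the fixed field \<psi> turns a pairing of gradients into a
  pairing with \<open>lap \<psi>\<close>, against which weak convergence is known.\<close>

lemma jac_lap:
  assumes \<psi>: "smooth \<psi>" "bsupp \<psi>" and w: "smooth w"
  shows "(\<integral>x. jac \<psi> x \<bullet> jac w x \<partial>lborel) = - (\<integral>x. lap \<psi> x \<bullet> w x \<partial>lborel)"
proof -
  define p where "p j x = dd (axis j 1) \<psi> x \<bullet> w x" for j x
  have ps: "smooth (p j)" for j unfolding p_def by (intro smooth_inner smooth_dd \<psi> w)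
  have pb: "bsupp (p j)" for j using bsupp_dd[OF \<psi>(2), of "\<lambda>_. axis j 1"] unfolding p_def bsupp_def by fastforce
  have pd: "dd (axis j 1) (p j) x = dd (axis j 1) \<psi> x \<bullet> dd (axis j 1) w x + dd (axis j 1) (\<lambda>y. dd (axis j 1) \<psi> y) x \<bullet> w x" for j x
    unfolding p_def
    by (rule dd_eqI[OF has_derivative_inner[OF smooth_has_derivative[OF smooth_dd[OF \<psi>(1)]] smooth_has_derivative[OF w]]])
  have i: "integrable lborel (\<lambda>x. dd (axis j 1) (p j) x)" for j
    by (intro integrable_bsupp smooth_continuous smooth_dd bsupp_dd ps pb)
  have il: "integrable lborel (\<lambda>x. lap \<psi> x \<bullet> w x)"
  proof (rule integrable_bsupp)
    show "continuous_on UNIV (\<lambda>x. lap \<psi> x \<bullet> w x)" by (intro smooth_continuous smooth_inner lap_smooth \<psi> w)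
    show "bsupp (\<lambda>x. lap \<psi> x \<bullet> w x)" using lap_bsupp[OF \<psi>(2)] unfolding bsupp_def by fastforce
  qed
  have eq: "jac \<psi> x \<bullet> jac w x = (\<Sum>j\<in>UNIV. dd (axis j 1) (p j) x) - lap \<psi> x \<bullet> w x" for x
    unfolding pd jac_inner[OF \<psi>(1) w] lap_def by (simp add: sum.distrib inner_sum_left)
  have isx: "integrable lborel (\<lambda>x. \<Sum>j\<in>(UNIV::3 set). dd (axis j 1) (p j) x)" by (intro Bochner_Integration.integrable_sum i)
  have "(\<integral>x. jac \<psi> x \<bullet> jac w x \<partial>lborel) = (\<integral>x. (\<Sum>j\<in>UNIV. dd (axis j 1) (p j) x) \<partial>lborel) - (\<integral>x. lap \<psi> x \<bullet> w x \<partial>lborel)"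
    unfolding eq by (rule Bochner_Integration.integral_diff[OF isx il])
  also have "(\<integral>x. (\<Sum>j\<in>UNIV. dd (axis j 1) (p j) x) \<partial>lborel) = 0"
    using i integral_dd_eq_0[OF ps pb] by (simp add: Bochner_Integration.integral_sum)
  finally show ?thesis by simp
qed

lemma test_vec_dd_nth:
  assumes "test_vec \<Omega> \<psi>" shows "test_scalar \<Omega> (\<lambda>x. dd (axis j 1) \<psi> x $ i)"
proof -
  obtain K where K: "smooth \<psi>" "compact K" "K \<subseteq> \<Omega>" "\<And>x. x \<notin> K ==> \<psi> x = 0"
    using assms by (auto simp: test_vec_def)
  have "dd (axis j 1) \<psi> x = 0" if "x \<notin> K" for x
    by (rule dd_eq_0[of "- K"]) (use that K compact_imp_closed[OF K(2)] in auto)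
  then show ?thesis unfolding test_scalar_def
    using K by (auto intro!: smooth_vec_nth smooth_dd exI[of _ K])
qed

lemma jac_weak_grad:
  assumes \<psi>: "test_vec \<Omega> \<psi>" and v: "sqi lborel v" and A: "sqi lborel A"
    and wg: "\<And>\<phi> i j. test_scalar \<Omega> \<phi> ==> (\<integral>x. v x $ i * pd j \<phi> x \<partial>lborel) = - (\<integral>x. A x $ i $ j * \<phi> x \<partial>lborel)"
  shows "(\<integral>x. jac \<psi> x \<bullet> A x \<partial>lborel) = - (\<integral>x. lap \<psi> x \<bullet> v x \<partial>lborel)"
proof -
  note s = test_vec_smooth[OF \<psi>]
  have sv: "sqi lborel (\<lambda>x. v x $ i)" for i
    by (rule sqi_bound[OF sqi_integrable[OF v]])
      (use sqi_meas[OF v] component_le_norm_cart[of "v x" i for x] in \<open>auto intro!: power_mono simp: power2_le_iff_abs_le\<close>)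
  have sA: "sqi lborel (\<lambda>x. A x $ i $ j)" for i j
  proof (rule sqi_bound[OF sqi_integrable[OF A]])
    show "(\<lambda>x. A x $ i $ j) \<in> borel_measurable lborel" using sqi_meas[OF A] by measurable
    fix x
    have "\<bar>A x $ i $ j\<bar> \<le> norm (A x)"
      using component_le_norm_cart[of "A x $ i" j] Finite_Cartesian_Product.norm_nth_le[of "A x" i] by linarith
    then show "(norm (A x $ i $ j))\<^sup>2 \<le> (norm (A x))\<^sup>2" unfolding real_norm_def by (intro power_mono) auto
  qed
  have sp: "sqi lborel (\<lambda>x. dd (axis j 1) \<psi> x $ i)" "sqi lborel (\<lambda>x. dd (axis j 1) (\<lambda>y. dd (axis j 1) \<psi> y) x $ i)" for i j
  proof -
    have 1: "bsupp (\<lambda>x. dd (axis j 1) \<psi> x)" by (rule bsupp_dd[OF s(2)])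
    have 2: "bsupp (\<lambda>x. dd (axis j 1) (\<lambda>y. dd (axis j 1) \<psi> y) x)" by (rule bsupp_dd[OF 1])
    have b: "bsupp (\<lambda>x. f x $ i)" if "bsupp f" for f :: "real^3 => real^3" using that unfolding bsupp_def by (metis zero_index)
    show "sqi lborel (\<lambda>x. dd (axis j 1) \<psi> x $ i)"
      by (intro sqi_bsupp smooth_continuous smooth_vec_nth smooth_dd s b 1)
    show "sqi lborel (\<lambda>x. dd (axis j 1) (\<lambda>y. dd (axis j 1) \<psi> y) x $ i)"
      by (intro sqi_bsupp smooth_continuous smooth_vec_nth smooth_dd s b 2)
  qed
  have i1: "integrable lborel (\<lambda>x. dd (axis j 1) \<psi> x $ i * A x $ i $ j)" for i j
    using sqi_inner[OF sp(1)[of j i] sA[of i j]] by simp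
  have i2: "integrable lborel (\<lambda>x. dd (axis j 1) (\<lambda>y. dd (axis j 1) \<psi> y) x $ i * v x $ i)" for i j
    using sqi_inner[OF sp(2)[of j i] sv[of i]] by simp
  have c: "(\<integral>x. dd (axis j 1) \<psi> x $ i * A x $ i $ j \<partial>lborel) = - (\<integral>x. dd (axis j 1) (\<lambda>y. dd (axis j 1) \<psi> y) x $ i * v x $ i \<partial>lborel)" for i j
  proof -
    have "pd j (\<lambda>x. dd (axis j 1) \<psi> x $ i) x = dd (axis j 1) (\<lambda>y. dd (axis j 1) \<psi> y) x $ i" for x
      using smooth_differentiable[OF smooth_dd[OF s(1)]]
      by (subst pd_eq_dd) (auto intro!: smooth_differentiable smooth_vec_nth smooth_dd s dd_nth)
    then show ?thesis using wg[OF test_vec_dd_nth[OF \<psi>, of j i], of i j] by (simp add: mult.commute)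
  qed
  have "(\<integral>x. jac \<psi> x \<bullet> A x \<partial>lborel) = (\<integral>x. (\<Sum>i\<in>UNIV. \<Sum>j\<in>UNIV. dd (axis j 1) \<psi> x $ i * A x $ i $ j) \<partial>lborel)"
    by (intro Bochner_Integration.integral_cong refl) (simp add: inner_vec_def jac_nth[OF s(1)])
  also have "\<dots> = (\<Sum>i\<in>UNIV. \<Sum>j\<in>UNIV. \<integral>x. dd (axis j 1) \<psi> x $ i * A x $ i $ j \<partial>lborel)"
    using i1 by (simp add: Bochner_Integration.integral_sum)
  also have "\<dots> = - (\<Sum>i\<in>UNIV. \<Sum>j\<in>UNIV. \<integral>x. dd (axis j 1) (\<lambda>y. dd (axis j 1) \<psi> y) x $ i * v x $ i \<partial>lborel)"
    unfolding c by (simp add: sum_negf)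
  also have "(\<Sum>i\<in>UNIV. \<Sum>j\<in>UNIV. \<integral>x. dd (axis j 1) (\<lambda>y. dd (axis j 1) \<psi> y) x $ i * v x $ i \<partial>lborel)
      = (\<integral>x. (\<Sum>i\<in>UNIV. \<Sum>j\<in>UNIV. dd (axis j 1) (\<lambda>y. dd (axis j 1) \<psi> y) x $ i * v x $ i) \<partial>lborel)"
    using i2 by (simp add: Bochner_Integration.integral_sum)
  also have "\<dots> = (\<integral>x. lap \<psi> x \<bullet> v x \<partial>lborel)"
    by (intro Bochner_Integration.integral_cong refl) (simp add: inner_vec_def lap_def sum_distrib_right)
  finally show ?thesis .
qed

text \<open>\<open>B\<close> is an L^2 limit of Jacobians of test fields, and the gradients of
  \<open>w k\<close> are bounded in L^2, so it is enough to treat \<open>jac (\<psi> n)\<close> in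
  place of \<open>B\<close>. There \<open>jac_lap\<close> for \<open>w k\<close> and
  \<open>jac_weak_grad\<close> for \<open>v\<close> reduce both sides to pairings with
  \<open>lap (\<psi> n)\<close>.\<close>

lemma weak_pairing_grad:
  assumes w: "\<And>k. test_vec \<Omega> (w k)" "\<And>k. (n2 lborel (jac (w k)))\<^sup>2 \<le> K"
    and v: "sqi lborel v" and A: "sqi lborel A"
    and wg: "\<And>\<phi> i j. test_scalar \<Omega> \<phi> ==> (\<integral>x. v x $ i * pd j \<phi> x \<partial>lborel) = - (\<integral>x. A x $ i $ j * \<phi> x \<partial>lborel)"
    and wk: "\<And>\<theta>. continuous_on UNIV \<theta> ==> bsupp \<theta> ==> (\<lambda>k. \<integral>x. \<theta> x \<bullet> w k x \<partial>lborel) \<longlonglongrightarrow> (\<integral>x. \<theta> x \<bullet> v x \<partial>lborel)"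
    and B: "sqi lborel B" and \<psi>: "\<And>n. test_vec \<Omega> (\<psi> n)" "(\<lambda>n. n2 lborel (\<lambda>x. jac (\<psi> n) x - B x)) \<longlonglongrightarrow> 0"
  shows "(\<lambda>k. \<integral>x. B x \<bullet> jac (w k) x \<partial>lborel) \<longlonglongrightarrow> (\<integral>x. B x \<bullet> A x \<partial>lborel)"
proof (rule LIMSEQ_I)
  fix r :: real assume r: "r > 0"
  note s = test_vec_smooth[OF w(1)] and sp = test_vec_smooth[OF \<psi>(1)]
  have sw: "sqi lborel (jac (w k))" for k by (rule sqi_jac[OF s(1,2)])
  have sj: "sqi lborel (jac (\<psi> n))" for n by (rule sqi_jac[OF sp(1,2)])
  have K: "K \<ge> 0" using w(2)[of 0] by (meson order_trans zero_le_power2)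
  have wK: "n2 lborel (jac (w k)) \<le> sqrt K" for k using w(2)[of k] by (simp add: real_le_rsqrt)
  define Q where "Q = sqrt K + n2 lborel A + 1"
  have sK: "sqrt K \<ge> 0" using K by simp
  have Q: "Q > 0" "sqrt K + n2 lborel A \<le> Q" using sK n2_nonneg[of lborel A] unfolding Q_def by linarith+
  have "r / 2 / Q > 0" using r Q by simp
  from order_tendstoD(2)[OF \<psi>(2) this] obtain n where n: "n2 lborel (\<lambda>x. jac (\<psi> n) x - B x) < r / 2 / Q"
    using eventually_happens'[OF sequentially_bot] by blast
  define d where "d = n2 lborel (\<lambda>x. jac (\<psi> n) x - B x)"
  have sd: "sqi lborel (\<lambda>x. jac (\<psi> n) x - B x)" by (rule sqi_diff[OF sj B])
  have lim: "(\<lambda>k. \<integral>x. lap (\<psi> n) x \<bullet> w k x \<partial>lborel) \<longlonglongrightarrow> (\<integral>x. lap (\<psi> n) x \<bullet> v x \<partial>lborel)"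
    by (intro wk smooth_continuous lap_smooth lap_bsupp sp)
  have e1: "(\<integral>x. jac (\<psi> n) x \<bullet> jac (w k) x \<partial>lborel) = - (\<integral>x. lap (\<psi> n) x \<bullet> w k x \<partial>lborel)" for k
    by (rule jac_lap[OF sp(1,2) s(1)])
  have e2: "(\<integral>x. jac (\<psi> n) x \<bullet> A x \<partial>lborel) = - (\<integral>x. lap (\<psi> n) x \<bullet> v x \<partial>lborel)"
    by (rule jac_weak_grad[OF \<psi>(1) v A wg])
  have sub: "(\<integral>x. B x \<bullet> f x \<partial>lborel) = (\<integral>x. jac (\<psi> n) x \<bullet> f x \<partial>lborel) - (\<integral>x. (jac (\<psi> n) x - B x) \<bullet> f x \<partial>lborel)" if "sqi lborel f" for f
    using sqi_inner[OF sj that, of n] sqi_inner[OF B that] by (simp add: inner_diff_left)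
  have "\<forall>\<^sub>F k in sequentially. dist (\<integral>x. lap (\<psi> n) x \<bullet> w k x \<partial>lborel) (\<integral>x. lap (\<psi> n) x \<bullet> v x \<partial>lborel) < r / 2"
    using lim r by (intro tendstoD) auto
  then have "\<forall>\<^sub>F k in sequentially. norm ((\<integral>x. B x \<bullet> jac (w k) x \<partial>lborel) - (\<integral>x. B x \<bullet> A x \<partial>lborel)) < r"
  proof eventually_elim
    case (elim k)
    have d0: "d \<ge> 0" by (simp add: d_def)
    have 1: "\<bar>\<integral>x. (jac (\<psi> n) x - B x) \<bullet> jac (w k) x \<partial>lborel\<bar> \<le> d * sqrt K"
      using n2_Cauchy_Schwarz[OF sd sw[of k]] mult_left_mono[OF wK[of k] d0] unfolding d_def by linarith
    have 2: "\<bar>\<integral>x. (jac (\<psi> n) x - B x) \<bullet> A x \<partial>lborel\<bar> \<le> d * n2 lborel A"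
      unfolding d_def by (rule n2_Cauchy_Schwarz[OF sd A])
    have "d * sqrt K + d * n2 lborel A \<le> d * Q"
      unfolding distrib_left[symmetric] by (rule mult_left_mono[OF Q(2) d0])
    also have "\<dots> < r / 2 / Q * Q" unfolding d_def by (rule mult_strict_right_mono[OF n Q(1)])
    also have "r / 2 / Q * Q = r / 2" using Q(1) by simp
    finally have 3: "d * sqrt K + d * n2 lborel A < r / 2" .
    show ?case using 1 2 3 elim unfolding sub[OF sw] sub[OF A] e1 e2 dist_real_def real_norm_def by linarith
  qed
  then show "\<exists>no. \<forall>n\<ge>no. norm ((\<integral>x. B x \<bullet> jac (w n) x \<partial>lborel) - (\<integral>x. B x \<bullet> A x \<partial>lborel)) < r"
    by (simp add: eventually_sequentially)
qed

section \<open>The convective term does not contribute\<close>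

lemma smooth_exp: "smooth (exp :: real => real)"
proof -
  have "Ck n (exp :: real => real)" for n
  proof (induction n)
    case (Suc n)
    show ?case
    proof (rule Ck_SucI)
      show "(exp has_derivative (*) (exp x)) (at x)" for x :: real
        using DERIV_exp[of x] by (simp add: has_field_derivative_def)
      show "Ck n (\<lambda>x::real. exp x * b)" for b by (rule Ck_linear[OF bounded_linear_mult_left Suc])
    qed
  qed simp
  then show ?thesis by (simp add: smooth_def)
qed

text \<open>\<open>damp e v\<close> is the gradient of \<open>- exp (- e |v|\<^sup>2) / (2 e)\<close>, a bounded replacement of \<open>v\<close>. Tested with
  it, the convective term is the pairing of \<open>U\<close> with a gradient, which vanishes.\<close>

definition damp :: "real => real^3 => real^3" where "damp e v = exp (- e * (v \<bullet> v)) *\<^sub>R v"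

lemma damp_bound:
  assumes "e > 0" shows "norm (damp e v) \<le> 1 + 1 / e"
proof -
  let ?a = "norm v"
  have p: "0 < 1 + e * ?a\<^sup>2" using assms by (simp add: add_pos_nonneg)
  have "exp (- e * (v \<bullet> v)) = 1 / exp (e * ?a\<^sup>2)" by (simp add: exp_minus divide_inverse power2_norm_eq_inner)
  also have "\<dots> \<le> 1 / (1 + e * ?a\<^sup>2)" using p exp_ge_add_one_self[of "e * ?a\<^sup>2"] by (intro divide_left_mono) auto
  finally have le: "exp (- e * (v \<bullet> v)) \<le> 1 / (1 + e * ?a\<^sup>2)" .
  have "norm (damp e v) \<le> 1 / (1 + e * ?a\<^sup>2) * ?a"
    unfolding damp_def norm_scaleR abs_exp_cancel by (rule mult_right_mono[OF le norm_ge_zero])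
  also have "\<dots> \<le> 1 + 1 / e"
  proof -
    have "?a \<le> (1 + 1 / e) * (1 + e * ?a\<^sup>2)"
    proof -
      have "0 \<le> (?a - 1)\<^sup>2" by simp
      then have "2 * ?a \<le> 1 + ?a\<^sup>2" by (simp add: power2_diff)
      moreover have "(1 + 1 / e) * (1 + e * ?a\<^sup>2) = 1 + e * ?a\<^sup>2 + 1 / e + ?a\<^sup>2" using assms by (simp add: field_simps)
      moreover have "0 \<le> e * ?a\<^sup>2" "0 \<le> 1 / e" "0 \<le> ?a" using assms by auto
      ultimately show ?thesis by linarith
    qed
    then have "?a / (1 + e * ?a\<^sup>2) \<le> 1 + 1 / e" using p by (simp add: pos_divide_le_eq)
    then show ?thesis by simp
  qed
  finally show ?thesis .
qed

lemma damp_continuous: "continuous_on S (damp e)"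
  unfolding damp_def by (intro continuous_intros)

lemma tri_scaleR: "tri B a (c *\<^sub>R \<phi>) = c * tri B a \<phi>"
  by (simp add: tri_def sum_distrib_left mult_ac)

lemma tri_diff_left: "tri (B - B') a \<phi> = tri B a \<phi> - tri B' a \<phi>"
  by (simp add: tri_def algebra_simps sum_subtractf)

lemma tri_jac:
  assumes "smooth \<psi>" shows "tri (jac \<psi> x) a \<phi> = \<phi> \<bullet> dd a \<psi> x"
proof -
  have "\<phi> \<bullet> dd a \<psi> x = (\<Sum>j\<in>UNIV. \<Sum>i\<in>UNIV. \<phi> $ i * (a $ j * dd (axis j 1) \<psi> x $ i))"
    unfolding dd_sum_axis[OF smooth_differentiable[OF assms], of x a] inner_sum_right
    by (simp add: inner_vec_def)
  also have "\<dots> = (\<Sum>i\<in>UNIV. \<Sum>j\<in>UNIV. \<phi> $ i * (a $ j * dd (axis j 1) \<psi> x $ i))" by (rule sum.swap)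
  also have "\<dots> = tri (jac \<psi> x) a \<phi>"
    unfolding tri_def by (simp add: jac_nth[OF assms] sum_distrib_left sum_distrib_right mult_ac)
  finally show ?thesis by simp
qed

text \<open>Two limits, in this order. For fixed \<open>e\<close> the damped field is bounded, so a
  multiple of \<open>norm (G x) * norm (U x)\<close> dominates and the approximants can be replaced
  by \<open>U\<close>. Then \<open>e\<close> tends to 0, where the L^4 bound on \<open>U\<close>
  provides the dominating function.\<close>

lemma tri_vanish:
  fixes U :: "real^3 => real^3"
  assumes O: "open \<Omega>" "bounded \<Omega>" and U: "sqi lborel U" "\<And>x. x \<notin> \<Omega> ==> U x = 0" "integrable lborel (\<lambda>x. norm (U x) ^ 4)"
    and G: "sqi lborel G"
    and \<phi>: "\<And>n. test_divfree \<Omega> (\<phi> n)" "(\<lambda>n. n2 lborel (\<lambda>x. \<phi> n x - U x)) \<longlonglongrightarrow> 0"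
    and \<psi>: "\<And>n. test_vec \<Omega> (\<psi> n)" "(\<lambda>n. n2 lborel (\<lambda>x. \<psi> n x - U x)) \<longlonglongrightarrow> 0"
    and J: "(\<lambda>n. n2 lborel (\<lambda>x. jac (\<psi> n) x - G x)) \<longlonglongrightarrow> 0"
  shows "(\<integral>x. tri (G x) (U x) (U x) \<partial>lborel) = 0"
proof -
  note s = test_vec_smooth[OF \<psi>(1)]
  have Um[measurable]: "U \<in> borel_measurable borel" and Gm[measurable]: "G \<in> borel_measurable borel"
    using sqi_meas[OF U(1)] sqi_meas[OF G] by auto
  have sp: "sqi lborel (\<psi> n)" for n by (intro sqi_bsupp smooth_continuous s)
  have sj: "sqi lborel (jac (\<psi> n))" for n by (rule sqi_jac[OF s(1,2)])
  have pm[measurable]: "\<psi> n \<in> borel_measurable borel" "jac (\<psi> n) \<in> borel_measurable borel" for n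
    using sqi_meas[OF sp] sqi_meas[OF sj] by auto
  have dm[measurable (raw)]: "(\<lambda>x. damp e (f x)) \<in> borel_measurable borel" if "f \<in> borel_measurable borel" for f :: "real^3 => real^3" and e
    using measurable_compose[OF that borel_measurable_continuous_onI[OF damp_continuous]] .
  have sd: "sqi lborel (\<lambda>x. \<psi> n x - U x)" for n by (rule sqi_diff[OF sp U(1)])
  have zd: "\<psi> n x - U x = 0" if "x \<notin> \<Omega>" for n x using s(3) U(2) that by simp
  have id: "integrable lborel (\<lambda>x. \<psi> n x - U x)" for n by (rule bounded_support_L1_le(1)[OF sd zd O])
  have "(\<lambda>n. \<integral>x. norm (\<psi> n x - U x) \<partial>lborel) \<longlonglongrightarrow> 0"
  proof (rule tendsto_sandwich[OF _ _ tendsto_const])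
    show "(\<lambda>n. n2 lborel (\<lambda>x. \<psi> n x - U x) * sqrt (measure lborel \<Omega>)) \<longlonglongrightarrow> 0"
      using tendsto_mult_right[OF \<psi>(2)] by simp
    show "\<forall>\<^sub>F n in sequentially. (\<integral>x. norm (\<psi> n x - U x) \<partial>lborel) \<le> n2 lborel (\<lambda>x. \<psi> n x - U x) * sqrt (measure lborel \<Omega>)"
      by (intro always_eventually allI bounded_support_L1_le(2)[OF sd zd O])
  qed simp
  from tendsto_L1_AE_subseq[OF id this] obtain r :: "nat => nat"
    where r: "strict_mono r" "AE x in lborel. (\<lambda>n. \<psi> (r n) x - U x) \<longlonglongrightarrow> 0" by blast
  have zero: "(\<integral>x. tri (jac (\<psi> n) x) (U x) (damp e (\<psi> n x)) \<partial>lborel) = 0" if e: "e > 0" for e n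
  proof -
    \<comment> \<open>Twice the potential of \<open>damp\<close>, shifted by a constant so that it
      is 0 where \<open>\<psi> n\<close> vanishes and hence has bounded support.\<close>
    define \<theta> where "\<theta> x = (1 / e) * (1 - exp (- e * (\<psi> n x \<bullet> \<psi> n x)))" for x
    have \<theta>s: "smooth \<theta>" unfolding \<theta>_def
      by (intro smooth_mult smooth_const smooth_diff smooth_compose[OF smooth_exp] smooth_inner s)
    have \<theta>b: "bsupp \<theta>" using s(2)[of n] unfolding \<theta>_def bsupp_def by force
    obtain B where B: "\<And>x b. norm (dd b \<theta> x) \<le> B * norm b" by (rule smooth_bsupp_bounded[OF \<theta>s \<theta>b]) (rule that)
    have d: "dd b \<theta> x = 2 * (exp (- e * (\<psi> n x \<bullet> \<psi> n x)) * (\<psi> n x \<bullet> dd b (\<psi> n) x))" for b x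
    proof -
      have 1: "((\<lambda>x. \<psi> n x \<bullet> \<psi> n x) has_derivative (\<lambda>h. \<psi> n x \<bullet> dd h (\<psi> n) x + dd h (\<psi> n) x \<bullet> \<psi> n x)) (at x)"
        by (rule has_derivative_inner[OF smooth_has_derivative[OF s(1)] smooth_has_derivative[OF s(1)]])
      have 2: "((\<lambda>y. (1 / e) * (1 - exp (- e * y))) has_derivative (\<lambda>h. exp (- e * y) * h)) (at y)" for y
        using e by (auto intro!: derivative_eq_intros)
      have "dd b \<theta> x = exp (- e * (\<psi> n x \<bullet> \<psi> n x)) * (\<psi> n x \<bullet> dd b (\<psi> n) x + dd b (\<psi> n) x \<bullet> \<psi> n x)"
        unfolding \<theta>_def by (rule dd_eqI[OF has_derivative_compose[OF 1 2]])
      then show ?thesis by (simp add: inner_commute)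
    qed
    have "(\<integral>x. dd (U x) \<theta> x \<partial>lborel) = 0" by (rule weakly_divfree[OF O U(1,2) \<phi> \<theta>s B])
    then have "(\<integral>x. 2 * tri (jac (\<psi> n) x) (U x) (damp e (\<psi> n x)) \<partial>lborel) = 0"
      unfolding d damp_def tri_scaleR tri_jac[OF s(1)] .
    then show ?thesis by simp
  qed
  have lim: "(\<integral>x. tri (G x) (U x) (damp e (U x)) \<partial>lborel) = 0" if e: "e > 0" for e
  proof -
    define C where "C = 1 + 1 / e"
    have C: "C > 0" using e by (simp add: C_def add_pos_pos)
    have db: "norm (damp e v) \<le> C" for v unfolding C_def by (rule damp_bound[OF e])
    have tb: "norm (tri B a (damp e v)) \<le> C * (norm B * norm a)" for B a v
    proof -
      have "\<bar>tri B a (damp e v)\<bar> \<le> norm B * norm a * norm (damp e v)" by (rule tri_bound)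
      also have "\<dots> \<le> norm B * norm a * C" by (intro mult_left_mono db) auto
      finally show ?thesis by (simp add: mult_ac)
    qed
    have iGU: "integrable lborel (\<lambda>x. C * (norm (G x) * norm (U x)))" using sqi_prod_integrable[OF G U(1)] by simp
    have iB: "integrable lborel (\<lambda>x. tri (B x) (U x) (damp e (f x)))" if "sqi lborel B" and [measurable]: "f \<in> borel_measurable borel" for B f
    proof (rule Bochner_Integration.integrable_bound)
      have [measurable]: "B \<in> borel_measurable borel" using sqi_meas[OF that(1)] by simp
      show "integrable lborel (\<lambda>x. C * (norm (B x) * norm (U x)))" using sqi_prod_integrable[OF that(1) U(1)] by simp
      show "AE x in lborel. norm (tri (B x) (U x) (damp e (f x))) \<le> norm (C * (norm (B x) * norm (U x)))"
        unfolding real_norm_def[of "C * _"] by (intro AE_I2 order_trans[OF tb abs_ge_self])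
      show "(\<lambda>x. tri (B x) (U x) (damp e (f x))) \<in> borel_measurable lborel" using dm[OF that(2)] by measurable
    qed
    have 1: "(\<lambda>n. \<integral>x. tri (G x) (U x) (damp e (\<psi> (r n) x)) \<partial>lborel) \<longlonglongrightarrow> (\<integral>x. tri (G x) (U x) (damp e (U x)) \<partial>lborel)"
    proof (rule integral_dominated_convergence[OF _ _ iGU])
      show "AE x in lborel. (\<lambda>n. tri (G x) (U x) (damp e (\<psi> (r n) x))) \<longlonglongrightarrow> tri (G x) (U x) (damp e (U x))"
        using r(2)
      proof eventually_elim
        case (elim x)
        then have "(\<lambda>n. \<psi> (r n) x) \<longlonglongrightarrow> U x" by (simp add: LIM_zero_iff)
        then have "(\<lambda>n. damp e (\<psi> (r n) x)) \<longlonglongrightarrow> damp e (U x)"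
          using continuous_on_tendsto_compose[OF damp_continuous[of UNIV e]] by simp
        then show ?case unfolding tri_def by (intro tendsto_intros)
      qed
      show "AE x in lborel. norm (tri (G x) (U x) (damp e (\<psi> (r n) x))) \<le> C * (norm (G x) * norm (U x))" for n
        by (intro AE_I2 tb)
    qed (use iB[OF G] in auto)
    have 2: "(\<lambda>n. \<integral>x. tri (G x) (U x) (damp e (\<psi> (r n) x)) \<partial>lborel) \<longlonglongrightarrow> 0"
    proof (rule tendsto_0_le[where K="C * n2 lborel U"])
      show "(\<lambda>n. n2 lborel (\<lambda>x. jac (\<psi> (r n)) x - G x)) \<longlonglongrightarrow> 0"
        using LIMSEQ_subseq_LIMSEQ[OF J r(1)] by (simp add: o_def)
      have le: "norm (\<integral>x. tri (G x) (U x) (damp e (\<psi> n x)) \<partial>lborel) \<le> norm (n2 lborel (\<lambda>x. jac (\<psi> n) x - G x)) * (C * n2 lborel U)" for n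
      proof -
        have sdj: "sqi lborel (\<lambda>x. jac (\<psi> n) x - G x)" by (rule sqi_diff[OF sj G])
        have e1: "(\<integral>x. tri (jac (\<psi> n) x - G x) (U x) (damp e (\<psi> n x)) \<partial>lborel)
            = - (\<integral>x. tri (G x) (U x) (damp e (\<psi> n x)) \<partial>lborel)"
          unfolding tri_diff_left using iB[OF sj, of "\<psi> n" n] iB[OF G, of "\<psi> n"] zero[OF e, of n] by simp
        have "norm (\<integral>x. tri (G x) (U x) (damp e (\<psi> n x)) \<partial>lborel) = norm (\<integral>x. tri (jac (\<psi> n) x - G x) (U x) (damp e (\<psi> n x)) \<partial>lborel)"
          unfolding e1 by simp
        also have "\<dots> \<le> (\<integral>x. norm (tri (jac (\<psi> n) x - G x) (U x) (damp e (\<psi> n x))) \<partial>lborel)"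
          by (rule integral_norm_bound)
        also have "\<dots> \<le> (\<integral>x. C * (norm (jac (\<psi> n) x - G x) * norm (U x)) \<partial>lborel)"
        proof (rule Bochner_Integration.integral_mono)
          show "integrable lborel (\<lambda>x. norm (tri (jac (\<psi> n) x - G x) (U x) (damp e (\<psi> n x))))"
            by (rule integrable_norm[OF iB[OF sdj]]) simp
          show "integrable lborel (\<lambda>x. C * (norm (jac (\<psi> n) x - G x) * norm (U x)))"
            using sqi_prod_integrable[OF sdj U(1)] by simp
        qed (rule tb)
        also have "\<dots> = C * (\<integral>x. norm (jac (\<psi> n) x - G x) * norm (U x) \<partial>lborel)" by simp
        also have "\<dots> \<le> C * (n2 lborel (\<lambda>x. jac (\<psi> n) x - G x) * n2 lborel U)"
          using C by (intro mult_left_mono n2_Cauchy_Schwarz_norm[OF sdj U(1)]) auto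
        finally show ?thesis by (simp add: mult_ac)
      qed
      show "\<forall>\<^sub>F n in sequentially. norm (\<integral>x. tri (G x) (U x) (damp e (\<psi> (r n) x)) \<partial>lborel) \<le> norm (n2 lborel (\<lambda>x. jac (\<psi> (r n)) x - G x)) * (C * n2 lborel U)"
        by (intro always_eventually allI le)
    qed
    show ?thesis by (rule LIMSEQ_unique[OF 1 2])
  qed
  define h where "h n = inverse (real (Suc n))" for n
  have h: "h n > 0" "h \<longlonglongrightarrow> 0" for n unfolding h_def using LIMSEQ_inverse_real_of_nat by auto
  have "(\<lambda>n. \<integral>x. tri (G x) (U x) (damp (h n) (U x)) \<partial>lborel) \<longlonglongrightarrow> (\<integral>x. tri (G x) (U x) (U x) \<partial>lborel)"
  proof (rule integral_dominated_convergence[where w="\<lambda>x. (norm (G x))\<^sup>2 + norm (U x) ^ 4"])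
    show "integrable lborel (\<lambda>x. (norm (G x))\<^sup>2 + norm (U x) ^ 4)" using sqi_integrable[OF G] U(3) by simp
    show "AE x in lborel. (\<lambda>n. tri (G x) (U x) (damp (h n) (U x))) \<longlonglongrightarrow> tri (G x) (U x) (U x)"
    proof (intro AE_I2)
      fix x
      have "(\<lambda>n. exp (- h n * (U x \<bullet> U x)) * tri (G x) (U x) (U x)) \<longlonglongrightarrow> exp (- 0 * (U x \<bullet> U x)) * tri (G x) (U x) (U x)"
        by (intro tendsto_intros h)
      then show "(\<lambda>n. tri (G x) (U x) (damp (h n) (U x))) \<longlonglongrightarrow> tri (G x) (U x) (U x)"
        by (simp add: damp_def tri_scaleR)
    qed
    show "AE x in lborel. norm (tri (G x) (U x) (damp (h n) (U x))) \<le> (norm (G x))\<^sup>2 + norm (U x) ^ 4" for n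
    proof (intro AE_I2)
      fix x
      have "exp (- h n * (U x \<bullet> U x)) \<le> 1" using h(1)[of n] by simp
      then have "norm (tri (G x) (U x) (damp (h n) (U x))) \<le> 1 * \<bar>tri (G x) (U x) (U x)\<bar>"
        unfolding damp_def tri_scaleR real_norm_def abs_mult by (intro mult_right_mono) auto
      also have "\<dots> \<le> norm (G x) * norm (U x) * norm (U x)" using tri_bound by simp
      also have "\<dots> = norm (G x) * (norm (U x))\<^sup>2" by (simp add: power2_eq_square)
      also have "\<dots> \<le> (norm (G x))\<^sup>2 + ((norm (U x))\<^sup>2)\<^sup>2"
      proof -
        have "0 \<le> norm (G x) * (norm (U x))\<^sup>2" by simp
        then show ?thesis using sum_squares_bound[of "norm (G x)" "(norm (U x))\<^sup>2"] by linarith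
      qed
      also have "((norm (U x))\<^sup>2)\<^sup>2 = norm (U x) ^ 4" by simp
      finally show "norm (tri (G x) (U x) (damp (h n) (U x))) \<le> (norm (G x))\<^sup>2 + norm (U x) ^ 4" .
    qed
  qed measurable
  then show ?thesis unfolding lim[OF h(1)] by (simp add: LIMSEQ_const_iff)
qed

section \<open>Testing with a fixed divergence free field\<close>

text \<open>The cut-off is 1 on a neighbourhood of [0, s], so that at time \<open>s\<close> the weak
  form sees a test field frozen in time, whose time derivative drops out. The support has to be
  compact towards negative times too; \<open>cutoff (- r - 1)\<close> ends it at -2.\<close>

lemma time_cutoff:
  assumes s: "0 < s" "s < T"
  obtains X :: "real => real" and a b where "smooth X" "a < 0" "s < b" "\<And>r. a < r ==> r < b ==> X r = 1"
    "\<And>r. r \<notin> {-2..(s + 2 * T) / 3} ==> X r = 0"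
proof -
  \<comment> \<open>A third of the gap: \<open>X\<close> is 1 up to \<open>s + \<delta>\<close> and
    0 from \<open>s + 2 * \<delta>\<close> on, which equals \<open>(s + 2 * T) / 3\<close> and lies
    before \<open>T\<close>.\<close>
  define \<delta> where "\<delta> = (T - s) / 3"
  have \<delta>: "\<delta> > 0" using s by (simp add: \<delta>_def)
  define X where "X r = cutoff ((1 / \<delta>) * (r - (s + \<delta>))) * cutoff (- r - 1)" for r
  show ?thesis
  proof (rule that[of X "-1" "s + \<delta>"])
    show "smooth X" unfolding X_def
      by (intro smooth_mult smooth_compose[OF smooth_cutoff] smooth_const smooth_diff smooth_minus smooth_ident)
    show "X r = 1" if "-1 < r" "r < s + \<delta>" for r
    proof -
      have "(1 / \<delta>) * (r - (s + \<delta>)) \<le> 0" using that \<delta> by (intro mult_nonneg_nonpos) auto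
      then show ?thesis using that by (simp add: X_def cutoff_1)
    qed
    show "X r = 0" if r: "r \<notin> {-2..(s + 2 * T) / 3}" for r
    proof (cases "r < -2")
      case False
      then have "r > (s + 2 * T) / 3" using r by auto
      then have "r - (s + \<delta>) \<ge> \<delta>" by (simp add: \<delta>_def field_simps)
      then have "(1 / \<delta>) * (r - (s + \<delta>)) \<ge> 1" using \<delta> by (simp add: pos_le_divide_eq)
      then show ?thesis by (simp add: X_def cutoff_0)
    qed (simp add: X_def cutoff_0)
  qed (use s \<delta> in auto)
qed

lemma product_test_DT:
  assumes w: "test_divfree \<Omega> w" and X: "smooth X" "\<And>r. r \<notin> {-2..c} ==> X r = 0" "c < T"
  shows "test_DT \<Omega> T (\<lambda>p. X (fst p) *\<^sub>R w (snd p))"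
proof -
  obtain K where K: "smooth w" "compact K" "K \<subseteq> \<Omega>" "\<And>x. x \<notin> K ==> w x = 0"
    using test_divfree_vec[OF w] by (auto simp: test_vec_def)
  have "smooth (\<lambda>p::real \<times> (real^3). X (fst p) *\<^sub>R w (snd p))"
    by (intro smooth_scaleR smooth_compose[OF X(1)] smooth_compose[OF K(1)] smooth_bounded_linear bounded_linear_fst bounded_linear_snd)
  moreover have "\<exists>K. compact K \<and> K \<subseteq> {..<T} \<times> \<Omega> \<and> (\<forall>p. p \<notin> K --> X (fst p) *\<^sub>R w (snd p) = 0)"
  proof (intro exI[of _ "{-2..c} \<times> K"] conjI allI impI)
    show "compact ({-2..c} \<times> K)" by (intro compact_Times K compact_Icc)
    show "{-2..c} \<times> K \<subseteq> {..<T} \<times> \<Omega>" using K(3) X(3) by auto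
    fix p :: "real \<times> (real^3)" assume "p \<notin> {-2..c} \<times> K"
    then have "fst p \<notin> {-2..c} \<or> snd p \<notin> K" by (cases p) auto
    then show "X (fst p) *\<^sub>R w (snd p) = 0" using X(2)[of "fst p"] K(4)[of "snd p"] by auto
  qed
  moreover have "(\<Sum>j\<in>UNIV. pdx j (\<lambda>p. (X (fst p) *\<^sub>R w (snd p)) $ j) t x) = 0" for t x
  proof -
    have "pdx j (\<lambda>p. (X (fst p) *\<^sub>R w (snd p)) $ j) t x = X t * dd (axis j 1) w x $ j" for j
    proof -
      have "pdx j (\<lambda>p. (X (fst p) *\<^sub>R w (snd p)) $ j) t x = pd j (\<lambda>y. X t * w y $ j) x" by (simp add: pdx_def pd_def)
      also have "\<dots> = dd (axis j 1) (\<lambda>y. X t * w y $ j) x"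
        by (intro pd_eq_dd smooth_differentiable smooth_mult smooth_const smooth_vec_nth K)
      also have "\<dots> = X t * dd (axis j 1) (\<lambda>y. w y $ j) x"
        by (rule dd_eqI[OF bounded_linear.has_derivative[OF bounded_linear_mult_right smooth_has_derivative[OF smooth_vec_nth[OF K(1)]]]])
      finally show ?thesis by (simp add: dd_nth[OF smooth_differentiable[OF K(1)]])
    qed
    then show ?thesis using test_divfree_sum_dd[OF w, of x] by (simp add: sum_distrib_left[symmetric])
  qed
  ultimately show ?thesis by (simp add: test_DT_def)
qed

lemma pdt_locally_constant:
  assumes "a < r" "r < b" "\<And>r. a < r ==> r < b ==> X r = (1::real)"
  shows "pdt (\<lambda>p. X (fst p) *\<^sub>R w (snd p)) r x = 0"
proof -
  have "((\<lambda>s. X s *\<^sub>R w x) has_vector_derivative 0) (at r)"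
    by (rule has_vector_derivative_transform_within_open[of "\<lambda>_. w x" _ _ "{a<..<b}"])
      (use assms in auto)
  then show ?thesis by (simp add: pdt_def vector_derivative_at)
qed

lemma joint_comp:
  fixes U :: "real => real^3 => 'b::euclidean_space"
  assumes "(\<lambda>p. U (fst p) (snd p)) \<in> borel_measurable borel" "f \<in> borel_measurable M" "g \<in> borel_measurable M"
  shows "(\<lambda>p. U (f p) (g p)) \<in> borel_measurable M"
  using measurable_compose[OF borel_measurable_Pair[OF assms(2,3)] assms(1)] by simp

lemma time_integral_representative:
  fixes f Q :: "real => real"
  assumes Q[measurable]: "Q \<in> borel_measurable borel" and ae: "AE r in lborel. r \<in> {a<..<b} --> f r = Q r"
  shows "integral\<^sup>L (lebesgue_on {a..b}) f = (\<integral>r. indicator {a<..<b} r * Q r \<partial>lborel)"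
proof (rule lebesgue_on_representative(2))
  show "AE r in lborel. r \<in> {a..b} --> f r = indicator {a<..<b} r * Q r"
    using ae AE_lborel_singleton[of a] AE_lborel_singleton[of b] by eventually_elim (auto simp: indicator_def)
qed auto

lemma jac_zero:
  assumes "test_vec \<Omega> \<psi>" "x \<notin> \<Omega>" shows "jac \<psi> x = 0"
proof -
  obtain K where K: "smooth \<psi>" "compact K" "K \<subseteq> \<Omega>" "\<And>x. x \<notin> K ==> \<psi> x = 0"
    using assms by (auto simp: test_vec_def)
  have "dd b \<psi> x = 0" for b
    by (rule dd_eq_0[of "- K"]) (use assms(2) K compact_imp_closed[OF K(2)] in auto)
  then show ?thesis by (simp add: vec_eq_iff jac_nth[OF K(1)])
qed

text \<open>The last clause of \<open>weak_solution\<close> at one time, word for word, named so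
  that it can be carried as a single fact.\<close>

definition weak_form :: "(real^3) set => real => real => real => (real => real^3 => real^3) => (real => real^3 => real^3^3) => real => bool" where
  "weak_form \<Omega> \<mu> \<beta> T u G t \<longleftrightarrow> (\<forall>\<phi>. test_DT \<Omega> T \<phi> -->
           - integral\<^sup>L (lebesgue_on {0..t}) (\<lambda>s. integral\<^sup>L (lebesgue_on \<Omega>)
                 (\<lambda>x. u s x \<bullet> pdt \<phi> s x))
           + \<mu> * integral\<^sup>L (lebesgue_on {0..t}) (\<lambda>s. integral\<^sup>L (lebesgue_on \<Omega>)
                 (\<lambda>x. \<Sum>i\<in>UNIV. \<Sum>j\<in>UNIV. G s x $ i $ j * pdx j (\<lambda>p. \<phi> p $ i) s x))
           + integral\<^sup>L (lebesgue_on {0..t}) (\<lambda>s. integral\<^sup>L (lebesgue_on \<Omega>)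
                 (\<lambda>x. \<Sum>i\<in>UNIV. (\<Sum>j\<in>UNIV. u s x $ j * G s x $ i $ j) * \<phi> (s, x) $ i))
           + \<beta> * integral\<^sup>L (lebesgue_on {0..t}) (\<lambda>s. integral\<^sup>L (lebesgue_on \<Omega>)
                 (\<lambda>x. (norm (u s x))\<^sup>2 * (u s x \<bullet> \<phi> (s, x))))
           = - integral\<^sup>L (lebesgue_on \<Omega>) (\<lambda>x. u t x \<bullet> \<phi> (t, x))
             + integral\<^sup>L (lebesgue_on \<Omega>) (\<lambda>x. u 0 x \<bullet> \<phi> (0, x)))"

text \<open>The test function is \<open>w\<close> times a time cut-off. Integrability in time of the
  pairing is stated separately: it is what lets the time integral shrink to 0 when the initial value
  is identified.\<close>

lemma test_identity:
  fixes u U :: "real => real^3 => real^3" and Gw G :: "real => real^3 => real^3^3"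
  assumes O: "open \<Omega>" "bounded \<Omega>"
    and Um: "(\<lambda>p. U (fst p) (snd p)) \<in> borel_measurable borel"
    and Gm: "(\<lambda>p. G (fst p) (snd p)) \<in> borel_measurable borel"
    and U0: "\<And>t x. t \<notin> {0<..<T} \<or> x \<notin> \<Omega> ==> U t x = 0"
    and G0: "\<And>t x. t \<notin> {0<..<T} \<or> x \<notin> \<Omega> ==> G t x = 0"
    and U4: "integrable lborel (\<lambda>p. norm (U (fst p) (snd p)) ^ 4)"
    and G2: "integrable lborel (\<lambda>p. (norm (G (fst p) (snd p)))\<^sup>2)"
    and ae: "AE r in lborel. r \<in> {0<..<T} --> (AE x in lborel. x \<in> \<Omega> --> u r x = U r x \<and> Gw r x = G r x)"
    and w: "test_divfree \<Omega> w"
  shows "integrable lborel (\<lambda>r. \<integral>x. kk \<mu> \<beta> (U r x) (G r x) (w x) (jac w x) \<partial>lborel)"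
    and "\<And>s u0b. s \<in> {0<..<T} ==> AE x in lborel. x \<in> \<Omega> --> u s x = U s x ==>
      u0b \<in> borel_measurable borel ==> (\<And>x. x \<notin> \<Omega> ==> u0b x = 0) ==> AE x in lborel. x \<in> \<Omega> --> u 0 x = u0b x ==>
      weak_form \<Omega> \<mu> \<beta> T u Gw s ==>
      (\<integral>x. U s x \<bullet> w x \<partial>lborel) - (\<integral>x. u0b x \<bullet> w x \<partial>lborel)
        = - (\<integral>r. indicator {0<..<s} r * (\<integral>x. kk \<mu> \<beta> (U r x) (G r x) (w x) (jac w x) \<partial>lborel) \<partial>lborel)"
proof -
  note [measurable (raw)] = joint_comp[OF Um] joint_comp[OF Gm]
  note ws = test_vec_smooth[OF test_divfree_vec[OF w]]
  have Ob[measurable]: "\<Omega> \<in> sets borel" using O by simp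
  have wm[measurable]: "w \<in> borel_measurable borel" by (rule borel_smooth[OF ws(1)])
  have jm[measurable]: "jac w \<in> borel_measurable borel" by (intro borel_measurable_continuous_onI jac_continuous ws)
  obtain b1 where b1: "b1 > 0" "\<And>x. norm (w x) \<le> b1" using bsupp_uniform(2)[OF smooth_continuous[OF ws(1)] ws(2)] by auto
  obtain b2 where b2: "b2 > 0" "\<And>x. norm (jac w x) \<le> b2" using bsupp_uniform(2)[OF jac_continuous[OF ws(1)] jac_bsupp[OF ws(1,2)]] by auto
  define b where "b = max b1 b2"
  have b: "b > 0" "\<And>x. norm (w x) \<le> b" "\<And>x. norm (jac w x) \<le> b"
    using b1 b2 by (auto simp: b_def intro: max.coboundedI1 max.coboundedI2)
  \<comment> \<open>\<open>w\<close> and its Jacobian are bounded, so the three terms have degrees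
    1, 2 and 3 in the solution; the indicator supplies the constant that bounds these lower degrees
    by |U|^4 + |G|^2.\<close>
  define D where "D p = indicat_real ({0<..<T} \<times> \<Omega>) p + norm (U (fst p) (snd p)) ^ 4 + (norm (G (fst p) (snd p)))\<^sup>2" for p
  have "bounded ({0<..<T} \<times> \<Omega>)" using O(2) by (intro bounded_Times) auto
  then have iD: "integrable lborel D"
    unfolding D_def using U4 G2 O emeasure_bounded_finite[of "{0<..<T} \<times> \<Omega>"]
    by (intro Bochner_Integration.integrable_add) (auto simp: integrable_indicator_iff open_Times)
  have D0: "D p \<ge> 0" for p by (simp add: D_def)
  have dom: "integrable lborel q" if q: "q \<in> borel_measurable borel" "\<And>p. \<bar>q p\<bar> \<le> b * D p" for q :: "real \<times> (real^3) => real"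
  proof (rule Bochner_Integration.integrable_bound)
    show "integrable lborel (\<lambda>p. b * D p)" using iD by simp
    show "AE p in lborel. norm (q p) \<le> norm (b * D p)" unfolding real_norm_def by (intro AE_I2 order_trans[OF q(2) abs_ge_self])
  qed (use q in simp)
  have sec: "AE r in lborel. integrable lborel (\<lambda>x. q (r, x))" "integrable lborel (\<lambda>r. \<integral>x. q (r, x) \<partial>lborel)"
    if "integrable lborel q" for q :: "real \<times> (real^3) => real"
  proof -
    have "integrable (lborel \<Otimes>\<^sub>M lborel) q" using that by (subst lborel_prod)
    from lborel_pair.AE_integrable_fst'[OF this] lborel_pair.integrable_fst'[OF this]
    show "AE r in lborel. integrable lborel (\<lambda>x. q (r, x))" "integrable lborel (\<lambda>r. \<integral>x. q (r, x) \<partial>lborel)" by auto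
  qed
  define q1 where "q1 p = G (fst p) (snd p) \<bullet> jac w (snd p)" for p
  define q2 where "q2 p = tri (G (fst p) (snd p)) (U (fst p) (snd p)) (w (snd p))" for p
  define q3 where "q3 p = (norm (U (fst p) (snd p)))\<^sup>2 * (U (fst p) (snd p) \<bullet> w (snd p))" for p
  have UG: "U (fst p) (snd p) = 0 \<and> G (fst p) (snd p) = 0" if "p \<notin> {0<..<T} \<times> \<Omega>" for p
    using U0[of "fst p" "snd p"] G0[of "fst p" "snd p"] that by (cases p) auto
  have pt: "\<bar>q1 p\<bar> \<le> b * D p \<and> \<bar>q2 p\<bar> \<le> b * D p \<and> \<bar>q3 p\<bar> \<le> b * D p" for p
  proof (cases "p \<in> {0<..<T} \<times> \<Omega>")
    case False
    have "0 \<le> b * D p" using b(1) D0 by simp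
    then show ?thesis using UG[OF False] by (simp add: q1_def q2_def q3_def tri_def)
  next
    case True
    define x where "x = norm (U (fst p) (snd p))"
    define y where "y = norm (G (fst p) (snd p))"
    have xy: "x \<ge> 0" "y \<ge> 0" by (auto simp: x_def y_def)
    have Dp: "D p = 1 + x^4 + y\<^sup>2" using True by (simp add: D_def x_def y_def)
    have x2: "x\<^sup>2 \<le> 1 + x^4" by (rule square_le_fourth)
    have y1: "y \<le> 1 + y\<^sup>2" using sum_squares_bound[of y 1] xy by simp
    have yx: "y * x \<le> 1 + x^4 + y\<^sup>2"
    proof -
      have "0 \<le> y * x" using xy by simp
      then show ?thesis using sum_squares_bound[of y x] x2 by linarith
    qed
    have x3: "x\<^sup>2 * x \<le> 1 + x^4"
    proof -
      have "2 * (x\<^sup>2 * x) \<le> x^4 + x\<^sup>2" using sum_squares_bound[of "x\<^sup>2" x] by simp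
      then show ?thesis using x2 by linarith
    qed
    have "\<bar>q1 p\<bar> \<le> y * b"
      unfolding q1_def y_def by (rule order_trans[OF Cauchy_Schwarz_ineq2 mult_left_mono[OF b(3)]]) simp
    also have "\<dots> \<le> (1 + x^4 + y\<^sup>2) * b" using y1 b(1) xy by (intro mult_right_mono) (auto intro: order_trans)
    finally have 1: "\<bar>q1 p\<bar> \<le> b * D p" by (simp add: Dp mult.commute)
    have "\<bar>q2 p\<bar> \<le> y * x * b"
      unfolding q2_def y_def x_def by (rule order_trans[OF tri_bound mult_left_mono[OF b(2)]]) simp
    also have "\<dots> \<le> (1 + x^4 + y\<^sup>2) * b" using yx b(1) by (intro mult_right_mono) auto
    finally have 2: "\<bar>q2 p\<bar> \<le> b * D p" by (simp add: Dp mult.commute)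
    have "\<bar>q3 p\<bar> \<le> x\<^sup>2 * (x * b)"
      unfolding q3_def abs_mult x_def
      by (simp, rule mult_left_mono[OF order_trans[OF Cauchy_Schwarz_ineq2 mult_left_mono[OF b(2)]]]) auto
    also have "\<dots> = x\<^sup>2 * x * b" by simp
    also have "\<dots> \<le> (1 + x^4 + y\<^sup>2) * b"
    proof (rule mult_right_mono)
      show "x\<^sup>2 * x \<le> 1 + x^4 + y\<^sup>2" using x3 zero_le_power2[of y] by linarith
    qed (use b(1) in simp)
    finally have 3: "\<bar>q3 p\<bar> \<le> b * D p" by (simp add: Dp mult.commute)
    show ?thesis using 1 2 3 by simp
  qed
  have qm[measurable]: "q1 \<in> borel_measurable borel" "q2 \<in> borel_measurable borel" "q3 \<in> borel_measurable borel"
  proof -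
    have s: "(snd :: real \<times> (real^3) => real^3) \<in> borel_measurable borel"
      by (intro borel_measurable_continuous_onI continuous_intros)
    note h = Um Gm measurable_compose[OF s wm] measurable_compose[OF s jm]
      measurable_compose[OF Um borel_measurable_norm]
    show "q1 \<in> borel_measurable borel" "q2 \<in> borel_measurable borel" "q3 \<in> borel_measurable borel"
      unfolding q1_def q2_def q3_def
      by (intro borel_measurable_inner tri_measurable borel_measurable_times borel_measurable_power h)+
  qed
  have iq: "integrable lborel q1" "integrable lborel q2" "integrable lborel q3" using pt by (auto intro!: dom qm)
  define A1 where "A1 r = (\<integral>x. q1 (r, x) \<partial>lborel)" for r
  define A2 where "A2 r = (\<integral>x. q2 (r, x) \<partial>lborel)" for r
  define A3 where "A3 r = (\<integral>x. q3 (r, x) \<partial>lborel)" for r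
  have iA: "integrable lborel A1" "integrable lborel A2" "integrable lborel A3"
    unfolding A1_def A2_def A3_def using sec(2)[OF iq(1)] sec(2)[OF iq(2)] sec(2)[OF iq(3)] by auto
  define FW where "FW r = (\<integral>x. kk \<mu> \<beta> (U r x) (G r x) (w x) (jac w x) \<partial>lborel)" for r
  have FWm[measurable]: "FW \<in> borel_measurable borel" unfolding FW_def by measurable
  have FWA: "AE r in lborel. FW r = \<mu> * A1 r + A2 r + \<beta> * A3 r"
    using sec(1)[OF iq(1)] sec(1)[OF iq(2)] sec(1)[OF iq(3)]
  proof eventually_elim
    case (elim r)
    then show ?case unfolding FW_def A1_def A2_def A3_def kk_def q1_def q2_def q3_def by simp
  qed
  have "integrable lborel (\<lambda>r. \<mu> * A1 r + A2 r + \<beta> * A3 r)" using iA by simp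
  then show I: "integrable lborel (\<lambda>r. \<integral>x. kk \<mu> \<beta> (U r x) (G r x) (w x) (jac w x) \<partial>lborel)"
    unfolding FW_def[symmetric] using FWA iA by (subst integrable_cong_AE[OF _ _ FWA]) auto
  fix s u0b
  assume s: "s \<in> {0<..<T}" and us: "AE x in lborel. x \<in> \<Omega> --> u s x = U s x"
    and u0m[measurable]: "u0b \<in> borel_measurable borel" and u0z: "\<And>x. x \<notin> \<Omega> ==> u0b x = 0"
    and u0: "AE x in lborel. x \<in> \<Omega> --> u 0 x = u0b x"
    and WF: "weak_form \<Omega> \<mu> \<beta> T u Gw s"
  have sT: "0 < s" "s < T" using s by auto
  obtain X :: "real => real" and a c where X: "smooth X" "a < 0" "s < c" "\<And>r. a < r ==> r < c ==> X r = 1"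
    "\<And>r. r \<notin> {-2..(s + 2 * T) / 3} ==> X r = 0"
    by (rule time_cutoff[OF sT]) (rule that)
  define \<phi> where "\<phi> = (\<lambda>p::real \<times> (real^3). X (fst p) *\<^sub>R w (snd p))"
  have tD: "test_DT \<Omega> T \<phi>" unfolding \<phi>_def
    by (rule product_test_DT[where c="(s + 2 * T) / 3", OF w X(1)]) (use sT X(5) in auto)
  have \<phi>r: "\<phi> (r, x) = w x" if "0 \<le> r" "r \<le> s" for r x using X(4)[of r] X(2,3) that by (simp add: \<phi>_def)
  have pt0: "pdt \<phi> r x = 0" if "0 \<le> r" "r \<le> s" for r x
    unfolding \<phi>_def by (rule pdt_locally_constant[of a r c]) (use X that in auto)
  have px: "pdx j (\<lambda>p. \<phi> p $ i) r x = jac w x $ i $ j" if "0 \<le> r" "r \<le> s" for r x i j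
    using \<phi>r[OF that] by (simp add: pdx_def jac_def pd_def)
  have in0: "AE r in lborel. r \<in> {0<..<s} --> integral\<^sup>L (lebesgue_on \<Omega>) (\<lambda>x. u r x \<bullet> pdt \<phi> r x) = 0"
    by (intro AE_I2 impI) (simp add: pt0)
  have in1: "AE r in lborel. r \<in> {0<..<s} --> integral\<^sup>L (lebesgue_on \<Omega>) (\<lambda>x. \<Sum>i\<in>UNIV. \<Sum>j\<in>UNIV. Gw r x $ i $ j * pdx j (\<lambda>p. \<phi> p $ i) r x) = A1 r"
    using ae
  proof eventually_elim
    case (elim r)
    show ?case
    proof
      assume r: "r \<in> {0<..<s}"
      then have "AE x in lborel. x \<in> \<Omega> --> u r x = U r x \<and> Gw r x = G r x" using elim sT by auto
      then have "AE x in lborel. x \<in> \<Omega> --> (\<Sum>i\<in>UNIV. \<Sum>j\<in>UNIV. Gw r x $ i $ j * pdx j (\<lambda>p. \<phi> p $ i) r x) = q1 (r, x)"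
        by eventually_elim (use r in \<open>simp add: px q1_def inner_vec_def\<close>)
      from lebesgue_on_representative(2)[OF Ob _ _ this]
      show "integral\<^sup>L (lebesgue_on \<Omega>) (\<lambda>x. \<Sum>i\<in>UNIV. \<Sum>j\<in>UNIV. Gw r x $ i $ j * pdx j (\<lambda>p. \<phi> p $ i) r x) = A1 r"
        unfolding A1_def using G0 by (simp add: q1_def)
    qed
  qed
  have in2: "AE r in lborel. r \<in> {0<..<s} --> integral\<^sup>L (lebesgue_on \<Omega>) (\<lambda>x. \<Sum>i\<in>UNIV. (\<Sum>j\<in>UNIV. u r x $ j * Gw r x $ i $ j) * \<phi> (r, x) $ i) = A2 r"
    using ae
  proof eventually_elim
    case (elim r)
    show ?case
    proof
      assume r: "r \<in> {0<..<s}"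
      then have "AE x in lborel. x \<in> \<Omega> --> u r x = U r x \<and> Gw r x = G r x" using elim sT by auto
      then have "AE x in lborel. x \<in> \<Omega> --> (\<Sum>i\<in>UNIV. (\<Sum>j\<in>UNIV. u r x $ j * Gw r x $ i $ j) * \<phi> (r, x) $ i) = q2 (r, x)"
        by eventually_elim (use r in \<open>simp add: \<phi>r q2_def tri_def\<close>)
      from lebesgue_on_representative(2)[OF Ob _ _ this]
      show "integral\<^sup>L (lebesgue_on \<Omega>) (\<lambda>x. \<Sum>i\<in>UNIV. (\<Sum>j\<in>UNIV. u r x $ j * Gw r x $ i $ j) * \<phi> (r, x) $ i) = A2 r"
        unfolding A2_def using U0 by (simp add: q2_def tri_def)
    qed
  qed
  have in3: "AE r in lborel. r \<in> {0<..<s} --> integral\<^sup>L (lebesgue_on \<Omega>) (\<lambda>x. (norm (u r x))\<^sup>2 * (u r x \<bullet> \<phi> (r, x))) = A3 r"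
    using ae
  proof eventually_elim
    case (elim r)
    show ?case
    proof
      assume r: "r \<in> {0<..<s}"
      then have "AE x in lborel. x \<in> \<Omega> --> u r x = U r x \<and> Gw r x = G r x" using elim sT by auto
      then have "AE x in lborel. x \<in> \<Omega> --> (norm (u r x))\<^sup>2 * (u r x \<bullet> \<phi> (r, x)) = q3 (r, x)"
        by eventually_elim (use r in \<open>simp add: \<phi>r q3_def\<close>)
      from lebesgue_on_representative(2)[OF Ob _ _ this]
      show "integral\<^sup>L (lebesgue_on \<Omega>) (\<lambda>x. (norm (u r x))\<^sup>2 * (u r x \<bullet> \<phi> (r, x))) = A3 r"
        unfolding A3_def using U0 by (simp add: q3_def)
    qed
  qed
  have Am: "A1 \<in> borel_measurable borel" "A2 \<in> borel_measurable borel" "A3 \<in> borel_measurable borel" using iA by auto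
  have e0: "integral\<^sup>L (lebesgue_on {0..s}) (\<lambda>r. integral\<^sup>L (lebesgue_on \<Omega>) (\<lambda>x. u r x \<bullet> pdt \<phi> r x)) = 0"
    using time_integral_representative[OF _ in0] by simp
  note e1 = time_integral_representative[OF Am(1) in1] and e2 = time_integral_representative[OF Am(2) in2]
    and e3 = time_integral_representative[OF Am(3) in3]
  have es: "integral\<^sup>L (lebesgue_on \<Omega>) (\<lambda>x. u s x \<bullet> \<phi> (s, x)) = (\<integral>x. U s x \<bullet> w x \<partial>lborel)"
  proof (rule lebesgue_on_representative(2)[OF Ob])
    show "AE x in lborel. x \<in> \<Omega> --> u s x \<bullet> \<phi> (s, x) = U s x \<bullet> w x"
      using us by eventually_elim (use sT in \<open>simp add: \<phi>r\<close>)
    show "U s x \<bullet> w x = 0" if "x \<notin> \<Omega>" for x using U0 that by simp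
    show "(\<lambda>x. U s x \<bullet> w x) \<in> borel_measurable borel" by measurable
  qed
  have eu0: "integral\<^sup>L (lebesgue_on \<Omega>) (\<lambda>x. u 0 x \<bullet> \<phi> (0, x)) = (\<integral>x. u0b x \<bullet> w x \<partial>lborel)"
  proof (rule lebesgue_on_representative(2)[OF Ob])
    show "AE x in lborel. x \<in> \<Omega> --> u 0 x \<bullet> \<phi> (0, x) = u0b x \<bullet> w x"
      using u0 by eventually_elim (use sT in \<open>simp add: \<phi>r\<close>)
    show "u0b x \<bullet> w x = 0" if "x \<notin> \<Omega>" for x using u0z that by simp
    show "(\<lambda>x. u0b x \<bullet> w x) \<in> borel_measurable borel" by measurable
  qed
  have ind: "integrable lborel (\<lambda>r. indicator {0<..<s} r * A r)" if "integrable lborel A" for A :: "real => real"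
    using integrable_mult_indicator[OF _ that, of "{0<..<s}"] by simp
  have "(\<integral>r. indicator {0<..<s} r * FW r \<partial>lborel) = (\<integral>r. \<mu> * (indicator {0<..<s} r * A1 r) + indicator {0<..<s} r * A2 r + \<beta> * (indicator {0<..<s} r * A3 r) \<partial>lborel)"
  proof (rule integral_cong_AE)
    show "AE r in lborel. indicator {0<..<s} r * FW r = \<mu> * (indicator {0<..<s} r * A1 r) + indicator {0<..<s} r * A2 r + \<beta> * (indicator {0<..<s} r * A3 r)"
      using FWA by eventually_elim (simp add: algebra_simps)
    show "(\<lambda>r. indicator {0<..<s} r * FW r) \<in> borel_measurable lborel" by measurable
    show "(\<lambda>r. \<mu> * (indicator {0<..<s} r * A1 r) + indicator {0<..<s} r * A2 r + \<beta> * (indicator {0<..<s} r * A3 r)) \<in> borel_measurable lborel"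
      using Am by measurable
  qed
  also have "\<dots> = \<mu> * (\<integral>r. indicator {0<..<s} r * A1 r \<partial>lborel) + (\<integral>r. indicator {0<..<s} r * A2 r \<partial>lborel) + \<beta> * (\<integral>r. indicator {0<..<s} r * A3 r \<partial>lborel)"
    using ind[OF iA(1)] ind[OF iA(2)] ind[OF iA(3)] by simp
  finally have Fs: "(\<integral>r. indicator {0<..<s} r * FW r \<partial>lborel) = \<mu> * (\<integral>r. indicator {0<..<s} r * A1 r \<partial>lborel) + (\<integral>r. indicator {0<..<s} r * A2 r \<partial>lborel) + \<beta> * (\<integral>r. indicator {0<..<s} r * A3 r \<partial>lborel)" .
  show "(\<integral>x. U s x \<bullet> w x \<partial>lborel) - (\<integral>x. u0b x \<bullet> w x \<partial>lborel)
        = - (\<integral>r. indicator {0<..<s} r * (\<integral>x. kk \<mu> \<beta> (U r x) (G r x) (w x) (jac w x) \<partial>lborel) \<partial>lborel)"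
    using WF[unfolded weak_form_def, rule_format, OF tD] unfolding FW_def[symmetric] Fs e0 e1 e2 e3 es eu0 by linarith
qed

section \<open>Transfer of norms and approximating sequences to Borel representatives\<close>

lemma l2norm_eq_n2: "l2norm \<Omega> f = n2 (lebesgue_on \<Omega>) f" by (simp add: l2norm_def n2_def)

lemma n2_lebesgue_on:
  fixes f g :: "real^3 => 'b::euclidean_space"
  assumes "\<Omega> \<in> sets borel" "g \<in> borel_measurable borel" "\<And>x. x \<notin> \<Omega> ==> g x = 0" "AE x in lborel. x \<in> \<Omega> --> f x = g x"
  shows "n2 (lebesgue_on \<Omega>) f = n2 lborel g" "sqi (lebesgue_on \<Omega>) f \<longleftrightarrow> sqi lborel g"
proof -
  have ae: "AE x in lborel. x \<in> \<Omega> --> (norm (f x))\<^sup>2 = (norm (g x))\<^sup>2" using assms(4) by eventually_elim simp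
  have gm: "(\<lambda>x. (norm (g x))\<^sup>2) \<in> borel_measurable borel" using assms(2) by measurable
  have gz: "(norm (g x))\<^sup>2 = 0" if "x \<notin> \<Omega>" for x using assms(3) that by simp
  have r2: "(\<integral>x. (norm (f x))\<^sup>2 \<partial>lebesgue_on \<Omega>) = (\<integral>x. (norm (g x))\<^sup>2 \<partial>lborel)"
    by (rule lebesgue_on_representative(2)[OF assms(1) gm gz ae])
  have r3: "integrable (lebesgue_on \<Omega>) (\<lambda>x. (norm (f x))\<^sup>2) \<longleftrightarrow> integrable lborel (\<lambda>x. (norm (g x))\<^sup>2)"
    by (rule lebesgue_on_representative(3)[OF assms(1) gm gz ae])
  show "n2 (lebesgue_on \<Omega>) f = n2 lborel g" unfolding n2_def r2 ..
  show "sqi (lebesgue_on \<Omega>) f \<longleftrightarrow> sqi lborel g"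
    unfolding sqi_def r3 using assms(2) lebesgue_on_representative(1)[OF assms] by simp
qed

text \<open>Collects, in terms of representatives, what is known at a single time. The gradient
  approximated in \<open>in_H01\<close> is first identified with the given one by
  \<open>weak_grad_unique\<close>.\<close>

lemma good_time:
  fixes u U :: "real^3 => real^3" and Gw G :: "real^3 => real^3^3"
  assumes O: "open \<Omega>" "bounded \<Omega>"
    and U: "U \<in> borel_measurable borel" "\<And>x. x \<notin> \<Omega> ==> U x = 0" "AE x in lborel. x \<in> \<Omega> --> u x = U x"
    and G: "G \<in> borel_measurable borel" "\<And>x. x \<notin> \<Omega> ==> G x = 0" "AE x in lborel. x \<in> \<Omega> --> Gw x = G x"
    and H: "in_H \<Omega> u" "in_H01 \<Omega> u" "is_weak_grad \<Omega> u Gw"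
  obtains \<phi> \<psi> where "\<And>n. test_divfree \<Omega> (\<phi> n)" "(\<lambda>n. n2 lborel (\<lambda>x. \<phi> n x - U x)) \<longlonglongrightarrow> 0"
    "\<And>n. test_vec \<Omega> (\<psi> n)" "(\<lambda>n. n2 lborel (\<lambda>x. \<psi> n x - U x)) \<longlonglongrightarrow> 0"
    "(\<lambda>n. n2 lborel (\<lambda>x. jac (\<psi> n) x - G x)) \<longlonglongrightarrow> 0"
    "\<And>f i j. test_scalar \<Omega> f ==> (\<integral>x. U x $ i * pd j f x \<partial>lborel) = - (\<integral>x. G x $ i $ j * f x \<partial>lborel)"
proof -
  have Ob: "\<Omega> \<in> sets borel" using O by simp
  note [measurable] = U(1) G(1)
  obtain \<phi> where \<phi>: "\<And>n. test_divfree \<Omega> (\<phi> n)" "(\<lambda>n. l2norm \<Omega> (\<lambda>x. \<phi> n x - u x)) \<longlonglongrightarrow> 0"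
    using H(1) unfolding in_H_def by blast
  obtain G' \<psi> where G': "is_weak_grad \<Omega> u G'" and \<psi>: "\<And>n. test_vec \<Omega> (\<psi> n)" "(\<lambda>n. l2norm \<Omega> (\<lambda>x. \<psi> n x - u x)) \<longlonglongrightarrow> 0"
    "(\<lambda>n. l2norm \<Omega> (\<lambda>x. (\<chi> i j. pd j (\<lambda>y. \<psi> n y $ i) x) - G' x)) \<longlonglongrightarrow> 0"
    using H(2) unfolding in_H01_def by blast
  have c1: "l2norm \<Omega> (\<lambda>x. f x - u x) = n2 lborel (\<lambda>x. f x - U x)" if f: "test_vec \<Omega> f" for f
  proof -
    note s = test_vec_smooth[OF f]
    have [measurable]: "f \<in> borel_measurable borel" by (rule borel_smooth[OF s(1)])
    show ?thesis unfolding l2norm_eq_n2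
    proof (rule n2_lebesgue_on(1)[OF Ob])
      show "AE x in lborel. x \<in> \<Omega> --> f x - u x = f x - U x" using U(3) by eventually_elim simp
      show "f x - U x = 0" if "x \<notin> \<Omega>" for x using s(3) U(2) that by simp
    qed measurable
  qed
  have ae: "AE x in lborel. x \<in> \<Omega> --> G' x = G x"
    using weak_grad_unique[OF O(1) G' H(3)] G(3) by eventually_elim simp
  have c2: "l2norm \<Omega> (\<lambda>x. (\<chi> i j. pd j (\<lambda>y. f y $ i) x) - G' x) = n2 lborel (\<lambda>x. jac f x - G x)" if f: "test_vec \<Omega> f" for f
  proof -
    note s = test_vec_smooth[OF f]
    have [measurable]: "jac f \<in> borel_measurable borel" by (intro borel_measurable_continuous_onI jac_continuous s)
    show ?thesis unfolding l2norm_eq_n2 jac_def[symmetric]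
    proof (rule n2_lebesgue_on(1)[OF Ob])
      show "AE x in lborel. x \<in> \<Omega> --> jac f x - G' x = jac f x - G x" using ae by eventually_elim simp
      show "jac f x - G x = 0" if "x \<notin> \<Omega>" for x using jac_zero[OF f] G(2) that by simp
    qed measurable
  qed
  show ?thesis
  proof (rule that[of \<phi> \<psi>])
    show "(\<lambda>n. n2 lborel (\<lambda>x. \<phi> n x - U x)) \<longlonglongrightarrow> 0" using \<phi>(2) unfolding c1[OF test_divfree_vec[OF \<phi>(1)]] .
    show "(\<lambda>n. n2 lborel (\<lambda>x. \<psi> n x - U x)) \<longlonglongrightarrow> 0" using \<psi>(2) unfolding c1[OF \<psi>(1)] .
    show "(\<lambda>n. n2 lborel (\<lambda>x. jac (\<psi> n) x - G x)) \<longlonglongrightarrow> 0" using \<psi>(3) unfolding c2[OF \<psi>(1)] .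
    fix f :: "real^3 => real" and i j :: 3 assume f: "test_scalar \<Omega> f"
    have fs: "smooth f" using f by (simp add: test_scalar_def)
    have [measurable]: "f \<in> borel_measurable borel" by (rule borel_smooth[OF fs])
    have "pd j f = (\<lambda>x. dd (axis j 1) f x)" by (intro ext pd_eq_dd smooth_differentiable fs)
    then have [measurable]: "(\<lambda>x. pd j f x) \<in> borel_measurable borel" using borel_smooth[OF smooth_dd[OF fs]] by simp
    have "integral\<^sup>L (lebesgue_on \<Omega>) (\<lambda>x. u x $ i * pd j f x) = (\<integral>x. U x $ i * pd j f x \<partial>lborel)"
    proof (rule lebesgue_on_representative(2)[OF Ob])
      show "AE x in lborel. x \<in> \<Omega> --> u x $ i * pd j f x = U x $ i * pd j f x" using U(3) by eventually_elim simp
      show "U x $ i * pd j f x = 0" if "x \<notin> \<Omega>" for x using U(2) that by simp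
    qed measurable
    moreover have "integral\<^sup>L (lebesgue_on \<Omega>) (\<lambda>x. Gw x $ i $ j * f x) = (\<integral>x. G x $ i $ j * f x \<partial>lborel)"
    proof (rule lebesgue_on_representative(2)[OF Ob])
      show "AE x in lborel. x \<in> \<Omega> --> Gw x $ i $ j * f x = G x $ i $ j * f x" using G(3) by eventually_elim simp
      show "G x $ i $ j * f x = 0" if "x \<notin> \<Omega>" for x using G(2) that by simp
    qed measurable
    moreover have "integral\<^sup>L (lebesgue_on \<Omega>) (\<lambda>x. u x $ i * pd j f x) = - integral\<^sup>L (lebesgue_on \<Omega>) (\<lambda>x. Gw x $ i $ j * f x)"
      using H(3) f unfolding is_weak_grad_def by blast
    ultimately show "(\<integral>x. U x $ i * pd j f x \<partial>lborel) = - (\<integral>x. G x $ i $ j * f x \<partial>lborel)" by simp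
  qed (rule \<phi>(1), rule \<psi>(1))
qed

section \<open>The continuous representative\<close>

text \<open>Extension by continuity from a dense set of times, using completeness of L^2. On
  \<open>D\<close> the old value is kept as a function and not merely up to null sets, hence the
  case distinction.\<close>

lemma (in finite_measure) cauchy_extension:
  fixes f :: "real => 'a => 'b::euclidean_space"
  assumes f: "\<And>t. t \<in> D ==> sqi M (f t)"
    and dense: "\<And>t d. t \<in> I ==> d > 0 ==> \<exists>s\<in>D. \<bar>s - t\<bar> < d"
    and C: "\<And>t e. t \<in> I ==> e > 0 ==>
      \<exists>d>0. \<forall>s\<in>D. \<forall>s'\<in>D. \<bar>s - t\<bar> < d --> \<bar>s' - t\<bar> < d --> n2 M (\<lambda>x. f s x - f s' x) < e"
  obtains v where "\<And>t. t \<in> D ==> t \<in> I ==> v t = f t" "\<And>t. t \<in> I ==> sqi M (v t)"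
    "\<And>t e. t \<in> I ==> e > 0 ==> \<exists>d>0. \<forall>s\<in>D. \<bar>s - t\<bar> < d --> n2 M (\<lambda>x. f s x - v t x) < e"
    "\<And>t e. t \<in> I ==> e > 0 ==> \<exists>d>0. \<forall>s\<in>I. \<bar>s - t\<bar> < d --> n2 M (\<lambda>x. v s x - v t x) < e"
proof -
  have ex: "\<exists>g. (t \<in> D --> g = f t) \<and> sqi M g \<and> (\<forall>e>0. \<exists>d>0. \<forall>s\<in>D. \<bar>s - t\<bar> < d --> n2 M (\<lambda>x. f s x - g x) < e)"
    if t: "t \<in> I" for t
  proof (cases "t \<in> D")
    case True
    have "\<exists>d>0. \<forall>s\<in>D. \<bar>s - t\<bar> < d --> n2 M (\<lambda>x. f s x - f t x) < e" if e: "e > 0" for e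
    proof -
      obtain d where d: "d > 0" "\<And>s s'. s \<in> D ==> s' \<in> D ==> \<bar>s - t\<bar> < d ==> \<bar>s' - t\<bar> < d ==> n2 M (\<lambda>x. f s x - f s' x) < e"
        using C[OF t e] by blast
      show ?thesis using d(1) d(2)[OF _ True] by (intro exI[of _ d]) simp
    qed
    then show ?thesis using f[OF True] by (intro exI[of _ "f t"]) simp
  next
    case False
    have "\<forall>n. \<exists>s. s \<in> D \<and> \<bar>s - t\<bar> < inverse (real (Suc n))" using dense[OF t] by (auto simp: Bex_def)
    then obtain \<sigma> where \<sigma>: "\<And>n. \<sigma> n \<in> D" "\<And>n. \<bar>\<sigma> n - t\<bar> < inverse (real (Suc n))" by metis
    have near: "\<exists>N. \<forall>n\<ge>N. \<bar>\<sigma> n - t\<bar> < d" if d: "d > 0" for d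
    proof -
      obtain N where N: "inverse (real (Suc N)) < d" using reals_Archimedean[OF d] by blast
      have "\<bar>\<sigma> n - t\<bar> < d" if "n \<ge> N" for n
      proof -
        have "inverse (real (Suc n)) \<le> inverse (real (Suc N))" using that by (intro le_imp_inverse_le) auto
        then show ?thesis using \<sigma>(2)[of n] N by linarith
      qed
      then show ?thesis by blast
    qed
    have cau: "\<exists>N. \<forall>i\<ge>N. \<forall>j\<ge>N. n2 M (\<lambda>x. f (\<sigma> i) x - f (\<sigma> j) x) < e" if e: "e > 0" for e
    proof -
      obtain d where d: "d > 0" "\<And>s s'. s \<in> D ==> s' \<in> D ==> \<bar>s - t\<bar> < d ==> \<bar>s' - t\<bar> < d ==> n2 M (\<lambda>x. f s x - f s' x) < e"
        using C[OF t e] by blast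
      obtain N where "\<And>n. n \<ge> N ==> \<bar>\<sigma> n - t\<bar> < d" using near[OF d(1)] by blast
      then show ?thesis using d(2)[OF \<sigma>(1) \<sigma>(1)] by blast
    qed
    obtain g where g: "sqi M g" "(\<lambda>n. n2 M (\<lambda>x. f (\<sigma> n) x - g x)) \<longlonglongrightarrow> 0"
      by (rule n2_complete[of "\<lambda>n. f (\<sigma> n)", OF f[OF \<sigma>(1)]], erule cau, rule that)
    have "\<exists>d>0. \<forall>s\<in>D. \<bar>s - t\<bar> < d --> n2 M (\<lambda>x. f s x - g x) < e" if "e > 0" for e
    proof -
      have "e / 2 > 0" using that by simp
      then obtain d where d: "d > 0" "\<And>s s'. s \<in> D ==> s' \<in> D ==> \<bar>s - t\<bar> < d ==> \<bar>s' - t\<bar> < d ==> n2 M (\<lambda>x. f s x - f s' x) < e / 2"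
        using C[OF t] by blast
      obtain N where N: "\<And>n. n \<ge> N ==> \<bar>\<sigma> n - t\<bar> < d" using near[OF d(1)] by blast
      obtain N' where N': "\<And>n. n \<ge> N' ==> norm (n2 M (\<lambda>x. f (\<sigma> n) x - g x) - 0) < e / 2"
        using LIMSEQ_D[OF g(2) \<open>e / 2 > 0\<close>] by blast
      define k where "k = max N N'"
      have "n2 M (\<lambda>x. f s x - g x) < e" if s: "s \<in> D" "\<bar>s - t\<bar> < d" for s
        using n2_triangle_diff[OF f[OF s(1)] f[OF \<sigma>(1)[of k]] g(1)] d(2)[OF s(1) \<sigma>(1)[of k] s(2) N[of k]] N'[of k]
        by (simp add: k_def)
      then show ?thesis using d(1) by blast
    qed
    then show ?thesis using False g(1) by blast
  qed
  obtain v where v: "\<And>t. t \<in> I ==> (t \<in> D --> v t = f t) \<and> sqi M (v t) \<and> (\<forall>e>0. \<exists>d>0. \<forall>s\<in>D. \<bar>s - t\<bar> < d --> n2 M (\<lambda>x. f s x - v t x) < e)"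
    using bchoice[of I "\<lambda>t g. (t \<in> D --> g = f t) \<and> sqi M g \<and> (\<forall>e>0. \<exists>d>0. \<forall>s\<in>D. \<bar>s - t\<bar> < d --> n2 M (\<lambda>x. f s x - g x) < e)"] ex
    by blast
  have v3: "\<exists>d>0. \<forall>s\<in>D. \<bar>s - t\<bar> < d --> n2 M (\<lambda>x. f s x - v t x) < e" if "t \<in> I" "e > 0" for t e
    using v[OF that(1)] that(2) by blast
  show ?thesis
  proof (rule that[OF _ _ v3])
    fix t e :: real assume t: "t \<in> I" and "e > 0"
    then have e: "e / 2 > 0" by simp
    obtain d where d: "d > 0" "\<And>s. s \<in> D ==> \<bar>s - t\<bar> < d ==> n2 M (\<lambda>x. f s x - v t x) < e / 2"
      using v3[OF t e] by blast
    have "n2 M (\<lambda>x. v s x - v t x) < e" if s: "s \<in> I" "\<bar>s - t\<bar> < d" for s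
    proof -
      obtain d' where d': "d' > 0" "\<And>r. r \<in> D ==> \<bar>r - s\<bar> < d' ==> n2 M (\<lambda>x. f r x - v s x) < e / 2"
        using v3[OF s(1) e] by blast
      \<comment> \<open>\<open>r\<close> lies within \<open>d'\<close> of \<open>s\<close> and still
        within \<open>d\<close> of \<open>t\<close>, so both estimates for \<open>f r\<close>
        apply.\<close>
      obtain r where r: "r \<in> D" "\<bar>r - s\<bar> < min d' (d - \<bar>s - t\<bar>)" using dense[OF s(1), of "min d' (d - \<bar>s - t\<bar>)"] d'(1) s(2) by auto
      have "\<bar>r - s\<bar> < d'" "\<bar>r - t\<bar> < d" using r(2) by linarith+
      then show ?thesis
        using n2_triangle_diff[of M "v s" "f r" "v t"] v[OF s(1)] v[OF t] f[OF r(1)] d(2)[OF r(1)] d'(2)[OF r(1)]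
        by (simp add: n2_diff_commute[of M "v s" "f r"])
    qed
    then show "\<exists>d>0. \<forall>s\<in>I. \<bar>s - t\<bar> < d --> n2 M (\<lambda>x. v s x - v t x) < e" using d(1) by blast
  qed (use v in blast)+
qed

lemma sqi_test_divfree:
  assumes "open \<Omega>" "test_divfree \<Omega> w" shows "sqi lborel w" "sqi (lebesgue_on \<Omega>) w"
proof -
  note s = test_vec_smooth[OF test_divfree_vec[OF assms(2)]]
  show *: "sqi lborel w" by (intro sqi_bsupp smooth_continuous s)
  show "sqi (lebesgue_on \<Omega>) w"
    by (subst n2_lebesgue_on(2)[of _ w w]) (use assms(1) * borel_smooth[OF s(1)] s(3) in auto)
qed

lemma in_H_iff: "in_H \<Omega> f \<longleftrightarrow> sqi (lebesgue_on \<Omega>) f \<and> (\<forall>e>0. \<exists>\<phi>. test_divfree \<Omega> \<phi> \<and> n2 (lebesgue_on \<Omega>) (\<lambda>x. \<phi> x - f x) < e)"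
proof
  assume "in_H \<Omega> f"
  then obtain \<phi> where \<phi>: "L2 \<Omega> f" "\<And>n. test_divfree \<Omega> (\<phi> n)" "(\<lambda>n. n2 (lebesgue_on \<Omega>) (\<lambda>x. \<phi> n x - f x)) \<longlonglongrightarrow> 0"
    unfolding in_H_def l2norm_eq_n2 by blast
  have "\<exists>\<phi>. test_divfree \<Omega> \<phi> \<and> n2 (lebesgue_on \<Omega>) (\<lambda>x. \<phi> x - f x) < e" if e: "e > 0" for e
  proof -
    obtain N where "\<And>n. n \<ge> N ==> norm (n2 (lebesgue_on \<Omega>) (\<lambda>x. \<phi> n x - f x) - 0) < e" using LIMSEQ_D[OF \<phi>(3) e] by blast
    from this[of N] show ?thesis using \<phi>(2)[of N] by (intro exI[of _ "\<phi> N"]) simp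
  qed
  then show "sqi (lebesgue_on \<Omega>) f \<and> (\<forall>e>0. \<exists>\<phi>. test_divfree \<Omega> \<phi> \<and> n2 (lebesgue_on \<Omega>) (\<lambda>x. \<phi> x - f x) < e)"
    using \<phi>(1) by (simp add: L2_def sqi_def)
next
  assume R: "sqi (lebesgue_on \<Omega>) f \<and> (\<forall>e>0. \<exists>\<phi>. test_divfree \<Omega> \<phi> \<and> n2 (lebesgue_on \<Omega>) (\<lambda>x. \<phi> x - f x) < e)"
  then have "\<forall>n. \<exists>\<phi>. test_divfree \<Omega> \<phi> \<and> n2 (lebesgue_on \<Omega>) (\<lambda>x. \<phi> x - f x) < 1 / real (Suc n)" by simp
  from choice[OF this] obtain \<phi> where \<phi>: "\<And>n. test_divfree \<Omega> (\<phi> n)" "\<And>n. n2 (lebesgue_on \<Omega>) (\<lambda>x. \<phi> n x - f x) < 1 / real (Suc n)" by blast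
  have "(\<lambda>n. n2 (lebesgue_on \<Omega>) (\<lambda>x. \<phi> n x - f x)) \<longlonglongrightarrow> 0"
    by (rule LIMSEQ_norm_0) (use \<phi>(2) in simp)
  then show "in_H \<Omega> f" unfolding in_H_def l2norm_eq_n2 using \<phi>(1) R by (auto simp: L2_def sqi_def)
qed

lemma in_H_closed:
  assumes "open \<Omega>" "sqi (lebesgue_on \<Omega>) g" "\<And>e. e > 0 ==> \<exists>f. in_H \<Omega> f \<and> n2 (lebesgue_on \<Omega>) (\<lambda>x. f x - g x) < e"
  shows "in_H \<Omega> g"
  unfolding in_H_iff
proof (intro conjI allI impI assms(2))
  fix e :: real assume "e > 0"
  then have e: "e / 2 > 0" by simp
  obtain f where f: "in_H \<Omega> f" "n2 (lebesgue_on \<Omega>) (\<lambda>x. f x - g x) < e / 2" using assms(3)[OF e] by blast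
  then obtain \<phi> where \<phi>: "test_divfree \<Omega> \<phi>" "n2 (lebesgue_on \<Omega>) (\<lambda>x. \<phi> x - f x) < e / 2" and fs: "sqi (lebesgue_on \<Omega>) f"
    using e unfolding in_H_iff by blast
  show "\<exists>\<phi>. test_divfree \<Omega> \<phi> \<and> n2 (lebesgue_on \<Omega>) (\<lambda>x. \<phi> x - g x) < e"
    using n2_triangle_diff[OF sqi_test_divfree(2)[OF assms(1) \<phi>(1)] fs assms(2)] f(2) \<phi> by (intro exI[of _ \<phi>]) simp
qed

lemma in_H_cong_AE:
  assumes O: "open \<Omega>" and f: "in_H \<Omega> f" and g: "g \<in> borel_measurable borel" "\<And>x. x \<notin> \<Omega> ==> g x = 0"
    and ae: "AE x in lborel. x \<in> \<Omega> --> f x = g x"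
  shows "in_H \<Omega> g"
proof (rule in_H_closed[OF O])
  have Ob: "\<Omega> \<in> sets borel" using O by simp
  show "sqi (lebesgue_on \<Omega>) g"
    using f n2_lebesgue_on(2)[OF Ob g ae] n2_lebesgue_on(2)[OF Ob g, of g] by (simp add: in_H_iff)
  have "n2 (lebesgue_on \<Omega>) (\<lambda>x. f x - g x) = n2 lborel (\<lambda>x::real^3. 0::real^3)"
    by (rule n2_lebesgue_on(1)[OF Ob]) (use ae in \<open>auto elim: eventually_mono\<close>)
  then show "\<exists>f. in_H \<Omega> f \<and> n2 (lebesgue_on \<Omega>) (\<lambda>x. f x - g x) < e" if "e > 0" for e
    using f that by (intro exI[of _ f]) (simp add: n2_def)
qed

text \<open>The difference is orthogonal to the solenoidal test fields, by density to all of H, in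
  particular to \<open>f\<close> and to \<open>g\<close>, and therefore to itself.\<close>

lemma in_H_eqI:
  assumes O: "open \<Omega>" and f: "in_H \<Omega> f" and g: "in_H \<Omega> g"
    and orth: "\<And>w. test_divfree \<Omega> w ==> (\<integral>x. f x \<bullet> w x \<partial>lebesgue_on \<Omega>) = (\<integral>x. g x \<bullet> w x \<partial>lebesgue_on \<Omega>)"
  shows "AE x in lebesgue_on \<Omega>. f x = g x"
proof -
  let ?M = "lebesgue_on \<Omega>"
  have s: "sqi ?M f" "sqi ?M g" using f g by (auto simp: in_H_iff)
  define h where "h = (\<lambda>x. f x - g x)"
  have h: "sqi ?M h" unfolding h_def by (rule sqi_diff[OF s])
  have hw: "(\<integral>x. w x \<bullet> h x \<partial>?M) = 0" if w: "test_divfree \<Omega> w" for w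
  proof -
    note sw = sqi_test_divfree(2)[OF O w]
    show ?thesis unfolding h_def inner_diff_right
      using sqi_inner[OF sw s(1)] sqi_inner[OF sw s(2)] orth[OF w] by (simp add: inner_commute)
  qed
  have z: "(\<integral>x. k x \<bullet> h x \<partial>?M) = 0" if k: "in_H \<Omega> k" for k
  proof -
    obtain \<phi> where \<phi>: "\<And>n. test_divfree \<Omega> (\<phi> n)" "(\<lambda>n. n2 ?M (\<lambda>x. \<phi> n x - k x)) \<longlonglongrightarrow> 0"
      using k unfolding in_H_def l2norm_eq_n2 by blast
    have ks: "sqi ?M k" using k by (simp add: in_H_iff)
    have "(\<lambda>n. \<integral>x. \<phi> n x \<bullet> h x \<partial>?M) \<longlonglongrightarrow> (\<integral>x. k x \<bullet> h x \<partial>?M)"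
      by (rule inner_tendsto_n2[OF sqi_test_divfree(2)[OF O \<phi>(1)] ks h \<phi>(2)])
    then show ?thesis unfolding hw[OF \<phi>(1)] by (simp add: LIMSEQ_const_iff)
  qed
  have "(\<integral>x. (norm (h x))\<^sup>2 \<partial>?M) = (\<integral>x. f x \<bullet> h x - g x \<bullet> h x \<partial>?M)"
    by (simp add: h_def power2_norm_eq_inner inner_diff_left)
  also have "\<dots> = 0" using sqi_inner[OF s(1) h] sqi_inner[OF s(2) h] z[OF f] z[OF g] by simp
  finally have "AE x in ?M. (norm (h x))\<^sup>2 = 0"
    using integral_nonneg_eq_0_iff_AE[OF sqi_integrable[OF h]] by simp
  then show ?thesis by eventually_elim (simp add: h_def)
qed

lemma interval_integral_tendsto:
  fixes f :: "real => real"
  assumes f: "integrable lborel f" and a: "a \<longlonglongrightarrow> t"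
  shows "(\<lambda>n. \<integral>r. indicator {0<..<a n} r * f r \<partial>lborel) \<longlonglongrightarrow> (\<integral>r. indicator {0<..<t} r * f r \<partial>lborel)"
proof (rule integral_dominated_convergence)
  have [measurable]: "f \<in> borel_measurable lborel" using f by auto
  show "(\<lambda>r. indicator {0<..<t} r * f r) \<in> borel_measurable lborel" by measurable
  show "(\<lambda>r. indicator {0<..<a n} r * f r) \<in> borel_measurable lborel" for n by measurable
  show "integrable lborel (\<lambda>r. norm (f r))" using f by simp
  show "AE r in lborel. norm (indicator {0<..<a n} r * f r) \<le> norm (f r)" for n by (intro AE_I2) (simp add: indicator_def)
  show "AE r in lborel. (\<lambda>n. indicator {0<..<a n} r * f r) \<longlonglongrightarrow> indicator {0<..<t} r * f r"
    using AE_lborel_singleton[of t]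
  proof eventually_elim
    case (elim r)
    have "eventually (\<lambda>n. indicator {0<..<a n} r * f r = indicator {0<..<t} r * f r) sequentially"
    proof (cases "r < t")
      case True
      show ?thesis using order_tendstoD(1)[OF a True] by eventually_elim (use True in \<open>simp add: indicator_def\<close>)
    next
      case False
      then have "t < r" using elim by simp
      show ?thesis using order_tendstoD(2)[OF a \<open>t < r\<close>] by eventually_elim (use \<open>t < r\<close> in \<open>simp add: indicator_def\<close>)
    qed
    then show ?case by (rule tendsto_eventually)
  qed
qed

section \<open>The solution as its own test field\<close>

lemma hv_inner_integrable:
  assumes [measurable]: "a \<in> borel_measurable borel" "B \<in> borel_measurable borel" "\<phi> \<in> borel_measurable borel"
    and i: "integrable lborel (\<lambda>x. norm (a x) ^ 4)" "integrable lborel (\<lambda>x. (norm (B x))\<^sup>2)" "integrable lborel (\<lambda>x. norm (\<phi> x) ^ 4)"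
  shows "integrable lborel (\<lambda>x. hv \<beta> (a x) (B x) \<bullet> \<phi> x)"
proof -
  obtain C where C: "C \<ge> 0" "\<And>a B \<phi>. \<bar>hv \<beta> a B \<bullet> \<phi>\<bar> \<le> C * (norm a ^ 4 + (norm B)\<^sup>2) + 1 * norm \<phi> ^ 4"
    by (rule kk0_scaled_bound[of 1 \<beta>]) (simp, rule that)
  show ?thesis
  proof (rule Bochner_Integration.integrable_bound)
    show "integrable lborel (\<lambda>x. C * (norm (a x) ^ 4 + (norm (B x))\<^sup>2) + 1 * norm (\<phi> x) ^ 4)" using i by simp
    show "AE x in lborel. norm (hv \<beta> (a x) (B x) \<bullet> \<phi> x) \<le> norm (C * (norm (a x) ^ 4 + (norm (B x))\<^sup>2) + 1 * norm (\<phi> x) ^ 4)"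
      unfolding real_norm_def by (intro AE_I2 order_trans[OF C(2) abs_ge_self])
  qed measurable
qed

lemma integral_kk_split:
  assumes m: "a \<in> borel_measurable borel" "B \<in> borel_measurable borel" "\<phi> \<in> borel_measurable borel" "A \<in> borel_measurable borel"
    and i: "integrable lborel (\<lambda>x. norm (a x) ^ 4)" "integrable lborel (\<lambda>x. (norm (B x))\<^sup>2)" "integrable lborel (\<lambda>x. norm (\<phi> x) ^ 4)"
    "integrable lborel (\<lambda>x. (norm (A x))\<^sup>2)"
  shows "(\<integral>x. kk \<mu> \<beta> (a x) (B x) (\<phi> x) (A x) \<partial>lborel) = \<mu> * (\<integral>x. B x \<bullet> A x \<partial>lborel) + (\<integral>x. hv \<beta> (a x) (B x) \<bullet> \<phi> x \<partial>lborel)"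
proof -
  have "sqi lborel B" "sqi lborel A" using m i by (simp_all add: sqi_def)
  then show ?thesis unfolding kk_split using hv_inner_integrable[OF m(1-3) i(1-3)] sqi_inner[of lborel B A] by simp
qed

lemma n2_le_fourth:
  fixes w :: "real^3 => 'b::euclidean_space"
  assumes O: "open \<Omega>" "bounded \<Omega>" and w: "w \<in> borel_measurable borel" "\<And>x. x \<notin> \<Omega> ==> w x = 0" "integrable lborel (\<lambda>x. norm (w x) ^ 4)"
    and K: "(\<integral>x. norm (w x) ^ 4 \<partial>lborel) \<le> K"
  shows "n2 lborel w \<le> sqrt (measure lborel \<Omega> + K)"
proof (rule real_le_rsqrt)
  have iO: "integrable lborel (indicat_real \<Omega>)" using O emeasure_bounded_finite[OF O(2)] by (simp add: integrable_indicator_iff)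
  have "(n2 lborel w)\<^sup>2 \<le> (\<integral>x. indicat_real \<Omega> x + norm (w x) ^ 4 \<partial>lborel)"
    unfolding n2_sq
  proof (rule integral_mono)
    show "integrable lborel (\<lambda>x. (norm (w x))\<^sup>2)" using sqi_L4[OF O w] by (simp add: sqi_def)
    show "integrable lborel (\<lambda>x. indicat_real \<Omega> x + norm (w x) ^ 4)" using iO w(3) by simp
    show "(norm (w x))\<^sup>2 \<le> indicat_real \<Omega> x + norm (w x) ^ 4" for x
      using square_le_fourth[of "norm (w x)"] w(2)[of x] by (cases "x \<in> \<Omega>") auto
  qed
  also have "\<dots> = measure lborel \<Omega> + (\<integral>x. norm (w x) ^ 4 \<partial>lborel)" using iO w(3) by simp
  finally show "(n2 lborel w)\<^sup>2 \<le> measure lborel \<Omega> + K" using K by linarith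
qed

text \<open>The approximating sequences vary with the time, so their existence is bundled per time:
  \<open>self_test_identity\<close> uses them at \<open>t\<close> for \<open>approx\<close> and at
  every \<open>r\<close> for the viscous limit.\<close>

definition H_data :: "(real^3) set => (real^3 => real^3) => (real^3 => real^3^3) => bool" where
  "H_data \<Omega> U G \<longleftrightarrow> integrable lborel (\<lambda>x. norm (U x) ^ 4) \<and> integrable lborel (\<lambda>x. (norm (G x))\<^sup>2) \<and>
    (\<forall>f i j. test_scalar \<Omega> f --> (\<integral>x. U x $ i * pd j f x \<partial>lborel) = - (\<integral>x. G x $ i $ j * f x \<partial>lborel)) \<and>
    (\<exists>\<phi> \<psi>. (\<forall>n. test_divfree \<Omega> (\<phi> n)) \<and> (\<lambda>n. n2 lborel (\<lambda>x. \<phi> n x - U x)) \<longlonglongrightarrow> 0 \<and>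
      (\<forall>n. test_vec \<Omega> (\<psi> n)) \<and> (\<lambda>n. n2 lborel (\<lambda>x. \<psi> n x - U x)) \<longlonglongrightarrow> 0 \<and> (\<lambda>n. n2 lborel (\<lambda>x. jac (\<psi> n) x - G x)) \<longlonglongrightarrow> 0)"

text \<open>\<open>approx\<close> at time \<open>t\<close> supplies test fields \<open>w k\<close>.
  At each good time \<open>r\<close> the inner integral converges, the viscous part by
  \<open>weak_pairing_grad\<close> and the rest by \<open>weak_pairing_L4\<close>; in
  \<open>r\<close> the bound \<open>m r\<close> plus a constant, uniform in \<open>k\<close>,
  permits dominated convergence.\<close>

lemma (in inward) self_test_identity:
  fixes U :: "real => real^3 => real^3" and G :: "real => real^3 => real^3^3"
  assumes Um: "(\<lambda>p. U (fst p) (snd p)) \<in> borel_measurable borel"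
    and Gm: "(\<lambda>p. G (fst p) (snd p)) \<in> borel_measurable borel"
    and U0: "\<And>t x. t \<notin> {0<..<T} \<or> x \<notin> \<Omega> ==> U t x = 0"
    and G0: "\<And>t x. t \<notin> {0<..<T} \<or> x \<notin> \<Omega> ==> G t x = 0"
    and U4: "integrable lborel (\<lambda>p. norm (U (fst p) (snd p)) ^ 4)"
    and G2: "integrable lborel (\<lambda>p. (norm (G (fst p) (snd p)))\<^sup>2)"
    and E: "E \<subseteq> {0<..<T}" "AE t in lborel. t \<in> {0<..<T} --> t \<in> E" "\<And>t. t \<in> E ==> H_data \<Omega> (U t) (G t)"
    and u0: "sqi lborel u0" "\<And>x. x \<notin> \<Omega> ==> u0 x = 0"
    and test: "\<And>w. test_divfree \<Omega> w ==> (\<integral>x. U s x \<bullet> w x \<partial>lborel) - (\<integral>x. u0 x \<bullet> w x \<partial>lborel)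
        = - (\<integral>r. indicator {0<..<s} r * (\<integral>x. kk \<mu> \<beta> (U r x) (G r x) (w x) (jac w x) \<partial>lborel) \<partial>lborel)"
    and st: "s \<in> E" "t \<in> E"
  shows "(\<integral>x. U s x \<bullet> U t x \<partial>lborel) - (\<integral>x. u0 x \<bullet> U t x \<partial>lborel)
       = - (\<integral>r. indicator {0<..<s} r * (\<integral>x. kk \<mu> \<beta> (U r x) (G r x) (U t x) (G t x) \<partial>lborel) \<partial>lborel)"
proof -
  note [measurable (raw)] = joint_comp[OF Um] joint_comp[OF Gm]
  have Ut: "U r \<in> borel_measurable borel" "\<And>x. x \<notin> \<Omega> ==> U r x = 0" for r using U0 by auto
  have Gt: "G r \<in> borel_measurable borel" "\<And>x. x \<notin> \<Omega> ==> G r x = 0" for r using G0 by auto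
  have iU: "integrable lborel (\<lambda>x. norm (U r x) ^ 4)" and iG: "integrable lborel (\<lambda>x. (norm (G r x))\<^sup>2)"
    and wg: "\<And>f i j. test_scalar \<Omega> f ==> (\<integral>x. U r x $ i * pd j f x \<partial>lborel) = - (\<integral>x. G r x $ i $ j * f x \<partial>lborel)"
    if "r \<in> E" for r using E(3)[OF that] by (auto simp: H_data_def)
  have sU: "sqi lborel (U r)" and sG: "sqi lborel (G r)" if "r \<in> E" for r
    using sqi_L4[OF op bd Ut iU[OF that]] Gt iG[OF that] by (auto simp: sqi_def)
  obtain \<phi> \<psi> where \<phi>: "\<And>n. test_divfree \<Omega> (\<phi> n)" "(\<lambda>n. n2 lborel (\<lambda>x. \<phi> n x - U t x)) \<longlonglongrightarrow> 0"
    and \<psi>: "\<And>n. test_vec \<Omega> (\<psi> n)" "(\<lambda>n. n2 lborel (\<lambda>x. \<psi> n x - U t x)) \<longlonglongrightarrow> 0" "(\<lambda>n. n2 lborel (\<lambda>x. jac (\<psi> n) x - G t x)) \<longlonglongrightarrow> 0"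
    using E(3)[OF st(2)] unfolding H_data_def by blast
  have sj: "sqi lborel (jac f)" if "test_vec \<Omega> f" for f using test_vec_smooth[OF that] by (intro sqi_jac)
  have "Bseq (\<lambda>n. n2 lborel (jac (\<psi> n)))"
    by (rule convergent_imp_Bseq, rule convergentI, rule n2_tendsto[OF sj[OF \<psi>(1)] sG[OF st(2)] \<psi>(3)])
  then obtain M where M: "\<And>n. n2 lborel (jac (\<psi> n)) \<le> M" by (auto simp: Bseq_def)
  obtain w K where w: "\<And>k. test_divfree \<Omega> (w k)" "\<And>k. (\<integral>x. norm (w k x) ^ 4 \<partial>lborel) \<le> K" "\<And>k. (n2 lborel (jac (w k)))\<^sup>2 \<le> K"
    and wk: "\<And>\<theta>. continuous_on UNIV \<theta> ==> bsupp \<theta> ==> (\<lambda>k. \<integral>x. \<theta> x \<bullet> w k x \<partial>lborel) \<longlonglongrightarrow> (\<integral>x. \<theta> x \<bullet> U t x \<partial>lborel)"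
    by (rule approx[OF Ut iU[OF st(2)] \<phi> \<psi>(1,2) M]) (assumption, rule that)
  note wv = test_divfree_vec[OF w(1)]
  note ws = test_vec_smooth[OF wv]
  have wm: "w k \<in> borel_measurable borel" and jm: "jac (w k) \<in> borel_measurable borel" for k
    using borel_smooth[OF ws(1)] sj[OF wv] by (auto simp: sqi_def)
  have w4: "integrable lborel (\<lambda>x. norm (w k x) ^ 4)" for k
  proof (rule integrable_bsupp)
    show "continuous_on UNIV (\<lambda>x. norm (w k x) ^ 4)" by (intro continuous_intros smooth_continuous ws)
    show "bsupp (\<lambda>x. norm (w k x) ^ 4)" using ws(2)[of k] by (auto simp: bsupp_def)
  qed
  have wj: "integrable lborel (\<lambda>x. (norm (jac (w k) x))\<^sup>2)" for k using sj[OF wv] by (simp add: sqi_def)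
  have wn: "n2 lborel (w k) \<le> sqrt (measure lborel \<Omega> + K)" for k by (rule n2_le_fourth[OF op bd wm ws(3) w4 w(2)])
  have w2: "sqi lborel (w k)" for k by (rule sqi_test_divfree(1)[OF op w(1)])
  have l1: "(\<lambda>k. \<integral>x. U s x \<bullet> w k x \<partial>lborel) \<longlonglongrightarrow> (\<integral>x. U s x \<bullet> U t x \<partial>lborel)"
    by (rule weak_pairing_L2[OF op bd w2 wn sU[OF st(2)] wk sU[OF st(1)] Ut(2)])
  have l2: "(\<lambda>k. \<integral>x. u0 x \<bullet> w k x \<partial>lborel) \<longlonglongrightarrow> (\<integral>x. u0 x \<bullet> U t x \<partial>lborel)"
    by (rule weak_pairing_L2[OF op bd w2 wn sU[OF st(2)] wk u0])
  define FW where "FW k r = (\<integral>x. kk \<mu> \<beta> (U r x) (G r x) (w k x) (jac (w k) x) \<partial>lborel)" for k r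
  define FT where "FT r = (\<integral>x. kk \<mu> \<beta> (U r x) (G r x) (U t x) (G t x) \<partial>lborel)" for r
  have FWm[measurable]: "FW k \<in> borel_measurable borel" for k unfolding FW_def using wm[of k] jm[of k] by measurable
  have FTm[measurable]: "FT \<in> borel_measurable borel" unfolding FT_def by measurable
  define m where "m r = (\<integral>x. norm (U r x) ^ 4 + (norm (G r x))\<^sup>2 \<partial>lborel)" for r
  have mi: "integrable lborel m"
  proof -
    have "integrable lborel (\<lambda>p. norm (U (fst p) (snd p)) ^ 4 + (norm (G (fst p) (snd p)))\<^sup>2)" using U4 G2 by simp
    then have "integrable (lborel \<Otimes>\<^sub>M lborel) (\<lambda>p. norm (U (fst p) (snd p)) ^ 4 + (norm (G (fst p) (snd p)))\<^sup>2)" by (subst lborel_prod)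
    from lborel_pair.integrable_fst'[OF this] show ?thesis unfolding m_def by simp
  qed
  obtain C where C: "C \<ge> 0" "\<And>a B \<phi> A. \<bar>kk \<mu> \<beta> a B \<phi> A\<bar> \<le> 1 * (norm a ^ 4 + (norm B)\<^sup>2) + C * (norm \<phi> ^ 4 + (norm A)\<^sup>2)"
    by (rule kk_bound[of 1 \<mu> \<beta>]) (simp, rule that)
  have FWb: "\<bar>FW k r\<bar> \<le> m r + C * (2 * K)" if r: "r \<in> E" for k r
  proof -
    have b: "integrable lborel (\<lambda>x. (norm (U r x) ^ 4 + (norm (G r x))\<^sup>2) + C * (norm (w k x) ^ 4 + (norm (jac (w k) x))\<^sup>2))"
      using iU[OF r] iG[OF r] w4 wj by simp
    have "\<bar>FW k r\<bar> \<le> (\<integral>x. (norm (U r x) ^ 4 + (norm (G r x))\<^sup>2) + C * (norm (w k x) ^ 4 + (norm (jac (w k) x))\<^sup>2) \<partial>lborel)"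
      unfolding FW_def real_norm_def[symmetric]
    proof (rule Bochner_Integration.integral_norm_bound_integral[OF _ b])
      have [measurable]: "w k \<in> borel_measurable borel" "jac (w k) \<in> borel_measurable borel" by (rule wm, rule jm)
      show "integrable lborel (\<lambda>x. kk \<mu> \<beta> (U r x) (G r x) (w k x) (jac (w k) x))"
      proof (rule Bochner_Integration.integrable_bound[OF b])
        show "AE x in lborel. norm (kk \<mu> \<beta> (U r x) (G r x) (w k x) (jac (w k) x))
            \<le> norm ((norm (U r x) ^ 4 + (norm (G r x))\<^sup>2) + C * (norm (w k x) ^ 4 + (norm (jac (w k) x))\<^sup>2))"
          unfolding real_norm_def by (intro AE_I2 order_trans[OF C(2)]) simp
      qed measurable
    qed (use C(2) in simp)
    also have "\<dots> = m r + C * ((\<integral>x. norm (w k x) ^ 4 \<partial>lborel) + (n2 lborel (jac (w k)))\<^sup>2)"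
      unfolding m_def n2_sq using iU[OF r] iG[OF r] w4[of k] wj[of k] by simp
    also have "\<dots> \<le> m r + C * (2 * K)"
      using mult_left_mono[OF add_mono[OF w(2)[of k] w(3)[of k]] C(1)] by simp
    finally show ?thesis .
  qed
  have lim: "(\<lambda>k. FW k r) \<longlonglongrightarrow> FT r" if r: "r \<in> E" for r
  proof -
    obtain \<psi>' where \<psi>': "\<And>n. test_vec \<Omega> (\<psi>' n)" "(\<lambda>n. n2 lborel (\<lambda>x. jac (\<psi>' n) x - G r x)) \<longlonglongrightarrow> 0"
      using E(3)[OF r] unfolding H_data_def by blast
    have a: "(\<lambda>k. \<integral>x. G r x \<bullet> jac (w k) x \<partial>lborel) \<longlonglongrightarrow> (\<integral>x. G r x \<bullet> G t x \<partial>lborel)"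
      by (rule weak_pairing_grad[OF wv w(3) sU[OF st(2)] sG[OF st(2)] wg[OF st(2)] wk sG[OF r] \<psi>'])
    have b: "(\<lambda>k. \<integral>x. hv \<beta> (U r x) (G r x) \<bullet> w k x \<partial>lborel) \<longlonglongrightarrow> (\<integral>x. hv \<beta> (U r x) (G r x) \<bullet> U t x \<partial>lborel)"
      by (rule weak_pairing_L4[OF op bd w2 wn w4 w(2) sU[OF st(2)] iU[OF st(2)] wk Ut(1) Gt(1) Ut(2) Gt(2) iU[OF r] iG[OF r]])
    have e1: "FW k r = \<mu> * (\<integral>x. G r x \<bullet> jac (w k) x \<partial>lborel) + (\<integral>x. hv \<beta> (U r x) (G r x) \<bullet> w k x \<partial>lborel)" for k
      unfolding FW_def by (rule integral_kk_split[OF Ut(1) Gt(1) wm jm iU[OF r] iG[OF r] w4 wj])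
    have e2: "FT r = \<mu> * (\<integral>x. G r x \<bullet> G t x \<partial>lborel) + (\<integral>x. hv \<beta> (U r x) (G r x) \<bullet> U t x \<partial>lborel)"
      unfolding FT_def by (rule integral_kk_split[OF Ut(1) Gt(1) Ut(1) Gt(1) iU[OF r] iG[OF r] iU[OF st(2)] iG[OF st(2)]])
    show ?thesis unfolding e1 e2 by (intro tendsto_intros a b)
  qed
  have sT: "s < T" using st(1) E(1) by auto
  have l3: "(\<lambda>k. \<integral>r. indicator {0<..<s} r * FW k r \<partial>lborel) \<longlonglongrightarrow> (\<integral>r. indicator {0<..<s} r * FT r \<partial>lborel)"
  proof (rule integral_dominated_convergence)
    show "integrable lborel (\<lambda>r. indicator {0<..<s} r * (m r + C * (2 * K)))"
    proof -
      have "integrable lborel (\<lambda>r. indicator {0<..<s} r *\<^sub>R m r)" by (rule integrable_mult_indicator[OF _ mi]) simp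
      moreover have "integrable lborel (\<lambda>r. indicat_real {0<..<s} r * (C * (2 * K)))"
        using emeasure_bounded_finite[of "{0<..<s}"] by (intro integrable_mult_left) (simp add: integrable_indicator_iff)
      ultimately show ?thesis by (simp add: distrib_left)
    qed
    show "AE r in lborel. norm (indicator {0<..<s} r * FW k r) \<le> indicator {0<..<s} r * (m r + C * (2 * K))" for k
      using E(2) by eventually_elim (use FWb sT in \<open>auto simp: indicator_def\<close>)
    show "AE r in lborel. (\<lambda>k. indicator {0<..<s} r * FW k r) \<longlonglongrightarrow> indicator {0<..<s} r * FT r"
      using E(2) by eventually_elim (use lim sT in \<open>auto simp: indicator_def\<close>)
  qed measurable
  have "(\<lambda>k. - (\<integral>r. indicator {0<..<s} r * FW k r \<partial>lborel)) \<longlonglongrightarrow> (\<integral>x. U s x \<bullet> U t x \<partial>lborel) - (\<integral>x. u0 x \<bullet> U t x \<partial>lborel)"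
    using tendsto_diff[OF l1 l2] unfolding test[OF w(1)] FW_def .
  from LIMSEQ_unique[OF this tendsto_minus[OF l3]] show ?thesis unfolding FT_def .
qed

section \<open>Energy equality for the continuous representative\<close>

context core begin

text \<open>The good times at which \<open>kf\<close> has its constant value have full measure, so
  they are dense. The solution on them is Cauchy at every time of [0, T), and the energy identity
  reaches all times because \<open>S\<close> is continuous.\<close>

lemma continuous_extension:
  assumes H: "\<And>t. t \<in> E ==> in_H \<Omega> (U t)"
  obtains v c where "AE t in lborel. t \<in> {0<..<T} --> v t = U t" "\<And>t. t \<in> {0..<T} ==> in_H \<Omega> (v t)"
    "\<And>t. t \<in> {0..<T} ==> ((\<lambda>s. l2norm \<Omega> (\<lambda>x. v s x - v t x)) \<longlongrightarrow> 0) (at t within {0..<T})"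
    "\<And>t. t \<in> {0..<T} ==> \<exists>\<sigma>. (\<forall>n. \<sigma> n \<in> E) \<and> \<sigma> \<longlonglongrightarrow> t \<and> (\<lambda>n. n2 (lebesgue_on \<Omega>) (\<lambda>x. U (\<sigma> n) x - v t x)) \<longlonglongrightarrow> 0"
    "\<And>t. t \<in> {0..<T} ==> (l2norm \<Omega> (v t))\<^sup>2 = c - 2 * S t"
proof -
  obtain c where c: "AE t in lborel. t \<in> {0<..<T} --> kf t = c" by (rule kf_constant) (rule that)
  let ?M = "lebesgue_on \<Omega>"
  have Ob: "\<Omega> \<in> sets borel" using op by simp
  interpret finite_measure ?M by (rule finite_measure_lebesgue_on[OF lmeasurable_open[OF bd op]])
  have Ut: "U r \<in> borel_measurable borel" "\<And>x. x \<notin> \<Omega> ==> U r x = 0" for r using U0 by auto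
  define D where "D = {t \<in> E. kf t = c}"
  have aeD: "AE t in lborel. t \<in> {0<..<T} --> t \<in> D"
    using EAE c by eventually_elim (simp add: D_def)
  have sE: "sqi ?M (U t)" if "t \<in> E" for t
    using n2_lebesgue_on(2)[OF Ob Ut(1)[of t] Ut(2)[of _ t], of "U t"] sqi_E[OF that] by simp
  have nE: "n2 ?M (U t) = n2 lborel (U t)" for t using n2_lebesgue_on(1)[OF Ob Ut(1)[of t] Ut(2)[of _ t], of "U t"] by simp
  have nd: "n2 ?M (\<lambda>x. U t x - U t' x) = n2 lborel (\<lambda>x. U t x - U t' x)" for t t'
    by (rule n2_lebesgue_on(1)[OF Ob]) (use Ut in auto)
  have dense: "\<exists>s\<in>D. \<bar>s - t\<bar> < d" if t: "t \<in> {0..<T}" and d: "d > 0" for t d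
  proof -
    have "t < min T (t + d)" using t d by simp
    then obtain s where "t < s" "s < min T (t + d)" "s \<in> {0<..<T} --> s \<in> D" by (rule AE_interval_ex[OF aeD]) (rule that)
    then show ?thesis using t by (intro bexI[of _ s]) auto
  qed
  have cau: "\<exists>d>0. \<forall>s\<in>D. \<forall>s'\<in>D. \<bar>s - t\<bar> < d --> \<bar>s' - t\<bar> < d --> n2 ?M (\<lambda>x. U s x - U s' x) < e"
    if t: "t \<in> {0..<T}" and e: "e > 0" for t e
  proof -
    have t': "0 \<le> t" "t < T" using t by auto
    obtain d where d: "d > 0" "\<And>s s'. s \<in> E ==> kf s = c ==> \<bar>s - t\<bar> < d ==> s' \<in> E ==> kf s' = c ==> \<bar>s' - t\<bar> < d ==>
       n2 lborel (\<lambda>x. U s x - U s' x) < e"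
      by (rule cauchy_at[OF c t' e]) (rule that)
    show ?thesis unfolding nd D_def using d by (intro exI[of _ d]) simp
  qed
  have sD: "sqi ?M (U t)" if "t \<in> D" for t using sE that by (simp add: D_def)
  obtain v where v: "\<And>t. t \<in> D ==> t \<in> {0..<T} ==> v t = U t" "\<And>t. t \<in> {0..<T} ==> sqi ?M (v t)"
    and v3: "\<And>t e. t \<in> {0..<T} ==> e > 0 ==> \<exists>d>0. \<forall>s\<in>D. \<bar>s - t\<bar> < d --> n2 ?M (\<lambda>x. U s x - v t x) < e"
    and v4: "\<And>t e. t \<in> {0..<T} ==> e > 0 ==> \<exists>d>0. \<forall>s\<in>{0..<T}. \<bar>s - t\<bar> < d --> n2 ?M (\<lambda>x. v s x - v t x) < e"
    by (rule cauchy_extension[of D U "{0..<T}", OF sD dense cau]) (assumption | rule that)+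
  have seq: "\<exists>\<sigma>. (\<forall>n. \<sigma> n \<in> D) \<and> \<sigma> \<longlonglongrightarrow> t \<and> (\<lambda>n. n2 ?M (\<lambda>x. U (\<sigma> n) x - v t x)) \<longlonglongrightarrow> 0" if t: "t \<in> {0..<T}" for t
  proof -
    have "\<exists>s. s \<in> D \<and> \<bar>s - t\<bar> < 1 / real (Suc n) \<and> n2 ?M (\<lambda>x. U s x - v t x) < 1 / real (Suc n)" for n
    proof -
      have p: "1 / real (Suc n) > 0" by simp
      obtain d where d: "d > 0" "\<And>s. s \<in> D ==> \<bar>s - t\<bar> < d ==> n2 ?M (\<lambda>x. U s x - v t x) < 1 / real (Suc n)"
        using v3[OF t p] by blast
      obtain s where "s \<in> D" "\<bar>s - t\<bar> < min d (1 / real (Suc n))" using dense[OF t, of "min d (1 / real (Suc n))"] d(1) p by auto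
      then show ?thesis using d(2)[of s] by auto
    qed
    then obtain \<sigma> where \<sigma>: "\<And>n. \<sigma> n \<in> D" "\<And>n. \<bar>\<sigma> n - t\<bar> < 1 / real (Suc n)" "\<And>n. n2 ?M (\<lambda>x. U (\<sigma> n) x - v t x) < 1 / real (Suc n)"
      by metis
    have "(\<lambda>n. \<sigma> n - t) \<longlonglongrightarrow> 0" by (rule LIMSEQ_norm_0) (use \<sigma>(2) in simp)
    then have "\<sigma> \<longlonglongrightarrow> t" by (simp add: LIM_zero_iff)
    moreover have "(\<lambda>n. n2 ?M (\<lambda>x. U (\<sigma> n) x - v t x)) \<longlonglongrightarrow> 0" by (rule LIMSEQ_norm_0) (use \<sigma>(3) in simp)
    ultimately show ?thesis using \<sigma>(1) by blast
  qed
  show ?thesis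
  proof (rule that[of v c])
    show "AE t in lborel. t \<in> {0<..<T} --> v t = U t" using aeD by eventually_elim (use v(1) in auto)
    fix t assume t: "t \<in> {0..<T}"
    obtain \<sigma> where \<sigma>: "\<And>n. \<sigma> n \<in> D" "\<sigma> \<longlonglongrightarrow> t" "(\<lambda>n. n2 ?M (\<lambda>x. U (\<sigma> n) x - v t x)) \<longlonglongrightarrow> 0" using seq[OF t] by blast
    have \<sigma>E: "\<sigma> n \<in> E" "kf (\<sigma> n) = c" for n using \<sigma>(1)[of n] by (auto simp: D_def)
    show "\<exists>\<sigma>. (\<forall>n. \<sigma> n \<in> E) \<and> \<sigma> \<longlonglongrightarrow> t \<and> (\<lambda>n. n2 ?M (\<lambda>x. U (\<sigma> n) x - v t x)) \<longlonglongrightarrow> 0"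
      using \<sigma>E(1) \<sigma>(2,3) by blast
    show "in_H \<Omega> (v t)"
    proof (rule in_H_closed[OF op v(2)[OF t]])
      fix e :: real assume e: "e > 0"
      obtain N where "\<And>n. n \<ge> N ==> norm (n2 ?M (\<lambda>x. U (\<sigma> n) x - v t x) - 0) < e" using LIMSEQ_D[OF \<sigma>(3) e] by blast
      from this[of N] show "\<exists>f. in_H \<Omega> f \<and> n2 ?M (\<lambda>x. f x - v t x) < e"
        using H[OF \<sigma>E(1)[of N]] by (intro exI[of _ "U (\<sigma> N)"]) simp
    qed
    show "((\<lambda>s. l2norm \<Omega> (\<lambda>x. v s x - v t x)) \<longlongrightarrow> 0) (at t within {0..<T})"
      unfolding l2norm_eq_n2 tendsto_iff eventually_at
    proof (intro allI impI)
      fix e :: real assume e: "e > 0"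
      obtain d where "d > 0" "\<And>s. s \<in> {0..<T} ==> \<bar>s - t\<bar> < d ==> n2 ?M (\<lambda>x. v s x - v t x) < e" using v4[OF t e] by blast
      then show "\<exists>d>0. \<forall>x\<in>{0..<T}. x \<noteq> t \<and> dist x t < d --> dist (n2 ?M (\<lambda>xa. v x xa - v t xa)) 0 < e"
        by (intro exI[of _ d]) (simp add: dist_real_def)
    qed
    have "(\<lambda>n. (n2 ?M (U (\<sigma> n)))\<^sup>2) \<longlonglongrightarrow> (n2 ?M (v t))\<^sup>2"
      by (intro tendsto_power n2_tendsto[OF sD[OF \<sigma>(1)] v(2)[OF t] \<sigma>(3)])
    moreover have "(n2 ?M (U (\<sigma> n)))\<^sup>2 = c - 2 * S (\<sigma> n)" for n
      using \<sigma>E(2)[of n] unfolding nE n2_sq kf_def en_def by simp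
    moreover have "(\<lambda>n. c - 2 * S (\<sigma> n)) \<longlonglongrightarrow> c - 2 * S t"
      unfolding S_def by (intro tendsto_intros interval_integral_tendsto[OF Frr_integrable \<sigma>(2)])
    ultimately have "(n2 ?M (v t))\<^sup>2 = c - 2 * S t" using LIMSEQ_unique by auto
    then show "(l2norm \<Omega> (v t))\<^sup>2 = c - 2 * S t" unfolding l2norm_eq_n2 .
  qed
qed

text \<open>On the diagonal the viscous term becomes |G|^2 and the damping term |U|^4, while the
  convective term integrates to zero by \<open>tri0\<close>.\<close>

lemma dissipation:
  assumes tri0: "\<And>r. r \<in> E ==> (\<integral>x. tri (G r x) (U r x) (U r x) \<partial>lborel) = 0" and t: "0 \<le> t0" "t0 < t1" "t1 < T"
  shows "S t1 - S t0 = \<mu> * (\<integral>r. indicator {t0<..<t1} r * (\<integral>x. (norm (G r x))\<^sup>2 \<partial>lborel) \<partial>lborel)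
     + \<beta> * (\<integral>r. indicator {t0<..<t1} r * (\<integral>x. norm (U r x) ^ 4 \<partial>lborel) \<partial>lborel)"
    "(\<lambda>r. \<integral>x. (norm (G r x))\<^sup>2 \<partial>lborel) \<in> borel_measurable borel" "(\<lambda>r. \<integral>x. norm (U r x) ^ 4 \<partial>lborel) \<in> borel_measurable borel"
proof -
  define g where "g r = (\<integral>x. (norm (G r x))\<^sup>2 \<partial>lborel)" for r
  define h where "h r = (\<integral>x. norm (U r x) ^ 4 \<partial>lborel)" for r
  have gm[measurable]: "g \<in> borel_measurable borel" unfolding g_def by measurable
  have hm[measurable]: "h \<in> borel_measurable borel" unfolding h_def by measurable
  then show "(\<lambda>r. \<integral>x. (norm (G r x))\<^sup>2 \<partial>lborel) \<in> borel_measurable borel" "(\<lambda>r. \<integral>x. norm (U r x) ^ 4 \<partial>lborel) \<in> borel_measurable borel"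
    using gm by (simp_all add: g_def[abs_def] h_def[abs_def])
  have "integrable (lborel \<Otimes>\<^sub>M lborel) (\<lambda>p. (norm (G (fst p) (snd p)))\<^sup>2)" using G2 by (subst lborel_prod)
  from lborel_pair.integrable_fst'[OF this] have gi: "integrable lborel g" unfolding g_def by simp
  have "integrable (lborel \<Otimes>\<^sub>M lborel) (\<lambda>p. norm (U (fst p) (snd p)) ^ 4)" using U4 by (subst lborel_prod)
  from lborel_pair.integrable_fst'[OF this] have hi: "integrable lborel h" unfolding h_def by simp
  have Frr: "F r r = \<mu> * g r + \<beta> * h r" if r: "r \<in> E" for r
  proof -
    have i: "integrable lborel (\<lambda>x. norm (U r x) ^ 4)" "integrable lborel (\<lambda>x. (norm (G r x))\<^sup>2)" using EU EG r by auto
    have p4: "norm a ^ 4 = (norm a)\<^sup>2 * (a \<bullet> a)" for a :: "real^3" by (simp add: dot_square_norm power2_eq_square power4_eq_xxxx)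
    have ti: "integrable lborel (\<lambda>x. tri (G r x) (U r x) (U r x))"
    proof (rule Bochner_Integration.integrable_bound)
      show "integrable lborel (\<lambda>x. (norm (G r x))\<^sup>2 + norm (U r x) ^ 4)" using i by simp
      have "\<bar>tri B a a\<bar> \<le> (norm B)\<^sup>2 + norm a ^ 4" for B a
      proof -
        have "2 * (norm B * (norm a)\<^sup>2) \<le> (norm B)\<^sup>2 + norm a ^ 4" using sum_squares_bound[of "norm B" "(norm a)\<^sup>2"] by simp
        moreover have "\<bar>tri B a a\<bar> \<le> norm B * (norm a)\<^sup>2" using tri_bound[of B a a] by (simp add: power2_eq_square mult.assoc)
        moreover have "0 \<le> norm B * (norm a)\<^sup>2" by simp
        ultimately show ?thesis by linarith
      qed
      then show "AE x in lborel. norm (tri (G r x) (U r x) (U r x)) \<le> norm ((norm (G r x))\<^sup>2 + norm (U r x) ^ 4)" by (intro AE_I2) simp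
    qed measurable
    have "F r r = (\<integral>x. \<mu> * (norm (G r x))\<^sup>2 + tri (G r x) (U r x) (U r x) + \<beta> * norm (U r x) ^ 4 \<partial>lborel)"
      unfolding F_def kk_def p4 by (simp add: power2_norm_eq_inner)
    then show ?thesis using i ti tri0[OF r] by (simp add: g_def h_def)
  qed
  have ind: "integrable lborel (\<lambda>r. indicator {t0<..<t1} r * f r)" if "integrable lborel f" for f :: "real => real"
    using integrable_mult_indicator[OF _ that, of "{t0<..<t1}"] by simp
  have "S t1 - S t0 = (\<integral>r. indicator {t0..<t1} r * F r r \<partial>lborel)" using S_diff[of t0 t1] t by simp
  also have "\<dots> = (\<integral>r. \<mu> * (indicator {t0<..<t1} r * g r) + \<beta> * (indicator {t0<..<t1} r * h r) \<partial>lborel)"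
  proof (rule integral_cong_AE)
    show "AE r in lborel. indicator {t0..<t1} r * F r r = \<mu> * (indicator {t0<..<t1} r * g r) + \<beta> * (indicator {t0<..<t1} r * h r)"
      using EAE AE_lborel_singleton[of t0] by eventually_elim (use t Frr in \<open>auto simp: indicator_def\<close>)
  qed measurable
  also have "\<dots> = \<mu> * (\<integral>r. indicator {t0<..<t1} r * g r \<partial>lborel) + \<beta> * (\<integral>r. indicator {t0<..<t1} r * h r \<partial>lborel)"
    using ind[OF gi] ind[OF hi] by simp
  finally show "S t1 - S t0 = \<mu> * (\<integral>r. indicator {t0<..<t1} r * (\<integral>x. (norm (G r x))\<^sup>2 \<partial>lborel) \<partial>lborel)
     + \<beta> * (\<integral>r. indicator {t0<..<t1} r * (\<integral>x. norm (U r x) ^ 4 \<partial>lborel) \<partial>lborel)" unfolding g_def h_def .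
qed

end

theorem theorem5p3:
  fixes \<Omega> :: "(real^3) set" and \<mu> \<beta> T :: real
    and u0 :: "real^3 \<Rightarrow> real^3" and u :: "real \<Rightarrow> real^3 \<Rightarrow> real^3"
  assumes "bounded_smooth_domain \<Omega>" and "\<mu> > 0" and "\<beta> \<ge> 0" and "T > 0"
    and "in_H \<Omega> u0"
    and "weak_solution \<Omega> \<mu> \<beta> T u0 u"
  shows "\<exists>v :: real \<Rightarrow> real^3 \<Rightarrow> real^3.
           (AE t in lebesgue_on {0<..<T}. AE x in lebesgue_on \<Omega>. v t x = u t x) \<and>
           (AE x in lebesgue_on \<Omega>. v 0 x = u 0 x) \<and>
           (\<forall>t\<in>{0..<T}. in_H \<Omega> (v t)) \<and>
           (\<forall>t\<in>{0..<T}. ((\<lambda>s. l2norm \<Omega> (\<lambda>x. v s x - v t x)) \<longlongrightarrow> 0) (at t within {0..<T})) \<and>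
           (\<forall>t0 t1. 0 \<le> t0 \<and> t0 < t1 \<and> t1 < T \<longrightarrow>
              (l2norm \<Omega> (v t1))\<^sup>2
              + 2 * \<mu> * integral\<^sup>L (lebesgue_on {t0..t1})
                          (\<lambda>s. (l2norm \<Omega> (wgrad \<Omega> (u s)))\<^sup>2)
              + 2 * \<beta> * integral\<^sup>L (lebesgue_on {t0..t1})
                          (\<lambda>s. integral\<^sup>L (lebesgue_on \<Omega>) (\<lambda>x. (norm (u s x)) ^ 4))
              = (l2norm \<Omega> (v t0))\<^sup>2)"
proof -
  have op: "open \<Omega>" and bd: "bounded \<Omega>" using assms(1) by (auto simp: bounded_smooth_domain_def)
  have Ob: "\<Omega> \<in> sets borel" using op by simp
  let ?S = "{0<..<T} \<times> \<Omega>"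
  have Sb: "?S \<in> sets borel" using op by (simp add: open_Times)
  obtain Gw :: "real => real^3 => real^3^3" where um: "(\<lambda>p. u (fst p) (snd p)) \<in> borel_measurable (lebesgue_on ?S)"
    and aH: "AE t in lebesgue_on {0<..<T}. in_H \<Omega> (u t)"
    and u4: "(\<integral>\<^sup>+ p. ennreal ((norm (u (fst p) (snd p))) ^ 4) \<partial>lebesgue_on ?S) < \<infinity>"
    and gm: "(\<lambda>p. Gw (fst p) (snd p)) \<in> borel_measurable (lebesgue_on ?S)"
    and aG: "AE t in lebesgue_on {0<..<T}. in_H01 \<Omega> (u t) \<and> is_weak_grad \<Omega> (u t) (Gw t)"
    and g2: "(\<integral>\<^sup>+ p. ennreal ((norm (Gw (fst p) (snd p)))\<^sup>2) \<partial>lebesgue_on ?S) < \<infinity>"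
    and ai: "AE x in lebesgue_on \<Omega>. u 0 x = u0 x"
    and aW: "AE t in lebesgue_on {0<..<T}. weak_form \<Omega> \<mu> \<beta> T u Gw t"
    using assms(6) unfolding weak_solution_def weak_form_def
  proof (elim exE conjE, goal_cases)
    case (1 G C)
    show ?case by (rule 1(1)[of G, OF 1(2,3,5-10)])
  qed
  obtain UU where UU: "UU \<in> borel_measurable borel" "\<And>p. p \<notin> ?S ==> UU p = 0" "AE p in lborel. p \<in> ?S --> u (fst p) (snd p) = UU p"
    by (rule borel_representative[OF um Sb]) (rule that)
  obtain GG where GG: "GG \<in> borel_measurable borel" "\<And>p. p \<notin> ?S ==> GG p = 0" "AE p in lborel. p \<in> ?S --> Gw (fst p) (snd p) = GG p"
    by (rule borel_representative[OF gm Sb]) (rule that)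
  define U where "U t x = UU (t, x)" for t x
  define G where "G t x = GG (t, x)" for t x
  have Um: "(\<lambda>p. U (fst p) (snd p)) \<in> borel_measurable borel" and Gm: "(\<lambda>p. G (fst p) (snd p)) \<in> borel_measurable borel"
    using UU(1) GG(1) by (simp_all add: U_def G_def)
  note [measurable (raw)] = joint_comp[OF Um] joint_comp[OF Gm]
  have U0: "U t x = 0" and G0: "G t x = 0" if "t \<notin> {0<..<T} \<or> x \<notin> \<Omega>" for t x
    using that UU(2)[of "(t, x)"] GG(2)[of "(t, x)"] by (auto simp: U_def G_def)
  have Ut: "U r \<in> borel_measurable borel" "\<And>x. x \<notin> \<Omega> ==> U r x = 0" for r using U0 by auto
  have Gt: "G r \<in> borel_measurable borel" "\<And>x. x \<notin> \<Omega> ==> G r x = 0" for r using G0 by auto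
  have U4: "integrable lborel (\<lambda>p. norm (U (fst p) (snd p)) ^ 4)"
  proof -
    have "integrable (lebesgue_on ?S) (\<lambda>p. norm (u (fst p) (snd p)) ^ 4)"
      using um u4 by (intro integrableI_bounded) auto
    moreover have "integrable (lebesgue_on ?S) (\<lambda>p. norm (u (fst p) (snd p)) ^ 4) \<longleftrightarrow> integrable lborel (\<lambda>p. norm (U (fst p) (snd p)) ^ 4)"
      by (rule lebesgue_on_representative(3)[OF Sb]) (use UU Um in \<open>auto simp: U_def elim!: eventually_mono\<close>)
    ultimately show ?thesis by simp
  qed
  have G2: "integrable lborel (\<lambda>p. (norm (G (fst p) (snd p)))\<^sup>2)"
  proof -
    have "integrable (lebesgue_on ?S) (\<lambda>p. (norm (Gw (fst p) (snd p)))\<^sup>2)"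
      using gm g2 by (intro integrableI_bounded) auto
    moreover have "integrable (lebesgue_on ?S) (\<lambda>p. (norm (Gw (fst p) (snd p)))\<^sup>2) \<longleftrightarrow> integrable lborel (\<lambda>p. (norm (G (fst p) (snd p)))\<^sup>2)"
      by (rule lebesgue_on_representative(3)[OF Sb]) (use GG Gm in \<open>auto simp: G_def elim!: eventually_mono\<close>)
    ultimately show ?thesis by simp
  qed
  have ae: "AE r in lborel. r \<in> {0<..<T} --> (AE x in lborel. x \<in> \<Omega> --> u r x = U r x \<and> Gw r x = G r x)"
    using AE_lborel_sections[OF UU(3)] AE_lborel_sections[OF GG(3)]
  proof eventually_elim
    case (elim r)
    show ?case
    proof
      assume r: "r \<in> {0<..<T}"
      show "AE x in lborel. x \<in> \<Omega> --> u r x = U r x \<and> Gw r x = G r x"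
        using elim(1) elim(2) by eventually_elim (use r in \<open>simp add: U_def G_def\<close>)
    qed
  qed
  have "L2 \<Omega> u0" using assms(5) by (simp add: in_H_def)
  then have "u0 \<in> borel_measurable (lebesgue_on \<Omega>)" by (simp add: L2_def)
  then obtain u0b where u0b: "u0b \<in> borel_measurable borel" "\<And>x. x \<notin> \<Omega> ==> u0b x = 0" "AE x in lborel. x \<in> \<Omega> --> u0 x = u0b x"
    by (rule borel_representative[OF _ Ob]) (rule that)
  have u00: "AE x in lborel. x \<in> \<Omega> --> u 0 x = u0b x"
    using u0b(3) ai[unfolded AE_lebesgue_on_iff[OF Ob]] by eventually_elim simp
  have Hu0: "in_H \<Omega> u0b" by (rule in_H_cong_AE[OF op assms(5) u0b])
  have su0: "sqi lborel u0b" using Hu0 n2_lebesgue_on(2)[OF Ob u0b(1,2), of u0b] by (simp add: in_H_iff)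
  define E where "E = {t \<in> {0<..<T}. (AE x in lborel. x \<in> \<Omega> --> u t x = U t x \<and> Gw t x = G t x) \<and> in_H \<Omega> (u t) \<and>
     (in_H01 \<Omega> (u t) \<and> is_weak_grad \<Omega> (u t) (Gw t)) \<and> weak_form \<Omega> \<mu> \<beta> T u Gw t \<and>
     integrable lborel (\<lambda>x. norm (U t x) ^ 4) \<and> integrable lborel (\<lambda>x. (norm (G t x))\<^sup>2)}"
  have ET: "E \<subseteq> {0<..<T}" by (auto simp: E_def)
  have EAE: "AE t in lborel. t \<in> {0<..<T} --> t \<in> E"
  proof -
    have i: "{0<..<T} \<in> sets borel" by simp
    have "integrable (lborel \<Otimes>\<^sub>M lborel) (\<lambda>p. norm (U (fst p) (snd p)) ^ 4)" using U4 by (subst lborel_prod)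
    from lborel_pair.AE_integrable_fst'[OF this] have a: "AE t in lborel. integrable lborel (\<lambda>x. norm (U t x) ^ 4)" by simp
    have "integrable (lborel \<Otimes>\<^sub>M lborel) (\<lambda>p. (norm (G (fst p) (snd p)))\<^sup>2)" using G2 by (subst lborel_prod)
    from lborel_pair.AE_integrable_fst'[OF this] have b: "AE t in lborel. integrable lborel (\<lambda>x. (norm (G t x))\<^sup>2)" by simp
    show ?thesis using ae aH[unfolded AE_lebesgue_on_iff[OF i]] aG[unfolded AE_lebesgue_on_iff[OF i]] aW[unfolded AE_lebesgue_on_iff[OF i]] a b
      by eventually_elim (simp add: E_def)
  qed
  have aeU: "AE x in lborel. x \<in> \<Omega> --> u t x = U t x" and aeG: "AE x in lborel. x \<in> \<Omega> --> Gw t x = G t x" if "t \<in> E" for t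
  proof -
    have a: "AE x in lborel. x \<in> \<Omega> --> u t x = U t x \<and> Gw t x = G t x" using that by (simp add: E_def)
    show "AE x in lborel. x \<in> \<Omega> --> u t x = U t x" using a by eventually_elim simp
    show "AE x in lborel. x \<in> \<Omega> --> Gw t x = G t x" using a by eventually_elim simp
  qed
  have EH: "in_H \<Omega> (u t)" "in_H01 \<Omega> (u t)" "is_weak_grad \<Omega> (u t) (Gw t)" if "t \<in> E" for t
    using that by (simp_all add: E_def)
  have EU: "integrable lborel (\<lambda>x. norm (U t x) ^ 4)" and EG: "integrable lborel (\<lambda>x. (norm (G t x))\<^sup>2)" if "t \<in> E" for t
    using that by (simp_all add: E_def)
  have HU: "in_H \<Omega> (U t)" if "t \<in> E" for t by (rule in_H_cong_AE[OF op EH(1)[OF that] Ut aeU[OF that]])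
  have HD: "H_data \<Omega> (U t) (G t)" and tri0: "(\<integral>x. tri (G t x) (U t x) (U t x) \<partial>lborel) = 0" if t: "t \<in> E" for t
  proof -
    obtain \<phi> \<psi> where d: "\<And>n. test_divfree \<Omega> (\<phi> n)" "(\<lambda>n. n2 lborel (\<lambda>x. \<phi> n x - U t x)) \<longlonglongrightarrow> 0"
      "\<And>n. test_vec \<Omega> (\<psi> n)" "(\<lambda>n. n2 lborel (\<lambda>x. \<psi> n x - U t x)) \<longlonglongrightarrow> 0"
      "(\<lambda>n. n2 lborel (\<lambda>x. jac (\<psi> n) x - G t x)) \<longlonglongrightarrow> 0"
      and wg: "\<And>f i j. test_scalar \<Omega> f ==> (\<integral>x. U t x $ i * pd j f x \<partial>lborel) = - (\<integral>x. G t x $ i $ j * f x \<partial>lborel)"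
      by (rule good_time[OF op bd Ut aeU[OF t] Gt aeG[OF t] EH[OF t]]) (assumption | rule that)+
    show "H_data \<Omega> (U t) (G t)" unfolding H_data_def using EU[OF t] EG[OF t] wg d by blast
    have sG: "sqi lborel (G t)" using Gt EG[OF t] by (simp add: sqi_def)
    show "(\<integral>x. tri (G t x) (U t x) (U t x) \<partial>lborel) = 0"
      by (rule tri_vanish[OF op bd sqi_L4[OF op bd Ut EU[OF t]] Ut(2) EU[OF t] sG d])
  qed
  have test: "(\<integral>x. U s x \<bullet> w x \<partial>lborel) - (\<integral>x. u0b x \<bullet> w x \<partial>lborel)
        = - (\<integral>r. indicator {0<..<s} r * (\<integral>x. kk \<mu> \<beta> (U r x) (G r x) (w x) (jac w x) \<partial>lborel) \<partial>lborel)"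
    if s: "s \<in> E" and w: "test_divfree \<Omega> w" for s w
  proof (rule test_identity(2)[OF op bd Um Gm U0 G0 U4 G2 ae w])
    show "s \<in> {0<..<T}" using s ET by auto
    show "weak_form \<Omega> \<mu> \<beta> T u Gw s"
      using s unfolding E_def by blast
  qed (assumption | rule aeU[OF s] u0b(1) u0b(2) u00)+
  obtain N c e0 where "smooth N" "bsupp N" "c > 0" "e0 > 0"
    "\<And>x e z. x \<in> closure \<Omega> ==> 0 < e ==> e < e0 ==> norm z \<le> c * e ==> x + e *\<^sub>R N x + z \<in> \<Omega>"
    by (rule inward_field[OF assms(1)]) (rule that)
  then interpret inw: inward \<Omega> N c e0 by unfold_locales (auto intro: op bd)
  interpret core T \<mu> \<beta> \<Omega> U G u0b E
  proof
    show "(\<integral>x. U s x \<bullet> U t x \<partial>lborel) - (\<integral>x. u0b x \<bullet> U t x \<partial>lborel)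
       = - (\<integral>r. indicator {0<..<s} r * (\<integral>x. kk \<mu> \<beta> (U r x) (G r x) (U t x) (G t x) \<partial>lborel) \<partial>lborel)"
      if "s \<in> E" "t \<in> E" for s t
      by (rule inw.self_test_identity[OF Um Gm U0 G0 U4 G2 ET EAE HD su0 u0b(2) test[OF that(1)] that])
  qed (fact assms(4) op bd Um Gm U0 G0 U4 G2 ET EAE EU EG)+
  obtain v c' where v: "AE t in lborel. t \<in> {0<..<T} --> v t = U t" "\<And>t. t \<in> {0..<T} ==> in_H \<Omega> (v t)"
    "\<And>t. t \<in> {0..<T} ==> ((\<lambda>s. l2norm \<Omega> (\<lambda>x. v s x - v t x)) \<longlongrightarrow> 0) (at t within {0..<T})"
    "\<And>t. t \<in> {0..<T} ==> \<exists>\<sigma>. (\<forall>n. \<sigma> n \<in> E) \<and> \<sigma> \<longlonglongrightarrow> t \<and> (\<lambda>n. n2 (lebesgue_on \<Omega>) (\<lambda>x. U (\<sigma> n) x - v t x)) \<longlonglongrightarrow> 0"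
    and en: "\<And>t. t \<in> {0..<T} ==> (l2norm \<Omega> (v t))\<^sup>2 = c' - 2 * S t"
    by (rule continuous_extension[OF HU]) (assumption | rule that)+
  have "AE x in lebesgue_on \<Omega>. v 0 x = u0b x"
  proof (rule in_H_eqI[OF op v(2) Hu0])
    show "0 \<in> {0..<T}" using assms(4) by simp
    then obtain \<sigma> where \<sigma>: "\<And>n. \<sigma> n \<in> E" "\<sigma> \<longlonglongrightarrow> 0" "(\<lambda>n. n2 (lebesgue_on \<Omega>) (\<lambda>x. U (\<sigma> n) x - v 0 x)) \<longlonglongrightarrow> 0"
      and v0: "in_H \<Omega> (v 0)" using v(2,4)[of 0] by blast
    fix w assume w: "test_divfree \<Omega> w"
    have wm: "w \<in> borel_measurable borel" using sqi_test_divfree(1)[OF op w] by (simp add: sqi_def)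
    have e1: "(\<integral>x. U s x \<bullet> w x \<partial>lebesgue_on \<Omega>) = (\<integral>x. U s x \<bullet> w x \<partial>lborel)" for s
      by (rule lebesgue_on_representative(2)[OF Ob]) (use wm Ut in auto)
    have e2: "(\<integral>x. u0b x \<bullet> w x \<partial>lebesgue_on \<Omega>) = (\<integral>x. u0b x \<bullet> w x \<partial>lborel)"
      by (rule lebesgue_on_representative(2)[OF Ob]) (use wm u0b in auto)
    have "(\<lambda>n. \<integral>x. U (\<sigma> n) x \<bullet> w x \<partial>lebesgue_on \<Omega>) \<longlonglongrightarrow> (\<integral>x. v 0 x \<bullet> w x \<partial>lebesgue_on \<Omega>)"
      by (rule inner_tendsto_n2[OF _ _ sqi_test_divfree(2)[OF op w] \<sigma>(3)]) (use HU[OF \<sigma>(1)] v0 in \<open>auto simp: in_H_iff\<close>)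
    then have l1: "(\<lambda>n. \<integral>x. U (\<sigma> n) x \<bullet> w x \<partial>lborel) \<longlonglongrightarrow> (\<integral>x. v 0 x \<bullet> w x \<partial>lebesgue_on \<Omega>)" unfolding e1 .
    \<comment> \<open>Integrability in time makes the integral over (0, \<sigma> n) tend to 0, so in
      the identity tested with \<open>w\<close> the initial value alone survives.\<close>
    have Ki: "integrable lborel (\<lambda>r. \<integral>x. kk \<mu> \<beta> (U r x) (G r x) (w x) (jac w x) \<partial>lborel)"
      by (rule test_identity(1)[OF op bd Um Gm U0 G0 U4 G2 ae w])
    have "(\<lambda>n. \<integral>x. U (\<sigma> n) x \<bullet> w x \<partial>lborel) \<longlonglongrightarrow> (\<integral>x. u0b x \<bullet> w x \<partial>lborel)"
    proof -
      have eq: "(\<integral>x. U (\<sigma> n) x \<bullet> w x \<partial>lborel) = (\<integral>x. u0b x \<bullet> w x \<partial>lborel)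
        - (\<integral>r. indicator {0<..<\<sigma> n} r * (\<integral>x. kk \<mu> \<beta> (U r x) (G r x) (w x) (jac w x) \<partial>lborel) \<partial>lborel)" for n
        using test[OF \<sigma>(1)[of n] w] by simp
      show ?thesis unfolding eq
        using tendsto_diff[OF tendsto_const interval_integral_tendsto[OF Ki \<sigma>(2)], of "\<integral>x. u0b x \<bullet> w x \<partial>lborel"] by simp
    qed
    from LIMSEQ_unique[OF l1 this] show "(\<integral>x. v 0 x \<bullet> w x \<partial>lebesgue_on \<Omega>) = (\<integral>x. u0b x \<bullet> w x \<partial>lebesgue_on \<Omega>)" unfolding e2 .
  qed
  then have v0: "AE x in lebesgue_on \<Omega>. v 0 x = u 0 x"
    unfolding AE_lebesgue_on_iff[OF Ob] using u00 by eventually_elim simp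
  have aeGrad: "AE r in lborel. r \<in> {a<..<b} --> (l2norm \<Omega> (wgrad \<Omega> (u r)))\<^sup>2 = (\<integral>x. (norm (G r x))\<^sup>2 \<partial>lborel)"
    and aeFour: "AE r in lborel. r \<in> {a<..<b} --> integral\<^sup>L (lebesgue_on \<Omega>) (\<lambda>x. (norm (u r x)) ^ 4) = (\<integral>x. norm (U r x) ^ 4 \<partial>lborel)"
    if ab: "0 \<le> a" "b < T" for a b
  proof -
    \<comment> \<open>\<open>wgrad\<close> is a choice among all weak gradients; by uniqueness its
      norm does not depend on the choice.\<close>
    have wE: "(l2norm \<Omega> (wgrad \<Omega> (u r)))\<^sup>2 = (\<integral>x. (norm (G r x))\<^sup>2 \<partial>lborel)" if r: "r \<in> E" for r
    proof -
      have "is_weak_grad \<Omega> (u r) (wgrad \<Omega> (u r))" unfolding wgrad_def by (rule someI[of "is_weak_grad \<Omega> (u r)", OF EH(3)[OF r]])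
      from weak_grad_unique[OF op this EH(3)[OF r]] have "AE x in lborel. x \<in> \<Omega> --> wgrad \<Omega> (u r) x = G r x"
        using aeG[OF r] by eventually_elim simp
      from n2_lebesgue_on(1)[OF Ob Gt this] show ?thesis by (simp add: l2norm_eq_n2 n2_sq)
    qed
    show "AE r in lborel. r \<in> {a<..<b} --> (l2norm \<Omega> (wgrad \<Omega> (u r)))\<^sup>2 = (\<integral>x. (norm (G r x))\<^sup>2 \<partial>lborel)"
      using EAE by eventually_elim (use wE ab in auto)
    have uE: "integral\<^sup>L (lebesgue_on \<Omega>) (\<lambda>x. (norm (u r x)) ^ 4) = (\<integral>x. norm (U r x) ^ 4 \<partial>lborel)" if r: "r \<in> E" for r
    proof (rule lebesgue_on_representative(2)[OF Ob])
      show "AE x in lborel. x \<in> \<Omega> --> norm (u r x) ^ 4 = norm (U r x) ^ 4" using aeU[OF r] by eventually_elim simp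
    qed (use Ut in auto)
    show "AE r in lborel. r \<in> {a<..<b} --> integral\<^sup>L (lebesgue_on \<Omega>) (\<lambda>x. (norm (u r x)) ^ 4) = (\<integral>x. norm (U r x) ^ 4 \<partial>lborel)"
      using EAE by eventually_elim (use uE ab in auto)
  qed
  show ?thesis
  proof (intro exI[of _ v] conjI ballI allI impI v0 v(2,3))
    have i: "{0<..<T} \<in> sets borel" by simp
    show "AE t in lebesgue_on {0<..<T}. AE x in lebesgue_on \<Omega>. v t x = u t x"
      unfolding AE_lebesgue_on_iff[OF i] AE_lebesgue_on_iff[OF Ob] using v(1) EAE
    proof eventually_elim
      case (elim t)
      show ?case
      proof
        assume "t \<in> {0<..<T}"
        then have t: "v t = U t" "t \<in> E" using elim by auto
        show "AE x in lborel. x \<in> \<Omega> --> v t x = u t x" using aeU[OF t(2)] by eventually_elim (simp add: t(1))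
      qed
    qed
    fix t0 t1 assume "0 \<le> t0 \<and> t0 < t1 \<and> t1 < T"
    then have t: "0 \<le> t0" "t0 < t1" "t1 < T" by auto
    note d = dissipation[OF tri0 t]
    have i1: "integral\<^sup>L (lebesgue_on {t0..t1}) (\<lambda>s. (l2norm \<Omega> (wgrad \<Omega> (u s)))\<^sup>2)
        = (\<integral>r. indicator {t0<..<t1} r * (\<integral>x. (norm (G r x))\<^sup>2 \<partial>lborel) \<partial>lborel)"
      by (rule time_integral_representative[OF d(2) aeGrad[OF t(1,3)]])
    have i2: "integral\<^sup>L (lebesgue_on {t0..t1}) (\<lambda>s. integral\<^sup>L (lebesgue_on \<Omega>) (\<lambda>x. (norm (u s x)) ^ 4))
        = (\<integral>r. indicator {t0<..<t1} r * (\<integral>x. norm (U r x) ^ 4 \<partial>lborel) \<partial>lborel)"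
      by (rule time_integral_representative[OF d(3) aeFour[OF t(1,3)]])
    show "(l2norm \<Omega> (v t1))\<^sup>2
              + 2 * \<mu> * integral\<^sup>L (lebesgue_on {t0..t1}) (\<lambda>s. (l2norm \<Omega> (wgrad \<Omega> (u s)))\<^sup>2)
              + 2 * \<beta> * integral\<^sup>L (lebesgue_on {t0..t1}) (\<lambda>s. integral\<^sup>L (lebesgue_on \<Omega>) (\<lambda>x. (norm (u s x)) ^ 4))
              = (l2norm \<Omega> (v t0))\<^sup>2"
      unfolding i1 i2
      using en[of t0] en[of t1] d(1) t by (simp add: algebra_simps)
  qed
qed

end
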